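(* Let $f,g$ be densities on $\mathbb{R}^d$ and let $k_N\to\infty$ be a sequence of natural numbers with $k_N=o(N)$. Let $\mathcal{F}_N=\sigma(\mathcal{Z}_N,L_N)$ be the sigma algebra generated by the points of the Poisson process $\mathcal{Z}_N$, and let $$\mathcal{R}_{\mathrm{cond}}(\mathscr{G}_{k_N}(\mathcal{Z}_N))=\frac{1}{\sqrt{N}\,k_N}\Big(T(\mathscr{G}_{k_N}(\mathcal{Z}_N))-\mathbb{E}\big(T(\mathscr{G}_{k_N}(\mathcal{Z}_N))\mid\mathcal{F}_N\big)\Big).$$ Then, as $N\to\infty$, $$\frac{\mathcal{R}_{\mathrm{cond}}(\mathscr{G}_{k_N}(\mathcal{Z}_N))}{\sqrt{\mathrm{Var}\big(\mathcal{R}_{\mathrm{cond}}(\mathscr{G}_{k_N}(\mathcal{Z}_N))\mid\mathcal{F}_N\big)}}\xrightarrow{d}N(0,1).$$ Furthermore, $$\mathrm{Var}\big(\mathcal{R}_{\mathrm{cond}}(\mathscr{G}_{k_N}(\mathcal{Z}_N))\mid\mathcal{F}_N\big)=\frac{1}{Nk_N^2}\mathrm{Var}\big(T(\mathscr{G}_{k_N}(\mathcal{Z}_N))\mid\mathcal{F}_N\big)\xrightarrow{p}\sigma^2_{\mathrm{cond}},$$ where, with $\phi(x)=pf(x)+qg(x)$, $$\sigma^2_{\mathrm{cond}}=pq\int\frac{f(x)g(x)(pf(x)-qg(x))^2}{\phi^3(x)}\,dx.$$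
   Context: Setting (Poissonized two-sample problem). Let $p\in(0,1)$, $q=1-p$. For each $N$ let $N_1+N_2=N$ with $\frac{N_1}{N}-p=o(N^{-1/2})$ and $\frac{N_2}{N}-q=o(N^{-1/2})$. For densities $f,g$ on $\mathbb{R}^d$ put $\phi_N(x)=\frac{N_1}{N}f(x)+\frac{N_2}{N}g(x)$. $\mathcal{Z}_N=\{Z_1,\dots,Z_{L_N}\}$ is the set of points of a Poisson process on $\mathbb{R}^d$ with intensity function $N\phi_N=N_1f+N_2g$ (so $L_N\sim\mathrm{Poisson}(N)$). Given $\mathcal{Z}_N$, the points receive independent labels: $z\in\mathcal{Z}_N$ gets label $c_z=1$ with probability $\frac{N_1f(z)}{N_1f(z)+N_2g(z)}$ and $c_z=2$ with probability $\frac{N_2g(z)}{N_1f(z)+N_2g(z)}$. For a finite set $S\subset\mathbb{R}^d$ and $K\in\mathbb{N}$, $\mathscr{G}_K(S)$ is the directed $K$-nearest-neighbor graph on $S$: for distinct $a,b\in S$ the edge $(a,b)$ is in $E(\mathscr{G}_K(S))$ iff $b$ is one of the $K$ closest points to $a$ in Euclidean distance among the other points of $S$. The test statistic is $$T(\mathscr{G}_K(\mathcal{Z}_N))=\sum_{x,y\in\mathcal{Z}_N}\mathbf{1}\{c_x=1,\,c_y=2\}\,\mathbf{1}\{(x,y)\in E(\mathscr{G}_K(\mathcal{Z}_N))\}.$$ All expectations and variances are taken in the model with densities $f,g$.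
   Formalization: The convergence to N(0,1) is stated only when fg is not almost everywhere zero; if fg = 0 a.e., the labels are determined by the points, the conditional variance is 0 and the ratio is 0/0. *)

theory Defs
  imports "HOL-Probability.Probability" "HOL-Library.Landau_Symbols"
begin

definition prob_density :: "('a::euclidean_space \<Rightarrow> real) \<Rightarrow> bool" where
  "prob_density f \<longleftrightarrow> f \<in> borel_measurable borel \<and> (\<forall>x. 0 \<le> f x) \<and>
     (\<integral>\<^sup>+ x. ennreal (f x) \<partial>lborel) = 1"

text \<open>
  A Poisson process with integrable intensity function \<open>h\<close>.  Its realisations are finite sets
  of points; the counts of Borel sets are Poisson distributed, and the counts of disjoint
  Borel sets are independent.  The Poisson weights are written out because the library's
  \<open>poisson_pmf\<close> only makes sense for a strictly positive rate, while the integral of \<open>h\<close> over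
  \<open>A\<close> may vanish (with the usual \<open>0 ^ 0 = 1\<close>).
\<close>
definition poisson_process ::
  "'w measure \<Rightarrow> ('a::euclidean_space \<Rightarrow> real) \<Rightarrow> ('w \<Rightarrow> 'a set) \<Rightarrow> bool" where
  "poisson_process M h P \<longleftrightarrow>
     (\<forall>\<omega>\<in>space M. finite (P \<omega>)) \<and>
     (\<forall>A\<in>sets borel. (\<lambda>\<omega>. card (P \<omega> \<inter> A)) \<in> measurable M (count_space UNIV)) \<and>
     (\<forall>A\<in>sets borel. \<forall>j::nat.
        measure M {\<omega> \<in> space M. card (P \<omega> \<inter> A) = j} =
          (LINT x:A|lborel. h x) ^ j / fact j * exp (- (LINT x:A|lborel. h x))) \<and>
     (\<forall>A :: nat \<Rightarrow> 'a set. range A \<subseteq> sets borel \<longrightarrow> disjoint_family A \<longrightarrow>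
        prob_space.indep_vars M (\<lambda>_. count_space UNIV) (\<lambda>i \<omega>. card (P \<omega> \<inter> A i)) UNIV)"

text \<open>
  The points \<open>Z\<^sub>1, \<dots>, Z\<^sub>L\<close> are indexed here as \<open>Z 0, \<dots>, Z (L - 1)\<close>; the values \<open>Z i \<omega>\<close> with
  \<open>i \<ge> L \<omega>\<close> are irrelevant.
\<close>
definition points :: "('w \<Rightarrow> nat) \<Rightarrow> (nat \<Rightarrow> 'w \<Rightarrow> 'a) \<Rightarrow> 'w \<Rightarrow> 'a set" where
  "points L Z \<omega> = (\<lambda>i. Z i \<omega>) ` {..<L \<omega>}"

text \<open>
  The sigma algebra generated by \<open>L\<close> and \<open>Z\<^sub>1, \<dots>, Z\<^sub>L\<close>.  Nothing is assumed about the order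
  of the enumeration; for an enumeration that depends on the point set alone (such as the
  lexicographic one) this is the sigma algebra of the point set.
\<close>
definition points_algebra ::
  "'w measure \<Rightarrow> ('w \<Rightarrow> nat) \<Rightarrow> (nat \<Rightarrow> 'w \<Rightarrow> 'a::euclidean_space) \<Rightarrow> 'w measure" where
  "points_algebra M L Z = sigma (space M)
     ({{\<omega> \<in> space M. L \<omega> = n} | n. True} \<union>
      {{\<omega> \<in> space M. i < L \<omega> \<and> Z i \<omega> \<in> A} | i A. A \<in> sets borel})"

definition label_prob ::
  "nat \<Rightarrow> nat \<Rightarrow> ('a \<Rightarrow> real) \<Rightarrow> ('a \<Rightarrow> real) \<Rightarrow> nat \<Rightarrow> 'a \<Rightarrow> real" where
  "label_prob n1 n2 f g e z =
     (if e = 1 then real n1 * f z / (real n1 * f z + real n2 * g z)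
      else if e = 2 then real n2 * g z / (real n1 * f z + real n2 * g z)
      else 0)"

text \<open>
  The Poissonized two-sample model with sample sizes \<open>n1\<close>, \<open>n2\<close>; the label of a point \<open>z\<close> is
  \<open>c \<omega> z\<close>.  Independent labelling given the points is expressed by the conditional joint
  law of the labels of \<open>Z 0, \<dots>, Z (L - 1)\<close>.
\<close>
locale poissonized_two_sample = prob_space M
  for M :: "'w measure" +
  fixes n1 n2 :: nat
    and f g :: "'a::euclidean_space \<Rightarrow> real"
    and L :: "'w \<Rightarrow> nat"
    and Z :: "nat \<Rightarrow> 'w \<Rightarrow> 'a"
    and c :: "'w \<Rightarrow> 'a \<Rightarrow> nat"
  assumes L_measurable: "L \<in> measurable M (count_space UNIV)"
    and Z_measurable: "\<And>i. Z i \<in> borel_measurable M"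
    and Z_distinct: "AE \<omega> in M. inj_on (\<lambda>i. Z i \<omega>) {..<L \<omega>}"
    and points_poisson: "poisson_process M (\<lambda>x. real n1 * f x + real n2 * g x) (points L Z)"
    and label_measurable: "\<And>i e. {\<omega> \<in> space M. i < L \<omega> \<and> c \<omega> (Z i \<omega>) = e} \<in> sets M"
    and labels_independent:
      "\<And>(n::nat) (e::nat \<Rightarrow> nat). AE \<omega> in M.
         real_cond_exp M (points_algebra M L Z)
           (indicator {\<omega> \<in> space M. L \<omega> = n \<and> (\<forall>i<n. c \<omega> (Z i \<omega>) = e i)}) \<omega> =
         (if L \<omega> = n then \<Prod>i<n. label_prob n1 n2 f g (e i) (Z i \<omega>) else 0)"

text \<open>
  Directed nearest-neighbour graph.  If some distances are tied, all points at the tied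
  distance are admitted as neighbours; for the Poisson process ties have probability zero.
\<close>
definition knn_edges :: "nat \<Rightarrow> 'a::euclidean_space set \<Rightarrow> ('a \<times> 'a) set" where
  "knn_edges K S =
     {(a, b). a \<in> S \<and> b \<in> S \<and> a \<noteq> b \<and> card {x \<in> S - {a}. dist a x < dist a b} < K}"

definition T_stat :: "nat \<Rightarrow> 'a::euclidean_space set \<Rightarrow> ('a \<Rightarrow> nat) \<Rightarrow> real" where
  "T_stat K S l = (\<Sum>x\<in>S. \<Sum>y\<in>S.
     of_bool (l x = 1 \<and> l y = 2) * of_bool ((x, y) \<in> knn_edges K S))"

definition real_cond_var :: "'w measure \<Rightarrow> 'w measure \<Rightarrow> ('w \<Rightarrow> real) \<Rightarrow> 'w \<Rightarrow> real" where
  "real_cond_var M F X = real_cond_exp M F (\<lambda>\<omega>. (X \<omega> - real_cond_exp M F X \<omega>)\<^sup>2)"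

definition R_cond :: "'w measure \<Rightarrow> 'w measure \<Rightarrow> nat \<Rightarrow> nat \<Rightarrow> ('w \<Rightarrow> real) \<Rightarrow> 'w \<Rightarrow> real" where
  "R_cond M F N K T \<omega> = 1 / (sqrt (real N) * real K) * (T \<omega> - real_cond_exp M F T \<omega>)"

definition tendsto_in_prob :: "(nat \<Rightarrow> 'w measure) \<Rightarrow> (nat \<Rightarrow> 'w \<Rightarrow> real) \<Rightarrow> real \<Rightarrow> bool" where
  "tendsto_in_prob M X a \<longleftrightarrow>
     (\<forall>\<epsilon>>0. (\<lambda>n. measure (M n) {\<omega> \<in> space (M n). \<bar>X n \<omega> - a\<bar> > \<epsilon>}) \<longlonglongrightarrow> 0)"

text \<open>Where \<open>p f + q g\<close> vanishes so do \<open>f\<close> and \<open>g\<close>, and the integrand is read as \<open>0\<close>.\<close>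
definition sigma2_cond ::
  "real \<Rightarrow> ('a::euclidean_space \<Rightarrow> real) \<Rightarrow> ('a \<Rightarrow> real) \<Rightarrow> real" where
  "sigma2_cond p f g = (let q = 1 - p; \<phi> = (\<lambda>x. p * f x + q * g x) in
     p * q * (LINT x|lborel. f x * g x * (p * f x - q * g x)\<^sup>2 / (\<phi> x) ^ 3))"

end

theory Submission
  imports Defs
begin

text \<open>
  Given the points, the labels are independent, so with \<open>a x\<close> the conditional probability of
  label 1 at \<open>x\<close> and \<open>\<xi> x\<close> the centred indicator of that label, the centred statistic is a linear plus
  a quadratic form in the \<open>\<xi> x\<close>: the linear coefficient of \<open>\<xi> x\<close> is
  (sum of \<open>1 - a\<close> over out-neighbours) minus (sum of \<open>a\<close> over in-neighbours), and the quadratic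
  coefficients are minus the edge multiplicities.  A Stein argument for characteristic functions
  bounds the distance of the normalised form from the normal law by a constant times
  (maximal degree) / (standard deviation).  Out-degrees are \<open>K\<close> (there are no ties) and in-degrees
  are at most a constant times \<open>K\<close> (cone covering), while the quadratic part alone makes the
  variance at least of order \<open>N K\<close> as soon as \<open>f g\<close> is not a.e. zero; so the error is of order
  \<open>sqrt (K / N)\<close>.  In particular the limit law does not need \<open>\<sigma>\<^sup>2 > 0\<close>.

  For the variance limit, edges are short, so \<open>a\<close> hardly varies along most edges (first moments and
  continuous approximation suffice), and most in-degrees are close to \<open>K\<close>: as in- and out-degrees have
  the same sum it is enough to bound most in-degrees from below, which follows from the
  concentration of the counts of cells of side \<open>(K / N) powr (1 / d)\<close> times a small constant.
\<close>

section \<open>Normal approximation of linear plus quadratic forms in independent labels\<close>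

text \<open>Conditionally on the points, the set of label-1 points is a random subset, so
  conditional expectations are finite weighted sums over subsets. Values in a real vector space
  serve real moments and complex characteristic functions at once. The conditional characteristic
  function of the ratio is thus a function of the point set, bounded by 1; its convergence in
  probability yields that of the unconditional one, and Levy's theorem concludes.

  On the Fourier side Stein's identity becomes y' = - t * y plus an error. The random quantity that
  replaces the variance in it is again a linear plus quadratic form, so the variance formula for
  such forms also controls its fluctuation, and no fourth moments are computed.

  The model describes the Poisson process only through counts of Borel sets: their laws and
  independence on disjoint sets. This shapes all that concerns the points: ties, laws of large
  numbers and in-degrees are read off from counts of level sets and grid cells. The densities are
  merely integrable, so local constancy is always obtained from a continuous function close in
  L1.\<close>

definition bern_expect :: "'v set \<Rightarrow> ('v \<Rightarrow> real) \<Rightarrow> ('v set \<Rightarrow> 'b) \<Rightarrow> 'b::real_vector" where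
  "bern_expect V a F = (\<Sum>S\<in>Pow V. ((\<Prod>x\<in>S. a x) * (\<Prod>x\<in>V - S. 1 - a x)) *\<^sub>R F S)"

lemma bern_expect_cong: "(\<And>S. S \<subseteq> V \<Longrightarrow> F S = G S) \<Longrightarrow> bern_expect V a F = bern_expect V a G"
  unfolding bern_expect_def by (rule sum.cong) auto

lemma bern_expect_add: "bern_expect V a (\<lambda>S. F S + G S) = bern_expect V a F + bern_expect V a G"
  by (simp add: bern_expect_def scaleR_add_right sum.distrib)

lemma bern_expect_diff: "bern_expect V a (\<lambda>S. F S - G S) = bern_expect V a F - bern_expect V a G"
  by (simp add: bern_expect_def scaleR_diff_right sum_subtractf)

lemma bern_expect_scale: "bern_expect V a (\<lambda>S. r *\<^sub>R F S) = r *\<^sub>R bern_expect V a F"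
  by (simp add: bern_expect_def scaleR_sum_right mult.commute)

lemma bern_expect_mult_left:
  fixes F :: "'v set \<Rightarrow> 'b::real_algebra"
  shows "bern_expect V a (\<lambda>S. r * F S) = r * bern_expect V a F"
  by (simp add: bern_expect_def sum_distrib_left)

lemma bern_expect_0 [simp]: "bern_expect V a (\<lambda>S. 0) = 0"
  by (simp add: bern_expect_def)

lemma bern_expect_sum:
  "bern_expect V a (\<lambda>S. \<Sum>i\<in>I. F i S) = (\<Sum>i\<in>I. bern_expect V a (F i))"
  unfolding bern_expect_def scaleR_sum_right by (rule sum.swap)

text \<open>Subsets of \<open>insert x V\<close> are the subsets of \<open>V\<close> and their
  copies with \<open>x\<close>; the weight gains the factor \<open>1 - a x\<close> or
  \<open>a x\<close>.\<close>

lemma bern_expect_insert: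
  assumes "finite V" "x \<notin> V"
  shows "bern_expect (insert x V) a F
    = bern_expect V a (\<lambda>S. a x *\<^sub>R F (insert x S) + (1 - a x) *\<^sub>R F S)"
proof -
  let ?w = "\<lambda>S. (\<Prod>x\<in>S. a x) * (\<Prod>x\<in>V - S. 1 - a x)"
  let ?w' = "\<lambda>S. (\<Prod>x\<in>S. a x) * (\<Prod>x\<in>insert x V - S. 1 - a x)"
  have inj: "inj_on (insert x) (Pow V)" using assms(2) by (auto simp: inj_on_def)
  have "bern_expect (insert x V) a F
      = (\<Sum>S\<in>Pow V. ?w' S *\<^sub>R F S) + (\<Sum>S\<in>insert x ` Pow V. ?w' S *\<^sub>R F S)"
    unfolding bern_expect_def Pow_insert
    by (rule sum.union_disjoint) (use assms in auto)
  also have "(\<Sum>S\<in>insert x ` Pow V. ?w' S *\<^sub>R F S) = (\<Sum>S\<in>Pow V. ?w' (insert x S) *\<^sub>R F (insert x S))"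
    by (subst sum.reindex[OF inj]) simp
  also have "\<dots> = (\<Sum>S\<in>Pow V. ?w S *\<^sub>R a x *\<^sub>R F (insert x S))"
  proof (rule sum.cong[OF refl])
    fix S assume S: "S \<in> Pow V"
    with assms have "finite S" "x \<notin> S" by (auto intro: finite_subset)
    moreover have "insert x V - insert x S = V - S" using assms S by auto
    ultimately show "?w' (insert x S) *\<^sub>R F (insert x S) = ?w S *\<^sub>R a x *\<^sub>R F (insert x S)"
      by (simp add: mult_ac)
  qed
  also have "(\<Sum>S\<in>Pow V. ?w' S *\<^sub>R F S) = (\<Sum>S\<in>Pow V. ?w S *\<^sub>R (1 - a x) *\<^sub>R F S)"
  proof (rule sum.cong[OF refl])
    fix S assume S: "S \<in> Pow V"
    have "insert x V - S = insert x (V - S)" "x \<notin> V - S" "finite (V - S)" using assms S by auto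
    then show "?w' S *\<^sub>R F S = ?w S *\<^sub>R (1 - a x) *\<^sub>R F S"
      by (simp add: mult_ac)
  qed
  finally show ?thesis
    by (simp add: bern_expect_def scaleR_add_right sum.distrib)
qed

lemma bern_expect_const:
  assumes "finite V" shows "bern_expect V a (\<lambda>S. c) = c"
  using assms
proof (induction V)
  case empty then show ?case by (simp add: bern_expect_def)
next
  case (insert x V)
  then show ?case by (simp add: bern_expect_insert flip: scaleR_add_left)
qed

text \<open>Resampling the single label of \<open>x\<close> does not change the product law.
  Centring and second moments below are this identity applied to one coordinate.\<close>

lemma bern_expect_coordinate:
  assumes "finite V" "x \<in> V"
  shows "bern_expect V a F
    = bern_expect V a (\<lambda>S. a x *\<^sub>R F (insert x S) + (1 - a x) *\<^sub>R F (S - {x}))"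
proof -
  obtain W where W: "V = insert x W" "x \<notin> W" using assms(2) by (metis Set.set_insert)
  with assms have "finite W" by simp
  have *: "S - {x} = S" if "S \<subseteq> W" for S using that W by auto
  show ?thesis unfolding W(1)
    apply (subst (1 2) bern_expect_insert[OF \<open>finite W\<close> W(2)])
    apply (rule bern_expect_cong)
    apply (simp add: * W flip: scaleR_add_left)
    done
qed

locale bernoulli_labels =
  fixes V :: "'v set" and a :: "'v \<Rightarrow> real"
  assumes finite_V: "finite V"
    and a_bounds: "\<And>x. x \<in> V \<Longrightarrow> 0 \<le> a x \<and> a x \<le> 1"
begin

abbreviation E :: "('v set \<Rightarrow> 'b::real_vector) \<Rightarrow> 'b" where "E \<equiv> bern_expect V a"

definition v :: "'v \<Rightarrow> real" where "v x = a x * (1 - a x)"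
definition \<xi> :: "'v \<Rightarrow> 'v set \<Rightarrow> real" where "\<xi> x S = of_bool (x \<in> S) - a x"

text \<open>Independence of the label of \<open>x\<close>, imposed on all sets \<open>S\<close> and
  not only on subsets of \<open>V\<close>, so that compositions inherit it without side
  conditions.\<close>

definition free_of :: "'v \<Rightarrow> ('v set \<Rightarrow> 'b) \<Rightarrow> bool" where
  "free_of x F \<longleftrightarrow> (\<forall>S. F (insert x S) = F (S - {x}))"

lemma weight_nonneg: "S \<subseteq> V \<Longrightarrow> 0 \<le> (\<Prod>x\<in>S. a x) * (\<Prod>x\<in>V - S. 1 - a x)"
  using a_bounds by (intro mult_nonneg_nonneg prod_nonneg) auto

lemma E_mono:
  fixes F G :: "'v set \<Rightarrow> real"
  assumes "\<And>S. S \<subseteq> V \<Longrightarrow> F S \<le> G S"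
  shows "E F \<le> E G"
  unfolding bern_expect_def
  by (intro sum_mono) (auto intro!: mult_left_mono weight_nonneg assms)

lemma E_nonneg: "(\<And>S. S \<subseteq> V \<Longrightarrow> 0 \<le> F S) \<Longrightarrow> 0 \<le> E (F :: 'v set \<Rightarrow> real)"
  using E_mono[of "\<lambda>_. 0" F] by simp

lemma E_norm_le:
  fixes F :: "'v set \<Rightarrow> 'b::real_normed_vector"
  shows "norm (E F) \<le> E (\<lambda>S. norm (F S))"
  unfolding bern_expect_def
  by (rule order_trans[OF norm_sum]) (intro sum_mono, use weight_nonneg in auto)

lemma E_const [simp]: "E (\<lambda>S. c) = c"
  by (rule bern_expect_const[OF finite_V])

text \<open>The variance of the absolute value of \<open>F\<close> is nonnegative.\<close>

lemma E_Cauchy_Schwarz: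
  fixes F :: "'v set \<Rightarrow> real"
  shows "(E (\<lambda>S. \<bar>F S\<bar>))\<^sup>2 \<le> E (\<lambda>S. (F S)\<^sup>2)"
proof -
  define m where "m = E (\<lambda>S. \<bar>F S\<bar>)"
  have "0 \<le> E (\<lambda>S. (\<bar>F S\<bar> - m)\<^sup>2)" by (rule E_nonneg) auto
  also have "\<dots> = E (\<lambda>S. ((F S)\<^sup>2 - (2 * m) * \<bar>F S\<bar>) + m\<^sup>2)"
    by (rule bern_expect_cong) (simp add: power2_diff)
  also have "\<dots> = E (\<lambda>S. (F S)\<^sup>2) - m\<^sup>2"
    unfolding bern_expect_add bern_expect_diff bern_expect_mult_left
    by (simp add: m_def[symmetric] power2_eq_square)
  finally show ?thesis by (simp add: m_def)
qed

text \<open>The second factor does not see the label of \<open>x\<close>, so the two values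
  \<open>1 - a x\<close> and \<open>- a x\<close> of the centred label average out.\<close>

lemma E_xi_free:
  assumes "x \<in> V" "free_of x F"
  shows "E (\<lambda>S. \<xi> x S *\<^sub>R F S) = 0"
proof -
  have F: "F (insert x S) = F (S - {x})" for S using assms(2) by (simp add: free_of_def)
  show ?thesis
    by (subst bern_expect_coordinate[OF finite_V assms(1)])
      (simp add: \<xi>_def F mult.commute flip: scaleR_add_left)
qed

lemma E_xi_sq_free:
  assumes "x \<in> V" "free_of x F"
  shows "E (\<lambda>S. (\<xi> x S)\<^sup>2 *\<^sub>R F S) = v x *\<^sub>R E F"
proof -
  have F: "F (insert x S) = F (S - {x})" for S using assms(2) by (simp add: free_of_def)
  have 1: "E F = E (\<lambda>S. F (S - {x}))"
    by (subst bern_expect_coordinate[OF finite_V assms(1)])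
      (simp add: F flip: scaleR_add_left)
  have 2: "E (\<lambda>S. (\<xi> x S)\<^sup>2 *\<^sub>R F S) = E (\<lambda>S. v x *\<^sub>R F (S - {x}))"
  proof (subst bern_expect_coordinate[OF finite_V assms(1)], rule bern_expect_cong)
    fix S
    have "a x * (1 - a x)\<^sup>2 + (1 - a x) * (a x)\<^sup>2 = v x"
      by (simp add: v_def power2_eq_square algebra_simps)
    then show "a x *\<^sub>R (\<xi> x (insert x S))\<^sup>2 *\<^sub>R F (insert x S)
        + (1 - a x) *\<^sub>R (\<xi> x (S - {x}))\<^sup>2 *\<^sub>R F (S - {x}) = v x *\<^sub>R F (S - {x})"
      by (simp add: \<xi>_def F flip: scaleR_add_left)
  qed
  show ?thesis unfolding 1 2 bern_expect_scale ..
qed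

text \<open>An indicator is idempotent, so the square of a centred indicator is affine in it.
  Diagonal quadratic terms thereby turn into constants and linear terms.\<close>

lemma xi_sq: "(\<xi> x S)\<^sup>2 = v x + (1 - 2 * a x) * \<xi> x S"
  by (auto simp: \<xi>_def v_def power2_eq_square algebra_simps)

lemma xi_abs_le: "x \<in> V \<Longrightarrow> \<bar>\<xi> x S\<bar> \<le> 1"
  using a_bounds[of x] by (auto simp: \<xi>_def)

lemma v_bounds: "x \<in> V \<Longrightarrow> 0 \<le> v x \<and> v x \<le> 1"
  using a_bounds[of x] by (auto simp: v_def intro: mult_le_one)

lemma free_of_const [simp]: "free_of x (\<lambda>S. c)"
  by (simp add: free_of_def)

lemma free_of_xi [simp]: "x \<noteq> y \<Longrightarrow> free_of x (\<xi> y)"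
  by (auto simp: free_of_def \<xi>_def)

lemma free_of_comp: "free_of x F \<Longrightarrow> free_of x (\<lambda>S. \<phi> (F S))"
  by (auto simp: free_of_def)

lemma free_of_comp2: "free_of x F \<Longrightarrow> free_of x G \<Longrightarrow> free_of x (\<lambda>S. \<phi> (F S) (G S))"
  by (auto simp: free_of_def)

lemma E_xi_xi:
  assumes "x \<in> V" "y \<in> V"
  shows "E (\<lambda>S. \<xi> x S * \<xi> y S) = (if x = y then v x else 0)"
proof (cases "x = y")
  case True
  with E_xi_sq_free[OF assms(1), of "\<lambda>S. 1::real"] show ?thesis
    by (simp add: power2_eq_square)
next
  case False
  with E_xi_free[OF assms(1), of "\<xi> y"] show ?thesis by simp
qed

lemma E_xi: "x \<in> V \<Longrightarrow> E (\<xi> x) = 0"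
  using E_xi_free[of x "\<lambda>S. 1::real"] by simp

section \<open>Linear and quadratic forms in the centred labels\<close>

definition lin :: "('v \<Rightarrow> real) \<Rightarrow> 'v set \<Rightarrow> real" where
  "lin b S = (\<Sum>y\<in>V. b y * \<xi> y S)"

text \<open>For symmetric \<open>w\<close> the factor 1/2 makes \<open>w x y\<close> the coefficient
  of the unordered pair of \<open>x\<close> and \<open>y\<close>.\<close>

definition qform :: "('v \<Rightarrow> real) \<Rightarrow> ('v \<Rightarrow> 'v \<Rightarrow> real) \<Rightarrow> 'v set \<Rightarrow> real" where
  "qform h w S = (\<Sum>x\<in>V. h x * \<xi> x S) + 1/2 * (\<Sum>x\<in>V. \<Sum>y\<in>V. w x y * \<xi> x S * \<xi> y S)"

lemma E_lin: "E (lin b) = 0"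
  unfolding lin_def by (simp add: bern_expect_sum bern_expect_mult_left E_xi)

lemma E_lin_sq: "E (\<lambda>S. (lin b S)\<^sup>2) = (\<Sum>y\<in>V. v y * (b y)\<^sup>2)"
proof -
  have "(lin b S)\<^sup>2 = (\<Sum>y\<in>V. \<Sum>z\<in>V. (b y * b z) * (\<xi> y S * \<xi> z S))" for S
    unfolding lin_def power2_eq_square sum_product by (simp add: mult_ac)
  then have "E (\<lambda>S. (lin b S)\<^sup>2) = (\<Sum>y\<in>V. \<Sum>z\<in>V. (b y * b z) * (if y = z then v y else 0))"
    by (simp add: bern_expect_sum bern_expect_mult_left E_xi_xi)
  also have "\<dots> = (\<Sum>y\<in>V. v y * (b y)\<^sup>2)"
    by (intro sum.cong refl) (simp add: finite_V power2_eq_square if_distrib sum.delta mult_ac cong: if_cong)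
  finally show ?thesis .
qed

lemma free_of_lin: "b x = 0 \<Longrightarrow> free_of x (lin b)"
  unfolding free_of_def lin_def \<xi>_def by (auto intro!: sum.cong)

lemma qform_eq: "qform h w S = (\<Sum>x\<in>V. \<xi> x S * (h x + lin (w x) S / 2))"
  unfolding qform_def lin_def
  by (simp add: algebra_simps sum.distrib sum_distrib_left sum_divide_distrib)

context
  fixes h :: "'v \<Rightarrow> real" and w :: "'v \<Rightarrow> 'v \<Rightarrow> real"
  assumes w_sym: "\<And>x y. w x y = w y x" and w_diag: "\<And>x. w x x = 0"
begin

text \<open>\<open>A x\<close> is the full coefficient of \<open>\<xi> x\<close> in
  \<open>Q\<close>, a discrete derivative. \<open>G x\<close> counts each pair term with weight one
  half, so that the sum of \<open>\<xi> x S * G x S\<close> over \<open>x\<close> restores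
  \<open>Q\<close> exactly.\<close>

abbreviation "A x S \<equiv> h x + lin (w x) S"
abbreviation "G x S \<equiv> h x + lin (w x) S / 2"
abbreviation "Q \<equiv> qform h w"
definition "rest x S = Q S - \<xi> x S * A x S"

lemma Q_split: "Q S = \<xi> x S * A x S + rest x S"
  by (simp add: rest_def)

lemma free_A: "free_of x (A x)" and free_G: "free_of x (G x)"
  using free_of_lin[of "w x" x] w_diag by (auto simp: free_of_def)

text \<open>With zero diagonal \<open>Q\<close> is affine in each single \<open>\<xi> x\<close>, and
  symmetry merges the two copies of every pair containing \<open>x\<close> into the coefficient
  \<open>A x\<close>.\<close>

lemma free_rest:
  assumes "x \<in> V" shows "free_of x (rest x)"
proof -
  have xi: "\<xi> y (insert x S) = \<xi> y (S - {x})" if "y \<noteq> x" for y S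
    using that by (auto simp: \<xi>_def)
  have Vx: "V = insert x (V - {x})" using assms by auto
  have fin: "finite (V - {x})" using finite_V by simp
  define R where "R = (\<lambda>S. (\<Sum>y\<in>V-{x}. h y * \<xi> y S)
    + 1/2 * (\<Sum>y\<in>V-{x}. \<Sum>z\<in>V-{x}. w y z * \<xi> y S * \<xi> z S))"
  have "rest x S = R S" for S
  proof -
    have s1: "(\<Sum>y\<in>V. F y) = F x + (\<Sum>y\<in>V-{x}. F y)" for F :: "'v \<Rightarrow> real"
      using assms by (simp add: sum.remove[OF finite_V])
    have s2: "(\<Sum>y\<in>V-{x}. w y x * (\<xi> y S * \<xi> x S)) = \<xi> x S * (\<Sum>y\<in>V-{x}. w x y * \<xi> y S)"
      unfolding sum_distrib_left by (rule sum.cong) (auto simp: w_sym mult_ac)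
    have s3: "(\<Sum>y\<in>V-{x}. w x y * (\<xi> y S * \<xi> x S)) = \<xi> x S * (\<Sum>y\<in>V-{x}. w x y * \<xi> y S)"
      unfolding sum_distrib_left by (rule sum.cong) (auto simp: mult_ac)
    show ?thesis
      unfolding rest_def R_def qform_def lin_def
      by (simp add: s1 w_diag sum.distrib s2 s3 algebra_simps)
  qed
  moreover have "R (insert x S) = R (S - {x})" for S
    unfolding R_def by (auto simp: xi intro!: sum.cong arg_cong2[where f="(+)"])
  ultimately show ?thesis by (simp add: free_of_def)
qed

lemma E_GA: "E (\<lambda>S. G x S * A x S) = (h x)\<^sup>2 + (\<Sum>y\<in>V. v y * (w x y)\<^sup>2) / 2"
proof -
  have "G x S * A x S = (h x)\<^sup>2 + ((3/2 * h x) * lin (w x) S + (1/2) * (lin (w x) S)\<^sup>2)" for S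
    by (simp add: field_simps power2_eq_square)
  then show ?thesis
    by (simp only: bern_expect_add E_lin E_lin_sq bern_expect_mult_left E_const)
qed

lemma E_A_sq: "E (\<lambda>S. (A x S)\<^sup>2) = (h x)\<^sup>2 + (\<Sum>y\<in>V. v y * (w x y)\<^sup>2)"
proof -
  have "(A x S)\<^sup>2 = (h x)\<^sup>2 + ((2 * h x) * lin (w x) S + (lin (w x) S)\<^sup>2)" for S
    by (simp add: algebra_simps power2_eq_square)
  then show ?thesis
    by (simp only: bern_expect_add E_lin E_lin_sq bern_expect_mult_left E_const)
qed

lemma E_qform: "E Q = 0"
proof -
  have "E Q = (\<Sum>x\<in>V. E (\<lambda>S. \<xi> x S *\<^sub>R G x S))"
    by (simp add: qform_eq[abs_def] bern_expect_sum)
  also have "\<dots> = 0" by (intro sum.neutral ballI E_xi_free free_G)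
  finally show ?thesis .
qed

text \<open>One factor \<open>Q\<close> is expanded as the sum of \<open>\<xi> x * G x\<close>, the
  other is split at the same \<open>x\<close>; only the term with the square of
  \<open>\<xi> x\<close> survives the expectation.\<close>

lemma E_qform_sq:
  "E (\<lambda>S. (Q S)\<^sup>2) = (\<Sum>x\<in>V. v x * (h x)\<^sup>2) + 1/2 * (\<Sum>x\<in>V. \<Sum>y\<in>V. v x * v y * (w x y)\<^sup>2)"
proof -
  have "E (\<lambda>S. (Q S)\<^sup>2) = E (\<lambda>S. \<Sum>x\<in>V. \<xi> x S * G x S * Q S)"
    unfolding power2_eq_square by (subst qform_eq) (simp add: sum_distrib_right)
  also have "\<dots> = (\<Sum>x\<in>V. E (\<lambda>S. \<xi> x S * G x S * Q S))"
    by (rule bern_expect_sum)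
  also have "\<dots> = (\<Sum>x\<in>V. v x * ((h x)\<^sup>2 + (\<Sum>y\<in>V. v y * (w x y)\<^sup>2) / 2))"
  proof (rule sum.cong[OF refl])
    fix x assume x: "x \<in> V"
    have "\<xi> x S * G x S * Q S = (\<xi> x S)\<^sup>2 *\<^sub>R (G x S * A x S) + \<xi> x S *\<^sub>R (G x S * rest x S)" for S
      by (subst Q_split[of S x]) (simp add: field_simps power2_eq_square)
    then have "E (\<lambda>S. \<xi> x S * G x S * Q S) = E (\<lambda>S. (\<xi> x S)\<^sup>2 *\<^sub>R (G x S * A x S))
        + E (\<lambda>S. \<xi> x S *\<^sub>R (G x S * rest x S))"
      by (simp add: bern_expect_add)
    also have "\<dots> = v x * E (\<lambda>S. G x S * A x S)"
      using E_xi_sq_free[OF x free_of_comp2[OF free_G free_A, where \<phi>="(*)"]]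
        E_xi_free[OF x free_of_comp2[OF free_G free_rest[OF x], where \<phi>="(*)"]]
      by simp
    finally show "E (\<lambda>S. \<xi> x S * G x S * Q S) = v x * ((h x)\<^sup>2 + (\<Sum>y\<in>V. v y * (w x y)\<^sup>2) / 2)"
      by (simp add: E_GA)
  qed
  also have "\<dots> = (\<Sum>x\<in>V. v x * (h x)\<^sup>2) + 1/2 * (\<Sum>x\<in>V. \<Sum>y\<in>V. v x * v y * (w x y)\<^sup>2)"
    by (simp add: algebra_simps sum.distrib sum_distrib_left sum_divide_distrib)
  finally show ?thesis .
qed

end

lemma weighted_Cauchy_Schwarz:
  fixes c d :: "'v \<Rightarrow> real"
  shows "(\<Sum>x\<in>V. c x * d x)\<^sup>2 \<le> (\<Sum>x\<in>V. \<bar>c x\<bar>) * (\<Sum>x\<in>V. \<bar>c x\<bar> * (d x)\<^sup>2)"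
proof -
  have "(\<Sum>x\<in>V. c x * d x) = (\<Sum>x\<in>V. sqrt \<bar>c x\<bar> * (sgn (c x) * sqrt \<bar>c x\<bar> * d x))"
    by (intro sum.cong refl) (simp add: sgn_real_def flip: mult.assoc)
  also have "\<dots>\<^sup>2 \<le> (\<Sum>x\<in>V. (sqrt \<bar>c x\<bar>)\<^sup>2) * (\<Sum>x\<in>V. (sgn (c x) * sqrt \<bar>c x\<bar> * d x)\<^sup>2)"
    by (rule Cauchy_Schwarz_ineq_sum)
  also have "(\<Sum>x\<in>V. (sgn (c x) * sqrt \<bar>c x\<bar> * d x)\<^sup>2) = (\<Sum>x\<in>V. \<bar>c x\<bar> * (d x)\<^sup>2)"
    by (intro sum.cong refl) (simp add: sgn_real_def power_mult_distrib)
  finally show ?thesis by simp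
qed

end

section \<open>Stein's argument for a form of variance one\<close>

locale small_quadratic_form = bernoulli_labels V a
  for V :: "'v set" and a :: "'v \<Rightarrow> real" +
  fixes h :: "'v \<Rightarrow> real" and w :: "'v \<Rightarrow> 'v \<Rightarrow> real" and \<eta> :: real
  assumes w_sym: "w x y = w y x" and w_diag: "w x x = 0"
    and h_small: "x \<in> V \<Longrightarrow> \<bar>h x\<bar> \<le> \<eta>"
    and w_small: "x \<in> V \<Longrightarrow> (\<Sum>y\<in>V. \<bar>w x y\<bar>) \<le> \<eta>"
    and variance_one: "(\<Sum>x\<in>V. v x * (h x)\<^sup>2)
      + 1/2 * (\<Sum>x\<in>V. \<Sum>y\<in>V. v x * v y * (w x y)\<^sup>2) = 1"
begin

abbreviation "A\<^sub>w x S \<equiv> h x + lin (w x) S"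
abbreviation "G\<^sub>w x S \<equiv> h x + lin (w x) S / 2"
abbreviation "Q\<^sub>w \<equiv> qform h w"
abbreviation "rest\<^sub>w \<equiv> rest h w"

text \<open>The random quantity that takes the place of the variance in Stein's identity: the mean
  of \<open>Q\<close> times a smooth function of \<open>Q\<close> is close to the mean of
  \<open>U\<close> times its derivative. By \<open>variance_one\<close> its own mean is 1.\<close>

definition "U S = (\<Sum>x\<in>V. v x * (G\<^sub>w x S * A\<^sub>w x S))"
text \<open>The linear coefficients of \<open>U - 1\<close>. The factors 3/2 and 1/2 come from
  multiplying \<open>h + l\<close> by \<open>h + l / 2\<close>, the factor
  \<open>1 - 2 * a y\<close> from the squares of \<open>\<xi> y\<close>.\<close>

definition "lc y = 3/2 * (\<Sum>x\<in>V. v x * w x y * h x) + 1/2 * (1 - 2 * a y) * (\<Sum>x\<in>V. v x * w x y * w x y)"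
definition "B y z = (if y = z then 0 else \<Sum>x\<in>V. v x * w x z * w x y)"

lemma lin_sq: "(lin (w x) S)\<^sup>2 = (\<Sum>y\<in>V. v y * (w x y)\<^sup>2) + (\<Sum>y\<in>V. (1 - 2 * a y) * (w x y)\<^sup>2 * \<xi> y S)
   + (\<Sum>y\<in>V. \<Sum>z\<in>V. if y = z then 0 else w x z * w x y * (\<xi> y S * \<xi> z S))"
proof -
  have "(lin (w x) S)\<^sup>2 = (\<Sum>y\<in>V. \<Sum>z\<in>V. w x z * w x y * (\<xi> y S * \<xi> z S))"
    unfolding lin_def power2_eq_square sum_product by (simp add: mult_ac)
  also have "\<dots> = (\<Sum>y\<in>V. \<Sum>z\<in>V. (if z = y then (w x y)\<^sup>2 * (\<xi> y S)\<^sup>2 else 0)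
      + (if y = z then 0 else w x z * w x y * (\<xi> y S * \<xi> z S)))"
    by (intro sum.cong refl) (auto simp: power2_eq_square)
  also have "\<dots> = (\<Sum>y\<in>V. (w x y)\<^sup>2 * (\<xi> y S)\<^sup>2)
      + (\<Sum>y\<in>V. \<Sum>z\<in>V. if y = z then 0 else w x z * w x y * (\<xi> y S * \<xi> z S))"
    by (simp add: sum.distrib finite_V)
  also have "(\<Sum>y\<in>V. (w x y)\<^sup>2 * (\<xi> y S)\<^sup>2)
      = (\<Sum>y\<in>V. v y * (w x y)\<^sup>2) + (\<Sum>y\<in>V. (1 - 2 * a y) * (w x y)\<^sup>2 * \<xi> y S)"
    by (simp add: xi_sq algebra_simps sum.distrib sum_subtractf)
  finally show ?thesis by simp
qed

text \<open>The fluctuation of \<open>U\<close> is a form of the same type as \<open>Q\<close>, so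
  \<open>E_qform_sq\<close> computes its variance.\<close>

lemma U_eq: "U S - 1 = qform lc B S"
proof -
  have e1: "(\<Sum>x\<in>V. v x * (h x * lin (w x) S)) = (\<Sum>y\<in>V. (\<Sum>x\<in>V. v x * w x y * h x) * \<xi> y S)"
    unfolding lin_def sum_distrib_left sum_distrib_right
    by (subst sum.swap) (simp add: mult_ac)
  have e2: "(\<Sum>x\<in>V. v x * (\<Sum>y\<in>V. (1 - 2 * a y) * (w x y)\<^sup>2 * \<xi> y S))
     = (\<Sum>y\<in>V. ((1 - 2 * a y) * (\<Sum>x\<in>V. v x * w x y * w x y)) * \<xi> y S)"
    unfolding sum_distrib_left sum_distrib_right
    by (subst sum.swap) (simp add: mult_ac power2_eq_square)
  have e3: "(\<Sum>x\<in>V. v x * (\<Sum>y\<in>V. \<Sum>z\<in>V. if y = z then 0 else w x z * w x y * (\<xi> y S * \<xi> z S)))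
     = (\<Sum>y\<in>V. \<Sum>z\<in>V. B y z * \<xi> y S * \<xi> z S)"
  proof -
    have "(\<Sum>x\<in>V. v x * (\<Sum>y\<in>V. \<Sum>z\<in>V. if y = z then 0 else w x z * w x y * (\<xi> y S * \<xi> z S)))
       = (\<Sum>y\<in>V. \<Sum>z\<in>V. \<Sum>x\<in>V. v x * (if y = z then 0 else w x z * w x y * (\<xi> y S * \<xi> z S)))"
      unfolding sum_distrib_left
      by (rule trans[OF sum.swap sum.cong[OF refl sum.swap]])
    also have "\<dots> = (\<Sum>y\<in>V. \<Sum>z\<in>V. B y z * \<xi> y S * \<xi> z S)"
      by (intro sum.cong refl) (auto simp: B_def sum_distrib_right sum_distrib_left mult_ac)
    finally show ?thesis .
  qed
  have "U S = (\<Sum>x\<in>V. v x * (h x)\<^sup>2) + 3/2 * (\<Sum>x\<in>V. v x * (h x * lin (w x) S))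
      + 1/2 * (\<Sum>x\<in>V. v x * (lin (w x) S)\<^sup>2)"
    unfolding U_def sum_distrib_left sum.distrib[symmetric]
    by (intro sum.cong refl) (simp add: field_simps power2_eq_square)
  also have "(\<Sum>x\<in>V. v x * (lin (w x) S)\<^sup>2) = (\<Sum>x\<in>V. \<Sum>y\<in>V. v x * v y * (w x y)\<^sup>2)
     + (\<Sum>x\<in>V. v x * (\<Sum>y\<in>V. (1 - 2 * a y) * (w x y)\<^sup>2 * \<xi> y S))
     + (\<Sum>x\<in>V. v x * (\<Sum>y\<in>V. \<Sum>z\<in>V. if y = z then 0 else w x z * w x y * (\<xi> y S * \<xi> z S)))"
    unfolding lin_sq by (simp add: algebra_simps sum.distrib sum_distrib_left)
  finally have "U S - 1 = 3/2 * (\<Sum>x\<in>V. v x * (h x * lin (w x) S))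
     + 1/2 * (\<Sum>x\<in>V. v x * (\<Sum>y\<in>V. (1 - 2 * a y) * (w x y)\<^sup>2 * \<xi> y S))
     + 1/2 * (\<Sum>x\<in>V. v x * (\<Sum>y\<in>V. \<Sum>z\<in>V. if y = z then 0 else w x z * w x y * (\<xi> y S * \<xi> z S)))"
    using variance_one by (simp add: field_simps)
  then show ?thesis
    unfolding e1 e2 e3 qform_def lc_def
    by (simp add: algebra_simps sum.distrib sum_subtractf sum_distrib_left)
qed

lemma eta_nonneg: "x \<in> V \<Longrightarrow> 0 \<le> \<eta>"
  using h_small[of x] by simp

lemma v_nonneg: "x \<in> V \<Longrightarrow> 0 \<le> v x" and v_le_1: "x \<in> V \<Longrightarrow> v x \<le> 1"
  using v_bounds[of x] by auto

lemma w_le: assumes "x \<in> V" "y \<in> V" shows "\<bar>w x y\<bar> \<le> \<eta>"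
proof -
  have "\<bar>w x y\<bar> \<le> (\<Sum>y\<in>V. \<bar>w x y\<bar>)" by (rule member_le_sum) (use assms finite_V in auto)
  with w_small[OF assms(1)] show ?thesis by simp
qed

lemma vw_small: assumes "y \<in> V" shows "(\<Sum>x\<in>V. \<bar>v x * w x y\<bar>) \<le> \<eta>"
proof -
  have "(\<Sum>x\<in>V. \<bar>v x * w x y\<bar>) \<le> (\<Sum>x\<in>V. \<bar>w y x\<bar>)"
    by (intro sum_mono) (auto simp: abs_mult v_nonneg v_le_1 w_sym[of y] intro!: mult_left_le_one_le)
  with w_small[OF assms] show ?thesis by simp
qed

lemma vvw_le: "(\<Sum>x\<in>V. \<Sum>y\<in>V. v x * v y * (w x y)\<^sup>2) \<le> 2"
proof -
  have "0 \<le> (\<Sum>x\<in>V. v x * (h x)\<^sup>2)" by (intro sum_nonneg) (simp add: v_nonneg)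
  with variance_one show ?thesis by simp
qed

lemma vh_le: "(\<Sum>x\<in>V. v x * (h x)\<^sup>2) \<le> 1"
proof -
  have "0 \<le> (\<Sum>x\<in>V. \<Sum>y\<in>V. v x * v y * (w x y)\<^sup>2)" by (intro sum_nonneg) (simp add: v_nonneg)
  with variance_one show ?thesis by simp
qed

lemma weighted_row_bound:
  assumes "y \<in> V"
  shows "(\<Sum>x\<in>V. v x * w x y * d x)\<^sup>2 \<le> \<eta> * (\<Sum>x\<in>V. v x * \<bar>w x y\<bar> * (d x)\<^sup>2)"
proof -
  have "(\<Sum>x\<in>V. v x * w x y * d x)\<^sup>2 \<le> (\<Sum>x\<in>V. \<bar>v x * w x y\<bar>) * (\<Sum>x\<in>V. \<bar>v x * w x y\<bar> * (d x)\<^sup>2)"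
    by (rule weighted_Cauchy_Schwarz)
  also have "\<dots> \<le> \<eta> * (\<Sum>x\<in>V. \<bar>v x * w x y\<bar> * (d x)\<^sup>2)"
    by (intro mult_right_mono vw_small assms sum_nonneg) auto
  finally show ?thesis by (simp add: abs_mult v_nonneg)
qed

text \<open>Cauchy-Schwarz with the weights \<open>\<bar>v x * w x y\<bar>\<close>, whose sum over
  \<open>x\<close> is at most \<open>\<eta>\<close>. A row sum or a single entry of \<open>w\<close>
  gives a second \<open>\<eta>\<close>, and what remains is part of the unit variance.\<close>

lemma E_U: "E (\<lambda>S. (U S - 1)\<^sup>2) \<le> (3 * \<eta>)\<^sup>2"
proof (cases "V = {}")
  case True
  then show ?thesis using variance_one by simp
next
  case False
  then have eta: "0 \<le> \<eta>" using eta_nonneg by auto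
  let ?P = "\<lambda>y. (\<Sum>x\<in>V. v x * w x y * h x)\<^sup>2"
  let ?R = "\<lambda>y. (\<Sum>x\<in>V. v x * w x y * w x y)\<^sup>2"
  have P: "(\<Sum>y\<in>V. v y * ?P y) \<le> \<eta>\<^sup>2"
  proof -
    have "(\<Sum>y\<in>V. v y * ?P y) \<le> (\<Sum>y\<in>V. \<eta> * (\<Sum>x\<in>V. v x * \<bar>w x y\<bar> * (h x)\<^sup>2))"
      by (intro sum_mono order_trans[OF mult_left_le_one_le weighted_row_bound]) (auto simp: v_le_1 v_nonneg)
    also have "\<dots> = \<eta> * (\<Sum>x\<in>V. v x * (h x)\<^sup>2 * (\<Sum>y\<in>V. \<bar>w x y\<bar>))"
      unfolding sum_distrib_left by (subst sum.swap) (simp add: mult_ac)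
    also have "\<dots> \<le> \<eta> * (\<Sum>x\<in>V. v x * (h x)\<^sup>2 * \<eta>)"
      by (intro mult_left_mono sum_mono w_small eta) (auto simp: v_nonneg)
    also have "\<dots> = \<eta>\<^sup>2 * (\<Sum>x\<in>V. v x * (h x)\<^sup>2)"
      by (simp add: power2_eq_square sum_distrib_left sum_distrib_right mult_ac)
    also have "\<dots> \<le> \<eta>\<^sup>2 * 1" by (intro mult_left_mono vh_le) auto
    finally show ?thesis by simp
  qed
  have R: "(\<Sum>y\<in>V. v y * ?R y) \<le> 2 * \<eta>\<^sup>2"
  proof -
    have "(\<Sum>y\<in>V. v y * ?R y) \<le> (\<Sum>y\<in>V. v y * (\<eta> * (\<Sum>x\<in>V. v x * \<bar>w x y\<bar> * (w x y)\<^sup>2)))"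
      by (intro sum_mono mult_left_mono weighted_row_bound) (auto simp: v_nonneg)
    also have "\<dots> \<le> (\<Sum>y\<in>V. v y * (\<eta> * (\<Sum>x\<in>V. v x * \<eta> * (w x y)\<^sup>2)))"
      by (intro sum_mono mult_left_mono mult_right_mono eta w_le) (auto simp: v_nonneg)
    also have "\<dots> = \<eta>\<^sup>2 * (\<Sum>x\<in>V. \<Sum>y\<in>V. v x * v y * (w x y)\<^sup>2)"
      unfolding sum_distrib_left by (subst sum.swap) (simp add: power2_eq_square mult_ac)
    also have "\<dots> \<le> \<eta>\<^sup>2 * 2" by (intro mult_left_mono vvw_le) auto
    finally show ?thesis by simp
  qed
  have l: "(\<Sum>y\<in>V. v y * (lc y)\<^sup>2) \<le> 9/2 * \<eta>\<^sup>2 + \<eta>\<^sup>2"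
  proof -
    have "(lc y)\<^sup>2 \<le> 9/2 * ?P y + 1/2 * ?R y" if "y \<in> V" for y
    proof -
      have "(1 - 2 * a y)\<^sup>2 \<le> 1" using a_bounds[OF that] by (simp add: abs_square_le_1 abs_le_iff)
      then have "(1 - 2 * a y)\<^sup>2 * ?R y \<le> 1 * ?R y" by (intro mult_right_mono) auto
      moreover have "(lc y)\<^sup>2 \<le> 2 * (3/2 * (\<Sum>x\<in>V. v x * w x y * h x))\<^sup>2
         + 2 * (1/2 * (1 - 2 * a y) * (\<Sum>x\<in>V. v x * w x y * w x y))\<^sup>2"
        unfolding lc_def using sum_squares_bound by (smt (verit) power2_sum power2_diff zero_le_power2)
      ultimately show ?thesis by (simp add: power_mult_distrib power_divide)
    qed
    then have "(\<Sum>y\<in>V. v y * (lc y)\<^sup>2) \<le> (\<Sum>y\<in>V. v y * (9/2 * ?P y + 1/2 * ?R y))"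
      by (intro sum_mono mult_left_mono) (auto simp: v_nonneg)
    also have "\<dots> = 9/2 * (\<Sum>y\<in>V. v y * ?P y) + 1/2 * (\<Sum>y\<in>V. v y * ?R y)"
      by (simp add: sum_distrib_left sum.distrib algebra_simps)
    finally show ?thesis using P R by linarith
  qed
  have b: "(\<Sum>y\<in>V. \<Sum>z\<in>V. v y * v z * (B y z)\<^sup>2) \<le> 2 * \<eta>\<^sup>2"
  proof -
    have "v z * (B y z)\<^sup>2 \<le> \<eta> * (\<Sum>x\<in>V. v x * \<bar>w x z\<bar> * (w x y)\<^sup>2)" if "y \<in> V" "z \<in> V" for y z
    proof (cases "y = z")
      case True
      with that show ?thesis by (auto simp: B_def v_nonneg eta intro!: mult_nonneg_nonneg sum_nonneg)
    next
      case False
      with that show ?thesis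
        using order_trans[OF mult_left_le_one_le weighted_row_bound[OF that(2), of "\<lambda>x. w x y"], of "v z"]
        by (simp add: B_def v_nonneg v_le_1)
    qed
    then have "(\<Sum>y\<in>V. \<Sum>z\<in>V. v y * v z * (B y z)\<^sup>2)
        \<le> (\<Sum>y\<in>V. \<Sum>z\<in>V. v y * (\<eta> * (\<Sum>x\<in>V. v x * \<bar>w x z\<bar> * (w x y)\<^sup>2)))"
      unfolding mult.assoc by (intro sum_mono mult_left_mono) (auto simp: v_nonneg)
    also have "\<dots> = \<eta> * (\<Sum>y\<in>V. \<Sum>x\<in>V. v x * v y * (w x y)\<^sup>2 * (\<Sum>z\<in>V. \<bar>w x z\<bar>))"
      unfolding sum_distrib_left by (rule sum.cong[OF refl], subst sum.swap) (simp add: mult_ac)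
    also have "\<dots> \<le> \<eta> * (\<Sum>y\<in>V. \<Sum>x\<in>V. v x * v y * (w x y)\<^sup>2 * \<eta>)"
      by (intro mult_left_mono sum_mono w_small eta) (auto simp: v_nonneg)
    also have "\<dots> = \<eta>\<^sup>2 * (\<Sum>x\<in>V. \<Sum>y\<in>V. v x * v y * (w x y)\<^sup>2)"
      unfolding sum_distrib_left by (subst sum.swap) (simp add: power2_eq_square mult_ac)
    also have "\<dots> \<le> \<eta>\<^sup>2 * 2" by (intro mult_left_mono vvw_le) auto
    finally show ?thesis by simp
  qed
  have "B y z = B z y" "B y y = 0" for y z
    by (auto simp: B_def mult_ac)
  then have "E (\<lambda>S. (U S - 1)\<^sup>2) = (\<Sum>y\<in>V. v y * (lc y)\<^sup>2)
     + 1/2 * (\<Sum>y\<in>V. \<Sum>z\<in>V. v y * v z * (B y z)\<^sup>2)"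
    unfolding U_eq by (intro E_qform_sq)
  also have "\<dots> \<le> (9/2 * \<eta>\<^sup>2 + \<eta>\<^sup>2) + 1/2 * (2 * \<eta>\<^sup>2)"
    using l b by linarith
  \<comment> \<open>The total 13/2 is rounded up to 9 in order to have a perfect square.\<close>
  also have "\<dots> \<le> (3 * \<eta>)\<^sup>2" by (simp add: power_mult_distrib)
  finally show ?thesis .
qed

lemma E_A_sum: "(\<Sum>x\<in>V. v x * E (\<lambda>S. (A\<^sub>w x S)\<^sup>2)) \<le> 2"
proof -
  have "(\<Sum>x\<in>V. v x * E (\<lambda>S. (A\<^sub>w x S)\<^sup>2))
      = (\<Sum>x\<in>V. v x * (h x)\<^sup>2) + (\<Sum>x\<in>V. \<Sum>y\<in>V. v x * v y * (w x y)\<^sup>2)"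
    using E_A_sq[where w=w and h=h, OF w_sym w_diag] by (simp add: algebra_simps sum.distrib sum_distrib_left)
  with variance_one vvw_le show ?thesis by simp
qed

definition cf :: "real \<Rightarrow> complex" where "cf t = E (\<lambda>S. iexp (t * Q\<^sub>w S))"

lemma cf_deriv: "(cf has_vector_derivative E (\<lambda>S. \<i> * of_real (Q\<^sub>w S) * iexp (t * Q\<^sub>w S))) (at t)"
proof -
  have *: "((\<lambda>t. iexp (t * q)) has_vector_derivative \<i> * of_real q * iexp (t * q)) (at t)" for q
  proof -
    have "((\<lambda>z. exp (\<i> * (z * of_real q))) has_field_derivative \<i> * of_real q * iexp (t * q)) (at (of_real t))"
      by (auto intro!: derivative_eq_intros simp: mult_ac)
    from has_vector_derivative_real_field[OF this] show ?thesis by simp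
  qed
  show ?thesis
    unfolding cf_def[abs_def] bern_expect_def
    by (intro has_vector_derivative_sum
        bounded_linear.has_vector_derivative[OF bounded_linear_scaleR_right] *)
qed

text \<open>The exponent is that of \<open>rest\<close> plus a small increment carrying the label of
  \<open>x\<close>. Expanding the increment, the constant term vanishes, the linear one produces
  \<open>v x\<close> times \<open>G * A\<close>, and the remainder is quadratic. Putting the full
  exponent back costs one more first order error.\<close>

lemma cf_deriv_term:
  assumes x: "x \<in> V"
  shows "cmod (E (\<lambda>S. of_real (\<xi> x S * G\<^sub>w x S) * iexp (t * Q\<^sub>w S))
      - \<i> * of_real t * of_real (v x) * E (\<lambda>S. of_real (G\<^sub>w x S * A\<^sub>w x S) * iexp (t * Q\<^sub>w S)))
    \<le> 9/4 * t\<^sup>2 * \<eta> * (v x * E (\<lambda>S. (A\<^sub>w x S)\<^sup>2))"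
    (is "cmod (?L - ?M) \<le> _")
proof -
  let ?R = "\<lambda>S. iexp (t * rest\<^sub>w x S)"
  let ?z = "\<lambda>S. t * (\<xi> x S * A\<^sub>w x S)"
  have fR: "free_of x ?R"
    by (rule free_of_comp[OF free_rest[where w=w and h=h, OF w_sym w_diag x], of "\<lambda>r. iexp (t * r)"])
  have fA: "free_of x (A\<^sub>w x)" and fG: "free_of x (G\<^sub>w x)"
    using free_A[where w=w and h=h, OF w_sym w_diag] free_G[where w=w and h=h, OF w_sym w_diag] by auto
  have Q: "iexp (t * Q\<^sub>w S) = iexp (?z S) * ?R S" for S
    by (subst Q_split[where w=w and h=h, OF w_sym w_diag, of S x]) (simp add: algebra_simps flip: exp_add)
  have f1: "free_of x (\<lambda>S. of_real (G\<^sub>w x S) * ?R S)"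
    by (rule free_of_comp2[OF fG fR, where \<phi>="\<lambda>g r. of_real g * r"])
  have f2: "free_of x (\<lambda>S. of_real (G\<^sub>w x S * A\<^sub>w x S) * ?R S)"
    by (rule free_of_comp2[OF free_of_comp2[OF fG fA, where \<phi>="(*)"] fR, where \<phi>="\<lambda>g r. of_real g * r"])
  have f3: "free_of x (\<lambda>S. \<bar>G\<^sub>w x S\<bar> * (A\<^sub>w x S)\<^sup>2)"
    by (rule free_of_comp2[OF fG fA, where \<phi>="\<lambda>g a. \<bar>g\<bar> * a\<^sup>2"])
  let ?e1 = "\<lambda>S. of_real (\<xi> x S * G\<^sub>w x S) * ?R S * (iexp (?z S) - 1 - \<i> * of_real (?z S))"
  let ?e2 = "\<lambda>S. of_real (G\<^sub>w x S * A\<^sub>w x S) * ?R S * (iexp (?z S) - 1)"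
  have alg1: "of_real (y * g) * (I * r) = y *\<^sub>R (of_real g * r) + \<i> * of_real t * (y\<^sup>2 *\<^sub>R (of_real (g * b) * r))
      + of_real (y * g) * r * (I - 1 - \<i> * of_real (t * (y * b)))" for y g b :: real and I r :: complex
    by (simp add: scaleR_conv_of_real algebra_simps power2_eq_square)
  have alg2: "of_real p * (I * r) = of_real p * r + of_real p * r * (I - 1)" for p :: real and I r :: complex
    by (simp add: algebra_simps)
  have nrm: "cmod (of_real p * r * X) \<le> \<bar>p\<bar> * b" if "cmod X \<le> b" "cmod r = 1"
    for p b :: real and r X :: complex
    using that by (simp add: norm_mult mult_left_mono)
  have "?L = E (\<lambda>S. \<xi> x S *\<^sub>R (of_real (G\<^sub>w x S) * ?R S)
      + \<i> * of_real t * ((\<xi> x S)\<^sup>2 *\<^sub>R (of_real (G\<^sub>w x S * A\<^sub>w x S) * ?R S)) + ?e1 S)"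
    unfolding Q by (rule bern_expect_cong) (rule alg1)
  also have "\<dots> = \<i> * of_real t * (v x *\<^sub>R E (\<lambda>S. of_real (G\<^sub>w x S * A\<^sub>w x S) * ?R S)) + E ?e1"
    by (simp only: bern_expect_add bern_expect_mult_left E_xi_free[OF x f1] E_xi_sq_free[OF x f2]) simp
  finally have L: "?L = \<i> * of_real t * of_real (v x) * E (\<lambda>S. of_real (G\<^sub>w x S * A\<^sub>w x S) * ?R S) + E ?e1"
    by (simp add: scaleR_conv_of_real mult_ac)
  have "E (\<lambda>S. of_real (G\<^sub>w x S * A\<^sub>w x S) * iexp (t * Q\<^sub>w S))
      = E (\<lambda>S. of_real (G\<^sub>w x S * A\<^sub>w x S) * ?R S + ?e2 S)"
    unfolding Q by (rule bern_expect_cong) (rule alg2)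
  then have M: "?M = \<i> * of_real t * of_real (v x) * (E (\<lambda>S. of_real (G\<^sub>w x S * A\<^sub>w x S) * ?R S) + E ?e2)"
    by (simp only: bern_expect_add)
  have "?L - ?M = E ?e1 - \<i> * of_real t * of_real (v x) * E ?e2"
    unfolding L M by (simp add: algebra_simps)
  then have b0: "cmod (?L - ?M) \<le> cmod (E ?e1) + \<bar>t\<bar> * v x * cmod (E ?e2)"
    using norm_triangle_ineq4[of "E ?e1" "\<i> * of_real t * of_real (v x) * E ?e2"]
    by (simp add: norm_mult v_nonneg[OF x])
  have "cmod (E ?e1) \<le> E (\<lambda>S. t\<^sup>2/2 * ((\<xi> x S)\<^sup>2 *\<^sub>R (\<bar>G\<^sub>w x S\<bar> * (A\<^sub>w x S)\<^sup>2)))"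
  proof (rule order_trans[OF E_norm_le E_mono])
    fix S
    have "cmod (iexp (?z S) - 1 - \<i> * of_real (?z S)) \<le> (?z S)\<^sup>2 / 2"
      using iexp_approx1[of "?z S" 1] by (simp add: algebra_simps power2_eq_square)
    from nrm[OF this norm_exp_i_times, of "\<xi> x S * G\<^sub>w x S" "t * rest\<^sub>w x S"]
    have "cmod (?e1 S) \<le> \<bar>\<xi> x S\<bar> * \<bar>G\<^sub>w x S\<bar> * ((?z S)\<^sup>2 / 2)"
      unfolding abs_mult .
    also have "\<dots> \<le> 1 * \<bar>G\<^sub>w x S\<bar> * ((?z S)\<^sup>2 / 2)"
      by (intro mult_right_mono xi_abs_le x) auto
    finally show "cmod (?e1 S) \<le> t\<^sup>2/2 * ((\<xi> x S)\<^sup>2 *\<^sub>R (\<bar>G\<^sub>w x S\<bar> * (A\<^sub>w x S)\<^sup>2))"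
      by (simp add: power_mult_distrib mult_ac)
  qed
  also have "\<dots> = t\<^sup>2/2 * (v x * E (\<lambda>S. \<bar>G\<^sub>w x S\<bar> * (A\<^sub>w x S)\<^sup>2))"
    by (simp only: bern_expect_mult_left E_xi_sq_free[OF x f3]) simp
  finally have b1: "cmod (E ?e1) \<le> t\<^sup>2/2 * (v x * E (\<lambda>S. \<bar>G\<^sub>w x S\<bar> * (A\<^sub>w x S)\<^sup>2))" .
  have "cmod (E ?e2) \<le> E (\<lambda>S. \<bar>t\<bar> * (\<bar>G\<^sub>w x S\<bar> * (A\<^sub>w x S)\<^sup>2))"
  proof (rule order_trans[OF E_norm_le E_mono])
    fix S
    have "cmod (iexp (?z S) - 1) \<le> \<bar>?z S\<bar>"
      using iexp_approx1[of "?z S" 0] by simp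
    from nrm[OF this norm_exp_i_times, of "G\<^sub>w x S * A\<^sub>w x S" "t * rest\<^sub>w x S"]
    have "cmod (?e2 S) \<le> \<bar>G\<^sub>w x S\<bar> * \<bar>A\<^sub>w x S\<bar> * \<bar>?z S\<bar>"
      unfolding abs_mult[of "G\<^sub>w x S" "A\<^sub>w x S"] .
    also have "\<dots> = \<bar>\<xi> x S\<bar> * (\<bar>t\<bar> * (\<bar>G\<^sub>w x S\<bar> * (A\<^sub>w x S)\<^sup>2))"
      by (simp add: abs_mult mult_ac power2_eq_square)
    also have "\<dots> \<le> 1 * (\<bar>t\<bar> * (\<bar>G\<^sub>w x S\<bar> * (A\<^sub>w x S)\<^sup>2))"
      by (intro mult_right_mono xi_abs_le x) auto
    finally show "cmod (?e2 S) \<le> \<bar>t\<bar> * (\<bar>G\<^sub>w x S\<bar> * (A\<^sub>w x S)\<^sup>2)" by simp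
  qed
  also have "\<dots> = \<bar>t\<bar> * E (\<lambda>S. \<bar>G\<^sub>w x S\<bar> * (A\<^sub>w x S)\<^sup>2)"
    by (simp only: bern_expect_mult_left)
  finally have b2: "\<bar>t\<bar> * v x * cmod (E ?e2)
      \<le> \<bar>t\<bar> * v x * (\<bar>t\<bar> * E (\<lambda>S. \<bar>G\<^sub>w x S\<bar> * (A\<^sub>w x S)\<^sup>2))"
    by (rule mult_left_mono) (simp add: v_nonneg x)
  have "t\<^sup>2/2 * (p * e) + \<bar>t\<bar> * p * (\<bar>t\<bar> * e) = 3/2 * t\<^sup>2 * (p * e)" for p e :: real
  proof -
    have "\<bar>t\<bar> * p * (\<bar>t\<bar> * e) = (\<bar>t\<bar> * \<bar>t\<bar>) * (p * e)" by (simp only: mult_ac)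
    then show ?thesis by (simp add: power2_eq_square)
  qed
  \<comment> \<open>1/2 from the quadratic Taylor remainder plus 1 from putting the exponent
    back.\<close>
  then have *: "cmod (?L - ?M) \<le> 3/2 * t\<^sup>2 * (v x * E (\<lambda>S. \<bar>G\<^sub>w x S\<bar> * (A\<^sub>w x S)\<^sup>2))"
    using order_trans[OF b0 add_mono[OF b1 b2]] by metis
  \<comment> \<open>\<open>h x\<close> and the linear form are both at most \<open>\<eta>\<close>,
    so the coefficient with half the linear form is at most \<open>3/2 * \<eta>\<close>; this turns
    3/2 into 9/4.\<close>
  have "E (\<lambda>S. \<bar>G\<^sub>w x S\<bar> * (A\<^sub>w x S)\<^sup>2) \<le> E (\<lambda>S. 3/2 * \<eta> * (A\<^sub>w x S)\<^sup>2)"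
  proof (intro E_mono mult_right_mono)
    fix S
    have "\<bar>lin (w x) S\<bar> \<le> (\<Sum>y\<in>V. \<bar>w x y\<bar>)"
      unfolding lin_def
      by (rule order_trans[OF sum_abs]) (intro sum_mono, simp add: abs_mult mult_left_le xi_abs_le)
    then have "\<bar>lin (w x) S\<bar> \<le> \<eta>" using w_small[OF x] by simp
    then show "\<bar>G\<^sub>w x S\<bar> \<le> 3/2 * \<eta>" using h_small[OF x] by linarith
  qed auto
  then have "3/2 * t\<^sup>2 * (v x * E (\<lambda>S. \<bar>G\<^sub>w x S\<bar> * (A\<^sub>w x S)\<^sup>2))
      \<le> 3/2 * t\<^sup>2 * (v x * (3/2 * \<eta> * E (\<lambda>S. (A\<^sub>w x S)\<^sup>2)))"
    unfolding bern_expect_mult_left by (intro mult_left_mono) (auto simp: v_nonneg x)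
  with * show ?thesis by (simp add: mult_ac)
qed

text \<open>Up to \<open>\<eta>\<close> the characteristic function solves the equation y' = - t * y
  of the normal law. The error linear in \<open>t\<close> is the mean deviation of \<open>U\<close>
  from 1; the quadratic one collects the Taylor errors, whose weights sum to at most 2 by
  \<open>E_A_sum\<close>.\<close>

lemma cf_ode:
  "cmod (E (\<lambda>S. \<i> * of_real (Q\<^sub>w S) * iexp (t * Q\<^sub>w S)) + of_real t * cf t) \<le> (3 * \<bar>t\<bar> + 9/2 * t\<^sup>2) * \<eta>"
proof -
  have eta: "0 \<le> \<eta>" using variance_one eta_nonneg by (cases "V = {}") auto
  let ?e = "\<lambda>S. iexp (t * Q\<^sub>w S)"
  let ?L = "\<lambda>x. E (\<lambda>S. of_real (\<xi> x S * G\<^sub>w x S) * ?e S)"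
  let ?M = "\<lambda>x. \<i> * of_real t * of_real (v x) * E (\<lambda>S. of_real (G\<^sub>w x S * A\<^sub>w x S) * ?e S)"
  have "E (\<lambda>S. \<i> * of_real (Q\<^sub>w S) * ?e S) = E (\<lambda>S. \<i> * (\<Sum>x\<in>V. of_real (\<xi> x S * G\<^sub>w x S) * ?e S))"
    by (rule bern_expect_cong) (subst qform_eq, simp add: sum_distrib_right mult.assoc)
  also have "\<dots> = \<i> * (\<Sum>x\<in>V. ?L x)"
    unfolding bern_expect_mult_left bern_expect_sum ..
  finally have 1: "E (\<lambda>S. \<i> * of_real (Q\<^sub>w S) * ?e S) = \<i> * (\<Sum>x\<in>V. ?L x - ?M x) + \<i> * (\<Sum>x\<in>V. ?M x)"
    by (simp add: sum_subtractf algebra_simps)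
  have "(\<Sum>x\<in>V. of_real (v x) * E (\<lambda>S. of_real (G\<^sub>w x S * A\<^sub>w x S) * ?e S)) = E (\<lambda>S. of_real (U S) * ?e S)"
    unfolding bern_expect_mult_left[symmetric] bern_expect_sum[symmetric] U_def
    by (simp add: sum_distrib_right mult.assoc)
  also have "\<dots> = E (\<lambda>S. of_real (U S - 1) * ?e S + ?e S)"
    by (rule bern_expect_cong) (simp add: algebra_simps)
  also have "\<dots> = E (\<lambda>S. of_real (U S - 1) * ?e S) + cf t"
    unfolding cf_def by (rule bern_expect_add)
  finally have 2: "\<i> * (\<Sum>x\<in>V. ?M x) = - of_real t * (E (\<lambda>S. of_real (U S - 1) * ?e S) + cf t)"
    by (simp add: mult.assoc flip: sum_distrib_left)
  have "cmod (E (\<lambda>S. \<i> * of_real (Q\<^sub>w S) * ?e S) + of_real t * cf t)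
     = cmod (\<i> * (\<Sum>x\<in>V. ?L x - ?M x) - of_real t * E (\<lambda>S. of_real (U S - 1) * ?e S))"
    unfolding 1 2 by (simp add: algebra_simps)
  also have "\<dots> \<le> cmod (\<Sum>x\<in>V. ?L x - ?M x) + \<bar>t\<bar> * cmod (E (\<lambda>S. of_real (U S - 1) * ?e S))"
    using norm_triangle_ineq4[of "\<i> * (\<Sum>x\<in>V. ?L x - ?M x)" "of_real t * E (\<lambda>S. of_real (U S - 1) * ?e S)"]
    unfolding norm_mult by simp
  finally have 3: "cmod (E (\<lambda>S. \<i> * of_real (Q\<^sub>w S) * ?e S) + of_real t * cf t)
     \<le> cmod (\<Sum>x\<in>V. ?L x - ?M x) + \<bar>t\<bar> * cmod (E (\<lambda>S. of_real (U S - 1) * ?e S))" .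
  have "cmod (\<Sum>x\<in>V. ?L x - ?M x) \<le> (\<Sum>x\<in>V. 9/4 * t\<^sup>2 * \<eta> * (v x * E (\<lambda>S. (A\<^sub>w x S)\<^sup>2)))"
    by (rule order_trans[OF norm_sum]) (intro sum_mono cf_deriv_term)
  also have "\<dots> \<le> 9/4 * t\<^sup>2 * \<eta> * 2"
    unfolding sum_distrib_left[symmetric] by (intro mult_left_mono E_A_sum) (simp add: eta)
  finally have 4: "cmod (\<Sum>x\<in>V. ?L x - ?M x) \<le> 9/4 * t\<^sup>2 * \<eta> * 2" .
  have "cmod (E (\<lambda>S. of_real (U S - 1) * ?e S)) \<le> E (\<lambda>S. \<bar>U S - 1\<bar>)"
    by (rule order_trans[OF E_norm_le E_mono]) (simp add: norm_mult del: of_real_diff)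
  also have "\<dots> \<le> 3 * \<eta>"
    by (rule power2_le_imp_le[OF order_trans[OF E_Cauchy_Schwarz E_U]]) (simp add: eta)
  finally have "\<bar>t\<bar> * cmod (E (\<lambda>S. of_real (U S - 1) * ?e S)) \<le> \<bar>t\<bar> * (3 * \<eta>)"
    by (rule mult_left_mono) simp
  with 3 4 show ?thesis by (simp add: algebra_simps)
qed

text \<open>Variation of constants: after multiplication by \<open>exp (s\<^sup>2 / 2)\<close> the
  derivative consists of the error alone. The growth of this factor up to \<open>t\<close> is undone
  at the end by its inverse, so the bound stays polynomial in \<open>t\<close>.\<close>

theorem cf_normal_approx:
  "cmod (cf t - of_real (exp (- (t\<^sup>2 / 2)))) \<le> \<bar>t\<bar> * ((3 * \<bar>t\<bar> + 9/2 * t\<^sup>2) * \<eta>)"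
proof -
  have eta: "0 \<le> \<eta>" using variance_one eta_nonneg by (cases "V = {}") auto
  define D where "D s = E (\<lambda>S. \<i> * of_real (Q\<^sub>w S) * iexp (s * Q\<^sub>w S))" for s
  define g where "g s = exp (s\<^sup>2 / 2) *\<^sub>R cf s" for s
  have g': "(g has_vector_derivative exp (s\<^sup>2 / 2) *\<^sub>R (D s + of_real s * cf s)) (at s)" for s
  proof -
    have "((\<lambda>s. exp (s\<^sup>2 / 2)) has_field_derivative s * exp (s\<^sup>2 / 2)) (at s)"
      by (auto intro!: derivative_eq_intros)
    from has_vector_derivative_scaleR[OF this cf_deriv[of s]] show ?thesis
      unfolding g_def[abs_def] D_def by (simp add: scaleR_conv_of_real algebra_simps)
  qed
  let ?e = "(3 * \<bar>t\<bar> + 9/2 * t\<^sup>2) * \<eta>"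
  have "norm (g (0 + t) - g 0) \<le> norm t * (exp (t\<^sup>2 / 2) * ?e)"
  proof (rule differentiable_bound_segment[where G = UNIV and
        f' = "\<lambda>s r. r *\<^sub>R (exp (s\<^sup>2 / 2) *\<^sub>R (D s + of_real s * cf s))"])
    fix \<tau> :: real assume \<tau>: "\<tau> \<in> {0..1}"
    let ?s = "0 + \<tau> *\<^sub>R t"
    have s: "\<bar>?s\<bar> \<le> \<bar>t\<bar>" using \<tau> by (simp add: abs_mult mult_left_le_one_le)
    then have s2: "?s\<^sup>2 \<le> t\<^sup>2" by (simp only: abs_le_square_iff)
    have "onorm (\<lambda>r. r *\<^sub>R (exp (?s\<^sup>2 / 2) *\<^sub>R (D ?s + of_real ?s * cf ?s)))
        \<le> norm (exp (?s\<^sup>2 / 2) *\<^sub>R (D ?s + of_real ?s * cf ?s))"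
      by (rule onorm_le) (simp add: abs_mult mult_ac)
    also have "\<dots> \<le> exp (t\<^sup>2 / 2) * ?e"
    proof -
      have "cmod (D ?s + of_real ?s * cf ?s) \<le> (3 * \<bar>?s\<bar> + 9/2 * ?s\<^sup>2) * \<eta>"
        unfolding D_def by (rule cf_ode)
      also have "\<dots> \<le> ?e"
        using s s2 by (intro mult_right_mono eta add_mono mult_left_mono) auto
      finally show ?thesis
        using s2 unfolding norm_scaleR abs_exp_cancel by (intro mult_mono) auto
    qed
    finally show "onorm (\<lambda>r. r *\<^sub>R (exp (?s\<^sup>2 / 2) *\<^sub>R (D ?s + of_real ?s * cf ?s))) \<le> exp (t\<^sup>2 / 2) * ?e" .
  qed (use g' in \<open>auto simp: has_vector_derivative_def\<close>)
  then have "norm (g t - 1) \<le> \<bar>t\<bar> * (exp (t\<^sup>2 / 2) * ?e)"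
    by (simp add: g_def cf_def)
  moreover have "cf t - of_real (exp (- (t\<^sup>2 / 2))) = exp (- (t\<^sup>2 / 2)) *\<^sub>R (g t - 1)"
    by (simp add: g_def scaleR_diff_right scaleR_conv_of_real[of _ 1] flip: exp_add)
  ultimately have "cmod (cf t - of_real (exp (- (t\<^sup>2 / 2))))
      \<le> exp (- (t\<^sup>2 / 2)) * (\<bar>t\<bar> * (exp (t\<^sup>2 / 2) * ?e))"
    by (simp add: mult_left_mono)
  also have "\<dots> = \<bar>t\<bar> * ?e"
    by (simp add: exp_minus field_simps)
  finally show ?thesis .
qed

end

section \<open>Nearest neighbour graphs\<close>

definition out_nbrs :: "nat \<Rightarrow> 'a::euclidean_space set \<Rightarrow> 'a \<Rightarrow> 'a set" where
  "out_nbrs K S x = {y. (x, y) \<in> knn_edges K S}"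

definition in_nbrs :: "nat \<Rightarrow> 'a::euclidean_space set \<Rightarrow> 'a \<Rightarrow> 'a set" where
  "in_nbrs K S x = {y. (y, x) \<in> knn_edges K S}"

definition no_ties :: "'a::euclidean_space set \<Rightarrow> bool" where
  "no_ties S \<longleftrightarrow> (\<forall>x\<in>S. inj_on (dist x) (S - {x}))"

lemma out_nbrs_subset: "out_nbrs K S x \<subseteq> S - {x}" and in_nbrs_subset: "in_nbrs K S x \<subseteq> S - {x}"
  by (auto simp: out_nbrs_def in_nbrs_def knn_edges_def)

lemma knn_edges_subset: "knn_edges K S \<subseteq> S \<times> S"
  by (auto simp: knn_edges_def)

lemma finite_nbrs [simp, intro]:
  assumes "finite S"
  shows "finite (out_nbrs K S x)" "finite (in_nbrs K S x)" "finite (knn_edges K S)"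
  using assms finite_subset[OF out_nbrs_subset] finite_subset[OF in_nbrs_subset]
    finite_subset[OF knn_edges_subset[of K S]] by auto

lemma sum_over_edges:
  assumes "finite S"
  shows "(\<Sum>x\<in>S. \<Sum>y\<in>out_nbrs K S x. F x y) = (\<Sum>(x,y)\<in>knn_edges K S. F x y)"
    and "(\<Sum>x\<in>S. \<Sum>y\<in>in_nbrs K S x. F y x) = (\<Sum>(x,y)\<in>knn_edges K S. F x y)"
proof -
  have eq: "knn_edges K S = (SIGMA x:S. out_nbrs K S x)"
    by (auto simp: out_nbrs_def knn_edges_def)
  show "(\<Sum>x\<in>S. \<Sum>y\<in>out_nbrs K S x. F x y) = (\<Sum>(x,y)\<in>knn_edges K S. F x y)"
    unfolding eq using assms by (subst sum.Sigma) auto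
  have "bij_betw prod.swap (SIGMA x:S. in_nbrs K S x) (knn_edges K S)"
    by (rule bij_betwI[where g = prod.swap]) (auto simp: in_nbrs_def knn_edges_def)
  from sum.reindex_bij_betw[OF this, of "\<lambda>(x,y). F x y"]
  show "(\<Sum>x\<in>S. \<Sum>y\<in>in_nbrs K S x. F y x) = (\<Sum>(x,y)\<in>knn_edges K S. F x y)"
    using assms by (subst sum.Sigma) (auto simp: case_prod_unfold)
qed

text \<open>Without ties the number of strictly closer points is a rank, a bijection from the other
  points onto the numbers below \<open>card S - 1\<close>; out-neighbours are the ranks below
  \<open>K\<close>.\<close>

lemma card_out_nbrs:
  assumes "finite S" "no_ties S" "x \<in> S" "K < card S"
  shows "card (out_nbrs K S x) = K"
proof -
  let ?B = "S - {x}"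
  define rk where "rk b = card {z \<in> ?B. dist x z < dist x b}" for b
  have fin: "finite ?B" and card: "card ?B = card S - 1" using assms by auto
  have inj: "inj_on (dist x) ?B" using assms by (auto simp: no_ties_def)
  have less: "rk b < rk b'" if "b \<in> ?B" "dist x b < dist x b'" for b b'
    unfolding rk_def using that fin by (intro psubset_card_mono) auto
  have "inj_on rk ?B"
  proof (rule inj_onI)
    fix b b' assume b: "b \<in> ?B" "b' \<in> ?B" "rk b = rk b'"
    then have "dist x b = dist x b'" using less[of b b'] less[of b' b] by linarith
    with b inj show "b = b'" by (auto dest: inj_onD)
  qed
  moreover have "rk ` ?B \<subseteq> {..<card ?B}"
  proof
    fix r assume "r \<in> rk ` ?B"
    then obtain b where b: "b \<in> ?B" "r = rk b" by auto
    have "rk b < card ?B" unfolding rk_def using b fin by (intro psubset_card_mono) auto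
    with b show "r \<in> {..<card ?B}" by simp
  qed
  ultimately have bij: "bij_betw rk ?B {..<card ?B}"
    by (simp add: bij_betw_def card_image card_subset_eq)
  have "out_nbrs K S x = {b \<in> ?B. rk b < K}"
    using assms(3) by (auto simp: out_nbrs_def knn_edges_def rk_def)
  moreover have "rk ` {b \<in> ?B. rk b < K} = {..<K}"
  proof -
    have "rk ` {b \<in> ?B. rk b < K} = rk ` ?B \<inter> {..<K}" by auto
    also have "\<dots> = {..<K}" using bij card assms(4) by (auto simp: bij_betw_def)
    finally show ?thesis .
  qed
  moreover have "inj_on rk {b \<in> ?B. rk b < K}"
    using bij by (auto simp: bij_betw_def inj_on_def)
  ultimately show ?thesis by (metis card_image card_lessThan)
qed

text \<open>Unit vectors at distance below 1 enclose an angle below 60 degrees, and the side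
  opposite to such an angle is shorter than the longer of the other two sides.\<close>

lemma cone_dist:
  fixes u u' :: "'a::euclidean_space"
  assumes "norm u = 1" "norm u' = 1" "dist u u' < 1" "0 < r'" "r' \<le> r"
  shows "norm (r *\<^sub>R u - r' *\<^sub>R u') < r"
proof -
  have uu: "u \<bullet> u = 1" "u' \<bullet> u' = 1" using assms by (simp_all add: norm_eq_1)
  have "(dist u u')\<^sup>2 < 1" using assms(3) by (simp add: abs_square_less_1)
  then have "u \<bullet> u' > 1/2"
    by (simp add: dist_norm power2_norm_eq_inner inner_diff inner_commute uu)
  then have "2 * (r * r') * (u \<bullet> u') > 2 * (r * r') * (1/2)"
    using assms by (intro mult_strict_left_mono) auto
  then have "(norm (r *\<^sub>R u - r' *\<^sub>R u'))\<^sup>2 < r\<^sup>2 + r'\<^sup>2 - r * r'"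
    unfolding power2_norm_eq_inner
    by (simp add: inner_diff inner_commute uu power2_eq_square algebra_simps)
  also have "\<dots> \<le> r\<^sup>2" using assms by (simp add: power2_eq_square)
  finally show ?thesis using assms by (simp add: power2_less_imp_less)
qed

text \<open>Balls of radius 1/2 cover the directions at \<open>x\<close> by finitely many cones of
  angle below 60 degrees. In each cone the farthest in-neighbour has all others closer to itself
  than \<open>x\<close>, so there are fewer than \<open>K\<close> others. The number of cones
  depends only on the space.\<close>

lemma in_degree_bounded:
  "\<exists>C::nat. \<forall>S K (x::'a::euclidean_space). finite S \<longrightarrow> card (in_nbrs K S x) \<le> C * K"
proof -
  have "compact (sphere (0::'a) 1)" by simp
  then obtain D where D: "D \<subseteq> sphere (0::'a) 1" "finite D" "sphere (0::'a) 1 \<subseteq> (\<Union>d\<in>D. ball d (1/2))"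
    by (rule compactE_image[of _ "sphere (0::'a) 1" "\<lambda>d. ball d (1/2)"]) auto
  have "card (in_nbrs K S x) \<le> card D * K" if S: "finite S" for S K and x :: 'a
  proof -
    define u where "u y = (y - x) /\<^sub>R norm (y - x)" for y
    define cone where "cone d = {y \<in> in_nbrs K S x. u y \<in> ball d (1/2)}" for d
    have y_eq: "y = x + norm (y - x) *\<^sub>R u y" if "y \<noteq> x" for y using that by (simp add: u_def)
    have norm_u: "norm (u y) = 1" if "y \<noteq> x" for y using that by (simp add: u_def)
    have "in_nbrs K S x \<subseteq> (\<Union>d\<in>D. cone d)"
    proof
      fix y assume y: "y \<in> in_nbrs K S x"
      then have "y \<noteq> x" using in_nbrs_subset by blast
      then have "u y \<in> sphere 0 1" using norm_u by simp
      with D(3) y show "y \<in> (\<Union>d\<in>D. cone d)" unfolding cone_def by blast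
    qed
    moreover have fin: "finite (cone d)" for d using S unfolding cone_def by simp
    ultimately have "card (in_nbrs K S x) \<le> card (\<Union>d\<in>D. cone d)"
      using D by (intro card_mono) auto
    also have "\<dots> \<le> (\<Sum>d\<in>D. card (cone d))" by (rule card_UN_le[OF D(2)])
    also have "\<dots> \<le> (\<Sum>d\<in>D. K)"
    proof (rule sum_mono)
      fix d
      show "card (cone d) \<le> K"
      proof (cases "cone d = {}")
        case False
        let ?n = "(\<lambda>y. norm (y - x)) ` cone d"
        have "Max ?n \<in> ?n" using False fin by (intro Max_in) auto
        then obtain y where y0: "y \<in> cone d" "norm (y - x) = Max ?n" by auto
        have y1: "norm (y' - x) \<le> norm (y - x)" if "y' \<in> cone d" for y'
          unfolding y0(2) using that fin by (intro Max_ge) auto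
        note y = y0(1) y1
        have edge: "(y, x) \<in> knn_edges K S" using y by (auto simp: cone_def in_nbrs_def)
        have "cone d - {y} \<subseteq> {z \<in> S - {y}. dist y z < dist y x}"
        proof
          fix z assume z: "z \<in> cone d - {y}"
          have neq: "y \<noteq> x" "z \<noteq> x" "z \<in> S" using y z in_nbrs_subset[of K S x] by (auto simp: cone_def)
          have "dist (u y) (u z) < 1"
            using y z dist_triangle_half_r[of d "u y" 1 "u z"] by (auto simp: cone_def)
          from cone_dist[OF norm_u[OF neq(1)] norm_u[OF neq(2)] this, of "norm (z - x)" "norm (y - x)"]
          have "norm (norm (y - x) *\<^sub>R u y - norm (z - x) *\<^sub>R u z) < norm (y - x)"
            using neq y z by auto
          moreover have "norm (y - x) *\<^sub>R u y - norm (z - x) *\<^sub>R u z = y - z"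
            using neq by (simp add: u_def)
          ultimately show "z \<in> {z \<in> S - {y}. dist y z < dist y x}"
            using z neq by (simp add: dist_norm)
        qed
        then have "card (cone d - {y}) \<le> card {z \<in> S - {y}. dist y z < dist y x}"
          using S by (intro card_mono) auto
        also have "\<dots> < K" using edge by (simp add: knn_edges_def)
        finally show ?thesis using y(1) fin by (simp add: card_Diff_singleton)
      qed auto
    qed
    finally show ?thesis by simp
  qed
  then show ?thesis by blast
qed

text \<open>A neighbour at distance \<open>\<delta>\<close> or more would be preceded by all other
  points of the ball. The ball also contains \<open>x\<close> itself, whence the strict inequality
  for \<open>K\<close>.\<close>

lemma short_edges:
  assumes "finite S" "x \<in> S" "K < card (S \<inter> ball x \<delta>)" "(x, y) \<in> knn_edges K S"
  shows "dist x y < \<delta>"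
proof (rule ccontr)
  assume "\<not> dist x y < \<delta>"
  then have sub: "S \<inter> ball x \<delta> - {x} \<subseteq> {z \<in> S - {x}. dist x z < dist x y}" by auto
  have "0 < \<delta>" using assms(3) by (cases "0 < \<delta>") (auto simp: ball_empty)
  then have "K \<le> card (S \<inter> ball x \<delta> - {x})" using assms by (simp add: card_Diff_singleton)
  also have "\<dots> \<le> card {z \<in> S - {x}. dist x z < dist x y}"
    using sub assms by (intro card_mono) auto
  finally show False using assms(4) by (simp add: knn_edges_def)
qed

text \<open>Used for points with a sparsely filled \<open>\<delta>\<close>-ball: such a ball around
  one of them contains all points of its class under \<open>q\<close>, so each class has at most
  \<open>K\<close> of them.\<close>

lemma card_isolated_points:
  assumes S: "finite S" and J: "finite J" and diam: "\<And>x y. x \<in> A \<Longrightarrow> y \<in> A \<Longrightarrow> q x = q y \<Longrightarrow> dist x y < \<delta>"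
    and img: "q ` A \<subseteq> J"
  shows "card {x \<in> S \<inter> A. card (S \<inter> ball x \<delta>) \<le> K} \<le> card J * K"
proof -
  let ?I = "{x \<in> S \<inter> A. card (S \<inter> ball x \<delta>) \<le> K}"
  have "card ?I \<le> card (\<Union>j\<in>J. {x \<in> ?I. q x = j})"
    using S J img by (intro card_mono) auto
  also have "\<dots> \<le> (\<Sum>j\<in>J. card {x \<in> ?I. q x = j})" by (rule card_UN_le[OF J])
  also have "\<dots> \<le> (\<Sum>j\<in>J. K)"
  proof (rule sum_mono)
    fix j
    show "card {x \<in> ?I. q x = j} \<le> K"
    proof (cases "{x \<in> ?I. q x = j} = {}")
      case False
      then obtain x where x: "x \<in> ?I" "q x = j" by blast
      then have "{x \<in> ?I. q x = j} \<subseteq> S \<inter> ball x \<delta>" using diam by auto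
      then have "card {x \<in> ?I. q x = j} \<le> card (S \<inter> ball x \<delta>)" using S by (intro card_mono) auto
      with x show ?thesis by auto
    qed (metis card.empty le0)
  qed
  finally show ?thesis by simp
qed

text \<open>The competitors of \<open>x\<close> as a neighbour of \<open>y\<close> lie in the
  \<open>r\<close>-ball of \<open>y\<close>. So does \<open>y\<close>, which is no competitor, and
  this one point makes the inequality strict.\<close>

lemma in_nbrs_ball:
  assumes "finite S" "x \<in> S" "\<And>y. y \<in> S \<inter> ball x r \<Longrightarrow> card (S \<inter> ball y r) \<le> K"
  shows "S \<inter> ball x r - {x} \<subseteq> in_nbrs K S x"
proof
  fix y assume y: "y \<in> S \<inter> ball x r - {x}"
  have "{z \<in> S - {y}. dist y z < dist y x} \<subset> S \<inter> ball y r"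
  proof (rule psubsetI)
    show "{z \<in> S - {y}. dist y z < dist y x} \<subseteq> S \<inter> ball y r"
      using y by (auto simp: dist_commute intro: less_trans)
    have "0 < r" using y zero_le_dist[of x y] unfolding mem_ball Diff_iff Int_iff by linarith
    then have "y \<in> S \<inter> ball y r" using y by simp
    then show "{z \<in> S - {y}. dist y z < dist y x} \<noteq> S \<inter> ball y r" by blast
  qed
  then have "card {z \<in> S - {y}. dist y z < dist y x} < card (S \<inter> ball y r)"
    using assms(1) by (intro psubset_card_mono) auto
  also have "\<dots> \<le> K" using y assms by auto
  finally show "y \<in> in_nbrs K S x"
    using y assms(2) by (auto simp: in_nbrs_def knn_edges_def)
qed

text \<open>\<open>u\<close> is replaced by \<open>v\<close> at both ends of an edge: a point starts
  \<open>K\<close> edges and ends at most \<open>C * K\<close>. Along edges shorter than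
  \<open>\<delta>\<close>, \<open>v\<close> moves by at most \<open>e\<close>; edges that start
  outside \<open>A\<close> or at a sparse point are charged 1 each, and
  \<open>card_isolated_points\<close> counts the sparse points.\<close>

lemma edge_oscillation_bound:
  fixes u v :: "'a::euclidean_space \<Rightarrow> real"
  assumes S: "finite S" "no_ties S" "K < card S"
    and C: "\<And>x. card (in_nbrs K S x) \<le> C * K"
    and v: "\<And>x. 0 \<le> v x \<and> v x \<le> 1"
    and unif: "\<And>y z. y \<in> A \<Longrightarrow> dist y z < \<delta> \<Longrightarrow> \<bar>v y - v z\<bar> \<le> e" and e: "0 \<le> e"
    and J: "finite J" "r ` A \<subseteq> J" and diam: "\<And>x y. x \<in> A \<Longrightarrow> y \<in> A \<Longrightarrow> r x = r y \<Longrightarrow> dist x y < \<delta>"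
  shows "(\<Sum>(y,z)\<in>knn_edges K S. \<bar>u y - u z\<bar>)
    \<le> real K * ((1 + real C) * (\<Sum>y\<in>S. \<bar>u y - v y\<bar>) + e * real (card S) + real (card (S - A)) + real (card J * K))"
proof -
  let ?E = "knn_edges K S"
  let ?d = "\<lambda>y. \<bar>u y - v y\<bar>"
  define Bad where "Bad = (S - A) \<union> {y \<in> S \<inter> A. card (S \<inter> ball y \<delta>) \<le> K}"
  have fE: "finite ?E" and fB: "finite Bad" using S by (auto simp: Bad_def)
  have "(\<Sum>(y,z)\<in>?E. \<bar>u y - u z\<bar>) \<le> (\<Sum>(y,z)\<in>?E. ?d y + ?d z + \<bar>v y - v z\<bar>)"
    by (intro sum_mono) auto
  also have "\<dots> = (\<Sum>(y,z)\<in>?E. ?d y) + (\<Sum>(y,z)\<in>?E. ?d z) + (\<Sum>(y,z)\<in>?E. \<bar>v y - v z\<bar>)"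
    by (simp add: case_prod_unfold sum.distrib)
  also have "(\<Sum>(y,z)\<in>?E. ?d y) = real K * (\<Sum>y\<in>S. ?d y)"
    unfolding sum_over_edges(1)[OF S(1), symmetric] sum_distrib_left
    by (intro sum.cong refl) (simp add: card_out_nbrs S)
  also have "(\<Sum>(y,z)\<in>?E. ?d z) = (\<Sum>z\<in>S. real (card (in_nbrs K S z)) * ?d z)"
    unfolding sum_over_edges(2)[OF S(1), symmetric] by simp
  finally have 1: "(\<Sum>(y,z)\<in>?E. \<bar>u y - u z\<bar>)
     \<le> real K * (\<Sum>y\<in>S. ?d y) + (\<Sum>z\<in>S. real (card (in_nbrs K S z)) * ?d z) + (\<Sum>(y,z)\<in>?E. \<bar>v y - v z\<bar>)" .
  have 2: "(\<Sum>z\<in>S. real (card (in_nbrs K S z)) * ?d z) \<le> real C * real K * (\<Sum>y\<in>S. ?d y)"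
    unfolding sum_distrib_left
    using C by (intro sum_mono mult_right_mono) (simp_all only: of_nat_mult[symmetric] of_nat_le_iff abs_ge_zero)
  have "(\<Sum>(y,z)\<in>?E. \<bar>v y - v z\<bar>) = (\<Sum>y\<in>S. \<Sum>z\<in>out_nbrs K S y. \<bar>v y - v z\<bar>)"
    by (rule sum_over_edges(1)[OF S(1), symmetric])
  also have "\<dots> \<le> (\<Sum>y\<in>S. real K * (e + of_bool (y \<in> Bad)))"
  proof (rule sum_mono)
    fix y assume y: "y \<in> S"
    have "(\<Sum>z\<in>out_nbrs K S y. \<bar>v y - v z\<bar>) \<le> (\<Sum>z\<in>out_nbrs K S y. e + of_bool (y \<in> Bad))"
    proof (rule sum_mono)
      fix z assume z: "z \<in> out_nbrs K S y"
      show "\<bar>v y - v z\<bar> \<le> e + of_bool (y \<in> Bad)"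
      proof (cases "y \<in> Bad")
        case True
        have "\<bar>v y - v z\<bar> \<le> 1" using v[of y] v[of z] by linarith
        with True show ?thesis using e by simp
      next
        case False
        then have "y \<in> A" "K < card (S \<inter> ball y \<delta>)" using y by (auto simp: Bad_def)
        then show ?thesis using False short_edges[OF S(1) y, of K \<delta> z] z unif by (auto simp: out_nbrs_def)
      qed
    qed
    then show "(\<Sum>z\<in>out_nbrs K S y. \<bar>v y - v z\<bar>) \<le> real K * (e + of_bool (y \<in> Bad))"
      using card_out_nbrs[OF S(1,2) y S(3)] by simp
  qed
  also have "\<dots> = real K * (e * real (card S) + real (card Bad))"
  proof -
    have "(\<Sum>y\<in>S. of_bool (y \<in> Bad) :: real) = real (card (S \<inter> Bad))"
      using S(1) by (simp add: of_bool_def sum.If_cases)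
    also have "S \<inter> Bad = Bad" by (auto simp: Bad_def)
    finally show ?thesis by (simp add: sum.distrib algebra_simps flip: sum_distrib_left)
  qed
  also have "\<dots> \<le> real K * (e * real (card S) + (real (card (S - A)) + real (card J * K)))"
  proof (intro mult_left_mono add_left_mono)
    have "card Bad \<le> card (S - A) + card {y \<in> S \<inter> A. card (S \<inter> ball y \<delta>) \<le> K}"
      unfolding Bad_def by (rule card_Un_le)
    also have "\<dots> \<le> card (S - A) + card J * K"
      by (intro add_left_mono card_isolated_points[where q = r] S(1) J diam)
    finally show "real (card Bad) \<le> real (card (S - A)) + real (card J * K)"
      by (simp only: of_nat_add[symmetric] of_nat_le_iff)
  qed simp
  finally have 3: "(\<Sum>(y,z)\<in>?E. \<bar>v y - v z\<bar>)
     \<le> real K * (e * real (card S) + (real (card (S - A)) + real (card J * K)))" .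
  show ?thesis using 1 2 3 by (simp add: algebra_simps)
qed

section \<open>Cells and Poisson counts\<close>

text \<open>The integer index of the half-open cube of side \<open>s\<close> containing
  \<open>x\<close>, stored as a vector of \<open>'a\<close> so that equality and measurability come
  from the Euclidean structure. It is an index and in general not a point of the cube.\<close>

definition grid :: "real \<Rightarrow> 'a::euclidean_space \<Rightarrow> 'a" where
  "grid s x = (\<Sum>b\<in>Basis. of_int \<lfloor>x \<bullet> b / s\<rfloor> *\<^sub>R b)"

lemma grid_inner: "b \<in> Basis \<Longrightarrow> grid s x \<bullet> b = of_int \<lfloor>x \<bullet> b / s\<rfloor>"
  by (simp add: grid_def inner_sum_left inner_Basis if_distrib cong: if_cong)

lemma grid_eq_iff: "grid s x = grid s y \<longleftrightarrow> (\<forall>b\<in>Basis. \<lfloor>x \<bullet> b / s\<rfloor> = \<lfloor>y \<bullet> b / s\<rfloor>)"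
  by (subst euclidean_eq_iff) (simp add: grid_inner)

lemma grid_measurable [measurable]: "grid s \<in> borel_measurable borel"
  unfolding grid_def[abs_def] by measurable

lemma grid_dist:
  fixes x y :: "'a::euclidean_space"
  assumes "0 < s" "grid s x = grid s y"
  shows "dist x y \<le> real DIM('a) * s"
proof -
  have "norm (x - y) \<le> (\<Sum>b\<in>Basis. \<bar>(x - y) \<bullet> b\<bar>)" by (rule norm_le_l1)
  also have "\<dots> \<le> (\<Sum>b\<in>(Basis::'a set). s)"
  proof (rule sum_mono)
    fix b :: 'a assume b: "b \<in> Basis"
    then have "\<lfloor>x \<bullet> b / s\<rfloor> = \<lfloor>y \<bullet> b / s\<rfloor>" using assms by (simp add: grid_eq_iff)
    then have "\<bar>x \<bullet> b / s - y \<bullet> b / s\<bar> < 1" by linarith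
    then have "\<bar>(x \<bullet> b - y \<bullet> b) / s\<bar> < 1" by (simp add: diff_divide_distrib)
    with assms(1) show "\<bar>(x - y) \<bullet> b\<bar> \<le> s"
      by (simp add: inner_diff abs_divide divide_less_eq)
  qed
  finally show ?thesis by (simp add: dist_norm)
qed

lemma finite_grid_bounded:
  fixes A :: "'a::euclidean_space set"
  assumes "0 < s" "bounded A"
  shows "finite (grid s ` A)"
proof -
  obtain r where r: "\<And>x. x \<in> A \<Longrightarrow> norm x \<le> r" using assms(2) by (auto simp: bounded_iff)
  define m where "m = \<lceil>r / s\<rceil> + 1"
  have "grid s ` A \<subseteq> (\<lambda>j. \<Sum>b\<in>Basis. of_int (j b) *\<^sub>R b) ` (Basis \<rightarrow>\<^sub>E {-m..m})"
  proof
    fix a assume "a \<in> grid s ` A"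
    then obtain x where x: "x \<in> A" "a = grid s x" by auto
    define j where "j = restrict (\<lambda>b. \<lfloor>x \<bullet> b / s\<rfloor>) (Basis :: 'a set)"
    have "\<lfloor>x \<bullet> b / s\<rfloor> \<in> {-m..m}" if "b \<in> Basis" for b
    proof -
      have "\<bar>x \<bullet> b\<bar> \<le> r" using Basis_le_norm[OF that, of x] r[OF x(1)] by simp
      then have "\<bar>x \<bullet> b / s\<bar> \<le> r / s" using assms(1) by (simp add: abs_divide divide_right_mono)
      then have "- (r / s) \<le> x \<bullet> b / s" "x \<bullet> b / s \<le> r / s" by linarith+
      moreover have "r / s \<le> of_int m" unfolding m_def using le_of_int_ceiling[of "r / s"] by (simp del: le_of_int_ceiling)
      ultimately have "of_int (- m) \<le> x \<bullet> b / s" "x \<bullet> b / s \<le> of_int m" by auto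
      then show ?thesis by (simp only: atLeastAtMost_iff le_floor_iff floor_le_iff) simp
    qed
    then have "j \<in> Basis \<rightarrow>\<^sub>E {-m..m}" by (auto simp: j_def)
    moreover have "a = (\<Sum>b\<in>Basis. of_int (j b) *\<^sub>R b)"
      unfolding x(2) grid_def j_def by (intro sum.cong) auto
    ultimately show "a \<in> (\<lambda>j. \<Sum>b\<in>Basis. of_int (j b) *\<^sub>R b) ` (Basis \<rightarrow>\<^sub>E {-m..m})" by blast
  qed
  then show ?thesis by (rule finite_subset) (intro finite_imageI finite_PiE; simp)
qed

definition cell :: "real \<Rightarrow> 'a::euclidean_space \<Rightarrow> 'a set" where
  "cell s a = {x. grid s x = a}"

lemma cell_measurable [measurable]: "cell s a \<in> sets borel"
proof -
  have "cell s a = grid s -` {a} \<inter> space borel" by (auto simp: cell_def)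
  also have "\<dots> \<in> sets borel" by measurable
  finally show ?thesis .
qed

text \<open>A half-open cube lies between an open and a closed box of equal volume.\<close>

lemma emeasure_cell:
  fixes x :: "'a::euclidean_space"
  assumes s: "0 < s"
  shows "emeasure lborel (cell s (grid s x)) = ennreal (s ^ DIM('a))"
proof -
  define l where "l = s *\<^sub>R grid s x"
  define u where "u = l + s *\<^sub>R One"
  have lu: "l \<bullet> b = s * of_int \<lfloor>x \<bullet> b / s\<rfloor>" "u \<bullet> b = s * of_int \<lfloor>x \<bullet> b / s\<rfloor> + s" if "b \<in> Basis" for b
    using that by (simp_all add: l_def u_def grid_inner inner_add_left)
  have fl: "\<lfloor>y \<bullet> b / s\<rfloor> = \<lfloor>x \<bullet> b / s\<rfloor> \<longleftrightarrow> l \<bullet> b \<le> y \<bullet> b \<and> y \<bullet> b < u \<bullet> b" if "b \<in> Basis" for y b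
    using s by (simp add: floor_eq_iff lu[OF that] field_simps)
  have 1: "box l u \<subseteq> cell s (grid s x)" "cell s (grid s x) \<subseteq> cbox l u"
    by (auto simp: cell_def grid_eq_iff box_def cbox_def fl)
  have prod: "(\<Prod>b\<in>Basis. (u - l) \<bullet> b) = s ^ DIM('a)"
    by (simp add: u_def inner_add_left)
  have le: "\<And>b. b \<in> Basis \<Longrightarrow> l \<bullet> b \<le> u \<bullet> b" using s by (simp add: lu)
  have "emeasure lborel (box l u) = ennreal (s ^ DIM('a))" "emeasure lborel (cbox l u) = ennreal (s ^ DIM('a))"
    using le by (simp_all add: emeasure_lborel_box emeasure_lborel_cbox prod)
  moreover have "emeasure lborel (box l u) \<le> emeasure lborel (cell s (grid s x))"
    "emeasure lborel (cell s (grid s x)) \<le> emeasure lborel (cbox l u)"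
    by (intro emeasure_mono 1; simp)+
  ultimately show ?thesis by simp
qed

section \<open>Variance of a Poisson count\<close>

text \<open>A factor \<open>j\<close> cancels against \<open>fact j\<close> and shifts the index,
  which gives the sums of \<open>j\<close> and \<open>j * (j - 1)\<close>; the square is assembled
  from these. Nothing is divided by \<open>l\<close>, so rate 0 is covered.\<close>

lemma poisson_second_moment_sums:
  fixes l :: real
  shows "(\<lambda>j. (real j - l)\<^sup>2 * (l ^ j / fact j * exp (- l))) sums l"
proof -
  have e0: "(\<lambda>j. l ^ j / fact j) sums exp l"
    using exp_converges[of l] by (simp add: divide_inverse mult.commute)
  have shift: "(\<lambda>j. real j * (l ^ j / fact j * g j)) sums (l * v)"
    if "(\<lambda>j. l ^ j / fact j * g (Suc j)) sums v" for g :: "nat \<Rightarrow> real" and v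
  proof -
    have "(\<lambda>j. l * (l ^ j / fact j * g (Suc j))) sums (l * v)" by (rule sums_mult[OF that])
    moreover have "l * (l ^ j / fact j * g (Suc j)) = real (Suc j) * (l ^ Suc j / fact (Suc j) * g (Suc j))" for j
      by (simp add: field_simps del: of_nat_Suc)
    ultimately have "(\<lambda>j. real (Suc j) * (l ^ Suc j / fact (Suc j) * g (Suc j))) sums (l * v)"
      by (simp only:)
    then show ?thesis
      using sums_Suc[where f = "\<lambda>j. real j * (l ^ j / fact j * g j)" and l = "l * v"]
      by (metis (no_types, lifting) add_0_right mult_zero_left of_nat_0)
  qed
  have e1: "(\<lambda>j. real j * (l ^ j / fact j)) sums (l * exp l)"
    using shift[of "\<lambda>_. 1"] e0 by simp
  have e2: "(\<lambda>j. real j * (l ^ j / fact j * (real j - 1))) sums (l * (l * exp l))"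
    using shift[of "\<lambda>j. real j - 1" "l * exp l"] e1 by (simp add: mult_ac)
  have "(\<lambda>j. exp (-l) * (real j * (l ^ j / fact j * (real j - 1)) + (1 - 2 * l) * (real j * (l ^ j / fact j)) + l\<^sup>2 * (l ^ j / fact j)))
     sums (exp (-l) * (l * (l * exp l) + (1 - 2 * l) * (l * exp l) + l\<^sup>2 * exp l))"
    by (intro sums_mult sums_add e0 e1 e2)
  also have "(\<lambda>j. exp (-l) * (real j * (l ^ j / fact j * (real j - 1)) + (1 - 2 * l) * (real j * (l ^ j / fact j)) + l\<^sup>2 * (l ^ j / fact j)))
     = (\<lambda>j. (real j - l)\<^sup>2 * (l ^ j / fact j * exp (- l)))"
    by (simp add: fun_eq_iff power2_eq_square field_simps)
  also have "exp (-l) * (l * (l * exp l) + (1 - 2 * l) * (l * exp l) + l\<^sup>2 * exp l) = l"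
    by (simp add: algebra_simps power2_eq_square exp_minus)
  finally show ?thesis .
qed

lemma (in prob_space) poisson_second_moment:
  fixes l :: real
  assumes X [measurable]: "X \<in> measurable M (count_space UNIV)" and "0 \<le> l"
    and law: "\<And>j. prob {\<omega> \<in> space M. X \<omega> = j} = l ^ j / fact j * exp (- l)"
  shows "(\<integral>\<^sup>+\<omega>. ennreal ((real (X \<omega>) - l)\<^sup>2) \<partial>M) = ennreal l"
proof -
  let ?f = "\<lambda>j. ennreal ((real j - l)\<^sup>2)"
  have "?f (X \<omega>) = (\<Sum>j. ?f j * indicator {\<omega> \<in> space M. X \<omega> = j} \<omega>)" if "\<omega> \<in> space M" for \<omega>
  proof -
    have "(\<lambda>j. ?f j * indicator {\<omega> \<in> space M. X \<omega> = j} \<omega>) = (\<lambda>j. if j = X \<omega> then ?f j else 0)"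
      using that by (auto simp: fun_eq_iff)
    then show ?thesis using sums_unique[OF sums_single[of "X \<omega>" ?f]] by simp
  qed
  then have "(\<integral>\<^sup>+\<omega>. ?f (X \<omega>) \<partial>M) = (\<integral>\<^sup>+\<omega>. (\<Sum>j. ?f j * indicator {\<omega> \<in> space M. X \<omega> = j} \<omega>) \<partial>M)"
    by (intro nn_integral_cong) auto
  also have "\<dots> = (\<Sum>j. \<integral>\<^sup>+\<omega>. ?f j * indicator {\<omega> \<in> space M. X \<omega> = j} \<omega> \<partial>M)"
    by (intro nn_integral_suminf) measurable
  also have "\<dots> = (\<Sum>j. ?f j * emeasure M {\<omega> \<in> space M. X \<omega> = j})"
    by (intro suminf_cong nn_integral_cmult_indicator) measurable
  also have "\<dots> = (\<Sum>j. ennreal ((real j - l)\<^sup>2 * (l ^ j / fact j * exp (- l))))"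
    by (simp only: emeasure_eq_measure law ennreal_mult'[OF zero_le_power2])
  also have "\<dots> = ennreal l"
    using poisson_second_moment_sums[of l] assms(2)
    by (subst suminf_ennreal2) (auto simp: sums_iff)
  finally show ?thesis .
qed

lemma ennreal_square_le_cancel:
  fixes x y :: ennreal
  assumes "x\<^sup>2 \<le> y\<^sup>2" shows "x \<le> y"
proof (rule ccontr)
  assume "\<not> x \<le> y"
  then have yx: "y < x" by simp
  then obtain b where b: "y = ennreal b" "0 \<le> b" by (cases y) (auto simp: top_unique)
  have "\<exists>r. ennreal r \<le> x \<and> b < r"
  proof (cases x)
    case (real a)
    then show ?thesis using yx b by (intro exI[of _ a]) (simp add: ennreal_less_iff)
  next
    case top
    then show ?thesis by (intro exI[of _ "b + 1"]) simp
  qed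
  then obtain r where r: "ennreal r \<le> x" "b < r" by blast
  have "(ennreal r)\<^sup>2 \<le> (ennreal b)\<^sup>2"
    using power_mono[OF r(1), of 2] assms unfolding b(1) by (meson order_trans zero_le)
  moreover have "0 \<le> r" using b r by linarith
  ultimately have "r\<^sup>2 \<le> b\<^sup>2" using b(2) by (simp only: ennreal_power ennreal_le_iff zero_le_power2)
  then have "r \<le> b" using b(2) by (rule power2_le_imp_le)
  with r(2) show False by simp
qed

section \<open>Counts of the point process\<close>

locale two_sample_densities = poissonized_two_sample M n1 n2 f g L Z c
  for M :: "'w measure" and n1 n2 :: nat and f g :: "'a::euclidean_space \<Rightarrow> real"
    and L :: "'w \<Rightarrow> nat" and Z :: "nat \<Rightarrow> 'w \<Rightarrow> 'a" and c :: "'w \<Rightarrow> 'a \<Rightarrow> nat" +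
  assumes f_density: "prob_density f" and g_density: "prob_density g"
begin

lemma f_meas [measurable]: "f \<in> borel_measurable borel" and g_meas [measurable]: "g \<in> borel_measurable borel"
  and f_nonneg: "0 \<le> f x" and g_nonneg: "0 \<le> g x"
  using f_density g_density by (auto simp: prob_density_def)

lemma f_integrable: "integrable lborel f" and g_integrable: "integrable lborel g"
  and f_integral: "(\<integral>x. f x \<partial>lborel) = 1" and g_integral: "(\<integral>x. g x \<partial>lborel) = 1"
proof -
  have "(\<integral>\<^sup>+ x. ennreal (f x) \<partial>lborel) = ennreal 1" "(\<integral>\<^sup>+ x. ennreal (g x) \<partial>lborel) = ennreal 1"
    using f_density g_density by (auto simp: prob_density_def)
  then have "has_bochner_integral lborel f 1" "has_bochner_integral lborel g 1"
    by (auto intro!: has_bochner_integral_nn_integral simp: f_nonneg g_nonneg)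
  then show "integrable lborel f" "integrable lborel g" "(\<integral>x. f x \<partial>lborel) = 1" "(\<integral>x. g x \<partial>lborel) = 1"
    by (auto simp: has_bochner_integral_iff)
qed

definition h :: "'a \<Rightarrow> real" where "h x = real n1 * f x + real n2 * g x"
abbreviation P :: "'w \<Rightarrow> 'a set" where "P \<equiv> points L Z"
definition \<Lambda> :: "'a set \<Rightarrow> real" where "\<Lambda> A = (LINT x:A|lborel. h x)"
definition cnt :: "'a set \<Rightarrow> 'w \<Rightarrow> nat" where "cnt A \<omega> = card (P \<omega> \<inter> A)"
definition \<nu> :: "'a measure" where "\<nu> = density lborel (\<lambda>x. ennreal (h x))"

lemma h_meas [measurable]: "h \<in> borel_measurable borel" and h_nonneg: "0 \<le> h x"
  and h_integrable: "integrable lborel h" and h_integral: "(\<integral>x. h x \<partial>lborel) = real n1 + real n2"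
  using f_integrable g_integrable f_integral g_integral
  by (auto simp: h_def[abs_def] f_nonneg g_nonneg)

lemma finite_P: "\<omega> \<in> space M \<Longrightarrow> finite (P \<omega>)"
  by (simp add: points_def)

lemma Lambda_nonneg: "0 \<le> \<Lambda> A"
  unfolding \<Lambda>_def set_lebesgue_integral_def by (intro Bochner_Integration.integral_nonneg) (simp add: h_nonneg)

lemma emeasure_nu: "A \<in> sets borel \<Longrightarrow> emeasure \<nu> A = ennreal (\<Lambda> A)"
proof -
  assume A: "A \<in> sets borel"
  have int: "integrable lborel (\<lambda>x. indicator A x * h x)"
    using integrable_real_mult_indicator[OF _ h_integrable, of A] A by (simp add: mult.commute)
  have "emeasure \<nu> A = (\<integral>\<^sup>+x. ennreal (indicator A x * h x) \<partial>lborel)"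
    unfolding \<nu>_def using A
    by (subst emeasure_density) (auto intro!: nn_integral_cong simp: indicator_def)
  also have "\<dots> = ennreal (\<Lambda> A)"
    unfolding \<Lambda>_def set_lebesgue_integral_def using int
    by (subst nn_integral_eq_integral) (auto simp: h_nonneg)
  finally show ?thesis .
qed

lemma sets_nu [simp, measurable_cong]: "sets \<nu> = sets borel" and space_nu [simp]: "space \<nu> = UNIV"
  by (simp_all add: \<nu>_def)

lemma finite_measure_nu: "finite_measure \<nu>"
  by (rule finite_measureI) (simp add: emeasure_nu)

lemma Lambda_UNIV: "\<Lambda> UNIV = real n1 + real n2"
  by (simp add: \<Lambda>_def set_lebesgue_integral_def h_integral)

lemma Lambda_mono: "A \<subseteq> B \<Longrightarrow> A \<in> sets borel \<Longrightarrow> B \<in> sets borel \<Longrightarrow> \<Lambda> A \<le> \<Lambda> B"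
  using emeasure_mono[of A B \<nu>] by (simp add: emeasure_nu Lambda_nonneg)

lemma Lambda_sum:
  assumes "finite J" "\<And>j. j \<in> J \<Longrightarrow> A j \<in> sets borel" "disjoint_family_on A J"
  shows "(\<Sum>j\<in>J. \<Lambda> (A j)) = \<Lambda> (\<Union>j\<in>J. A j)"
proof -
  have "(\<Sum>j\<in>J. emeasure \<nu> (A j)) = emeasure \<nu> (\<Union>j\<in>J. A j)"
    using assms by (intro sum_emeasure) auto
  moreover have "(\<Sum>j\<in>J. emeasure \<nu> (A j)) = ennreal (\<Sum>j\<in>J. \<Lambda> (A j))"
    using assms by (simp add: emeasure_nu Lambda_nonneg sum_ennreal)
  moreover have "emeasure \<nu> (\<Union>j\<in>J. A j) = ennreal (\<Lambda> (\<Union>j\<in>J. A j))"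
    using assms by (intro emeasure_nu) auto
  ultimately show ?thesis by (simp add: Lambda_nonneg sum_nonneg)
qed

lemma cnt_measurable [measurable]: "A \<in> sets borel \<Longrightarrow> cnt A \<in> measurable M (count_space UNIV)"
  using points_poisson by (simp add: poisson_process_def cnt_def[abs_def])

lemma cnt_law: "A \<in> sets borel \<Longrightarrow>
  prob {\<omega> \<in> space M. cnt A \<omega> = j} = \<Lambda> A ^ j / fact j * exp (- \<Lambda> A)"
  using points_poisson unfolding poisson_process_def cnt_def \<Lambda>_def h_def by blast

lemma cnt_variance: "A \<in> sets borel \<Longrightarrow> (\<integral>\<^sup>+\<omega>. ennreal ((real (cnt A \<omega>) - \<Lambda> A)\<^sup>2) \<partial>M) = ennreal (\<Lambda> A)"
  by (intro poisson_second_moment cnt_law cnt_measurable Lambda_nonneg)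

text \<open>Cauchy-Schwarz against the constant 1. Sums over many cells are later estimated by this
  first moment through linearity alone.\<close>

lemma cnt_abs_deviation:
  assumes [measurable]: "A \<in> sets borel"
  shows "(\<integral>\<^sup>+\<omega>. ennreal \<bar>real (cnt A \<omega>) - \<Lambda> A\<bar> \<partial>M) \<le> ennreal (sqrt (\<Lambda> A))"
proof -
  let ?X = "\<lambda>\<omega>. real (cnt A \<omega>) - \<Lambda> A"
  have "(\<integral>\<^sup>+\<omega>. ennreal \<bar>?X \<omega>\<bar> * 1 \<partial>M)\<^sup>2
      \<le> (\<integral>\<^sup>+\<omega>. (ennreal \<bar>?X \<omega>\<bar>)\<^sup>2 \<partial>M) * (\<integral>\<^sup>+\<omega>. 1\<^sup>2 \<partial>M)"
    by (rule Cauchy_Schwarz_nn_integral) measurable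
  also have "\<dots> = ennreal (\<Lambda> A)"
    using cnt_variance[OF assms] by (simp add: ennreal_power emeasure_space_1)
  also have "\<dots> = (ennreal (sqrt (\<Lambda> A)))\<^sup>2"
    by (simp add: ennreal_power Lambda_nonneg)
  finally show ?thesis
    unfolding mult_1_right by (rule ennreal_square_le_cancel)
qed

lemma prob_cnt_pos:
  assumes [measurable]: "A \<in> sets borel"
  shows "prob {\<omega> \<in> space M. cnt A \<omega> \<noteq> 0} \<le> \<Lambda> A"
proof -
  have "prob {\<omega> \<in> space M. cnt A \<omega> \<noteq> 0} = prob (space M - {\<omega> \<in> space M. cnt A \<omega> = 0})"
    by (rule arg_cong[where f=prob]) auto
  also have "\<dots> = 1 - exp (- \<Lambda> A)"
    using cnt_law[OF assms, of 0] by (subst prob_compl) auto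
  also have "\<dots> \<le> \<Lambda> A" using exp_ge_add_one_self[of "- \<Lambda> A"] by simp
  finally show ?thesis .
qed

lemma prob_three_cells:
  assumes "A \<in> sets borel" "B \<in> sets borel" "C \<in> sets borel"
    and "A \<inter> B = {}" "A \<inter> C = {}" "B \<inter> C = {}"
  shows "prob {\<omega> \<in> space M. cnt A \<omega> \<noteq> 0 \<and> cnt B \<omega> \<noteq> 0 \<and> cnt C \<omega> \<noteq> 0} \<le> \<Lambda> A * \<Lambda> B * \<Lambda> C"
proof -
  \<comment> \<open>The model states independence for sequences of disjoint sets, so the three sets
    are padded with empty ones.\<close>
  define D where "D = (\<lambda>i::nat. if i = 0 then A else if i = 1 then B else if i = 2 then C else {})"
  have "range D \<subseteq> sets borel" "disjoint_family D"
    using assms by (auto simp: D_def disjoint_family_on_def)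
  then have ind: "indep_vars (\<lambda>_. count_space UNIV) (\<lambda>i. cnt (D i)) UNIV"
    using points_poisson unfolding poisson_process_def cnt_def by blast
  have "prob (\<Inter>i\<in>{0,1,2}. cnt (D i) -` {n. n \<noteq> 0} \<inter> space M)
      = (\<Prod>i\<in>{0,1,2}. prob (cnt (D i) -` {n. n \<noteq> 0} \<inter> space M))"
    by (rule indep_varsD[OF ind]) auto
  moreover have "(\<Inter>i\<in>{0,1,2}. cnt (D i) -` {n. n \<noteq> 0} \<inter> space M)
     = {\<omega> \<in> space M. cnt A \<omega> \<noteq> 0 \<and> cnt B \<omega> \<noteq> 0 \<and> cnt C \<omega> \<noteq> 0}"
    by (auto simp: D_def)
  moreover have "cnt X -` {n. n \<noteq> 0} \<inter> space M = {\<omega> \<in> space M. cnt X \<omega> \<noteq> 0}" for X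
    by auto
  ultimately have "prob {\<omega> \<in> space M. cnt A \<omega> \<noteq> 0 \<and> cnt B \<omega> \<noteq> 0 \<and> cnt C \<omega> \<noteq> 0}
     = prob {\<omega> \<in> space M. cnt A \<omega> \<noteq> 0} * prob {\<omega> \<in> space M. cnt B \<omega> \<noteq> 0} * prob {\<omega> \<in> space M. cnt C \<omega> \<noteq> 0}"
    by (simp add: D_def mult_ac)
  also have "\<dots> \<le> \<Lambda> A * \<Lambda> B * \<Lambda> C"
    by (intro mult_mono prob_cnt_pos assms mult_nonneg_nonneg Lambda_nonneg) auto
  finally show ?thesis .
qed

section \<open>Almost sure absence of ties\<close>

lemma sigma_finite_nu: "sigma_finite_measure \<nu>"
  by (rule finite_measure.sigma_finite_measure[OF finite_measure_nu])

lemma AE_nu_not_sphere: "AE z in \<nu>. dist x z \<noteq> r"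
proof -
  have "sphere x r \<in> null_sets lborel"
    using negligible_sphere[of x r] null_sets_completion_iff[of "sphere x r" lborel]
    by (simp add: negligible_iff_null_sets)
  then have "AE z in lborel. z \<notin> sphere x r" by (rule AE_not_in)
  then show ?thesis unfolding \<nu>_def by (subst AE_density) auto
qed

text \<open>On a product of three disjoint cells this third power of the intensity measure bounds
  the probability that all three are occupied.\<close>

definition \<tau> :: "('a \<times> 'a \<times> 'a) measure" where "\<tau> = \<nu> \<Otimes>\<^sub>M (\<nu> \<Otimes>\<^sub>M \<nu>)"

definition near_tie :: "real \<Rightarrow> ('a \<times> 'a \<times> 'a) set" where
  "near_tie e = {p. \<bar>dist (fst p) (fst (snd p)) - dist (fst p) (snd (snd p))\<bar> \<le> e}"

lemma sets_tau: "sets \<tau> = sets (borel \<Otimes>\<^sub>M (borel \<Otimes>\<^sub>M borel))"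
  unfolding \<tau>_def by (intro sets_pair_measure_cong) auto

lemma space_tau: "space \<tau> = UNIV"
  by (simp add: \<tau>_def space_pair_measure)

lemma near_tie_measurable [measurable]: "near_tie e \<in> sets \<tau>"
proof -
  have "near_tie e = {p \<in> space (borel \<Otimes>\<^sub>M (borel \<Otimes>\<^sub>M borel)).
      \<bar>dist (fst p) (fst (snd p)) - dist (fst p) (snd (snd p))\<bar> \<le> e}"
    by (auto simp: near_tie_def space_pair_measure)
  also have "\<dots> \<in> sets (borel \<Otimes>\<^sub>M (borel \<Otimes>\<^sub>M borel))" by measurable
  finally show ?thesis by (simp add: sets_tau)
qed

lemma sigma_finite_nu2: "sigma_finite_measure (\<nu> \<Otimes>\<^sub>M \<nu>)"
  by (intro sigma_finite_pair_measure sigma_finite_nu)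

lemma emeasure_tau_Times:
  assumes "A \<in> sets borel" "B \<in> sets borel" "C \<in> sets borel"
  shows "emeasure \<tau> (A \<times> B \<times> C) = ennreal (\<Lambda> A * \<Lambda> B * \<Lambda> C)"
proof -
  interpret sigma_finite_measure \<nu> by (rule sigma_finite_nu)
  interpret N2: sigma_finite_measure "\<nu> \<Otimes>\<^sub>M \<nu>" by (rule sigma_finite_nu2)
  have "emeasure \<tau> (A \<times> B \<times> C) = emeasure \<nu> A * (emeasure \<nu> B * emeasure \<nu> C)"
    unfolding \<tau>_def using assms
    by (subst N2.emeasure_pair_measure_Times) (auto simp: emeasure_pair_measure_Times)
  then show ?thesis using assms
    by (simp add: emeasure_nu ennreal_mult' Lambda_nonneg mult.assoc)
qed

lemma finite_tau: "emeasure \<tau> (space \<tau>) \<noteq> \<infinity>"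
  using emeasure_tau_Times[of UNIV UNIV UNIV] by (simp add: space_tau)

text \<open>Continuity from above, \<open>\<tau>\<close> being finite: near ties shrink to exact
  ties, which are null by Fubini because spheres have Lebesgue measure zero.\<close>

lemma near_tie_limit: "(\<lambda>m. emeasure \<tau> (near_tie (r * (1/2) ^ m))) \<longlonglongrightarrow> 0" if "0 \<le> r"
proof -
  interpret pair_sigma_finite \<nu> "\<nu> \<Otimes>\<^sub>M \<nu>"
    by (intro pair_sigma_finite.intro sigma_finite_nu sigma_finite_nu2)
  interpret N: pair_sigma_finite \<nu> \<nu>
    by (intro pair_sigma_finite.intro sigma_finite_nu)
  have dec: "decseq (\<lambda>m. near_tie (r * (1/2) ^ m))"
  proof (rule decseq_SucI)
    fix m
    have "r * (1/2) ^ Suc m \<le> r * (1/2) ^ m" using that by (intro mult_left_mono power_decreasing) auto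
    then show "near_tie (r * (1/2) ^ Suc m) \<subseteq> near_tie (r * (1/2) ^ m)" by (auto simp: near_tie_def)
  qed
  have INT: "(\<Inter>m. near_tie (r * (1/2) ^ m)) = near_tie 0"
  proof (intro equalityI subsetI)
    fix p assume p: "p \<in> (\<Inter>m. near_tie (r * (1/2) ^ m))"
    have "(\<lambda>m. r * (1/2) ^ m) \<longlonglongrightarrow> r * 0" by (intro tendsto_intros LIMSEQ_power_zero) auto
    then show "p \<in> near_tie 0"
      using p LIMSEQ_le_const[of "\<lambda>m. r * (1/2) ^ m" "r * 0" "\<bar>dist (fst p) (fst (snd p)) - dist (fst p) (snd (snd p))\<bar>"]
      by (auto simp: near_tie_def)
  next
    fix p assume "p \<in> near_tie 0"
    then show "p \<in> (\<Inter>m. near_tie (r * (1/2) ^ m))" using that by (auto simp: near_tie_def)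
  qed
  have z: "AE q in \<nu> \<Otimes>\<^sub>M \<nu>. (x, q) \<notin> near_tie 0" for x
  proof (rule N.AE_pair_measure)
    have "{q \<in> space (borel \<Otimes>\<^sub>M borel). dist x (fst q) \<noteq> dist x (snd q)} \<in> sets (borel \<Otimes>\<^sub>M borel)" by measurable
    then show "{q \<in> space (\<nu> \<Otimes>\<^sub>M \<nu>). (x, q) \<notin> near_tie 0} \<in> sets (\<nu> \<Otimes>\<^sub>M \<nu>)"
      by (simp add: near_tie_def space_pair_measure sets_pair_measure_cong[OF sets_nu sets_nu])
    show "AE y in \<nu>. AE z in \<nu>. (x, y, z) \<notin> near_tie 0"
    proof (rule AE_I2)
      fix y show "AE z in \<nu>. (x, y, z) \<notin> near_tie 0"
        using AE_nu_not_sphere[of x "dist x y"] by eventually_elim (simp add: near_tie_def)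
    qed
  qed
  have "AE p in \<tau>. p \<notin> near_tie 0"
    unfolding \<tau>_def
  proof (rule AE_pair_measure)
    show "{p \<in> space (\<nu> \<Otimes>\<^sub>M \<nu> \<Otimes>\<^sub>M \<nu>). p \<notin> near_tie 0} \<in> sets (\<nu> \<Otimes>\<^sub>M \<nu> \<Otimes>\<^sub>M \<nu>)"
      unfolding \<tau>_def[symmetric] using near_tie_measurable[of 0] by measurable
    show "AE x in \<nu>. AE q in \<nu> \<Otimes>\<^sub>M \<nu>. (x, q) \<notin> near_tie 0" by (intro AE_I2 z)
  qed
  then have "emeasure \<tau> (near_tie 0) = 0"
    by (subst (asm) AE_iff_measurable[OF near_tie_measurable[of 0]]) (auto simp: space_tau)
  moreover have "(\<lambda>m. emeasure \<tau> (near_tie (r * (1/2) ^ m))) \<longlonglongrightarrow> emeasure \<tau> (\<Inter>m. near_tie (r * (1/2) ^ m))"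
  proof (rule Lim_emeasure_decseq[OF _ dec])
    fix i show "emeasure \<tau> (near_tie (r * (1/2) ^ i)) \<noteq> \<infinity>"
      using finite_tau emeasure_space[of \<tau> "near_tie (r * (1/2) ^ i)"] by (auto simp: top_unique)
  qed auto
  ultimately show ?thesis by (simp add: INT)
qed

text \<open>Only counts of sets are at hand, so a tie is detected by three distinct occupied cells
  that contain some exact tie. The window \<open>ball 0 R\<close> keeps the number of triples
  finite.\<close>

definition tie_triples :: "real \<Rightarrow> real \<Rightarrow> ('a \<times> 'a \<times> 'a) set" where
  "tie_triples s R = {(i, j, l) \<in> (grid s ` ball 0 R) \<times> (grid s ` ball 0 R) \<times> (grid s ` ball 0 R).
     i \<noteq> j \<and> i \<noteq> l \<and> j \<noteq> l \<and> (\<exists>x\<in>cell s i. \<exists>y\<in>cell s j. \<exists>z\<in>cell s l. dist x y = dist x z)}"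

definition tie_event :: "real \<Rightarrow> real \<Rightarrow> 'w set" where
  "tie_event s R = (\<Union>(i, j, l)\<in>tie_triples s R.
     {\<omega> \<in> space M. cnt (cell s i) \<omega> \<noteq> 0 \<and> cnt (cell s j) \<omega> \<noteq> 0 \<and> cnt (cell s l) \<omega> \<noteq> 0})"

lemma finite_tie_triples: "0 < s \<Longrightarrow> finite (tie_triples s R)"
  by (rule finite_subset[of _ "(grid s ` ball 0 R) \<times> (grid s ` ball 0 R) \<times> (grid s ` ball 0 R)"])
    (auto simp: tie_triples_def finite_grid_bounded)

lemma tie_event_measurable [measurable]: "0 < s \<Longrightarrow> tie_event s R \<in> sets M"
  unfolding tie_event_def using finite_tie_triples
  by (intro sets.finite_UN) (auto simp: case_prod_unfold)

text \<open>A product of cells containing one exact tie consists of near ties: moving the points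
  within their cells changes each of the two distances by at most twice the diameter bound, whence
  the 4. The products are disjoint, so the union bound adds up to the measure of a subset of
  \<open>near_tie\<close>.\<close>

lemma emeasure_tie_event:
  assumes s: "0 < s"
  shows "emeasure M (tie_event s R) \<le> emeasure \<tau> (near_tie (4 * (real DIM('a) * s)))"
proof -
  let ?E = "\<lambda>(i, j, l). {\<omega> \<in> space M. cnt (cell s i) \<omega> \<noteq> 0 \<and> cnt (cell s j) \<omega> \<noteq> 0 \<and> cnt (cell s l) \<omega> \<noteq> 0}"
  let ?B = "\<lambda>(i, j, l). cell s i \<times> cell s j \<times> cell s l"
  have "emeasure M (tie_event s R) \<le> (\<Sum>t\<in>tie_triples s R. emeasure M (?E t))"
    unfolding tie_event_def
    by (intro emeasure_subadditive_finite finite_tie_triples s) (auto simp: case_prod_unfold)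
  also have "\<dots> \<le> (\<Sum>t\<in>tie_triples s R. emeasure \<tau> (?B t))"
  proof (rule sum_mono)
    fix t assume t: "t \<in> tie_triples s R"
    obtain i j l where ijl: "t = (i, j, l)" by (cases t)
    with t have ne: "i \<noteq> j" "i \<noteq> l" "j \<noteq> l" by (auto simp: tie_triples_def)
    then have "cell s i \<inter> cell s j = {}" "cell s i \<inter> cell s l = {}" "cell s j \<inter> cell s l = {}"
      by (auto simp: cell_def)
    from prob_three_cells[OF _ _ _ this] show "emeasure M (?E t) \<le> emeasure \<tau> (?B t)"
      by (simp add: ijl emeasure_tau_Times emeasure_eq_measure ennreal_leI)
  qed
  also have "\<dots> = emeasure \<tau> (\<Union>t\<in>tie_triples s R. ?B t)"
  proof (rule sum_emeasure)
    show "?B ` tie_triples s R \<subseteq> sets \<tau>" unfolding sets_tau by auto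
    show "disjoint_family_on ?B (tie_triples s R)"
      by (auto simp: disjoint_family_on_def cell_def)
  qed (rule finite_tie_triples[OF s])
  also have "\<dots> \<le> emeasure \<tau> (near_tie (4 * (real DIM('a) * s)))"
  proof (rule emeasure_mono)
    show "(\<Union>t\<in>tie_triples s R. ?B t) \<subseteq> near_tie (4 * (real DIM('a) * s))"
    proof
      fix p assume "p \<in> (\<Union>t\<in>tie_triples s R. ?B t)"
      then obtain i j l x y z x' y' z' where p: "p = (x', y', z')" "x' \<in> cell s i" "y' \<in> cell s j" "z' \<in> cell s l"
        and t: "x \<in> cell s i" "y \<in> cell s j" "z \<in> cell s l" "dist x y = dist x z"
        by (auto simp: tie_triples_def)
      have d: "dist x x' \<le> real DIM('a) * s" "dist y y' \<le> real DIM('a) * s" "dist z z' \<le> real DIM('a) * s"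
        using p t by (auto intro!: grid_dist s simp: cell_def)
      have "\<bar>dist x' y' - dist x y\<bar> \<le> 2 * (real DIM('a) * s)" "\<bar>dist x' z' - dist x z\<bar> \<le> 2 * (real DIM('a) * s)"
        using d dist_triangle[of x' y' x] dist_triangle[of x y' y] dist_triangle[of x y x'] dist_triangle[of x' y y']
          dist_triangle[of x' z' x] dist_triangle[of x z' z] dist_triangle[of x z x'] dist_triangle[of x' z z']
        by (auto simp: dist_commute abs_le_iff)
      then show "p \<in> near_tie (4 * (real DIM('a) * s))" using t(4) by (simp add: near_tie_def p(1))
    qed
  qed simp
  finally show ?thesis .
qed

lemma tie_in_tie_event:
  assumes "finite (P \<omega>)" "\<omega> \<in> space M" "\<not> no_ties (P \<omega>)"
  shows "\<exists>R::nat. \<exists>n. \<forall>m\<ge>n. \<omega> \<in> tie_event ((1/2) ^ m) (real R)"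
proof -
  obtain x y z where xyz: "x \<in> P \<omega>" "y \<in> P \<omega>" "z \<in> P \<omega>" "x \<noteq> y" "x \<noteq> z" "y \<noteq> z" "dist x y = dist x z"
    using assms(3) by (auto simp: no_ties_def inj_on_def)
  define R where "R = nat \<lceil>norm x + norm y + norm z\<rceil> + 1"
  have R: "norm x < real R" "norm y < real R" "norm z < real R"
    unfolding R_def using norm_ge_zero[of x] norm_ge_zero[of y] norm_ge_zero[of z] by linarith+
  \<comment> \<open>\<open>dist x z\<close> equals \<open>dist x y\<close>, so two distances
    separate all three pairs.\<close>
  define d where "d = min (dist x y) (dist y z)"
  have "0 < d" using xyz by (simp add: d_def)
  moreover have "(\<lambda>m. real DIM('a) * (1/2) ^ m) \<longlonglongrightarrow> real DIM('a) * 0"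
    by (intro tendsto_intros LIMSEQ_power_zero) auto
  ultimately have "eventually (\<lambda>m. real DIM('a) * (1/2) ^ m < d) sequentially"
    by (intro order_tendstoD(2)) simp_all
  then obtain n where n: "\<And>m. n \<le> m \<Longrightarrow> real DIM('a) * (1/2) ^ m < d"
    by (auto simp: eventually_sequentially)
  have "\<omega> \<in> tie_event ((1/2) ^ m) (real R)" if "n \<le> m" for m
  proof -
    let ?s = "(1/2) ^ m :: real"
    have sep: "grid ?s u \<noteq> grid ?s w" if "d \<le> dist u w" for u w :: 'a
      using grid_dist[of ?s u w] n[OF \<open>n \<le> m\<close>] that by auto
    have "(grid ?s x, grid ?s y, grid ?s z) \<in> tie_triples ?s (real R)"
      using R xyz sep[of x y] sep[of x z] sep[of y z] by (auto simp: tie_triples_def d_def cell_def)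
    moreover have "cnt (cell ?s (grid ?s u)) \<omega> \<noteq> 0" if "u \<in> P \<omega>" for u
      using that assms(1) by (auto simp: cnt_def cell_def)
    ultimately show ?thesis
      using xyz assms(2) unfolding tie_event_def by blast
  qed
  then show ?thesis by blast
qed

text \<open>A tie lies in all sufficiently fine tie events of some window. For a fixed window and
  starting level this intersection is null, since its probability is below the near-tie measure at
  every later level; both parameters are natural numbers, so countably many null sets
  suffice.\<close>

lemma AE_no_ties: "AE \<omega> in M. no_ties (P \<omega>)"
proof -
  have "AE \<omega> in M. \<forall>R::nat. \<forall>n. \<not> (\<forall>m\<ge>n. \<omega> \<in> tie_event ((1/2) ^ m) (real R))"
    unfolding AE_all_countable
  proof (intro allI)
    fix R n :: nat
    let ?E = "\<Inter>m\<in>{n..}. tie_event ((1/2) ^ m) (real R)"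
    have meas: "?E \<in> sets M" by (intro sets.countable_INT) auto
    have "emeasure M ?E \<le> 0"
    proof (rule LIMSEQ_le_const[OF near_tie_limit[of "4 * real DIM('a)"]])
      show "\<exists>K. \<forall>m\<ge>K. emeasure M ?E \<le> emeasure \<tau> (near_tie (4 * real DIM('a) * (1/2) ^ m))"
      proof (intro exI[of _ n] allI impI)
        fix m assume "n \<le> m"
        then have "emeasure M ?E \<le> emeasure M (tie_event ((1/2) ^ m) (real R))"
          by (intro emeasure_mono) auto
        also have "\<dots> \<le> emeasure \<tau> (near_tie (4 * real DIM('a) * (1/2) ^ m))"
          using emeasure_tie_event[of "(1/2) ^ m" "real R"] by (simp add: mult.assoc)
        finally show "emeasure M ?E \<le> emeasure \<tau> (near_tie (4 * real DIM('a) * (1/2) ^ m))" .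
      qed
    qed simp
    then have "?E \<in> null_sets M" using meas by auto
    then have "AE \<omega> in M. \<omega> \<notin> ?E" by (rule AE_not_in)
    then show "AE \<omega> in M. \<not> (\<forall>m\<ge>n. \<omega> \<in> tie_event ((1/2) ^ m) (real R))"
      by eventually_elim auto
  qed
  with AE_space show ?thesis
    by eventually_elim (use tie_in_tie_event finite_P in blast)
qed

end

section \<open>Convergence in probability and the law of large numbers\<close>

text \<open>A Lebesgue measurable function is the limit of continuous functions off a negligible
  set. Clipping them to [0, 1] preserves continuity and limit, and then \<open>w\<close>
  dominates.\<close>

lemma continuous_approx_L1:
  fixes w u :: "'a::euclidean_space \<Rightarrow> real"
  assumes w: "integrable lborel w" "\<And>x. 0 \<le> w x"
    and u [measurable]: "u \<in> borel_measurable borel" and u01: "\<And>x. 0 \<le> u x \<and> u x \<le> 1" and "0 < e"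
  obtains v where "continuous_on UNIV v" "\<And>x. 0 \<le> v x \<and> v x \<le> 1" "(\<integral>x. \<bar>u x - v x\<bar> * w x \<partial>lborel) < e"
proof -
  have [measurable]: "w \<in> borel_measurable borel" using w(1) by auto
  have "u \<in> borel_measurable lebesgue"
    using u by (intro measurable_completion) simp
  then have "u measurable_on UNIV"
    by (intro lebesgue_measurable_imp_measurable_on) simp_all
  then obtain N g where N: "negligible N" and g: "\<forall>n. continuous_on UNIV (g n)"
    and lim': "\<forall>x. x \<notin> N \<longrightarrow> (\<lambda>n. g n x) \<longlonglongrightarrow> (if x \<in> UNIV then u x else 0)"
    unfolding measurable_on_def by blast
  have lim: "(\<lambda>n. g n x) \<longlonglongrightarrow> u x" if "x \<notin> N" for x
    using lim'[rule_format, OF that] by simp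
  define v where "v n x = max 0 (min 1 (g n x))" for n x
  have v: "continuous_on UNIV (v n)" "0 \<le> v n x" "v n x \<le> 1" for n x
    unfolding v_def using g by (auto intro!: continuous_intros)
  have [measurable]: "v n \<in> borel_measurable borel" for n
    using v(1) by (rule borel_measurable_continuous_onI)
  have "AE x in completion lborel. x \<notin> N"
    using N by (intro AE_not_in) (simp add: negligible_iff_null_sets)
  then have ae: "AE x in lborel. x \<notin> N"
    by (simp add: AE_completion_iff)
  have "(\<lambda>n. \<integral>x. \<bar>u x - v n x\<bar> * w x \<partial>lborel) \<longlonglongrightarrow> (\<integral>x. 0 * w x \<partial>(lborel :: 'a measure))"
  proof (rule integral_dominated_convergence[where w = w])
    show "AE x in lborel. (\<lambda>n. \<bar>u x - v n x\<bar> * w x) \<longlonglongrightarrow> 0 * w x"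
      using ae
    proof eventually_elim
      fix x assume "x \<notin> N"
      then have "(\<lambda>n. v n x) \<longlonglongrightarrow> max 0 (min 1 (u x))"
        unfolding v_def by (intro tendsto_intros lim)
      then have "(\<lambda>n. v n x) \<longlonglongrightarrow> u x" using u01[of x] by simp
      then have "(\<lambda>n. \<bar>u x - v n x\<bar> * w x) \<longlonglongrightarrow> \<bar>u x - u x\<bar> * w x" by (intro tendsto_intros)
      then show "(\<lambda>n. \<bar>u x - v n x\<bar> * w x) \<longlonglongrightarrow> 0 * w x" by simp
    qed
    show "AE x in lborel. norm (\<bar>u x - v n x\<bar> * w x) \<le> w x" for n
    proof (rule AE_I2)
      fix x
      have "\<bar>u x - v n x\<bar> \<le> 1" using u01[of x] v(2,3)[of n x] by linarith
      then show "norm (\<bar>u x - v n x\<bar> * w x) \<le> w x"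
        using w(2)[of x] by (simp add: abs_mult mult_left_le_one_le)
    qed
  qed (use w in auto)
  then have "eventually (\<lambda>n. (\<integral>x. \<bar>u x - v n x\<bar> * w x \<partial>lborel) < e) sequentially"
    using assms(5) by (intro order_tendstoD(2)) auto
  then obtain n where "(\<integral>x. \<bar>u x - v n x\<bar> * w x \<partial>lborel) < e"
    by (auto simp: eventually_sequentially)
  with v show ?thesis by (intro that[of "v n"]) auto
qed

section \<open>The sequence of models and its filter\<close>

locale two_sample_sequence =
  fixes p q :: real
    and N1 N2 k :: "nat \<Rightarrow> nat"
    and f g :: "'a::euclidean_space \<Rightarrow> real"
    and M :: "nat \<Rightarrow> 'w measure"
    and L :: "nat \<Rightarrow> 'w \<Rightarrow> nat"
    and Z :: "nat \<Rightarrow> nat \<Rightarrow> 'w \<Rightarrow> 'a"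
    and c :: "nat \<Rightarrow> 'w \<Rightarrow> 'a \<Rightarrow> nat"
  assumes p: "0 < p" "p < 1" and q: "q = 1 - p"
    and sizes: "\<And>N. N1 N + N2 N = N"
    and N1_lim: "(\<lambda>N. real (N1 N) / real N) \<longlonglongrightarrow> p"
    and densities: "prob_density f" "prob_density g"
    and model: "\<And>N. N \<ge> 1 \<Longrightarrow>
          poissonized_two_sample (M N) (N1 N) (N2 N) f g (L N) (Z N) (c N)"
    and k_infinity: "filterlim k at_top sequentially"
    and k_small: "(\<lambda>N. real (k N) / real N) \<longlonglongrightarrow> 0"
begin

lemma model': "N \<ge> 1 \<Longrightarrow> two_sample_densities (M N) (N1 N) (N2 N) f g (L N) (Z N) (c N)"
  using model densities by (intro two_sample_densities.intro two_sample_densities_axioms.intro)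

lemma N2_lim: "(\<lambda>N. real (N2 N) / real N) \<longlonglongrightarrow> q"
proof -
  have "(\<lambda>N. 1 - real (N1 N) / real N) \<longlonglongrightarrow> q" unfolding q by (intro tendsto_intros N1_lim)
  moreover have "eventually (\<lambda>N. 1 - real (N1 N) / real N = real (N2 N) / real N) sequentially"
    using eventually_gt_at_top[of 0]
  proof eventually_elim
    fix N :: nat assume "0 < N"
    moreover have "real N = real (N1 N) + real (N2 N)" using sizes[of N] by linarith
    ultimately show "1 - real (N1 N) / real N = real (N2 N) / real N"
      by (simp add: field_simps)
  qed
  ultimately show ?thesis by (rule Lim_transform_eventually)
qed

lemma q_pos: "0 < q" "q < 1" using p q by auto

lemma f_meas [measurable]: "f \<in> borel_measurable borel" and g_meas [measurable]: "g \<in> borel_measurable borel"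
  and f_nonneg: "0 \<le> f x" and g_nonneg: "0 \<le> g x"
  and f_integrable: "integrable lborel f" and g_integrable: "integrable lborel g"
  and f_integral: "(\<integral>x. f x \<partial>lborel) = 1" and g_integral: "(\<integral>x. g x \<partial>lborel) = 1"
proof -
  interpret two_sample_densities "M 1" "N1 1" "N2 1" f g "L 1" "Z 1" "c 1" by (rule model') simp
  show "f \<in> borel_measurable borel" "g \<in> borel_measurable borel" "0 \<le> f x" "0 \<le> g x"
    "integrable lborel f" "integrable lborel g" "(\<integral>x. f x \<partial>lborel) = 1" "(\<integral>x. g x \<partial>lborel) = 1"
    using f_meas g_meas f_nonneg g_nonneg f_integrable g_integrable f_integral g_integral by auto
qed

definition \<phi> :: "'a \<Rightarrow> real" where "\<phi> x = p * f x + q * g x"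

lemma phi_meas [measurable]: "\<phi> \<in> borel_measurable borel" and phi_nonneg: "0 \<le> \<phi> x"
  and phi_integrable: "integrable lborel \<phi>" and phi_integral: "(\<integral>x. \<phi> x \<partial>lborel) = 1"
proof -
  have pq: "p + q = 1" using q by simp
  show "\<phi> \<in> borel_measurable borel" "0 \<le> \<phi> x" "integrable lborel \<phi>" "(\<integral>x. \<phi> x \<partial>lborel) = 1"
    using f_integrable g_integrable f_integral g_integral p q_pos pq
    by (auto simp: \<phi>_def[abs_def] f_nonneg g_nonneg)
qed

text \<open>Convergence along this filter on pairs \<open>(N, \<omega>)\<close> is convergence in probability, without measurability side conditions.\<close>
definition hp :: "(nat \<times> 'w) filter" where
  "hp = Abs_filter (\<lambda>Q. \<exists>A. (\<forall>N\<ge>1. A N \<in> sets (M N) \<and> (\<forall>\<omega>\<in>A N. Q (N, \<omega>))) \<and>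
     (\<lambda>N. measure (M N) (A N)) \<longlonglongrightarrow> 1)"

text \<open>The one filter law with content is stability under conjunction, from P(A \<inter> B)
  \<ge> P(A) + P(B) - 1. Events are asked for from \<open>N = 1\<close> on because nothing is known
  about \<open>M 0\<close>.\<close>

lemma eventually_hp:
  "eventually Q hp \<longleftrightarrow> (\<exists>A. (\<forall>N\<ge>1. A N \<in> sets (M N) \<and> (\<forall>\<omega>\<in>A N. Q (N, \<omega>))) \<and>
     (\<lambda>N. measure (M N) (A N)) \<longlonglongrightarrow> 1)"
  unfolding hp_def
proof (rule eventually_Abs_filter, rule is_filter.intro)
  have "eventually (\<lambda>N. 1 = measure (M N) (space (M N))) sequentially"
    using eventually_ge_at_top[of 1]
  proof eventually_elim
    case (elim N)
    interpret two_sample_densities "M N" "N1 N" "N2 N" f g "L N" "Z N" "c N" by (rule model'[OF elim])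
    show ?case by (simp add: prob_space)
  qed
  then have "(\<lambda>N. measure (M N) (space (M N))) \<longlonglongrightarrow> 1"
    by (rule Lim_transform_eventually[OF tendsto_const])
  then show "\<exists>A. (\<forall>N\<ge>1. A N \<in> sets (M N) \<and> (\<forall>\<omega>\<in>A N. True)) \<and> (\<lambda>N. measure (M N) (A N)) \<longlonglongrightarrow> 1"
    by (intro exI[of _ "\<lambda>N. space (M N)"]) auto
next
  fix P Q :: "nat \<times> 'w \<Rightarrow> bool"
  assume "\<exists>A. (\<forall>N\<ge>1. A N \<in> sets (M N) \<and> (\<forall>\<omega>\<in>A N. P (N, \<omega>))) \<and> (\<lambda>N. measure (M N) (A N)) \<longlonglongrightarrow> 1"
    "\<exists>A. (\<forall>N\<ge>1. A N \<in> sets (M N) \<and> (\<forall>\<omega>\<in>A N. Q (N, \<omega>))) \<and> (\<lambda>N. measure (M N) (A N)) \<longlonglongrightarrow> 1"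
  then obtain A B where A: "\<And>N. N \<ge> 1 \<Longrightarrow> A N \<in> sets (M N) \<and> (\<forall>\<omega>\<in>A N. P (N, \<omega>))" "(\<lambda>N. measure (M N) (A N)) \<longlonglongrightarrow> 1"
    and B: "\<And>N. N \<ge> 1 \<Longrightarrow> B N \<in> sets (M N) \<and> (\<forall>\<omega>\<in>B N. Q (N, \<omega>))" "(\<lambda>N. measure (M N) (B N)) \<longlonglongrightarrow> 1"
    by auto
  have bound: "measure (M N) (A N) + measure (M N) (B N) - 1 \<le> measure (M N) (A N \<inter> B N) \<and> measure (M N) (A N \<inter> B N) \<le> 1"
    if "N \<ge> 1" for N
  proof -
    interpret two_sample_densities "M N" "N1 N" "N2 N" f g "L N" "Z N" "c N" by (rule model'[OF that])
    have "prob (A N \<union> B N) = prob (A N) + prob (B N - A N)"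
      using A(1)[OF that] B(1)[OF that] by (intro finite_measure_Union') auto
    moreover have "prob (B N) = prob (B N - A N) + prob (A N \<inter> B N)"
      using A(1)[OF that] B(1)[OF that] finite_measure_Diff'[of "B N" "A N"] by (simp add: Int_commute)
    ultimately show ?thesis using prob_le_1[of "A N \<union> B N"] prob_le_1[of "A N \<inter> B N"] by linarith
  qed
  have "(\<lambda>N. measure (M N) (A N \<inter> B N)) \<longlonglongrightarrow> 1"
  proof (rule tendsto_sandwich)
    show "(\<lambda>N. measure (M N) (A N) + measure (M N) (B N) - 1) \<longlonglongrightarrow> 1"
      using tendsto_diff[OF tendsto_add[OF A(2) B(2)] tendsto_const[of 1]] by simp
    show "(\<lambda>N. 1::real) \<longlonglongrightarrow> 1" by simp
    show "eventually (\<lambda>N. measure (M N) (A N) + measure (M N) (B N) - 1 \<le> measure (M N) (A N \<inter> B N)) sequentially"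
      by (rule eventually_mono[OF eventually_ge_at_top[of 1]]) (use bound in auto)
    show "eventually (\<lambda>N. measure (M N) (A N \<inter> B N) \<le> 1) sequentially"
      by (rule eventually_mono[OF eventually_ge_at_top[of 1]]) (use bound in auto)
  qed
  then show "\<exists>A. (\<forall>N\<ge>1. A N \<in> sets (M N) \<and> (\<forall>\<omega>\<in>A N. P (N, \<omega>) \<and> Q (N, \<omega>))) \<and> (\<lambda>N. measure (M N) (A N)) \<longlonglongrightarrow> 1"
    using A(1) B(1) by (intro exI[of _ "\<lambda>N. A N \<inter> B N"]) auto
next
  fix P Q :: "nat \<times> 'w \<Rightarrow> bool"
  assume "\<forall>x. P x \<longrightarrow> Q x" "\<exists>A. (\<forall>N\<ge>1. A N \<in> sets (M N) \<and> (\<forall>\<omega>\<in>A N. P (N, \<omega>))) \<and> (\<lambda>N. measure (M N) (A N)) \<longlonglongrightarrow> 1"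
  then show "\<exists>A. (\<forall>N\<ge>1. A N \<in> sets (M N) \<and> (\<forall>\<omega>\<in>A N. Q (N, \<omega>))) \<and> (\<lambda>N. measure (M N) (A N)) \<longlonglongrightarrow> 1"
    by meson
qed

lemma eventually_hpI:
  assumes "\<And>N. N \<ge> 1 \<Longrightarrow> A N \<in> sets (M N)" "\<And>N \<omega>. N \<ge> 1 \<Longrightarrow> \<omega> \<in> A N \<Longrightarrow> Q (N, \<omega>)"
    and "e \<longlonglongrightarrow> 0" "\<And>N. N \<ge> 1 \<Longrightarrow> measure (M N) (space (M N) - A N) \<le> e N"
  shows "eventually Q hp"
  unfolding eventually_hp
proof (intro exI[of _ A] conjI allI impI)
  show "(\<lambda>N. measure (M N) (A N)) \<longlonglongrightarrow> 1"
  proof (rule tendsto_sandwich)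
    show "(\<lambda>N. 1 - e N) \<longlonglongrightarrow> 1" using tendsto_diff[OF tendsto_const[of 1] assms(3)] by simp
    show "(\<lambda>N. 1::real) \<longlonglongrightarrow> 1" by simp
    have bound: "1 - e N \<le> measure (M N) (A N) \<and> measure (M N) (A N) \<le> 1" if "N \<ge> 1" for N
    proof -
      interpret two_sample_densities "M N" "N1 N" "N2 N" f g "L N" "Z N" "c N" by (rule model'[OF that])
      show ?thesis using assms(4)[OF that] prob_compl[OF assms(1)[OF that]] prob_le_1[of "A N"] by simp
    qed
    show "eventually (\<lambda>N. 1 - e N \<le> measure (M N) (A N)) sequentially"
      by (rule eventually_mono[OF eventually_ge_at_top[of 1]]) (use bound in auto)
    show "eventually (\<lambda>N. measure (M N) (A N) \<le> 1) sequentially"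
      by (rule eventually_mono[OF eventually_ge_at_top[of 1]]) (use bound in auto)
  qed
qed (use assms in auto)

lemma filterlim_fst_hp: "filterlim fst sequentially hp"
proof (rule filterlim_at_top[THEN iffD2], intro allI)
  fix n :: nat
  show "eventually (\<lambda>x. n \<le> fst x) hp"
    unfolding eventually_hp
  proof (intro exI[of _ "\<lambda>N. if n \<le> N then space (M N) else {}"] conjI allI impI)
    have "eventually (\<lambda>N. 1 = measure (M N) (if n \<le> N then space (M N) else {})) sequentially"
      using eventually_ge_at_top[of "max 1 n"]
    proof eventually_elim
      case (elim N)
      then have "N \<ge> 1" by simp
      then interpret two_sample_densities "M N" "N1 N" "N2 N" f g "L N" "Z N" "c N" by (rule model')
      show ?case using elim by (simp add: prob_space)
    qed
    then show "(\<lambda>N. measure (M N) (if n \<le> N then space (M N) else {})) \<longlonglongrightarrow> 1"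
      by (rule Lim_transform_eventually[OF tendsto_const])
  qed (auto split: if_splits)
qed

lemma hp_const: "(a \<longlongrightarrow> l) sequentially \<Longrightarrow> ((\<lambda>x. a (fst x)) \<longlongrightarrow> l) hp"
  by (rule filterlim_compose[OF _ filterlim_fst_hp])

lemma eventually_hp_fst: "eventually Q sequentially \<Longrightarrow> eventually (\<lambda>x. Q (fst x)) hp"
  by (rule eventually_compose_filterlim[OF _ filterlim_fst_hp])

lemma eventually_hp_AE:
  assumes "\<And>N. N \<ge> 1 \<Longrightarrow> AE \<omega> in M N. Q (N, \<omega>)"
  shows "eventually Q hp"
proof -
  have "\<exists>B. N \<ge> 1 \<longrightarrow> B \<in> null_sets (M N) \<and> {\<omega>\<in>space (M N). \<not> Q (N, \<omega>)} \<subseteq> B" for N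
    using assms[of N] by (auto simp: eventually_ae_filter)
  then obtain B where B: "\<And>N. N \<ge> 1 \<Longrightarrow> B N \<in> null_sets (M N) \<and> {\<omega>\<in>space (M N). \<not> Q (N, \<omega>)} \<subseteq> B N"
    by metis
  show ?thesis
  proof (rule eventually_hpI[where A = "\<lambda>N. space (M N) - B N" and e = "\<lambda>_. 0"])
    fix N :: nat assume N: "N \<ge> 1"
    show "space (M N) - B N \<in> sets (M N)" using B[OF N] by auto
    have "space (M N) - (space (M N) - B N) = B N" using B[OF N] sets.sets_into_space by fastforce
    then show "measure (M N) (space (M N) - (space (M N) - B N)) \<le> 0"
      using B[OF N] by (simp add: measure_eq_0_null_sets)
  qed (use B in auto)
qed

lemma eventually_hp_space: "eventually (\<lambda>x. 1 \<le> fst x \<and> snd x \<in> space (M (fst x))) hp"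
proof (rule eventually_conj)
  show "eventually (\<lambda>x. 1 \<le> fst x) hp" by (rule eventually_hp_fst) (rule eventually_ge_at_top)
  show "eventually (\<lambda>x. snd x \<in> space (M (fst x))) hp" by (rule eventually_hp_AE) simp
qed

text \<open>The entrance for moment bounds; applied to a square it is Chebyshev's
  inequality.\<close>

lemma tendsto_hp_Markov:
  assumes meas: "\<And>N. N \<ge> 1 \<Longrightarrow> X N \<in> borel_measurable (M N)"
    and nonneg: "\<And>N \<omega>. 0 \<le> X N \<omega>"
    and bound: "\<And>N. N \<ge> 1 \<Longrightarrow> (\<integral>\<^sup>+\<omega>. ennreal (X N \<omega>) \<partial>M N) \<le> ennreal (e N)"
    and e: "e \<longlonglongrightarrow> 0" "\<And>N. 0 \<le> e N"
  shows "((\<lambda>x. X (fst x) (snd x)) \<longlongrightarrow> 0) hp"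
proof (rule tendstoI)
  fix r :: real assume r: "0 < r"
  show "eventually (\<lambda>x. dist (X (fst x) (snd x)) 0 < r) hp"
  proof (rule eventually_hpI[where A = "\<lambda>N. {\<omega>\<in>space (M N). X N \<omega> < r}" and e = "\<lambda>N. e N / r"])
    show "(\<lambda>N. e N / r) \<longlonglongrightarrow> 0" using tendsto_divide_zero[OF e(1)] by simp
    fix N :: nat assume N: "N \<ge> 1"
    interpret two_sample_densities "M N" "N1 N" "N2 N" f g "L N" "Z N" "c N" by (rule model'[OF N])
    note meas[OF N, measurable]
    have m: "(\<lambda>\<omega>. ennreal (X N \<omega>) * indicator (space (M N)) \<omega>) \<in> borel_measurable (M N)" by measurable
    show "{\<omega>\<in>space (M N). X N \<omega> < r} \<in> sets (M N)" by measurable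
    have "space (M N) - {\<omega>\<in>space (M N). X N \<omega> < r} = {\<omega>\<in>space (M N). 1 \<le> ennreal (1/r) * ennreal (X N \<omega>)}"
    proof -
      have iff: "1 \<le> ennreal (1/r) * ennreal (X N \<omega>) \<longleftrightarrow> r \<le> X N \<omega>" for \<omega>
        using r by (subst ennreal_mult'[symmetric]) (simp_all add: pos_le_divide_eq)
      show ?thesis unfolding iff by (auto simp: not_less)
    qed
    also have "emeasure (M N) \<dots> \<le> ennreal (1/r) * (\<integral>\<^sup>+\<omega>. ennreal (X N \<omega>) * indicator (space (M N)) \<omega> \<partial>M N)"
      by (rule nn_integral_Markov_inequality[OF m sets.top])
    also have "(\<integral>\<^sup>+\<omega>. ennreal (X N \<omega>) * indicator (space (M N)) \<omega> \<partial>M N) = (\<integral>\<^sup>+\<omega>. ennreal (X N \<omega>) \<partial>M N)"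
      by (intro nn_integral_cong) simp
    also have "ennreal (1/r) * \<dots> \<le> ennreal (1/r) * ennreal (e N)" by (intro mult_left_mono bound N) simp
    also have "\<dots> = ennreal (e N / r)" using r by (subst ennreal_mult'[symmetric]) auto
    finally show "measure (M N) (space (M N) - {\<omega>\<in>space (M N). X N \<omega> < r}) \<le> e N / r"
      using r e(2) by (simp add: emeasure_eq_measure)
  qed (use nonneg in auto)
qed

abbreviation pts :: "nat \<times> 'w \<Rightarrow> 'a set" where "pts x \<equiv> points (L (fst x)) (Z (fst x)) (snd x)"
abbreviation kk :: "nat \<times> 'w \<Rightarrow> nat" where "kk x \<equiv> k (fst x)"
abbreviation NN :: "nat \<times> 'w \<Rightarrow> real" where "NN x \<equiv> real (fst x)"

lemma finite_pts [simp]: "finite (pts x)"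
  by (simp add: points_def)

lemma eventually_no_ties: "eventually (\<lambda>x. no_ties (pts x)) hp"
proof (rule eventually_hp_AE)
  fix N :: nat assume N: "N \<ge> 1"
  interpret two_sample_densities "M N" "N1 N" "N2 N" f g "L N" "Z N" "c N" by (rule model'[OF N])
  show "AE \<omega> in M N. no_ties (pts (N, \<omega>))" using AE_no_ties by simp
qed

lemma NN_pos: "eventually (\<lambda>x. 0 < NN x) hp"
  using eventually_hp_space by eventually_elim auto

lemma kk_pos: "eventually (\<lambda>x. 0 < kk x) hp"
  using eventually_hp_fst[OF filterlim_at_top[THEN iffD1, OF k_infinity, rule_format, of 1]]
  by eventually_elim simp

section \<open>Laws of large numbers\<close>

lemma set_integrable_density: "A \<in> sets borel \<Longrightarrow> integrable lborel u \<Longrightarrow> set_integrable lborel A (u :: 'a \<Rightarrow> real)"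
  unfolding set_integrable_def by (intro integrable_mult_indicator) auto

text \<open>The variance of the count equals its mean and is at most \<open>N\<close>, so the
  normalised second moment is at most \<open>1 / N\<close>; the means converge because the sample
  fractions do.\<close>

lemma LLN_set:
  assumes A [measurable]: "A \<in> sets borel"
  shows "((\<lambda>x. real (card (pts x \<inter> A)) / NN x) \<longlongrightarrow> (LINT y:A|lborel. \<phi> y)) hp"
proof -
  define a b where "a = (LINT y:A|lborel. f y)" and "b = (LINT y:A|lborel. g y)"
  define lam where "lam N = real (N1 N) * a + real (N2 N) * b" for N
  have ab: "0 \<le> a" "0 \<le> b" unfolding a_def b_def set_lebesgue_integral_def
    by (auto intro!: Bochner_Integration.integral_nonneg simp: f_nonneg g_nonneg)
  note si = set_integrable_density[OF A f_integrable] set_integrable_density[OF A g_integrable]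
  have lim: "(\<lambda>N. lam N / real N) \<longlonglongrightarrow> (LINT y:A|lborel. \<phi> y)"
  proof -
    have "(LINT y:A|lborel. \<phi> y) = p * a + q * b"
      unfolding \<phi>_def a_def b_def using si by (simp add: set_integral_add)
    moreover have "(\<lambda>N. real (N1 N) / real N * a + real (N2 N) / real N * b) \<longlonglongrightarrow> p * a + q * b"
      by (intro tendsto_intros N1_lim N2_lim)
    ultimately show ?thesis by (simp add: lam_def add_divide_distrib)
  qed
  let ?X = "\<lambda>N \<omega>. ((real (card (points (L N) (Z N) \<omega> \<inter> A)) - lam N) / real N)\<^sup>2"
  have X: "((\<lambda>x. ?X (fst x) (snd x)) \<longlongrightarrow> 0) hp"
  proof (rule tendsto_hp_Markov[where e = "\<lambda>N. 1 / real N"])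
    show "(\<lambda>N. 1 / real N) \<longlonglongrightarrow> 0" by (rule lim_1_over_n)
    fix N :: nat assume N: "N \<ge> 1"
    interpret two_sample_densities "M N" "N1 N" "N2 N" f g "L N" "Z N" "c N" by (rule model'[OF N])
    have lamN: "\<Lambda> A = lam N"
      unfolding \<Lambda>_def h_def lam_def a_def b_def using si by (simp add: set_integral_add)
    have eq: "?X N \<omega> = 1 / (real N)\<^sup>2 * (real (cnt A \<omega>) - \<Lambda> A)\<^sup>2" for \<omega>
      by (simp add: cnt_def lamN power_divide)
    show "?X N \<in> borel_measurable (M N)" unfolding eq by measurable
    have "(\<integral>\<^sup>+\<omega>. ennreal (?X N \<omega>) \<partial>M N)
        = (\<integral>\<^sup>+\<omega>. ennreal (1 / (real N)\<^sup>2) * ennreal ((real (cnt A \<omega>) - \<Lambda> A)\<^sup>2) \<partial>M N)"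
      unfolding eq by (intro nn_integral_cong ennreal_mult') simp
    also have "\<dots> = ennreal (1 / (real N)\<^sup>2) * (\<integral>\<^sup>+\<omega>. ennreal ((real (cnt A \<omega>) - \<Lambda> A)\<^sup>2) \<partial>M N)"
      by (rule nn_integral_cmult) measurable
    also have "\<dots> = ennreal (1 / (real N)\<^sup>2) * ennreal (\<Lambda> A)" by (simp only: cnt_variance[OF A])
    also have "\<dots> = ennreal (1 / (real N)\<^sup>2 * \<Lambda> A)" by (rule ennreal_mult'[symmetric]) simp
    also have "\<dots> \<le> ennreal (1 / real N)"
    proof (rule ennreal_leI)
      have "\<Lambda> A \<le> real N"
        using Lambda_mono[of A UNIV] sizes[of N] by (simp add: Lambda_UNIV)
      then have "1 / (real N)\<^sup>2 * \<Lambda> A \<le> 1 / (real N)\<^sup>2 * real N" by (intro mult_left_mono) auto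
      then show "1 / (real N)\<^sup>2 * \<Lambda> A \<le> 1 / real N" using N by (simp add: power2_eq_square)
    qed
    finally show "(\<integral>\<^sup>+\<omega>. ennreal (?X N \<omega>) \<partial>M N) \<le> ennreal (1 / real N)" .
  qed auto
  have "((\<lambda>x. sqrt (?X (fst x) (snd x))) \<longlongrightarrow> sqrt 0) hp" by (intro tendsto_intros X)
  then have "((\<lambda>x. \<bar>(real (card (pts x \<inter> A)) - lam (fst x)) / NN x\<bar>) \<longlongrightarrow> 0) hp" by simp
  then have "((\<lambda>x. (real (card (pts x \<inter> A)) - lam (fst x)) / NN x) \<longlongrightarrow> 0) hp"
    by (rule tendsto_rabs_zero_cancel)
  from tendsto_add[OF this hp_const[OF lim]] show ?thesis
    by (simp add: diff_divide_distrib)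
qed

lemma LLN_card: "((\<lambda>x. real (card (pts x)) / NN x) \<longlongrightarrow> 1) hp"
  using LLN_set[of UNIV] by (simp add: set_lebesgue_integral_def phi_integral)

lemma integrable_bounded_phi:
  assumes [measurable]: "u \<in> borel_measurable borel" and "\<And>y. \<bar>u y\<bar> \<le> B"
  shows "integrable lborel (\<lambda>y. u y * \<phi> y)"
proof (rule Bochner_Integration.integrable_bound)
  show "integrable lborel (\<lambda>y. B * \<phi> y)" using phi_integrable by simp
  show "AE y in lborel. norm (u y * \<phi> y) \<le> norm (B * \<phi> y)"
  proof (rule AE_I2)
    fix y
    have "\<bar>u y\<bar> * \<phi> y \<le> \<bar>B\<bar> * \<phi> y" using assms(2)[of y] by (intro mult_right_mono phi_nonneg) linarith
    then show "norm (u y * \<phi> y) \<le> norm (B * \<phi> y)" by (simp add: abs_mult phi_nonneg)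
  qed
qed measurable

text \<open>Rounding \<open>u\<close> down to multiples of \<open>1 / m\<close> gives a step
  function with finitely many level sets, and a sum over points becomes a combination of their
  counts.\<close>

lemma LLN_fun:
  assumes u [measurable]: "u \<in> borel_measurable borel" and bound: "\<And>y. \<bar>u y\<bar> \<le> B"
  shows "((\<lambda>x. (\<Sum>y\<in>pts x. u y) / NN x) \<longlongrightarrow> (\<integral>y. u y * \<phi> y \<partial>lborel)) hp"
proof (rule tendstoI)
  fix e :: real assume e: "0 < e"
  \<comment> \<open>Rounding costs \<open>1 / m\<close> in the integral and at most
    \<open>2 / m\<close> in the average, as there are fewer than \<open>2 * N\<close> points;
    together with \<open>e / 8\<close> for the step function this stays below
    \<open>e\<close>.\<close>
  obtain m :: nat where m: "8 / e < real m" using reals_Archimedean2 by blast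
  then have m0: "0 < real m" using e by (smt (verit) divide_pos_pos)
  have me: "1 / real m < e / 8" using m m0 e by (simp add: field_simps)
  define fl where "fl y = \<lfloor>real m * u y\<rfloor>" for y
  have [measurable]: "fl \<in> measurable borel (count_space UNIV)" unfolding fl_def by measurable
  define A where "A j = {y. fl y = j}" for j
  have A [measurable]: "A j \<in> sets borel" for j
  proof -
    have "A j = fl -` {j} \<inter> space borel" by (auto simp: A_def)
    also have "\<dots> \<in> sets borel" by measurable
    finally show ?thesis .
  qed
  define J where "J = {\<lfloor>- (real m * B)\<rfloor> .. \<lfloor>real m * B\<rfloor>}"
  have flJ: "fl y \<in> J" for y
  proof -
    have "- (real m * B) \<le> real m * u y" "real m * u y \<le> real m * B"
      using bound[of y] mult_left_mono[of "u y" B "real m"] mult_left_mono[of "- B" "u y" "real m"] m0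
      by (auto simp: abs_le_iff)
    then show ?thesis unfolding J_def fl_def by (auto intro: floor_mono)
  qed
  define um where "um y = of_int (fl y) / real m" for y
  have um: "\<bar>u y - um y\<bar> \<le> 1 / real m" for y
  proof -
    have "0 \<le> real m * u y - of_int (fl y)" "real m * u y - of_int (fl y) \<le> 1"
      unfolding fl_def using of_int_floor_le[of "real m * u y"] floor_correct[of "real m * u y"] by linarith+
    then have "\<bar>(real m * u y - of_int (fl y)) / real m\<bar> \<le> 1 / real m"
      using m0 by (simp add: divide_right_mono)
    then show ?thesis using m0 by (simp add: um_def diff_divide_distrib)
  qed
  have um_sum: "(\<Sum>y\<in>S. um y) = (\<Sum>j\<in>J. of_int j / real m * real (card (S \<inter> A j)))" if "finite S" for S
  proof -
    have "(\<Sum>y\<in>S. um y) = (\<Sum>j\<in>J. \<Sum>y\<in>{y\<in>S. fl y = j}. um y)"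
      by (rule sum.group[symmetric]) (use that flJ in \<open>auto simp: J_def\<close>)
    also have "\<dots> = (\<Sum>j\<in>J. of_int j / real m * real (card (S \<inter> A j)))"
      by (intro sum.cong refl) (simp add: um_def A_def Int_def conj_commute)
    finally show ?thesis .
  qed
  have um_int: "(\<integral>y. um y * \<phi> y \<partial>lborel) = (\<Sum>j\<in>J. of_int j / real m * (LINT y:A j|lborel. \<phi> y))"
  proof -
    have pt: "um y * \<phi> y = (\<Sum>j\<in>J. of_int j / real m * (indicator (A j) y *\<^sub>R \<phi> y))" for y
    proof -
      have "(\<Sum>j\<in>J. of_int j / real m * (indicator (A j) y *\<^sub>R \<phi> y))
          = (\<Sum>j\<in>J. if j = fl y then of_int j / real m * \<phi> y else 0)"
        by (intro sum.cong refl) (auto simp: A_def)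
      also have "\<dots> = um y * \<phi> y" using flJ[of y] by (simp add: um_def J_def)
      finally show ?thesis by simp
    qed
    show ?thesis
      unfolding pt set_lebesgue_integral_def
      using set_integrable_density[OF A phi_integrable]
      by (subst Bochner_Integration.integral_sum) (auto simp: set_integrable_def)
  qed
  have int_um: "integrable lborel (\<lambda>y. um y * \<phi> y)"
  proof (rule integrable_bounded_phi)
    show "um \<in> borel_measurable borel" unfolding um_def by measurable
    show "\<bar>um y\<bar> \<le> B + 1 / real m" for y using um[of y] bound[of y] by linarith
  qed
  have int_diff: "\<bar>(\<integral>y. u y * \<phi> y \<partial>lborel) - (\<integral>y. um y * \<phi> y \<partial>lborel)\<bar> \<le> 1 / real m"
  proof -
    note iu = integrable_bounded_phi[OF u bound]
    have "\<bar>(\<integral>y. u y * \<phi> y \<partial>lborel) - (\<integral>y. um y * \<phi> y \<partial>lborel)\<bar> = \<bar>\<integral>y. u y * \<phi> y - um y * \<phi> y \<partial>lborel\<bar>"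
      using iu int_um by simp
    also have "\<dots> \<le> (\<integral>y. \<bar>u y * \<phi> y - um y * \<phi> y\<bar> \<partial>lborel)" by (rule integral_abs_bound)
    also have "\<dots> \<le> (\<integral>y. 1 / real m * \<phi> y \<partial>lborel)"
    proof (rule integral_mono)
      fix y
      have "\<bar>u y * \<phi> y - um y * \<phi> y\<bar> = \<bar>u y - um y\<bar> * \<phi> y"
        by (simp add: abs_mult phi_nonneg flip: left_diff_distrib)
      also have "\<dots> \<le> 1 / real m * \<phi> y" by (intro mult_right_mono um phi_nonneg)
      finally show "\<bar>u y * \<phi> y - um y * \<phi> y\<bar> \<le> 1 / real m * \<phi> y" .
    qed (use iu int_um phi_integrable in auto)
    also have "\<dots> = 1 / real m" using phi_integral by simp
    finally show ?thesis .
  qed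
  have "((\<lambda>x. \<Sum>j\<in>J. of_int j / real m * (real (card (pts x \<inter> A j)) / NN x)) \<longlongrightarrow>
      (\<Sum>j\<in>J. of_int j / real m * (LINT y:A j|lborel. \<phi> y))) hp"
    by (intro tendsto_intros LLN_set A)
  then have lim_um: "((\<lambda>x. (\<Sum>y\<in>pts x. um y) / NN x) \<longlongrightarrow> (\<integral>y. um y * \<phi> y \<partial>lborel)) hp"
    by (simp add: um_sum um_int sum_divide_distrib)
  have "eventually (\<lambda>x. dist ((\<Sum>y\<in>pts x. um y) / NN x) (\<integral>y. um y * \<phi> y \<partial>lborel) < e / 8) hp"
    using e by (intro tendstoD[OF lim_um]) simp
  moreover have "eventually (\<lambda>x. real (card (pts x)) / NN x < 2) hp"
    by (rule order_tendstoD(2)[OF LLN_card]) simp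
  ultimately show "eventually (\<lambda>x. dist ((\<Sum>y\<in>pts x. u y) / NN x) (\<integral>y. u y * \<phi> y \<partial>lborel) < e) hp"
    using NN_pos
  proof eventually_elim
    case (elim x)
    have "\<bar>(\<Sum>y\<in>pts x. u y) - (\<Sum>y\<in>pts x. um y)\<bar> \<le> (\<Sum>y\<in>pts x. 1 / real m)"
      unfolding sum_subtractf[symmetric] by (rule order_trans[OF sum_abs]) (intro sum_mono um)
    then have "\<bar>(\<Sum>y\<in>pts x. u y) - (\<Sum>y\<in>pts x. um y)\<bar> / NN x \<le> (\<Sum>y\<in>pts x. 1 / real m) / NN x"
      by (rule divide_right_mono) simp
    also have "\<dots> = real (card (pts x)) / NN x * (1 / real m)" by simp
    also have "\<dots> \<le> 2 * (1 / real m)" using elim(2) by (intro mult_right_mono) auto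
    finally have "\<bar>(\<Sum>y\<in>pts x. u y) / NN x - (\<Sum>y\<in>pts x. um y) / NN x\<bar> \<le> 2 * (1 / real m)"
      using elim(3) by (simp add: abs_divide flip: diff_divide_distrib)
    with elim(1) int_diff me e show ?case unfolding dist_real_def by linarith
  qed
qed

text \<open>The event on which the deterministic graph estimates apply.\<close>

lemma eventually_regular: "eventually (\<lambda>x. no_ties (pts x) \<and> kk x < card (pts x) \<and> 0 < kk x \<and> 0 < NN x) hp"
proof -
  have "eventually (\<lambda>x. real (kk x) / NN x < 1/2) hp"
    by (rule order_tendstoD(2)[OF hp_const[OF k_small]]) simp
  moreover have "eventually (\<lambda>x. 1/2 < real (card (pts x)) / NN x) hp"
    by (rule order_tendstoD(1)[OF LLN_card]) simp
  ultimately show ?thesis using eventually_no_ties NN_pos kk_pos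
  proof eventually_elim
    case (elim x)
    then have "real (kk x) < 1/2 * NN x" "1/2 * NN x < real (card (pts x))"
      by (simp_all add: field_simps)
    then show ?case using elim by simp
  qed
qed

end

section \<open>In-degrees of locally homogeneous configurations\<close>

text \<open>Comparison of volumes: the cells that meet the ball are disjoint, cover it, and lie in
  the ball enlarged by the diameter bound of a cell.\<close>

lemma card_grid_ball:
  fixes y :: "'a::euclidean_space"
  assumes s: "0 < s" and r: "0 \<le> r"
  shows "unit_ball_vol (real DIM('a)) * r ^ DIM('a) \<le> real (card (grid s ` ball y r)) * s ^ DIM('a)"
    and "real (card (grid s ` ball y r)) * s ^ DIM('a)
      \<le> unit_ball_vol (real DIM('a)) * (r + real DIM('a) * s) ^ DIM('a)"
proof -
  let ?J = "grid s ` ball y r"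
  let ?U = "\<Union>a\<in>?J. cell s a"
  have J: "finite ?J" using s by (intro finite_grid_bounded) auto
  have "emeasure lborel ?U = (\<Sum>a\<in>?J. emeasure lborel (cell s a))"
    by (intro sum_emeasure[symmetric] J) (auto simp: disjoint_family_on_def cell_def)
  also have "\<dots> = (\<Sum>a\<in>?J. ennreal (s ^ DIM('a)))"
    by (intro sum.cong refl) (use emeasure_cell[OF s] in auto)
  also have "\<dots> = ennreal (real (card ?J) * s ^ DIM('a))"
    by (simp add: ennreal_mult'' ennreal_of_nat_eq_real_of_nat s less_imp_le)
  finally have U: "emeasure lborel ?U = ennreal (real (card ?J) * s ^ DIM('a))" .
  have "?U \<in> sets lborel" using J by (intro sets.finite_UN) auto
  moreover have "ball y r \<subseteq> ?U" by (auto simp: cell_def)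
  ultimately have "emeasure lborel (ball y r) \<le> emeasure lborel ?U"
    by (intro emeasure_mono)
  then show "unit_ball_vol (real DIM('a)) * r ^ DIM('a) \<le> real (card ?J) * s ^ DIM('a)"
    using r s unfolding U by (subst (asm) emeasure_ball) auto
  have sub: "?U \<subseteq> ball y (r + real DIM('a) * s)"
  proof
    fix x assume "x \<in> ?U"
    then obtain z where z: "z \<in> ball y r" "grid s x = grid s z" by (auto simp: cell_def)
    then show "x \<in> ball y (r + real DIM('a) * s)"
      using grid_dist[OF s z(2)] dist_triangle[of y x z] by (simp add: dist_commute)
  qed
  have "emeasure lborel ?U \<le> emeasure lborel (ball y (r + real DIM('a) * s))"
    by (intro emeasure_mono sub) auto
  then show "real (card ?J) * s ^ DIM('a) \<le> unit_ball_vol (real DIM('a)) * (r + real DIM('a) * s) ^ DIM('a)"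
    using r s unfolding U by (subst (asm) emeasure_ball) auto
qed

text \<open>By the upper cell counts no \<open>r\<close>-ball centred in the \<open>r\<close>-ball
  of \<open>x\<close> holds more than \<open>K\<close> points, so every point of that ball has
  \<open>x\<close> as a neighbour; by the lower ones the ball is well filled. All these balls lie
  within \<open>2 * r\<close> of \<open>x\<close>, and the extra 1 in \<open>lo\<close> pays for
  \<open>x\<close> itself.\<close>

lemma homogeneous_in_degree:
  fixes S :: "'a::euclidean_space set"
  defines "d \<equiv> DIM('a)"
  assumes S: "finite S" "x \<in> S" and s: "0 < s" and r: "real d * s < r" and \<mu>: "0 \<le> \<mu>" and \<eta>: "0 \<le> \<eta>" "\<eta> \<le> 1"
    and hom: "\<And>z. z \<in> ball x (2 * r) \<Longrightarrow> \<bar>real (card (S \<inter> cell s (grid s z))) - \<mu> * s ^ d\<bar> \<le> \<eta> * (\<mu> * s ^ d)"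
    and up: "(1 + \<eta>) * \<mu> * (unit_ball_vol (real d) * (r + real d * s) ^ d) \<le> real K"
    and lo: "c + 1 \<le> (1 - \<eta>) * \<mu> * (unit_ball_vol (real d) * (r - real d * s) ^ d)"
  shows "c \<le> real (card (in_nbrs K S x))"
proof -
  have r0: "0 < r" using r s by (smt (verit) mult_nonneg_nonneg of_nat_0_le_iff)
  have \<eta>0: "0 \<le> 1 + \<eta>" using \<eta>(1) by simp
  have up_ball: "card (S \<inter> ball y r) \<le> K" if y: "y \<in> ball x r" for y
  proof -
    let ?J = "grid s ` ball y r"
    have J: "finite ?J" using s by (intro finite_grid_bounded) auto
    have yz: "z \<in> ball x (2 * r)" if "z \<in> ball y r" for z
      using that y dist_triangle[of x z y] by simp
    have "card (S \<inter> ball y r) \<le> card (\<Union>a\<in>?J. S \<inter> cell s a)"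
      using S J by (intro card_mono) (auto simp: cell_def)
    also have "\<dots> \<le> (\<Sum>a\<in>?J. card (S \<inter> cell s a))" by (rule card_UN_le[OF J])
    finally have "real (card (S \<inter> ball y r)) \<le> (\<Sum>a\<in>?J. real (card (S \<inter> cell s a)))"
      by (simp only: of_nat_sum[symmetric] of_nat_le_iff)
    also have "\<dots> \<le> (\<Sum>a\<in>?J. (1 + \<eta>) * \<mu> * s ^ d)"
    proof (rule sum_mono)
      fix a assume "a \<in> ?J"
      then obtain z where "z \<in> ball y r" "a = grid s z" by auto
      with hom[OF yz] show "real (card (S \<inter> cell s a)) \<le> (1 + \<eta>) * \<mu> * s ^ d"
        by (fastforce simp: algebra_simps abs_le_iff)
    qed
    also have "\<dots> = (1 + \<eta>) * \<mu> * (real (card ?J) * s ^ d)" by simp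
    also have "\<dots> \<le> (1 + \<eta>) * \<mu> * (unit_ball_vol (real d) * (r + real d * s) ^ d)"
      using card_grid_ball(2)[OF s, of r y] r0 \<eta>0 \<mu> unfolding d_def by (intro mult_left_mono) auto
    also note up
    finally show ?thesis by simp
  qed
  have "c + 1 \<le> (1 - \<eta>) * \<mu> * (unit_ball_vol (real d) * (r - real d * s) ^ d)" by (rule lo)
  also have "\<dots> \<le> (1 - \<eta>) * \<mu> * (real (card (grid s ` ball x (r - real d * s))) * s ^ d)"
    using card_grid_ball(1)[OF s, of "r - real d * s" x] r \<eta> \<mu> unfolding d_def by (intro mult_left_mono) auto
  also have "\<dots> = (\<Sum>a\<in>grid s ` ball x (r - real d * s). (1 - \<eta>) * \<mu> * s ^ d)" by simp
  also have "\<dots> \<le> (\<Sum>a\<in>grid s ` ball x (r - real d * s). real (card (S \<inter> cell s a)))"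
  proof (rule sum_mono)
    fix a assume "a \<in> grid s ` ball x (r - real d * s)"
    then obtain z where z: "dist x z < r - real d * s" "a = grid s z" by auto
    have "0 \<le> real d * s" using s by simp
    then have "z \<in> ball x (2 * r)" using z r0 unfolding mem_ball by linarith
    from hom[OF this] show "(1 - \<eta>) * \<mu> * s ^ d \<le> real (card (S \<inter> cell s a))"
      using z(2) by (simp add: algebra_simps abs_le_iff)
  qed
  also have "\<dots> = real (card (\<Union>a\<in>grid s ` ball x (r - real d * s). S \<inter> cell s a))"
    unfolding of_nat_sum[symmetric] using S s
    by (intro arg_cong[where f = real] card_UN_disjoint[symmetric] finite_grid_bounded) (auto simp: cell_def)
  also have "\<dots> \<le> real (card (S \<inter> ball x r))"
  proof (intro of_nat_mono card_mono)
    show "(\<Union>a\<in>grid s ` ball x (r - real d * s). S \<inter> cell s a) \<subseteq> S \<inter> ball x r"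
    proof
      fix y assume "y \<in> (\<Union>a\<in>grid s ` ball x (r - real d * s). S \<inter> cell s a)"
      then obtain z where z: "dist x z < r - real d * s" "y \<in> S" "grid s y = grid s z" by (auto simp: cell_def)
      with grid_dist[OF s z(3)] dist_triangle[of x y z] show "y \<in> S \<inter> ball x r"
        by (simp add: dist_commute d_def)
    qed
  qed (use S in auto)
  finally have "c + 1 \<le> real (card (S \<inter> ball x r))" .
  moreover have "x \<in> S \<inter> ball x r" using S r0 by simp
  moreover have "card (S \<inter> ball x r - {x}) \<le> card (in_nbrs K S x)"
    using S up_ball by (intro card_mono in_nbrs_ball) auto
  ultimately show ?thesis using S(1) by (simp add: card_Diff_singleton)
qed

text \<open>A point of \<open>G\<close> with too small in-degree has within distance
  \<open>m * s\<close> a cell whose count misses its target \<open>w\<close> by more than a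
  threshold. Markov's inequality bounds the number of such cells, each affects boundedly many cells
  nearby, and the points in those are counted by the target plus the deviation.\<close>

lemma in_degree_grid_bound:
  fixes S G :: "'a::euclidean_space set" and \<psi> w :: "'a \<Rightarrow> real"
  defines "d \<equiv> DIM('a)"
  assumes S: "finite S" and s: "0 < s" and N: "0 < N" and kB: "0 < \<kappa>" "\<kappa> \<le> B" and \<eta>: "0 < \<eta>" "\<eta> \<le> 1"
    and J: "finite J" and m: "0 < m"
    and loc: "\<And>x z. x \<in> G \<Longrightarrow> dist x z < m * s \<Longrightarrow>
       grid s z \<in> J \<and> \<bar>w (grid s z) - N * \<psi> x * s ^ d\<bar> \<le> \<eta> * \<kappa> / 2 * (N * s ^ d)"
    and psi: "\<And>x. x \<in> G \<Longrightarrow> \<kappa> \<le> \<psi> x \<and> \<psi> x \<le> B"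
    and rad: "\<And>l. \<kappa> \<le> l \<Longrightarrow> l \<le> B \<Longrightarrow> \<exists>\<rho>>real d. 2 * \<rho> \<le> m \<and>
       (1 + \<eta>) * (N * l) * (unit_ball_vol (real d) * ((\<rho> + real d) * s) ^ d) \<le> real K \<and>
       c + 1 \<le> (1 - \<eta>) * (N * l) * (unit_ball_vol (real d) * ((\<rho> - real d) * s) ^ d)"
  shows "real (card {x \<in> S \<inter> G. real (card (in_nbrs K S x)) < c})
    \<le> (4 * B * (unit_ball_vol (real d) * (m + 2 * real d) ^ d) / (\<eta> * \<kappa>) + 1)
        * (\<Sum>a\<in>J. \<bar>real (card (S \<inter> cell s a)) - w a\<bar>)"
proof -
  let ?\<omega> = "unit_ball_vol (real d)"
  define M where "M = ?\<omega> * (m + 2 * real d) ^ d"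
  define \<delta> where "\<delta> a = \<bar>real (card (S \<inter> cell s a)) - w a\<bar>" for a
  \<comment> \<open>Half of the tolerance \<open>\<eta> * \<kappa>\<close>; the other half is spent
    on the distance between \<open>w\<close> and the local value of \<open>\<psi>\<close> in
    \<open>loc\<close>.\<close>
  define h where "h = \<eta> * \<kappa> / 2 * (N * s ^ d)"
  define Off where "Off = {a \<in> J. h < \<delta> a}"
  define X where "X = {x \<in> S \<inter> G. \<exists>z\<in>ball x (m * s). grid s z \<in> Off}"
  have sd: "0 < s ^ d" using s by simp
  have h: "0 < h" using \<eta> kB N sd by (simp add: h_def)
  have fO: "finite Off" and fX: "finite X" using J S by (auto simp: Off_def X_def)
  have "{x \<in> S \<inter> G. real (card (in_nbrs K S x)) < c} \<subseteq> X"
  proof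
    fix x assume "x \<in> {x \<in> S \<inter> G. real (card (in_nbrs K S x)) < c}"
    then have x: "x \<in> S" "x \<in> G" "real (card (in_nbrs K S x)) < c" by auto
    show "x \<in> X"
    proof (rule ccontr)
      assume "x \<notin> X"
      then have no: "grid s z \<notin> Off" if "z \<in> ball x (m * s)" for z using x that by (auto simp: X_def)
      obtain \<rho> where \<rho>: "real d < \<rho>" "2 * \<rho> \<le> m"
         "(1 + \<eta>) * (N * \<psi> x) * (?\<omega> * ((\<rho> + real d) * s) ^ d) \<le> real K"
         "c + 1 \<le> (1 - \<eta>) * (N * \<psi> x) * (?\<omega> * ((\<rho> - real d) * s) ^ d)"
        using rad[of "\<psi> x"] psi[OF x(2)] by auto
      have "c \<le> real (card (in_nbrs K S x))"
      proof (rule homogeneous_in_degree[where r = "\<rho> * s" and \<mu> = "N * \<psi> x" and \<eta> = \<eta>, OF S x(1) s, folded d_def])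
        show "real d * s < \<rho> * s" using \<rho> s by simp
        show "0 \<le> N * \<psi> x" using N psi[OF x(2)] kB by simp
        show "(1 + \<eta>) * (N * \<psi> x) * (?\<omega> * (\<rho> * s + real d * s) ^ d) \<le> real K"
          "c + 1 \<le> (1 - \<eta>) * (N * \<psi> x) * (?\<omega> * (\<rho> * s - real d * s) ^ d)"
          using \<rho>(3,4) by (simp_all only: distrib_right left_diff_distrib)
        fix z assume "z \<in> ball x (2 * (\<rho> * s))"
        moreover have "2 * (\<rho> * s) \<le> m * s" using \<rho>(2) s by simp
        ultimately have z: "dist x z < m * s" by (simp only: mem_ball)
        have "\<delta> (grid s z) \<le> h" using no[of z] loc[OF x(2) z] z by (auto simp: Off_def)
        moreover have "\<bar>w (grid s z) - N * \<psi> x * s ^ d\<bar> \<le> h" using loc[OF x(2) z] by (simp add: h_def)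
        ultimately have "\<bar>real (card (S \<inter> cell s (grid s z))) - N * \<psi> x * s ^ d\<bar> \<le> 2 * h"
          unfolding \<delta>_def by linarith
        also have "2 * h = \<eta> * (N * \<kappa> * s ^ d)" by (simp add: h_def)
        also have "\<dots> \<le> \<eta> * (N * \<psi> x * s ^ d)"
          using psi[OF x(2)] N \<eta> sd by (intro mult_left_mono mult_right_mono) auto
        finally show "\<bar>real (card (S \<inter> cell s (grid s z))) - N * \<psi> x * s ^ d\<bar> \<le> \<eta> * (N * \<psi> x * s ^ d)" .
      qed (use \<eta> in auto)
      with x show False by simp
    qed
  qed
  then have 1: "card {x \<in> S \<inter> G. real (card (in_nbrs K S x)) < c} \<le> card X"
    by (intro card_mono fX)
  define Q where "Q = grid s ` X"
  have QJ: "Q \<subseteq> J" unfolding Q_def using loc m s by (auto simp: X_def)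
  then have fQ: "finite Q" using J finite_subset by auto
  have cardQ: "real (card Q) \<le> real (card Off) * M"
  proof -
    \<comment> \<open>A cell index is not a point of its cell, so a representative is chosen as the
      centre of a ball.\<close>
    define zz where "zz a = (SOME z :: 'a. grid s z = a)" for a
    have zz: "grid s (zz (grid s z)) = grid s z" for z :: 'a
      unfolding zz_def by (rule someI) (rule refl)
    have "Q \<subseteq> (\<Union>a\<in>Off. grid s ` ball (zz a) ((m + real d) * s))"
    proof
      fix a assume "a \<in> Q"
      then obtain x z where xz: "a = grid s x" "dist x z < m * s" "grid s z \<in> Off"
        by (auto simp: Q_def X_def)
      have "dist z (zz (grid s z)) \<le> real d * s"
        using grid_dist[OF s, of z "zz (grid s z)"] zz by (simp add: d_def)
      then have "x \<in> ball (zz (grid s z)) ((m + real d) * s)"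
        using xz(2) dist_triangle[of x "zz (grid s z)" z] by (simp add: dist_commute distrib_right)
      with xz show "a \<in> (\<Union>a\<in>Off. grid s ` ball (zz a) ((m + real d) * s))" by blast
    qed
    then have "card Q \<le> card (\<Union>a\<in>Off. grid s ` ball (zz a) ((m + real d) * s))"
      using fO s by (intro card_mono finite_UN_I finite_grid_bounded) auto
    also have "\<dots> \<le> (\<Sum>a\<in>Off. card (grid s ` ball (zz a) ((m + real d) * s)))" by (rule card_UN_le[OF fO])
    finally have "real (card Q) \<le> (\<Sum>a\<in>Off. real (card (grid s ` ball (zz a) ((m + real d) * s))))"
      by (simp only: of_nat_sum[symmetric] of_nat_le_iff)
    also have "\<dots> \<le> (\<Sum>a\<in>Off. M)"
    proof (rule sum_mono)
      fix a
      have "real (card (grid s ` ball (zz a) ((m + real d) * s))) * s ^ d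
         \<le> ?\<omega> * ((m + real d) * s + real d * s) ^ d"
        using card_grid_ball(2)[OF s, of "(m + real d) * s" "zz a"] m s unfolding d_def by simp
      also have "(m + real d) * s + real d * s = (m + 2 * real d) * s" by (simp add: algebra_simps)
      also have "?\<omega> * ((m + 2 * real d) * s) ^ d = M * s ^ d" by (simp add: M_def power_mult_distrib)
      finally show "real (card (grid s ` ball (zz a) ((m + real d) * s))) \<le> M"
        using sd by simp
    qed
    finally show ?thesis by simp
  qed
  have "card X \<le> card (\<Union>a\<in>Q. S \<inter> cell s a)"
    using fQ S by (intro card_mono) (auto simp: Q_def X_def cell_def)
  also have "\<dots> \<le> (\<Sum>a\<in>Q. card (S \<inter> cell s a))" by (rule card_UN_le[OF fQ])
  finally have "real (card X) \<le> (\<Sum>a\<in>Q. real (card (S \<inter> cell s a)))"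
    by (simp only: of_nat_sum[symmetric] of_nat_le_iff)
  also have "\<dots> \<le> (\<Sum>a\<in>Q. 2 * B * (N * s ^ d) + \<delta> a)"
  proof (rule sum_mono)
    fix a assume "a \<in> Q"
    then obtain x where x: "x \<in> G" "a = grid s x" by (auto simp: Q_def X_def)
    have "\<bar>w a - N * \<psi> x * s ^ d\<bar> \<le> \<eta> * \<kappa> / 2 * (N * s ^ d)"
      using loc[OF x(1), of x] m s by (simp add: x)
    also have "\<dots> \<le> B * (N * s ^ d)"
    proof (rule mult_right_mono)
      have "\<eta> * \<kappa> \<le> 1 * \<kappa>" using \<eta> kB by (intro mult_right_mono) auto
      then show "\<eta> * \<kappa> / 2 \<le> B" using kB by linarith
    qed (use N sd in simp)
    finally have "w a \<le> N * \<psi> x * s ^ d + B * (N * s ^ d)" by linarith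
    also have "N * \<psi> x * s ^ d \<le> B * (N * s ^ d)"
      using psi[OF x(1)] N sd by (simp add: mult.left_commute mult_right_mono)
    finally show "real (card (S \<inter> cell s a)) \<le> 2 * B * (N * s ^ d) + \<delta> a"
      unfolding \<delta>_def by linarith
  qed
  also have "\<dots> = real (card Q) * (2 * B * (N * s ^ d)) + (\<Sum>a\<in>Q. \<delta> a)"
    by (simp add: sum.distrib)
  also have "\<dots> \<le> (real (card Off) * M) * (2 * B * (N * s ^ d)) + (\<Sum>a\<in>J. \<delta> a)"
    using cardQ kB N sd QJ J by (intro add_mono mult_right_mono sum_mono2) (auto simp: \<delta>_def)
  finally have 2: "real (card X) \<le> (real (card Off) * M) * (2 * B * (N * s ^ d)) + (\<Sum>a\<in>J. \<delta> a)" .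
  have "real (card Off) * h = (\<Sum>a\<in>Off. h)" by simp
  also have "\<dots> \<le> (\<Sum>a\<in>Off. \<delta> a)" by (intro sum_mono) (auto simp: Off_def)
  also have "\<dots> \<le> (\<Sum>a\<in>J. \<delta> a)" using J by (intro sum_mono2) (auto simp: Off_def \<delta>_def)
  finally have off: "real (card Off) * h \<le> (\<Sum>a\<in>J. \<delta> a)" .
  have M0: "0 \<le> M" using m by (simp add: M_def)
  have "(real (card Off) * M) * (2 * B * (N * s ^ d)) = (real (card Off) * h) * (4 * B * M / (\<eta> * \<kappa>))"
    using \<eta> kB by (simp add: h_def field_simps)
  also have "\<dots> \<le> (\<Sum>a\<in>J. \<delta> a) * (4 * B * M / (\<eta> * \<kappa>))"
    using off M0 kB \<eta> by (intro mult_right_mono) auto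
  finally have "real (card X) \<le> (4 * B * M / (\<eta> * \<kappa>) + 1) * (\<Sum>a\<in>J. \<delta> a)"
    using 2 by (simp add: algebra_simps)
  with 1 show ?thesis unfolding M_def \<delta>_def by (meson of_nat_le_iff order_trans)
qed

lemma sum_cells_le:
  fixes u :: "'a::euclidean_space \<Rightarrow> real"
  assumes B: "B \<in> sets borel" and u: "set_integrable lborel B u" "\<And>y. 0 \<le> u y"
    and J: "finite J" "\<And>a. a \<in> J \<Longrightarrow> cell s a \<subseteq> B"
  shows "(\<Sum>a\<in>J. LINT y:cell s a|lborel. u y) \<le> (LINT y:B|lborel. u y)"
proof -
  have int: "integrable lborel (\<lambda>y. indicator (cell s a) y *\<^sub>R u y)" if "a \<in> J" for a
    using set_integrable_subset[OF u(1), of "cell s a"] J(2)[OF that]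
    by (simp add: set_integrable_def)
  have "(\<Sum>a\<in>J. LINT y:cell s a|lborel. u y) = (\<integral>y. (\<Sum>a\<in>J. indicator (cell s a) y *\<^sub>R u y) \<partial>lborel)"
    unfolding set_lebesgue_integral_def by (rule Bochner_Integration.integral_sum[symmetric]) (rule int)
  also have "\<dots> \<le> (LINT y:B|lborel. u y)"
    unfolding set_lebesgue_integral_def
  proof (rule integral_mono)
    show "integrable lborel (\<lambda>y. \<Sum>a\<in>J. indicator (cell s a) y *\<^sub>R u y)"
      by (intro Bochner_Integration.integrable_sum int)
    show "integrable lborel (\<lambda>y. indicator B y *\<^sub>R u y)" using u(1) by (simp add: set_integrable_def)
    fix y
    have "(\<Sum>a\<in>J. indicator (cell s a) y *\<^sub>R u y) = (\<Sum>a\<in>J. if a = grid s y then u y else 0)"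
      by (intro sum.cong refl) (auto simp: cell_def)
    also have "\<dots> \<le> indicator B y *\<^sub>R u y"
      using J u(2)[of y] by (auto simp: cell_def indicator_def)
    finally show "(\<Sum>a\<in>J. indicator (cell s a) y *\<^sub>R u y) \<le> indicator B y *\<^sub>R u y" .
  qed
  finally show ?thesis .
qed

section \<open>Bulk of the density and smoothness along edges\<close>

context two_sample_sequence
begin

text \<open>The bounds leave a factor 2 on both sides: where an approximation of
  \<open>\<phi>\<close> leaves the interval from \<open>1 / n\<close> to \<open>n\<close> at a point
  of the bulk, it differs from \<open>\<phi>\<close> by at least \<open>1 / n\<close>.\<close>

definition bulk :: "nat \<Rightarrow> 'a set" where
  "bulk n = {y \<in> ball 0 (real n). 2 / real n \<le> \<phi> y \<and> \<phi> y \<le> real n / 2}"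

lemma bulk_measurable [measurable]: "bulk n \<in> sets borel"
proof -
  have "{y \<in> space borel. 2 / real n \<le> \<phi> y \<and> \<phi> y \<le> real n / 2} \<in> sets borel" by measurable
  then have "ball 0 (real n) \<inter> {y \<in> space borel. 2 / real n \<le> \<phi> y \<and> \<phi> y \<le> real n / 2} \<in> sets borel"
    by (intro sets.Int) auto
  also have "ball 0 (real n) \<inter> {y \<in> space borel. 2 / real n \<le> \<phi> y \<and> \<phi> y \<le> real n / 2} = bulk n"
    by (auto simp: bulk_def)
  finally show ?thesis .
qed

lemma bulk_exists:
  assumes "0 < e"
  shows "\<exists>n\<ge>1. (LINT y:- bulk n|lborel. \<phi> y) < e"
proof -
  have "(\<lambda>n. LINT y:- bulk n|lborel. \<phi> y) \<longlonglongrightarrow> (\<integral>y. 0 \<partial>(lborel :: 'a measure))"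
    unfolding set_lebesgue_integral_def
  proof (rule integral_dominated_convergence[where w = \<phi>])
    show "AE y in lborel. (\<lambda>n. indicator (- bulk n) y *\<^sub>R \<phi> y) \<longlonglongrightarrow> 0"
    proof (rule AE_I2)
      fix y
      show "(\<lambda>n. indicator (- bulk n) y *\<^sub>R \<phi> y) \<longlonglongrightarrow> 0"
      proof (cases "\<phi> y = 0")
        case False
        then have pos: "0 < \<phi> y" using phi_nonneg[of y] by simp
        define n0 where "n0 = nat \<lceil>norm y + 2 / \<phi> y + 2 * \<phi> y\<rceil> + 1"
        have n0: "norm y + 2 / \<phi> y + 2 * \<phi> y < real n0" unfolding n0_def by linarith
        have in_bulk: "y \<in> bulk n" if "n0 \<le> n" for n
        proof -
          have n: "norm y + 2 / \<phi> y + 2 * \<phi> y < real n" using n0 that by linarith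
          have pp: "0 < 2 / \<phi> y" "0 \<le> norm y" using pos by simp_all
          have "2 / \<phi> y \<le> real n" using n pp pos by linarith
          moreover have "0 < real n" using n pp pos by linarith
          ultimately have "2 / real n \<le> \<phi> y" using pos by (simp add: field_simps)
          moreover have "norm y < real n" using n pp pos by linarith
          moreover have "\<phi> y \<le> real n / 2" using n pp by linarith
          ultimately show ?thesis by (simp add: bulk_def)
        qed
        then have "eventually (\<lambda>n. indicator (- bulk n) y *\<^sub>R \<phi> y = 0) sequentially"
          by (intro eventually_sequentiallyI[of n0]) auto
        then show ?thesis by (rule tendsto_eventually)
      qed simp
    qed
    show "AE y in lborel. norm (indicator (- bulk n) y *\<^sub>R \<phi> y) \<le> \<phi> y" for n
      by (rule AE_I2) (auto simp: indicator_def phi_nonneg)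
  qed (use phi_integrable in auto)
  then have "(\<lambda>n. LINT y:- bulk n|lborel. \<phi> y) \<longlonglongrightarrow> 0" by simp
  then have "eventually (\<lambda>n. (LINT y:- bulk n|lborel. \<phi> y) < e) sequentially"
    using assms by (rule order_tendstoD(2))
  then have "eventually (\<lambda>n. n \<ge> 1 \<and> (LINT y:- bulk n|lborel. \<phi> y) < e) sequentially"
    using eventually_ge_at_top[of 1] by eventually_elim simp
  then show ?thesis by (auto simp: eventually_sequentially)
qed

text \<open>Truncation at a large \<open>b\<close> and division by \<open>b\<close> lead to values
  in [0, 1], where \<open>continuous_approx_L1\<close> applies with the indicator of the ball as
  weight. Scaling back is paid for by the accuracy \<open>e / (2 * b)\<close>.\<close>

lemma phi_continuous_approx:
  assumes "0 < e"
  obtains \<psi> :: "'a \<Rightarrow> real" where "continuous_on UNIV \<psi>" "\<And>y. 0 \<le> \<psi> y"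
    "(LINT y:ball 0 r|lborel. \<bar>\<phi> y - \<psi> y\<bar>) < e"
proof -
  have "(\<lambda>b::nat. \<integral>y. \<phi> y - min (\<phi> y) (real b) \<partial>lborel) \<longlonglongrightarrow> (\<integral>y. 0 \<partial>(lborel :: 'a measure))"
  proof (rule integral_dominated_convergence[where w = \<phi>])
    show "AE y in lborel. (\<lambda>b. \<phi> y - min (\<phi> y) (real b)) \<longlonglongrightarrow> 0"
    proof (rule AE_I2)
      fix y
      have "\<phi> y - min (\<phi> y) (real b) = 0" if "nat \<lceil>\<phi> y\<rceil> \<le> b" for b
        using that by (simp add: min_def)
      then have "eventually (\<lambda>b. \<phi> y - min (\<phi> y) (real b) = 0) sequentially"
        by (intro eventually_sequentiallyI)
      then show "(\<lambda>b. \<phi> y - min (\<phi> y) (real b)) \<longlonglongrightarrow> 0" by (rule tendsto_eventually)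
    qed
    show "AE y in lborel. norm (\<phi> y - min (\<phi> y) (real b)) \<le> \<phi> y" for b
      by (rule AE_I2) (auto simp: phi_nonneg min_def)
  qed (use phi_integrable in auto)
  then have "(\<lambda>b::nat. \<integral>y. \<phi> y - min (\<phi> y) (real b) \<partial>lborel) \<longlonglongrightarrow> 0" by simp
  then have "eventually (\<lambda>b. (\<integral>y. \<phi> y - min (\<phi> y) (real b) \<partial>lborel) < e / 2) sequentially"
    by (rule order_tendstoD(2)) (use assms in simp)
  then have "eventually (\<lambda>b. b \<ge> 1 \<and> (\<integral>y. \<phi> y - min (\<phi> y) (real b) \<partial>lborel) < e / 2) sequentially"
    using eventually_ge_at_top[of 1] by eventually_elim simp
  then obtain b :: nat where b: "b \<ge> 1" "(\<integral>y. \<phi> y - min (\<phi> y) (real b) \<partial>lborel) < e / 2"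
    by (auto simp: eventually_sequentially)
  define w :: "'a \<Rightarrow> real" where "w = (\<lambda>y. indicator (ball 0 r) y :: real)"
  have int_w: "integrable lborel w"
    unfolding w_def using emeasure_bounded_finite[of "ball (0::'a) r"] by (intro integrable_real_indicator) auto
  have [measurable]: "w \<in> borel_measurable borel" unfolding w_def by (intro borel_measurable_indicator) simp
  have w0: "0 \<le> w y" for y by (simp add: w_def)
  have uM: "(\<lambda>y. min (\<phi> y) (real b) / real b) \<in> borel_measurable borel" by measurable
  have u01: "0 \<le> min (\<phi> y) (real b) / real b \<and> min (\<phi> y) (real b) / real b \<le> 1" for y
    using b by (auto simp: phi_nonneg min_def)
  have "0 < e / (2 * real b)" using assms b by simp
  then obtain v where v: "continuous_on UNIV v" "\<And>y. 0 \<le> v y \<and> v y \<le> 1"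
      "(\<integral>y. \<bar>min (\<phi> y) (real b) / real b - v y\<bar> * w y \<partial>lborel) < e / (2 * real b)"
    using continuous_approx_L1[OF int_w w0 uM u01] by blast
  have [measurable]: "v \<in> borel_measurable borel" using v(1) by (rule borel_measurable_continuous_onI)
  let ?F = "\<lambda>y. \<bar>min (\<phi> y) (real b) / real b - v y\<bar> * w y"
  have intF: "integrable lborel ?F"
  proof (rule Bochner_Integration.integrable_bound[OF int_w])
    show "AE y in lborel. norm (?F y) \<le> norm (w y)"
    proof (rule AE_I2)
      fix y
      have "\<bar>min (\<phi> y) (real b) / real b - v y\<bar> \<le> 1" using u01[of y] v(2)[of y] by linarith
      then show "norm (?F y) \<le> norm (w y)" by (simp add: abs_mult w0 mult_left_le_one_le)
    qed
  qed measurable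
  show ?thesis
  proof (rule that[of "\<lambda>y. real b * v y"])
    show "continuous_on UNIV (\<lambda>y. real b * v y)" by (intro continuous_intros v)
    show "0 \<le> real b * v y" for y using v(2)[of y] by simp
    have ptw: "indicator (ball 0 r) y *\<^sub>R \<bar>\<phi> y - real b * v y\<bar> \<le> (\<phi> y - min (\<phi> y) (real b)) + real b * ?F y" for y
    proof (cases "y \<in> ball 0 r")
      case True
      have "min (\<phi> y) (real b) - real b * v y = real b * (min (\<phi> y) (real b) / real b - v y)"
        using b(1) by (simp add: right_diff_distrib)
      then have "real b * \<bar>min (\<phi> y) (real b) / real b - v y\<bar> = \<bar>min (\<phi> y) (real b) - real b * v y\<bar>"
        by (simp add: abs_mult)
      then have "real b * ?F y = \<bar>min (\<phi> y) (real b) - real b * v y\<bar>"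
        using True by (simp add: w_def)
      then show ?thesis using True by simp
    next
      case False
      then show ?thesis by (simp add: w_def)
    qed
    have intD: "integrable lborel (\<lambda>y. \<phi> y - min (\<phi> y) (real b))"
      using phi_integrable
      by (intro Bochner_Integration.integrable_diff Bochner_Integration.integrable_bound[OF phi_integrable])
        (auto simp: phi_nonneg)
    have intR: "integrable lborel (\<lambda>y. (\<phi> y - min (\<phi> y) (real b)) + real b * ?F y)"
      by (intro Bochner_Integration.integrable_add intD integrable_mult_right intF)
    have "(LINT y:ball 0 r|lborel. \<bar>\<phi> y - real b * v y\<bar>) \<le> (\<integral>y. (\<phi> y - min (\<phi> y) (real b)) + real b * ?F y \<partial>lborel)"
      unfolding set_lebesgue_integral_def
      by (intro integral_mono' intR ptw add_nonneg_nonneg mult_nonneg_nonneg) (auto simp: w0 min_def phi_nonneg)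
    also have "\<dots> = (\<integral>y. \<phi> y - min (\<phi> y) (real b) \<partial>lborel) + real b * (\<integral>y. ?F y \<partial>lborel)"
      by (subst Bochner_Integration.integral_add[OF intD integrable_mult_right[OF intF]]) simp
    also have "\<dots> < e / 2 + real b * (e / (2 * real b))"
      using b v(3) by (intro add_strict_mono mult_strict_left_mono) auto
    also have "\<dots> = e" using b by simp
    finally show "(LINT y:ball 0 r|lborel. \<bar>\<phi> y - real b * v y\<bar>) < e" .
  qed
qed

text \<open>Heine-Cantor on the ball enlarged by 1; \<open>\<delta> \<le> 1\<close> keeps the second
  point inside it.\<close>

lemma uniformly_continuous_ball:
  fixes v :: "'a \<Rightarrow> real"
  assumes "continuous_on UNIV v" "0 < e"
  obtains \<delta> where "0 < \<delta>" "\<delta> \<le> 1"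
    "\<And>y z. norm y < r \<Longrightarrow> dist y z < \<delta> \<Longrightarrow> \<bar>v y - v z\<bar> \<le> e"
proof -
  have "uniformly_continuous_on (cball 0 (r + 1)) v"
    using assms(1) by (intro compact_uniformly_continuous) (auto intro: continuous_on_subset)
  then obtain d where d: "0 < d" "\<And>y z. y \<in> cball 0 (r + 1) \<Longrightarrow> z \<in> cball 0 (r + 1) \<Longrightarrow> dist z y < d \<Longrightarrow> dist (v z) (v y) < e"
    using assms(2) unfolding uniformly_continuous_on_def by meson
  show ?thesis
  proof (rule that[of "min d 1"])
    fix y z :: 'a assume yz: "norm y < r" "dist y z < min d 1"
    have "norm z \<le> norm y + dist y z" using dist_triangle[of 0 z y] by simp
    with yz have "y \<in> cball 0 (r + 1)" "z \<in> cball 0 (r + 1)" by auto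
    with d(2)[of y z] yz have "dist (v z) (v y) < e" by (simp add: dist_commute)
    then show "\<bar>v y - v z\<bar> \<le> e" by (simp add: dist_real_def)
  qed (use d in auto)
qed

text \<open>\<open>edge_oscillation_bound\<close> divided by \<open>N * K\<close>: the L1 distance
  to a continuous \<open>v\<close>, its modulus of continuity, the points off the bulk, and the
  sparse points. The latter number at most \<open>K\<close> times a fixed number of cells, which is
  small against \<open>N\<close>.\<close>

lemma edge_smoothing:
  assumes u [measurable]: "u \<in> borel_measurable borel" and u01: "\<And>y. 0 \<le> u y \<and> u y \<le> 1"
  shows "((\<lambda>x. (\<Sum>(y,z)\<in>knn_edges (kk x) (pts x). \<bar>u y - u z\<bar>) / (NN x * real (kk x))) \<longlongrightarrow> 0) hp"
proof (rule tendstoI)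
  fix e :: real assume e: "0 < e"
  obtain C :: nat where C: "\<And>S K (x::'a). finite S \<Longrightarrow> card (in_nbrs K S x) \<le> C * K"
    using in_degree_bounded by blast
  \<comment> \<open>The contributions add up to \<open>(C + 5) * \<epsilon>\<close>.\<close>
  define \<epsilon> where "\<epsilon> = e / (2 * real C + 8)"
  have \<epsilon>: "0 < \<epsilon>" using e by (simp add: \<epsilon>_def)
  obtain n where n: "n \<ge> 1" "(LINT y:- bulk n|lborel. \<phi> y) < \<epsilon>" using bulk_exists[OF \<epsilon>] by auto
  obtain v where v: "continuous_on UNIV v" "\<And>y. 0 \<le> v y \<and> v y \<le> 1"
      "(\<integral>y. \<bar>u y - v y\<bar> * \<phi> y \<partial>lborel) < \<epsilon>"
    using continuous_approx_L1[OF phi_integrable phi_nonneg u u01 \<epsilon>] by blast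
  have [measurable]: "v \<in> borel_measurable borel" using v(1) by (rule borel_measurable_continuous_onI)
  obtain \<delta> where \<delta>: "0 < \<delta>" "\<delta> \<le> 1" "\<And>y z. norm y < real n \<Longrightarrow> dist y z < \<delta> \<Longrightarrow> \<bar>v y - v z\<bar> \<le> \<epsilon>"
    using uniformly_continuous_ball[OF v(1) \<epsilon>] by metis
  define A where "A = ball (0::'a) (real n)"
  define s where "s = \<delta> / (2 * real DIM('a))"
  have s: "0 < s" "real DIM('a) * s < \<delta>" using \<delta> by (simp_all add: s_def)
  define J where "J = grid s ` A"
  have J: "finite J" unfolding J_def A_def using s by (intro finite_grid_bounded) auto
  have "((\<lambda>x. (\<Sum>y\<in>pts x. \<bar>u y - v y\<bar>) / NN x) \<longlongrightarrow> (\<integral>y. \<bar>u y - v y\<bar> * \<phi> y \<partial>lborel)) hp"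
  proof (rule LLN_fun)
    show "\<bar>\<bar>u y - v y\<bar>\<bar> \<le> 1" for y using u01[of y] v(2)[of y] by linarith
  qed measurable
  then have e1: "eventually (\<lambda>x. (\<Sum>y\<in>pts x. \<bar>u y - v y\<bar>) / NN x < \<epsilon>) hp"
    by (rule order_tendstoD(2)[OF _ v(3)])
  have e2: "eventually (\<lambda>x. real (card (pts x)) / NN x < 2) hp"
    by (rule order_tendstoD(2)[OF LLN_card]) simp
  have e3: "eventually (\<lambda>x. real (card (pts x \<inter> - bulk n)) / NN x < \<epsilon>) hp"
    by (rule order_tendstoD(2)[OF LLN_set n(2)]) measurable
  have e4: "eventually (\<lambda>x. real (kk x) / NN x < \<epsilon> / (real (card J) + 1)) hp"
    by (rule order_tendstoD(2)[OF hp_const[OF k_small]]) (use \<epsilon> in simp)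
  show "eventually (\<lambda>x. dist ((\<Sum>(y,z)\<in>knn_edges (kk x) (pts x). \<bar>u y - u z\<bar>) / (NN x * real (kk x))) 0 < e) hp"
    using e1 e2 e3 e4 eventually_regular
  proof eventually_elim
    case (elim x)
    let ?S = "pts x" and ?K = "kk x"
    let ?T = "\<Sum>(y,z)\<in>knn_edges ?K ?S. \<bar>u y - u z\<bar>"
    have N: "0 < NN x" and K: "0 < real ?K" using elim by auto
    have "?T \<le> real ?K * ((1 + real C) * (\<Sum>y\<in>?S. \<bar>u y - v y\<bar>) + \<epsilon> * real (card ?S) + real (card (?S - A)) + real (card J * ?K))"
    proof (rule edge_oscillation_bound[where v = v and r = "grid s" and \<delta> = \<delta>])
      show "grid s ` A \<subseteq> J" by (simp add: J_def)
      show "dist y z < \<delta>" if "grid s y = grid s z" for y z :: 'a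
        using grid_dist[OF s(1) that] s(2) by simp
      show "\<bar>v y - v z\<bar> \<le> \<epsilon>" if "y \<in> A" "dist y z < \<delta>" for y z
        using \<delta>(3)[of y z] that by (simp add: A_def)
    qed (use elim C v(2) \<epsilon> J in auto)
    also have "card (?S - A) \<le> card (?S \<inter> - bulk n)"
      by (intro card_mono) (auto simp: A_def bulk_def)
    finally have le: "?T \<le> real ?K * ((1 + real C) * (\<Sum>y\<in>?S. \<bar>u y - v y\<bar>) + \<epsilon> * real (card ?S) + real (card (?S \<inter> - bulk n)) + real (card J * ?K))"
      using K by simp
    have "?T / (NN x * real ?K) \<le> (real ?K * ((1 + real C) * (\<Sum>y\<in>?S. \<bar>u y - v y\<bar>) + \<epsilon> * real (card ?S) + real (card (?S \<inter> - bulk n)) + real (card J * ?K))) / (NN x * real ?K)"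
      by (rule divide_right_mono[OF le]) simp
    also have "\<dots> = (1 + real C) * ((\<Sum>y\<in>?S. \<bar>u y - v y\<bar>) / NN x) + \<epsilon> * (real (card ?S) / NN x)
        + real (card (?S \<inter> - bulk n)) / NN x + real (card J) * (real ?K / NN x)"
      using N K by (simp add: field_simps)
    also have "\<dots> \<le> (1 + real C) * \<epsilon> + \<epsilon> * 2 + \<epsilon> + \<epsilon>"
    proof (intro add_mono mult_left_mono)
      have "real (card J) * (real ?K / NN x) \<le> real (card J) * (\<epsilon> / (real (card J) + 1))"
        using elim by (intro mult_left_mono) auto
      also have "\<dots> \<le> \<epsilon>" using \<epsilon> by (simp add: field_simps)
      finally show "real (card J) * (real ?K / NN x) \<le> \<epsilon>" .
    qed (use elim \<epsilon> in auto)
    also have "\<dots> < \<epsilon> * (2 * real C + 8)"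
      using \<epsilon> by (simp add: algebra_simps add_nonneg_pos)
    also have "\<dots> = e" by (simp add: \<epsilon>_def)
    finally have "?T / (NN x * real ?K) < e" .
    moreover have "0 \<le> ?T / (NN x * real ?K)"
      by (intro divide_nonneg_nonneg sum_nonneg) auto
    ultimately show ?case by simp
  qed
qed

end

section \<open>In-degrees in the Poisson process\<close>

text \<open>The case \<open>s = 0\<close> arises as the mesh when \<open>k N = 0\<close>; division
  by zero then gives all points the same index.\<close>

lemma finite_grid_ball: "0 \<le> s \<Longrightarrow> finite (grid s ` ball (0::'a::euclidean_space) r)"
proof (cases "s = 0")
  case True
  then have "grid s ` ball (0::'a) r \<subseteq> {0}" by (auto simp: grid_def)
  then show ?thesis by (rule finite_subset) simp
qed (intro finite_grid_bounded, auto)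

lemma measure_cell:
  fixes z :: "'a::euclidean_space"
  shows "0 < s \<Longrightarrow> measure lborel (cell s (grid s z)) = s ^ DIM('a)"
  by (simp add: measure_def emeasure_cell)

lemma cell_average:
  fixes v :: "'a::euclidean_space \<Rightarrow> real"
  assumes s: "0 < s" and v: "continuous_on UNIV v"
    and near: "\<And>y. y \<in> cell s (grid s z) \<Longrightarrow> \<bar>v y - t\<bar> \<le> e"
  shows "\<bar>(LINT y:cell s (grid s z)|lborel. v y) - t * s ^ DIM('a)\<bar> \<le> e * s ^ DIM('a)"
proof -
  let ?Q = "cell s (grid s z)"
  have [measurable]: "v \<in> borel_measurable borel" using v by (rule borel_measurable_continuous_onI)
  have fin: "emeasure lborel ?Q < \<infinity>" by (simp add: emeasure_cell[OF s])
  have ci: "set_integrable lborel ?Q (\<lambda>y. r)" for r :: real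
    unfolding set_integrable_def using fin by (intro integrable_scaleR_left integrable_real_indicator) auto
  have cI: "(LINT y:?Q|lborel. r) = r * s ^ DIM('a)" for r :: real
    using fin by (simp add: set_lebesgue_integral_def measure_cell[OF s])
  have di: "set_integrable lborel ?Q (\<lambda>y. v y - t)"
  proof (rule set_integrable_bound[OF ci[of e]])
    show "set_borel_measurable lborel ?Q (\<lambda>y. v y - t)"
      unfolding set_borel_measurable_def by measurable
    show "AE y in lborel. y \<in> ?Q \<longrightarrow> norm (v y - t) \<le> norm e"
      using near by (intro AE_I2) fastforce
  qed
  have "(LINT y:?Q|lborel. v y) = (LINT y:?Q|lborel. (v y - t) + t)" by simp
  also have "\<dots> = (LINT y:?Q|lborel. v y - t) + t * s ^ DIM('a)"
    by (subst set_integral_add[OF di ci]) (simp add: cI)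
  finally have "\<bar>(LINT y:?Q|lborel. v y) - t * s ^ DIM('a)\<bar> = \<bar>LINT y:?Q|lborel. v y - t\<bar>" by simp
  also have "\<dots> \<le> (LINT y:?Q|lborel. \<bar>v y - t\<bar>)"
    using set_integral_norm_bound[OF di] by simp
  also have "\<dots> \<le> (LINT y:?Q|lborel. e)"
    using near by (intro set_integral_mono set_integrable_abs di ci) auto
  finally show ?thesis by (simp add: cI)
qed

text \<open>At \<open>t = 0\<close> both expressions equal \<open>1 - \<epsilon>/2\<close>, strictly
  between \<open>1 - 3/4 * \<epsilon>\<close> and 1, and continuity leaves room for a positive
  \<open>t\<close>.\<close>

lemma radius_parameters:
  fixes \<epsilon> :: real
  assumes "0 < \<epsilon>" "\<epsilon> < 1"
  obtains t where "0 < t" "t < 1" "(1 + t) * (1 - \<epsilon>/2) * (1 + t) ^ d \<le> 1"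
    "1 - 3/4 * \<epsilon> \<le> (1 - t) * (1 - \<epsilon>/2) * (1 - t) ^ d"
proof -
  have "((\<lambda>t. (1 + t) * (1 - \<epsilon>/2) * (1 + t) ^ d) \<longlongrightarrow> (1 + 0) * (1 - \<epsilon>/2) * (1 + 0) ^ d) (at_right (0::real))"
    by (intro tendsto_intros)
  then have 1: "eventually (\<lambda>t. (1 + t) * (1 - \<epsilon>/2) * (1 + t) ^ d < 1) (at_right (0::real))"
    by (rule order_tendstoD(2)) (use assms in simp)
  have "((\<lambda>t. (1 - t) * (1 - \<epsilon>/2) * (1 - t) ^ d) \<longlongrightarrow> (1 - 0) * (1 - \<epsilon>/2) * (1 - 0) ^ d) (at_right (0::real))"
    by (intro tendsto_intros)
  then have 2: "eventually (\<lambda>t. 1 - 3/4 * \<epsilon> < (1 - t) * (1 - \<epsilon>/2) * (1 - t) ^ d) (at_right (0::real))"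
    by (rule order_tendstoD(1)) (use assms in simp)
  have 3: "eventually (\<lambda>t. t < 1) (at_right (0::real))"
    by (rule order_tendstoD(2)[OF tendsto_ident_at]) simp
  have 4: "eventually (\<lambda>t. 0 < t) (at_right (0::real))" by (rule eventually_at_right_less)
  have "eventually (\<lambda>t. 0 < t \<and> t < 1 \<and> (1 + t) * (1 - \<epsilon>/2) * (1 + t) ^ d < 1 \<and>
     1 - 3/4 * \<epsilon> < (1 - t) * (1 - \<epsilon>/2) * (1 - t) ^ d) (at_right (0::real))"
    using 1 2 3 4 by eventually_elim simp
  then obtain t :: real where "0 < t \<and> t < 1 \<and> (1 + t) * (1 - \<epsilon>/2) * (1 + t) ^ d < 1 \<and>
     1 - 3/4 * \<epsilon> < (1 - t) * (1 - \<epsilon>/2) * (1 - t) ^ d"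
    using eventually_happens'[OF trivial_limit_at_right_real] by blast
  then show ?thesis by (intro that[of t]) auto
qed

context two_sample_sequence
begin

text \<open>A fixed fraction \<open>\<theta>\<close> of the typical radius of a ball holding
  \<open>k\<close> of \<open>N\<close> points. Cells shrink, yet their volume times \<open>N\<close>
  is of order \<open>k\<close> and tends to infinity.\<close>

definition mesh :: "real \<Rightarrow> nat \<Rightarrow> real" where
  "mesh \<theta> N = \<theta> * root DIM('a) (real (k N) / real N)"

lemma mesh_nonneg: "0 \<le> \<theta> \<Longrightarrow> 0 \<le> mesh \<theta> N"
  by (simp add: mesh_def)

lemma mesh_pos: "0 < \<theta> \<Longrightarrow> 0 < k N \<Longrightarrow> 0 < N \<Longrightarrow> 0 < mesh \<theta> N"
  by (simp add: mesh_def)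

lemma mesh_power: "mesh \<theta> N ^ DIM('a) = \<theta> ^ DIM('a) * (real (k N) / real N)"
  by (simp add: mesh_def power_mult_distrib)

lemma mesh_lim: "(\<lambda>N. mesh \<theta> N) \<longlonglongrightarrow> 0"
proof -
  have "(\<lambda>N. \<theta> * root DIM('a) (real (k N) / real N)) \<longlonglongrightarrow> \<theta> * root DIM('a) 0"
    by (intro tendsto_intros k_small)
  then show ?thesis by (simp add: mesh_def)
qed

text \<open>The intensity measure of \<open>A\<close>, written without the model at \<open>N\<close>
  so that it can be used under the filter.\<close>

definition lam :: "nat \<Rightarrow> 'a set \<Rightarrow> real" where
  "lam N A = real (N1 N) * (LINT y:A|lborel. f y) + real (N2 N) * (LINT y:A|lborel. g y)"

text \<open>The expected total deviation is at most the sum of the roots of the cell intensities, by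
  Cauchy-Schwarz at most \<open>sqrt (card J * N)\<close>. Cells have volume of order
  \<open>k / N\<close>, so \<open>card J / N\<close> is of order \<open>1 / k\<close>.\<close>

lemma cell_deviation:
  assumes \<theta>: "0 < \<theta>" and R: "0 < R"
  shows "((\<lambda>x. (\<Sum>a\<in>grid (mesh \<theta> (fst x)) ` ball 0 R.
      \<bar>real (card (pts x \<inter> cell (mesh \<theta> (fst x)) a)) - lam (fst x) (cell (mesh \<theta> (fst x)) a)\<bar>) / NN x) \<longlongrightarrow> 0) hp"
proof -
  let ?s = "mesh \<theta>" and ?d = "DIM('a)" and ?\<omega> = "unit_ball_vol (real DIM('a))"
  let ?J = "\<lambda>N. grid (?s N) ` ball (0::'a) R"
  let ?X = "\<lambda>N \<omega>. (\<Sum>a\<in>?J N. \<bar>real (card (points (L N) (Z N) \<omega> \<inter> cell (?s N) a)) - lam N (cell (?s N) a)\<bar>) / real N"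
  have fJ: "finite (?J N)" for N using \<theta> by (intro finite_grid_ball mesh_nonneg) simp
  have "((\<lambda>x. ?X (fst x) (snd x)) \<longlongrightarrow> 0) hp"
  proof (rule tendsto_hp_Markov[where e = "\<lambda>N. sqrt (real (card (?J N)) / real N)"])
    show "(\<lambda>N. sqrt (real (card (?J N)) / real N)) \<longlonglongrightarrow> 0"
    proof -
      have kinf: "filterlim (\<lambda>N. real (k N)) at_top sequentially"
        by (rule filterlim_compose[OF filterlim_real_sequentially k_infinity])
      have "(\<lambda>N. ?\<omega> * (R + real ?d * ?s N) ^ ?d / \<theta> ^ ?d * inverse (real (k N))) \<longlonglongrightarrow> ?\<omega> * (R + real ?d * 0) ^ ?d / \<theta> ^ ?d * 0"
        using \<theta> by (intro tendsto_intros mesh_lim tendsto_inverse_0_at_top kinf) auto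
      then have up: "(\<lambda>N. ?\<omega> * (R + real ?d * ?s N) ^ ?d / \<theta> ^ ?d * inverse (real (k N))) \<longlonglongrightarrow> 0" by simp
      have "(\<lambda>N. real (card (?J N)) / real N) \<longlonglongrightarrow> 0"
      proof (rule tendsto_sandwich[OF _ _ tendsto_const up])
        show "eventually (\<lambda>N. 0 \<le> real (card (?J N)) / real N) sequentially" by simp
        show "eventually (\<lambda>N. real (card (?J N)) / real N
            \<le> ?\<omega> * (R + real ?d * ?s N) ^ ?d / \<theta> ^ ?d * inverse (real (k N))) sequentially"
          using filterlim_at_top[THEN iffD1, OF k_infinity, rule_format, of 1] eventually_ge_at_top[of 1]
        proof eventually_elim
          case (elim N)
          then have s: "0 < ?s N" using \<theta> by (intro mesh_pos) auto
          have "real (card (?J N)) * (\<theta> ^ ?d * (real (k N) / real N)) \<le> ?\<omega> * (R + real ?d * ?s N) ^ ?d"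
            using card_grid_ball(2)[OF s, of R "0 :: 'a"] R by (simp add: mesh_power)
          then show ?case using elim \<theta> by (simp add: field_simps)
        qed
      qed
      from tendsto_real_sqrt[OF this] show ?thesis by simp
    qed
    fix N :: nat assume N: "N \<ge> 1"
    interpret two_sample_densities "M N" "N1 N" "N2 N" f g "L N" "Z N" "c N" by (rule model'[OF N])
    have lamN: "lam N A = \<Lambda> A" if A: "A \<in> sets borel" for A
      unfolding \<Lambda>_def h_def lam_def
      using set_integrable_density[OF A f_integrable] set_integrable_density[OF A g_integrable]
      by (simp add: set_integral_add)
    have eq: "?X N \<omega> = (\<Sum>a\<in>?J N. \<bar>real (cnt (cell (?s N) a) \<omega>) - \<Lambda> (cell (?s N) a)\<bar>) / real N" for \<omega>
      by (simp add: cnt_def lamN)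
    show "?X N \<in> borel_measurable (M N)" unfolding eq by measurable
    have "(\<integral>\<^sup>+\<omega>. ennreal (?X N \<omega>) \<partial>M N)
      = (\<integral>\<^sup>+\<omega>. ennreal (1 / real N) * (\<Sum>a\<in>?J N. ennreal \<bar>real (cnt (cell (?s N) a) \<omega>) - \<Lambda> (cell (?s N) a)\<bar>) \<partial>M N)"
      unfolding eq by (intro nn_integral_cong) (simp add: sum_ennreal ennreal_mult'[symmetric])
    also have "\<dots> = ennreal (1 / real N) * (\<integral>\<^sup>+\<omega>. (\<Sum>a\<in>?J N. ennreal \<bar>real (cnt (cell (?s N) a) \<omega>) - \<Lambda> (cell (?s N) a)\<bar>) \<partial>M N)"
      by (rule nn_integral_cmult) measurable
    finally have I: "(\<integral>\<^sup>+\<omega>. ennreal (?X N \<omega>) \<partial>M N) = ennreal (1 / real N) *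
        (\<integral>\<^sup>+\<omega>. (\<Sum>a\<in>?J N. ennreal \<bar>real (cnt (cell (?s N) a) \<omega>) - \<Lambda> (cell (?s N) a)\<bar>) \<partial>M N)" .
    have "(\<integral>\<^sup>+\<omega>. (\<Sum>a\<in>?J N. ennreal \<bar>real (cnt (cell (?s N) a) \<omega>) - \<Lambda> (cell (?s N) a)\<bar>) \<partial>M N)
        = (\<Sum>a\<in>?J N. \<integral>\<^sup>+\<omega>. ennreal \<bar>real (cnt (cell (?s N) a) \<omega>) - \<Lambda> (cell (?s N) a)\<bar> \<partial>M N)"
      by (rule nn_integral_sum) measurable
    also have "\<dots> \<le> (\<Sum>a\<in>?J N. ennreal (sqrt (\<Lambda> (cell (?s N) a))))"
      by (intro sum_mono cnt_abs_deviation cell_measurable)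
    also have "\<dots> = ennreal (\<Sum>a\<in>?J N. sqrt (\<Lambda> (cell (?s N) a)))"
      by (rule sum_ennreal) (simp add: Lambda_nonneg)
    finally have "(\<integral>\<^sup>+\<omega>. ennreal (?X N \<omega>) \<partial>M N) \<le> ennreal (1 / real N) * ennreal (\<Sum>a\<in>?J N. sqrt (\<Lambda> (cell (?s N) a)))"
      unfolding I by (rule mult_left_mono) simp
    also have "\<dots> = ennreal (1 / real N * (\<Sum>a\<in>?J N. sqrt (\<Lambda> (cell (?s N) a))))"
      by (rule ennreal_mult'[symmetric]) simp
    also have "\<dots> \<le> ennreal (sqrt (real (card (?J N)) / real N))"
    proof (rule ennreal_leI)
      have disj: "disjoint_family_on (cell (?s N)) (?J N)" by (auto simp: disjoint_family_on_def cell_def)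
      have LS: "(\<Sum>a\<in>?J N. \<Lambda> (cell (?s N) a)) = \<Lambda> (\<Union>a\<in>?J N. cell (?s N) a)"
        by (rule Lambda_sum[OF fJ cell_measurable disj])
      have "(\<Sum>a\<in>?J N. 1 * sqrt (\<Lambda> (cell (?s N) a)))\<^sup>2 \<le> (\<Sum>a\<in>?J N. 1\<^sup>2) * (\<Sum>a\<in>?J N. (sqrt (\<Lambda> (cell (?s N) a)))\<^sup>2)"
        by (rule Cauchy_Schwarz_ineq_sum)
      also have "\<dots> = real (card (?J N)) * \<Lambda> (\<Union>a\<in>?J N. cell (?s N) a)"
        by (simp only: LS real_sqrt_pow2 Lambda_nonneg) simp
      also have "\<dots> \<le> real (card (?J N)) * real N"
      proof (rule mult_left_mono)
        have "(\<Union>a\<in>?J N. cell (?s N) a) \<in> sets borel" by (intro sets.finite_UN fJ) auto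
        then show "\<Lambda> (\<Union>a\<in>?J N. cell (?s N) a) \<le> real N"
          using Lambda_mono[of "\<Union>a\<in>?J N. cell (?s N) a" UNIV] sizes[of N] by (simp add: Lambda_UNIV)
      qed simp
      finally have "(\<Sum>a\<in>?J N. sqrt (\<Lambda> (cell (?s N) a))) \<le> sqrt (real (card (?J N)) * real N)"
        by (intro real_le_rsqrt) simp
      then have "1 / real N * (\<Sum>a\<in>?J N. sqrt (\<Lambda> (cell (?s N) a))) \<le> 1 / real N * sqrt (real (card (?J N)) * real N)"
        by (rule mult_left_mono) simp
      also have "\<dots> = sqrt (real (card (?J N)) / real N)"
        using N by (simp add: real_sqrt_mult real_sqrt_divide field_simps)
      finally show "1 / real N * (\<Sum>a\<in>?J N. sqrt (\<Lambda> (cell (?s N) a))) \<le> sqrt (real (card (?J N)) / real N)" .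
    qed
    finally show "(\<integral>\<^sup>+\<omega>. ennreal (?X N \<omega>) \<partial>M N) \<le> ennreal (sqrt (real (card (?J N)) / real N))" .
  qed (auto intro!: divide_nonneg_nonneg sum_nonneg)
  then show ?thesis .
qed

text \<open>Cell integrals of \<open>f\<close> and of \<open>g\<close> sum to at most 1, so
  replacing sample fractions by \<open>p\<close> and \<open>q\<close> costs just their errors;
  replacing \<open>\<phi>\<close> by \<open>\<psi>\<close> costs the L1 distance.\<close>

lemma intensity_deviation:
  fixes \<psi> :: "'a \<Rightarrow> real"
  assumes psi: "continuous_on UNIV \<psi>" and J: "finite J" "\<And>a. a \<in> J \<Longrightarrow> cell s a \<subseteq> ball 0 r" and N: "0 < N"
  shows "(\<Sum>a\<in>J. \<bar>lam N (cell s a) - real N * (LINT y:cell s a|lborel. \<psi> y)\<bar>) / real N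
    \<le> \<bar>real (N1 N) / real N - p\<bar> + \<bar>real (N2 N) / real N - q\<bar> + (LINT y:ball 0 r|lborel. \<bar>\<phi> y - \<psi> y\<bar>)"
proof -
  let ?I = "\<lambda>u a. LINT y:cell s a|lborel. u y"
  let ?a = "\<bar>real (N1 N) / real N - p\<bar>" and ?b = "\<bar>real (N2 N) / real N - q\<bar>"
  have psiB: "set_integrable lborel (cball 0 r) \<psi>"
    unfolding set_integrable_def using psi
    by (intro borel_integrable_compact) (auto intro: continuous_on_subset)
  then have psib: "set_integrable lborel (ball 0 r) \<psi>"
    by (rule set_integrable_subset) auto
  have dib: "set_integrable lborel (ball 0 r) (\<lambda>y. \<phi> y - \<psi> y)"
    by (intro set_integral_diff set_integrable_density phi_integrable psib) auto
  have tri: "\<bar>a * b + c * d + e\<bar> \<le> \<bar>a\<bar> * b + \<bar>c\<bar> * d + E" if "0 \<le> b" "0 \<le> d" "\<bar>e\<bar> \<le> E" for a b c d e E :: real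
  proof -
    have "\<bar>a * b\<bar> = \<bar>a\<bar> * b" "\<bar>c * d\<bar> = \<bar>c\<bar> * d" using that by (simp_all add: abs_mult)
    with that(3) show ?thesis by linarith
  qed
  have tm: "\<bar>lam N (cell s a) - real N * ?I \<psi> a\<bar> / real N
     \<le> ?a * ?I f a + ?b * ?I g a + ?I (\<lambda>y. \<bar>\<phi> y - \<psi> y\<bar>) a" if a: "a \<in> J" for a
  proof -
    have ps: "set_integrable lborel (cell s a) \<psi>"
      by (rule set_integrable_subset[OF psib]) (use J a in auto)
    have fs: "set_integrable lborel (cell s a) f" "set_integrable lborel (cell s a) g" "set_integrable lborel (cell s a) \<phi>"
      by (intro set_integrable_density f_integrable g_integrable phi_integrable; simp)+
    have "?I \<phi> a = p * ?I f a + q * ?I g a"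
      unfolding \<phi>_def using fs by (simp add: set_integral_add)
    moreover have "?I (\<lambda>y. \<phi> y - \<psi> y) a = ?I \<phi> a - ?I \<psi> a"
      by (rule set_integral_diff(2)[OF fs(3) ps])
    ultimately have "lam N (cell s a) / real N - ?I \<psi> a
      = (real (N1 N) / real N - p) * ?I f a + (real (N2 N) / real N - q) * ?I g a + ?I (\<lambda>y. \<phi> y - \<psi> y) a"
      by (simp add: lam_def add_divide_distrib algebra_simps)
    moreover have "0 \<le> ?I f a" "0 \<le> ?I g a"
      unfolding set_lebesgue_integral_def by (auto intro!: Bochner_Integration.integral_nonneg simp: f_nonneg g_nonneg)
    moreover have "\<bar>?I (\<lambda>y. \<phi> y - \<psi> y) a\<bar> \<le> ?I (\<lambda>y. \<bar>\<phi> y - \<psi> y\<bar>) a"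
      using set_integral_norm_bound[OF set_integral_diff(1)[OF fs(3) ps]] by simp
    ultimately have "\<bar>lam N (cell s a) / real N - ?I \<psi> a\<bar> \<le> ?a * ?I f a + ?b * ?I g a + ?I (\<lambda>y. \<bar>\<phi> y - \<psi> y\<bar>) a"
      using tri by simp
    moreover have "\<bar>lam N (cell s a) - real N * ?I \<psi> a\<bar> / real N = \<bar>lam N (cell s a) / real N - ?I \<psi> a\<bar>"
    proof -
      have "lam N (cell s a) / real N - ?I \<psi> a = (lam N (cell s a) - real N * ?I \<psi> a) / real N"
        using N by (simp add: diff_divide_distrib)
      then show ?thesis by (simp add: abs_divide)
    qed
    ultimately show ?thesis by simp
  qed
  have "(\<Sum>a\<in>J. \<bar>lam N (cell s a) - real N * ?I \<psi> a\<bar>) / real N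
     \<le> (\<Sum>a\<in>J. ?a * ?I f a + ?b * ?I g a + ?I (\<lambda>y. \<bar>\<phi> y - \<psi> y\<bar>) a)"
    unfolding sum_divide_distrib by (intro sum_mono tm)
  also have "\<dots> = ?a * (\<Sum>a\<in>J. ?I f a) + ?b * (\<Sum>a\<in>J. ?I g a) + (\<Sum>a\<in>J. ?I (\<lambda>y. \<bar>\<phi> y - \<psi> y\<bar>) a)"
    by (simp add: sum.distrib sum_distrib_left)
  also have "\<dots> \<le> ?a * 1 + ?b * 1 + (LINT y:ball 0 r|lborel. \<bar>\<phi> y - \<psi> y\<bar>)"
  proof (intro add_mono mult_left_mono)
    have UN: "set_integrable lborel UNIV f" "set_integrable lborel UNIV g"
      by (intro set_integrable_density f_integrable g_integrable; simp)+
    show "(\<Sum>a\<in>J. ?I f a) \<le> 1" "(\<Sum>a\<in>J. ?I g a) \<le> 1"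
      using sum_cells_le[OF _ UN(1) f_nonneg J(1)] sum_cells_le[OF _ UN(2) g_nonneg J(1)]
      by (auto simp: set_lebesgue_integral_def f_integral g_integral)
    show "(\<Sum>a\<in>J. ?I (\<lambda>y. \<bar>\<phi> y - \<psi> y\<bar>) a) \<le> (LINT y:ball 0 r|lborel. \<bar>\<phi> y - \<psi> y\<bar>)"
      by (intro sum_cells_le set_integrable_abs dib J) auto
  qed auto
  finally show ?thesis by simp
qed

text \<open>A ball with expected count \<open>(1 - \<epsilon>/2) * K\<close> leaves a margin on both
  sides: typically it holds no more than \<open>K\<close> points and more than
  \<open>(1 - \<epsilon>) * K\<close>. The parameters are chosen so that one mesh serves all local
  densities between \<open>\<kappa>\<close> and \<open>B\<close>; the exceptions go into
  \<open>in_degree_grid_bound\<close>.\<close>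

lemma few_small_in_degrees:
  assumes \<epsilon>: "0 < \<epsilon>" "\<epsilon> < 1"
  shows "eventually (\<lambda>x. real (card {y \<in> pts x. real (card (in_nbrs (kk x) (pts x) y)) < (1 - \<epsilon>) * real (kk x)}) \<le> \<epsilon> * NN x) hp"
proof -
  let ?d = "DIM('a)" and ?\<omega> = "unit_ball_vol (real DIM('a))"
  have \<omega>: "0 < ?\<omega>" by simp
  have d: "0 < real ?d" by simp
  obtain n where n: "n \<ge> 1" "(LINT y:- bulk n|lborel. \<phi> y) < \<epsilon> / 8"
    using bulk_exists[of "\<epsilon> / 8"] \<epsilon> by auto
  define \<kappa> B where "\<kappa> = 1 / real n" and "B = real n"
  have kB: "0 < \<kappa>" "\<kappa> \<le> B" "0 < B" using n mult_mono[of 1 "real n" 1 "real n"] by (auto simp: \<kappa>_def B_def field_simps)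
  obtain t where t: "0 < t" "t < 1" "(1 + t) * (1 - \<epsilon>/2) * (1 + t) ^ ?d \<le> 1"
    "1 - 3/4 * \<epsilon> \<le> (1 - t) * (1 - \<epsilon>/2) * (1 - t) ^ ?d"
    using radius_parameters[OF \<epsilon>] by metis
  \<comment> \<open>The radius of that ball at density \<open>l\<close>, in units of the
    \<open>d\<close>-th root of \<open>k / N\<close>.\<close>
  define \<rho>0 where "\<rho>0 l = root ?d ((1 - \<epsilon>/2) / (l * ?\<omega>))" for l
  have \<rho>0: "0 < \<rho>0 l" "\<rho>0 l ^ ?d * (l * ?\<omega>) = 1 - \<epsilon>/2" if "0 < l" for l
    using that \<epsilon> \<omega> less_imp_neq[OF \<omega>] by (simp_all add: \<rho>0_def)
  have \<rho>0_mono: "\<rho>0 l' \<le> \<rho>0 l" if "0 < l" "l \<le> l'" for l l'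
    unfolding \<rho>0_def using that \<epsilon> \<omega> by (intro real_root_le_mono divide_left_mono mult_right_mono) auto
  \<comment> \<open>Even the smallest radius, at density \<open>B\<close>, then spans
    \<open>d / t\<close> cells, so passing between balls and cells changes radii by factors within
    \<open>1 - t\<close> and \<open>1 + t\<close>.\<close>
  define \<theta> where "\<theta> = \<rho>0 B * t / real ?d"
  have \<theta>: "0 < \<theta>" using \<rho>0(1)[OF kB(3)] t d by (simp add: \<theta>_def)
  \<comment> \<open>The diameter of the largest ball, at density \<open>\<kappa>\<close>, in units
    of the mesh.\<close>
  define m where "m = 2 * (\<rho>0 \<kappa> / \<theta>)"
  have m: "0 < m" using \<rho>0(1)[OF kB(1)] \<theta> by (simp add: m_def)
  define Cst where "Cst = 4 * B * (?\<omega> * (m + 2 * real ?d) ^ ?d) / (t * \<kappa>) + 1"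
  have Cst: "1 \<le> Cst" using kB m t \<omega> by (simp add: Cst_def)
  \<comment> \<open>The first bound is for the bulk points outside \<open>G\<close>, the second for
    \<open>Cst\<close> times the total cell deviation, which will be at most
    \<open>4 * \<epsilon>1 * N\<close>.\<close>
  define \<epsilon>1 where "\<epsilon>1 = min (\<epsilon> / (4 * (real n)\<^sup>2)) (\<epsilon> / (8 * Cst))"
  have \<epsilon>1: "0 < \<epsilon>1" "(real n)\<^sup>2 / 2 * \<epsilon>1 \<le> \<epsilon> / 8" "Cst * (4 * \<epsilon>1) \<le> \<epsilon> / 2"
  proof -
    show "0 < \<epsilon>1" using \<epsilon> n Cst by (simp add: \<epsilon>1_def)
    have "(real n)\<^sup>2 / 2 * \<epsilon>1 \<le> (real n)\<^sup>2 / 2 * (\<epsilon> / (4 * (real n)\<^sup>2))"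
      by (intro mult_left_mono) (auto simp: \<epsilon>1_def)
    then show "(real n)\<^sup>2 / 2 * \<epsilon>1 \<le> \<epsilon> / 8" using n by simp
    have "Cst * (4 * \<epsilon>1) \<le> Cst * (4 * (\<epsilon> / (8 * Cst)))"
      using Cst by (intro mult_left_mono) (auto simp: \<epsilon>1_def)
    then show "Cst * (4 * \<epsilon>1) \<le> \<epsilon> / 2" using Cst by simp
  qed
  obtain \<psi> :: "'a \<Rightarrow> real" where psi: "continuous_on UNIV \<psi>" "\<And>y. 0 \<le> \<psi> y"
    "(LINT y:ball 0 (real n + 2)|lborel. \<bar>\<phi> y - \<psi> y\<bar>) < \<epsilon>1"
    using phi_continuous_approx[OF \<epsilon>1(1)] by metis
  have [measurable]: "\<psi> \<in> borel_measurable borel" using psi(1) by (rule borel_measurable_continuous_onI)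
  define G where "G = {y \<in> ball 0 (real n). \<kappa> \<le> \<psi> y \<and> \<psi> y \<le> B}"
  have Gm: "G \<in> sets borel"
  proof -
    have "{y \<in> space borel. \<kappa> \<le> \<psi> y \<and> \<psi> y \<le> B} \<in> sets borel" by measurable
    then have "ball 0 (real n) \<inter> {y \<in> space borel. \<kappa> \<le> \<psi> y \<and> \<psi> y \<le> B} \<in> sets borel"
      by (intro sets.Int) auto
    also have "ball 0 (real n) \<inter> {y \<in> space borel. \<kappa> \<le> \<psi> y \<and> \<psi> y \<le> B} = G"
      by (auto simp: G_def)
    finally show ?thesis .
  qed
  have intG: "(LINT y:- G|lborel. \<phi> y) < \<epsilon> / 2"
  proof -
    have "set_integrable lborel (cball 0 (real n + 2)) \<psi>"
      unfolding set_integrable_def using psi(1)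
      by (intro borel_integrable_compact) (auto intro: continuous_on_subset)
    then have psib: "set_integrable lborel (ball 0 (real n + 2)) \<psi>"
      by (rule set_integrable_subset) auto
    have dib: "set_integrable lborel (ball 0 (real n + 2)) (\<lambda>y. \<bar>\<phi> y - \<psi> y\<bar>)"
      by (intro set_integrable_abs set_integral_diff set_integrable_density phi_integrable psib) auto
    have i1: "integrable lborel (\<lambda>y. indicator (- bulk n) y *\<^sub>R \<phi> y)"
      using set_integrable_density[of "- bulk n", OF _ phi_integrable] by (simp add: set_integrable_def)
    have i2: "integrable lborel (\<lambda>y. (real n)\<^sup>2 / 2 * (indicator (ball 0 (real n + 2)) y *\<^sub>R \<bar>\<phi> y - \<psi> y\<bar>))"
      using dib unfolding set_integrable_def by (rule integrable_mult_right)
    have "indicator (- G) y *\<^sub>R \<phi> y \<le> indicator (- bulk n) y *\<^sub>R \<phi> y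
        + (real n)\<^sup>2 / 2 * (indicator (ball 0 (real n + 2)) y *\<^sub>R \<bar>\<phi> y - \<psi> y\<bar>)" for y
    proof (cases "y \<in> bulk n \<and> y \<notin> G")
      case True
      then have y: "norm y < real n" "2 * \<kappa> \<le> \<phi> y" "\<phi> y \<le> real n / 2" "\<psi> y < \<kappa> \<or> B < \<psi> y"
        by (auto simp: bulk_def G_def \<kappa>_def)
      \<comment> \<open>The factor 2 in \<open>bulk\<close> forces this gap. As
        \<open>\<phi> y\<close> is at most \<open>n / 2\<close>, which is
        \<open>n\<^sup>2 / 2\<close> times \<open>\<kappa>\<close>, the L1 error controls the mass
        of these points as in Markov's inequality.\<close>
      have "\<kappa> \<le> \<bar>\<phi> y - \<psi> y\<bar>"
        using y(2-4) unfolding B_def by linarith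
      then have "(real n)\<^sup>2 / 2 * \<kappa> \<le> (real n)\<^sup>2 / 2 * \<bar>\<phi> y - \<psi> y\<bar>" by (intro mult_left_mono) auto
      moreover have "(real n)\<^sup>2 / 2 * \<kappa> = real n / 2" using n by (simp add: \<kappa>_def power2_eq_square)
      ultimately show ?thesis using True y by simp
    next
      case False
      then show ?thesis by (auto simp: indicator_def phi_nonneg)
    qed
    then have "(LINT y:- G|lborel. \<phi> y) \<le> (\<integral>y. indicator (- bulk n) y *\<^sub>R \<phi> y
        + (real n)\<^sup>2 / 2 * (indicator (ball 0 (real n + 2)) y *\<^sub>R \<bar>\<phi> y - \<psi> y\<bar>) \<partial>lborel)"
      unfolding set_lebesgue_integral_def
      by (intro integral_mono' Bochner_Integration.integrable_add i1 i2) (auto simp: phi_nonneg)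
    also have "\<dots> = (LINT y:- bulk n|lborel. \<phi> y) + (real n)\<^sup>2 / 2 * (LINT y:ball 0 (real n + 2)|lborel. \<bar>\<phi> y - \<psi> y\<bar>)"
      unfolding set_lebesgue_integral_def by (subst Bochner_Integration.integral_add[OF i1 i2]) simp
    also have "\<dots> \<le> \<epsilon> / 8 + (real n)\<^sup>2 / 2 * \<epsilon>1"
      using n psi(3) by (intro add_mono mult_left_mono) auto
    also have "\<dots> < \<epsilon> / 2" using \<epsilon>1(2) \<epsilon> by linarith
    finally show ?thesis .
  qed
  have e1: "eventually (\<lambda>x. real (card (pts x \<inter> - G)) / NN x < \<epsilon> / 2) hp"
    by (rule order_tendstoD(2)[OF LLN_set intG]) (use Gm in auto)
  have "0 < t * \<kappa> / 2" using t kB by simp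
  then obtain \<delta> where \<delta>: "0 < \<delta>" "\<delta> \<le> 1"
      "\<And>y z. norm y < real n \<Longrightarrow> dist y z < \<delta> \<Longrightarrow> \<bar>\<psi> y - \<psi> z\<bar> \<le> t * \<kappa> / 2"
    using uniformly_continuous_ball[OF psi(1)] by metis
  have e2: "eventually (\<lambda>x. mesh \<theta> (fst x) < \<delta> / (m + real ?d)) hp"
    by (rule order_tendstoD(2)[OF hp_const[OF mesh_lim]]) (use \<delta> m in simp)
  \<comment> \<open>Then \<open>\<epsilon>/4 * k\<close> is at least 1, which pays for the additive
    1 between the factors \<open>1 - 3/4 * \<epsilon>\<close> and
    \<open>1 - \<epsilon>\<close>.\<close>
  have e3: "eventually (\<lambda>x. 4 / \<epsilon> \<le> real (kk x)) hp"
  proof -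
    have "filterlim (\<lambda>N. real (k N)) at_top sequentially"
      by (rule filterlim_compose[OF filterlim_real_sequentially k_infinity])
    then have "eventually (\<lambda>N. 4 / \<epsilon> \<le> real (k N)) sequentially"
      by (simp add: filterlim_at_top)
    then show ?thesis by (rule eventually_hp_fst)
  qed
  have e4: "eventually (\<lambda>x. \<bar>real (N1 (fst x)) / NN x - p\<bar> < \<epsilon>1) hp"
    using tendstoD[OF hp_const[OF N1_lim] \<epsilon>1(1)] by (simp add: dist_real_def)
  have e5: "eventually (\<lambda>x. \<bar>real (N2 (fst x)) / NN x - q\<bar> < \<epsilon>1) hp"
    using tendstoD[OF hp_const[OF N2_lim] \<epsilon>1(1)] by (simp add: dist_real_def)
  have n1: "0 < real n + 1" by simp
  have e6: "eventually (\<lambda>x. (\<Sum>a\<in>grid (mesh \<theta> (fst x)) ` ball 0 (real n + 1).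
      \<bar>real (card (pts x \<inter> cell (mesh \<theta> (fst x)) a)) - lam (fst x) (cell (mesh \<theta> (fst x)) a)\<bar>) / NN x < \<epsilon>1) hp"
    by (rule order_tendstoD(2)[OF cell_deviation[OF \<theta> n1] \<epsilon>1(1)])
  show ?thesis
    using e1 e2 e3 e4 e5 e6 eventually_regular
  proof eventually_elim
    case (elim x)
    let ?S = "pts x" and ?K = "kk x" and ?N = "NN x"
    define s where "s = mesh \<theta> (fst x)"
    have N: "0 < ?N" and K: "0 < ?K" using elim by auto
    have s: "0 < s" unfolding s_def using N K \<theta> by (intro mesh_pos) auto
    have sd: "s ^ ?d = \<theta> ^ ?d * (real ?K / ?N)" unfolding s_def by (rule mesh_power)
    have s\<delta>: "(m + real ?d) * s < \<delta>" using elim(2) m d by (simp add: s_def field_simps)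
    define J where "J = grid s ` ball (0::'a) (real n + 1)"
    define w where "w a = ?N * (LINT y:cell s a|lborel. \<psi> y)" for a
    have fJ: "finite J" unfolding J_def using s by (intro finite_grid_bounded) auto
    have "real (card {y \<in> ?S \<inter> G. real (card (in_nbrs ?K ?S y)) < (1 - \<epsilon>) * real ?K})
      \<le> (4 * B * (?\<omega> * (m + 2 * real ?d) ^ ?d) / (t * \<kappa>) + 1) * (\<Sum>a\<in>J. \<bar>real (card (?S \<inter> cell s a)) - w a\<bar>)"
    proof (rule in_degree_grid_bound[where \<psi> = \<psi> and N = ?N])
      fix x' z :: 'a assume x': "x' \<in> G" and xz: "dist x' z < m * s"
      have nx: "norm x' < real n" using x' by (simp add: G_def)
      have ms: "m * s + real ?d * s < \<delta>" using s\<delta> by (simp add: distrib_right)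
      have ds: "0 < real ?d * s" using s by simp
      have "norm z \<le> norm x' + dist x' z" using dist_triangle[of 0 z x'] by simp
      then have nz: "norm z < real n + 1" using nx xz ms ds \<delta>(2) by linarith
      then have "grid s z \<in> J" unfolding J_def by (intro imageI) simp
      moreover have "\<bar>w (grid s z) - ?N * \<psi> x' * s ^ ?d\<bar> \<le> t * \<kappa> / 2 * (?N * s ^ ?d)"
      proof -
        have "\<bar>(LINT y:cell s (grid s z)|lborel. \<psi> y) - \<psi> x' * s ^ ?d\<bar> \<le> t * \<kappa> / 2 * s ^ ?d"
        proof (rule cell_average[OF s psi(1)])
          fix y assume "y \<in> cell s (grid s z)"
          then have "dist y z \<le> real ?d * s" using s by (intro grid_dist) (auto simp: cell_def)
          then have "dist x' y < \<delta>" using dist_triangle[of x' y z] xz ms by (simp add: dist_commute)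
          then have "\<bar>\<psi> x' - \<psi> y\<bar> \<le> t * \<kappa> / 2" by (rule \<delta>(3)[OF nx])
          then show "\<bar>\<psi> y - \<psi> x'\<bar> \<le> t * \<kappa> / 2" by (simp only: abs_minus_commute)
        qed
        then have "?N * \<bar>(LINT y:cell s (grid s z)|lborel. \<psi> y) - \<psi> x' * s ^ ?d\<bar> \<le> ?N * (t * \<kappa> / 2 * s ^ ?d)"
          using N by (intro mult_left_mono) auto
        moreover have "?N * \<bar>(LINT y:cell s (grid s z)|lborel. \<psi> y) - \<psi> x' * s ^ ?d\<bar> = \<bar>w (grid s z) - ?N * \<psi> x' * s ^ ?d\<bar>"
        proof -
          have "w (grid s z) - ?N * \<psi> x' * s ^ ?d = ?N * ((LINT y:cell s (grid s z)|lborel. \<psi> y) - \<psi> x' * s ^ ?d)"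
            by (simp add: w_def algebra_simps)
          then show ?thesis by (simp add: abs_mult)
        qed
        ultimately show ?thesis by (simp add: mult_ac)
      qed
      ultimately show "grid s z \<in> J \<and> \<bar>w (grid s z) - ?N * \<psi> x' * s ^ ?d\<bar> \<le> t * \<kappa> / 2 * (?N * s ^ ?d)" by simp
    next
      fix l assume l: "\<kappa> \<le> l" "l \<le> B"
      then have l0: "0 < l" using kB by linarith
      define \<rho> where "\<rho> = \<rho>0 l / \<theta>"
      have \<rho>d: "real ?d \<le> t * \<rho>"
      proof -
        have "real ?d * \<theta> = t * \<rho>0 B" using d by (simp add: \<theta>_def)
        also have "\<dots> \<le> t * \<rho>0 l" using \<rho>0_mono[OF l0 l(2)] t by simp
        finally show ?thesis using \<theta> by (simp add: \<rho>_def field_simps)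
      qed
      have \<rho>: "0 < \<rho>" using \<rho>0(1)[OF l0] \<theta> by (simp add: \<rho>_def)
      have "t * \<rho> < \<rho>" using \<rho> t by simp
      then have 1: "real ?d < \<rho>" using \<rho>d by linarith
      have 2: "2 * \<rho> \<le> m" unfolding m_def \<rho>_def using \<rho>0_mono[OF kB(1) l(1)] \<theta> by (simp add: divide_right_mono)
      have key: "(?N * l) * (?\<omega> * (\<rho> * s) ^ ?d) = (1 - \<epsilon>/2) * real ?K"
      proof -
        have "(\<rho> * s) ^ ?d = \<rho>0 l ^ ?d * (real ?K / ?N)"
          using \<theta> by (simp add: power_mult_distrib sd \<rho>_def power_divide)
        then have "(?N * l) * (?\<omega> * (\<rho> * s) ^ ?d) = (\<rho>0 l ^ ?d * (l * ?\<omega>)) * real ?K"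
          using N by simp
        then show ?thesis by (simp only: \<rho>0(2)[OF l0])
      qed
      have 3: "(1 + t) * (?N * l) * (?\<omega> * ((\<rho> + real ?d) * s) ^ ?d) \<le> real ?K"
      proof -
        have "(\<rho> + real ?d) * s \<le> (1 + t) * (\<rho> * s)" using \<rho>d s by (simp add: algebra_simps)
        then have "((\<rho> + real ?d) * s) ^ ?d \<le> (1 + t) ^ ?d * (\<rho> * s) ^ ?d"
          unfolding power_mult_distrib[symmetric] using \<rho> s by (intro power_mono) auto
        then have "(1 + t) * (?N * l) * (?\<omega> * ((\<rho> + real ?d) * s) ^ ?d)
            \<le> (1 + t) * (?N * l) * (?\<omega> * ((1 + t) ^ ?d * (\<rho> * s) ^ ?d))"
          using t N l0 \<omega> by (intro mult_left_mono) auto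
        also have "\<dots> = (1 + t) * (1 + t) ^ ?d * ((?N * l) * (?\<omega> * (\<rho> * s) ^ ?d))" by (simp add: mult_ac)
        also have "\<dots> = ((1 + t) * (1 - \<epsilon>/2) * (1 + t) ^ ?d) * real ?K" unfolding key by (simp add: mult_ac)
        also have "\<dots> \<le> 1 * real ?K" by (intro mult_right_mono t) simp
        finally show ?thesis by simp
      qed
      have 4: "(1 - \<epsilon>) * real ?K + 1 \<le> (1 - t) * (?N * l) * (?\<omega> * ((\<rho> - real ?d) * s) ^ ?d)"
      proof -
        have "4 \<le> \<epsilon> * real ?K" using elim(3) \<epsilon> by (simp add: field_simps)
        then have "(1 - \<epsilon>) * real ?K + 1 \<le> (1 - 3/4 * \<epsilon>) * real ?K" by (simp add: algebra_simps)
        also have "\<dots> \<le> ((1 - t) * (1 - \<epsilon>/2) * (1 - t) ^ ?d) * real ?K" by (intro mult_right_mono t) simp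
        also have "\<dots> = (1 - t) * (1 - t) ^ ?d * ((?N * l) * (?\<omega> * (\<rho> * s) ^ ?d))" unfolding key by (simp add: mult_ac)
        also have "\<dots> = (1 - t) * (?N * l) * (?\<omega> * ((1 - t) ^ ?d * (\<rho> * s) ^ ?d))" by (simp add: mult_ac)
        also have "\<dots> \<le> (1 - t) * (?N * l) * (?\<omega> * ((\<rho> - real ?d) * s) ^ ?d)"
        proof -
          have "(1 - t) * (\<rho> * s) \<le> (\<rho> - real ?d) * s" using \<rho>d s by (simp add: algebra_simps)
          then have "(1 - t) ^ ?d * (\<rho> * s) ^ ?d \<le> ((\<rho> - real ?d) * s) ^ ?d"
            unfolding power_mult_distrib[symmetric] using \<rho> s t by (intro power_mono) auto
          then show ?thesis using t N l0 \<omega> by (intro mult_left_mono) auto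
        qed
        finally show ?thesis .
      qed
      show "\<exists>\<rho>>real ?d. 2 * \<rho> \<le> m \<and> (1 + t) * (?N * l) * (?\<omega> * ((\<rho> + real ?d) * s) ^ ?d) \<le> real ?K \<and>
         (1 - \<epsilon>) * real ?K + 1 \<le> (1 - t) * (?N * l) * (?\<omega> * ((\<rho> - real ?d) * s) ^ ?d)"
        using 1 2 3 4 by blast
    qed (use s N kB t fJ m in \<open>auto simp: G_def\<close>)
    also have "\<dots> \<le> Cst * (4 * \<epsilon>1 * ?N)"
      unfolding Cst_def[symmetric]
    proof (rule mult_left_mono)
      have "(\<Sum>a\<in>J. \<bar>real (card (?S \<inter> cell s a)) - w a\<bar>)
        \<le> (\<Sum>a\<in>J. \<bar>real (card (?S \<inter> cell s a)) - lam (fst x) (cell s a)\<bar> + \<bar>lam (fst x) (cell s a) - w a\<bar>)"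
        by (intro sum_mono) linarith
      also have "\<dots> = ((\<Sum>a\<in>J. \<bar>real (card (?S \<inter> cell s a)) - lam (fst x) (cell s a)\<bar>) / ?N
          + (\<Sum>a\<in>J. \<bar>lam (fst x) (cell s a) - w a\<bar>) / ?N) * ?N"
        using N by (simp add: sum.distrib field_simps)
      \<comment> \<open>One share for the counts against their means, three for the means against
        \<open>\<psi>\<close>: two sample fractions and the L1 error.\<close>
      also have "\<dots> \<le> (\<epsilon>1 + 3 * \<epsilon>1) * ?N"
      proof (intro mult_right_mono add_mono)
        show "(\<Sum>a\<in>J. \<bar>real (card (?S \<inter> cell s a)) - lam (fst x) (cell s a)\<bar>) / ?N \<le> \<epsilon>1"
          using elim(6) by (simp add: J_def s_def)
        have sub: "cell s a \<subseteq> ball 0 (real n + 2)" if a: "a \<in> J" for a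
        proof
          fix y assume "y \<in> cell s a"
          then obtain z where z: "norm z < real n + 1" "grid s y = grid s z" using a by (auto simp: J_def cell_def)
          have "0 \<le> m * s" using m s by simp
          then have "dist y z < 1" using grid_dist[OF s z(2)] s\<delta> \<delta>(2) by (simp add: distrib_right)
          then show "y \<in> ball 0 (real n + 2)" using z(1) dist_triangle[of 0 y z] by (simp add: dist_commute)
        qed
        have "0 < fst x" using N by simp
        from intensity_deviation[OF psi(1) fJ sub this]
        show "(\<Sum>a\<in>J. \<bar>lam (fst x) (cell s a) - w a\<bar>) / ?N \<le> 3 * \<epsilon>1"
          unfolding w_def using elim(4,5) psi(3) by linarith
      qed (use N in simp)
      finally show "(\<Sum>a\<in>J. \<bar>real (card (?S \<inter> cell s a)) - w a\<bar>) \<le> 4 * \<epsilon>1 * ?N" by simp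
    qed (use Cst in simp)
    also have "\<dots> = (Cst * (4 * \<epsilon>1)) * ?N" by simp
    also have "\<dots> \<le> \<epsilon> / 2 * ?N" using N by (intro mult_right_mono \<epsilon>1(3)) simp
    finally have g: "real (card {y \<in> ?S \<inter> G. real (card (in_nbrs ?K ?S y)) < (1 - \<epsilon>) * real ?K}) \<le> \<epsilon> / 2 * ?N" .
    have "card {y \<in> ?S. real (card (in_nbrs ?K ?S y)) < (1 - \<epsilon>) * real ?K}
      \<le> card ({y \<in> ?S \<inter> G. real (card (in_nbrs ?K ?S y)) < (1 - \<epsilon>) * real ?K} \<union> (?S \<inter> - G))"
      by (intro card_mono) auto
    also have "\<dots> \<le> card {y \<in> ?S \<inter> G. real (card (in_nbrs ?K ?S y)) < (1 - \<epsilon>) * real ?K} + card (?S \<inter> - G)"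
      by (rule card_Un_le)
    finally have "real (card {y \<in> ?S. real (card (in_nbrs ?K ?S y)) < (1 - \<epsilon>) * real ?K})
      \<le> real (card {y \<in> ?S \<inter> G. real (card (in_nbrs ?K ?S y)) < (1 - \<epsilon>) * real ?K}) + real (card (?S \<inter> - G))"
      by (simp only: of_nat_add[symmetric] of_nat_le_iff)
    moreover have "real (card (?S \<inter> - G)) \<le> \<epsilon> / 2 * ?N" using elim(1) N by (simp add: field_simps)
    ultimately show ?case using g by (simp add: algebra_simps)
  qed
qed

lemma in_degree_regular:
  "((\<lambda>x. (\<Sum>y\<in>pts x. \<bar>real (card (in_nbrs (kk x) (pts x) y)) - real (kk x)\<bar>) / (NN x * real (kk x))) \<longlongrightarrow> 0) hp"
proof (rule tendstoI)
  fix e :: real assume e: "0 < e"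
  define \<epsilon> where "\<epsilon> = min (1/2) (e / 8)"
  have \<epsilon>: "0 < \<epsilon>" "\<epsilon> < 1" "6 * \<epsilon> < e" using e by (auto simp: \<epsilon>_def)
  have e2: "eventually (\<lambda>x. real (card (pts x)) / NN x < 2) hp"
    by (rule order_tendstoD(2)[OF LLN_card]) simp
  show "eventually (\<lambda>x. dist ((\<Sum>y\<in>pts x. \<bar>real (card (in_nbrs (kk x) (pts x) y)) - real (kk x)\<bar>) / (NN x * real (kk x))) 0 < e) hp"
    using few_small_in_degrees[OF \<epsilon>(1,2)] e2 eventually_regular
  proof eventually_elim
    case (elim x)
    let ?S = "pts x" and ?K = "kk x" and ?N = "NN x"
    let ?D = "\<lambda>y. real (card (in_nbrs ?K ?S y))"
    have N: "0 < ?N" and K: "0 < real ?K" using elim by auto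
    have "(\<Sum>y\<in>?S. ?D y) = (\<Sum>y\<in>?S. real (card (out_nbrs ?K ?S y)))"
      using sum_over_edges[of ?S "\<lambda>_ _. 1::real" ?K] by simp
    also have "\<dots> = (\<Sum>y\<in>?S. real ?K)"
      using elim by (intro sum.cong refl) (simp add: card_out_nbrs)
    finally have tot: "(\<Sum>y\<in>?S. ?D y - real ?K) = 0" by (simp add: sum_subtractf)
    let ?Bad = "{y \<in> ?S. ?D y < (1 - \<epsilon>) * real ?K}"
    \<comment> \<open>An absolute value is the value plus twice its negative part. The values sum to
      zero by \<open>tot\<close>, and the negative part is at most \<open>\<epsilon> * K\<close>, or
      \<open>K\<close> at the few bad points.\<close>
    have "\<bar>?D y - real ?K\<bar> \<le> (?D y - real ?K) + 2 * (\<epsilon> * real ?K + (if y \<in> ?Bad then real ?K else 0))" if "y \<in> ?S" for y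
    proof (cases "y \<in> ?Bad")
      case True
      have "0 \<le> \<epsilon> * real ?K" using \<epsilon> by simp
      then show ?thesis using True by (simp add: abs_if)
    next
      case False
      then have "real ?K - \<epsilon> * real ?K \<le> ?D y" using that by (simp add: algebra_simps)
      moreover have "0 \<le> \<epsilon> * real ?K" using \<epsilon> by simp
      ultimately show ?thesis using False by (simp add: abs_if)
    qed
    then have "(\<Sum>y\<in>?S. \<bar>?D y - real ?K\<bar>) \<le> (\<Sum>y\<in>?S. (?D y - real ?K) + 2 * (\<epsilon> * real ?K + (if y \<in> ?Bad then real ?K else 0)))"
      by (rule sum_mono)
    also have "\<dots> = 2 * (\<epsilon> * real ?K * real (card ?S) + real ?K * real (card ?Bad))"
    proof -
      have "(\<Sum>y\<in>?S. if y \<in> ?Bad then real ?K else 0) = real (card (?S \<inter> ?Bad)) * real ?K"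
        by (subst sum.inter_restrict[symmetric]) auto
      moreover have "?S \<inter> ?Bad = ?Bad" by auto
      ultimately show ?thesis
        unfolding sum.distrib tot sum_distrib_left[symmetric] by (simp add: algebra_simps)
    qed
    finally have "(\<Sum>y\<in>?S. \<bar>?D y - real ?K\<bar>) / (?N * real ?K)
       \<le> 2 * (\<epsilon> * real ?K * real (card ?S) + real ?K * real (card ?Bad)) / (?N * real ?K)"
      by (rule divide_right_mono) simp
    also have "\<dots> = 2 * \<epsilon> * (real (card ?S) / ?N) + 2 * (real (card ?Bad) / ?N)"
      using N K by (simp add: field_simps)
    also have "\<dots> \<le> 2 * \<epsilon> * 2 + 2 * \<epsilon>"
    proof (intro add_mono mult_left_mono)
      show "real (card ?Bad) / ?N \<le> \<epsilon>" using elim(1) N by (simp add: field_simps)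
    qed (use elim \<epsilon> in auto)
    also have "\<dots> < e" using \<epsilon> by simp
    finally have "(\<Sum>y\<in>?S. \<bar>?D y - real ?K\<bar>) / (?N * real ?K) < e" .
    moreover have "0 \<le> (\<Sum>y\<in>?S. \<bar>?D y - real ?K\<bar>) / (?N * real ?K)"
      by (intro divide_nonneg_nonneg sum_nonneg) auto
    ultimately show ?case by simp
  qed
qed

end

section \<open>Conditional laws given the points\<close>

text \<open>Labels belong to points, but the model describes their law through the enumeration; this
  passes between the two.\<close>

lemma bern_expect_image:
  assumes "finite V" "inj_on r V"
  shows "bern_expect (r ` V) a F = bern_expect V (\<lambda>i. a (r i)) (\<lambda>I. F (r ` I))"
proof -
  have inj: "inj_on ((`) r) (Pow V)" using assms(2) by (rule inj_on_image_Pow)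
  have "bern_expect (r ` V) a F = (\<Sum>S\<in>(`) r ` Pow V. ((\<Prod>x\<in>S. a x) * (\<Prod>x\<in>r ` V - S. 1 - a x)) *\<^sub>R F S)"
    unfolding bern_expect_def by (simp add: image_Pow_surj)
  also have "\<dots> = (\<Sum>I\<in>Pow V. ((\<Prod>x\<in>r ` I. a x) * (\<Prod>x\<in>r ` V - r ` I. 1 - a x)) *\<^sub>R F (r ` I))"
    by (subst sum.reindex[OF inj]) simp
  also have "\<dots> = bern_expect V (\<lambda>i. a (r i)) (\<lambda>I. F (r ` I))"
    unfolding bern_expect_def
  proof (intro sum.cong refl)
    fix I assume I: "I \<in> Pow V"
    have "r ` V - r ` I = r ` (V - I)"
      using I assms(2) by (intro inj_on_image_set_diff[symmetric, where C = V]) auto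
    moreover have "inj_on r I" "inj_on r (V - I)" using I assms(2) by (auto intro: inj_on_subset)
    ultimately show "((\<Prod>x\<in>r ` I. a x) * (\<Prod>x\<in>r ` V - r ` I. 1 - a x)) *\<^sub>R F (r ` I)
        = ((\<Prod>i\<in>I. a (r i)) * (\<Prod>i\<in>V - I. 1 - a (r i))) *\<^sub>R F (r ` I)"
      by (simp add: prod.reindex)
  qed
  finally show ?thesis .
qed

text \<open>Counting each point at its first index expresses sums over the point set through the
  enumeration even where points coincide, so measurability can be proved on the whole space.\<close>

lemma sum_image_first_index:
  "(\<Sum>x\<in>r ` {..<n::nat}. \<phi> x) = (\<Sum>i<n. if \<exists>j<i. r j = r i then 0 else (\<phi> (r i) :: 'b::comm_monoid_add))"
proof (induction n)
  case (Suc n)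
  show ?case
  proof (cases "\<exists>j<n. r j = r n")
    case True
    then have "r n \<in> r ` {..<n}" by (metis imageI lessThan_iff)
    then have "r ` {..<Suc n} = r ` {..<n}" by (simp add: lessThan_Suc insert_absorb)
    with True Suc show ?thesis by simp
  next
    case False
    then have "r n \<notin> r ` {..<n}" by auto
    with False Suc show ?thesis by (auto simp: lessThan_Suc add.commute)
  qed
qed simp

section \<open>The sigma algebra of the points and the law of the labels\<close>

context two_sample_densities
begin

abbreviation "Fp \<equiv> points_algebra M L Z"

lemma subalgebra_Fp: "subalgebra M Fp"
proof -
  let ?G = "{{\<omega> \<in> space M. L \<omega> = n} | n. True} \<union> {{\<omega> \<in> space M. i < L \<omega> \<and> Z i \<omega> \<in> A} | i A. A \<in> sets borel}"
  note [measurable] = L_measurable Z_measurable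
  have "?G \<subseteq> sets M"
  proof
    fix B assume "B \<in> ?G"
    then consider n where "B = {\<omega> \<in> space M. L \<omega> = n}"
      | i A where "B = {\<omega> \<in> space M. i < L \<omega> \<and> Z i \<omega> \<in> A}" "A \<in> sets borel" by blast
    then show "B \<in> sets M"
    proof cases
      case 1 then show ?thesis by simp
    next
      case 2
      note 2(2)[measurable]
      show ?thesis unfolding 2(1) by measurable
    qed
  qed
  then have "sigma_sets (space M) ?G \<subseteq> sets M" by (rule sets.sigma_sets_subset)
  moreover have "?G \<subseteq> Pow (space M)" by auto
  ultimately show ?thesis
    unfolding subalgebra_def points_algebra_def by (simp add: sets_measure_of)
qed

sublocale Fp: finite_measure_subalgebra M Fp
  by unfold_locales (rule subalgebra_Fp)

lemma space_Fp [simp]: "space Fp = space M"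
  using subalgebra_Fp by (simp add: subalgebra_def)

lemma measurable_Fp_M: "u \<in> measurable Fp N \<Longrightarrow> u \<in> measurable M N"
  by (rule measurable_from_subalg[OF subalgebra_Fp])

lemma generator_in_Fp:
  shows "{\<omega> \<in> space M. L \<omega> = n} \<in> sets Fp"
    and "A \<in> sets borel \<Longrightarrow> {\<omega> \<in> space M. i < L \<omega> \<and> Z i \<omega> \<in> A} \<in> sets Fp"
proof -
  have "{{\<omega> \<in> space M. L \<omega> = n} | n. True} \<union> {{\<omega> \<in> space M. i < L \<omega> \<and> Z i \<omega> \<in> A} | i A. A \<in> sets borel} \<subseteq> Pow (space M)"
    by auto
  then show "{\<omega> \<in> space M. L \<omega> = n} \<in> sets Fp"
    "A \<in> sets borel \<Longrightarrow> {\<omega> \<in> space M. i < L \<omega> \<and> Z i \<omega> \<in> A} \<in> sets Fp"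
    unfolding points_algebra_def by (auto simp: sets_measure_of intro: sigma_sets.Basic)
qed

lemma L_Fp [measurable]: "L \<in> measurable Fp (count_space UNIV)"
proof (subst measurable_count_space_eq2_countable)
  have "L -` {n} \<inter> space Fp = {\<omega> \<in> space M. L \<omega> = n}" for n by auto
  then show "L \<in> space Fp \<rightarrow> UNIV \<and> (\<forall>a\<in>UNIV. L -` {a} \<inter> space Fp \<in> sets Fp)"
    using generator_in_Fp(1) by simp
qed

text \<open>The generators describe \<open>Z i\<close> only where \<open>i < L\<close>; the default
  0 makes the truncation measurable for the sigma algebra of the points without changing the point
  set.\<close>

definition Zt :: "nat \<Rightarrow> 'w \<Rightarrow> 'a" where "Zt i \<omega> = (if i < L \<omega> then Z i \<omega> else 0)"

lemma Zt_Fp [measurable]: "Zt i \<in> borel_measurable Fp"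
proof (rule measurableI)
  fix A :: "'a set" assume A: "A \<in> sets borel"
  have "Zt i -` A \<inter> space Fp = {\<omega> \<in> space M. i < L \<omega> \<and> Z i \<omega> \<in> A} \<union> (if 0 \<in> A then {\<omega> \<in> space Fp. \<not> i < L \<omega>} else {})"
    by (auto simp: Zt_def split: if_splits)
  also have "\<dots> \<in> sets Fp"
  proof -
    have "{\<omega> \<in> space Fp. \<not> i < L \<omega>} \<in> sets Fp" by measurable
    then show ?thesis using generator_in_Fp(2)[OF A, of i] by (intro sets.Un) auto
  qed
  finally show "Zt i -` A \<inter> space Fp \<in> sets Fp" .
qed simp

lemma points_Zt: "P \<omega> = (\<lambda>i. Zt i \<omega>) ` {..<L \<omega>}"
  by (auto simp: points_def Zt_def)

definition lp :: "'a \<Rightarrow> real" where "lp x = label_prob n1 n2 f g 1 x"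

lemma lp_bounds: "0 \<le> lp x" "lp x \<le> 1"
proof -
  have "0 \<le> real n1 * f x" "0 \<le> real n2 * g x" using f_nonneg g_nonneg by auto
  then show "0 \<le> lp x" "lp x \<le> 1" by (auto simp: lp_def label_prob_def divide_le_eq_1)
qed

text \<open>Where \<open>h\<close> vanishes both label probabilities are 0 by division by zero, so
  the complement rule is confined to its support.\<close>

lemma label_prob_2: "h x \<noteq> 0 \<Longrightarrow> label_prob n1 n2 f g 2 x = 1 - lp x"
  by (simp add: lp_def label_prob_def h_def field_simps)

lemma lp_measurable [measurable]: "lp \<in> borel_measurable borel"
  unfolding lp_def[abs_def] label_prob_def[abs_def] by simp

text \<open>The zero set of the intensity has intensity measure zero, hence is almost surely not
  hit.\<close>

lemma AE_h_pos: "AE \<omega> in M. \<forall>x\<in>P \<omega>. h x \<noteq> 0"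
proof -
  let ?A = "{x. h x = 0}"
  have A: "?A \<in> sets borel"
  proof -
    have "?A = {x \<in> space borel. h x = 0}" by simp
    also have "\<dots> \<in> sets borel" by measurable
    finally show ?thesis .
  qed
  have "\<Lambda> ?A = 0"
    unfolding \<Lambda>_def set_lebesgue_integral_def
    by (rule integral_eq_zero_AE) (auto simp: indicator_def)
  then have "prob {\<omega> \<in> space M. cnt ?A \<omega> \<noteq> 0} = 0"
    using prob_cnt_pos[OF A] measure_nonneg[of M "{\<omega> \<in> space M. cnt ?A \<omega> \<noteq> 0}"] by (simp add: measure_le_0_iff)
  then have "AE \<omega> in M. cnt ?A \<omega> = 0"
    using A by (subst (asm) prob_eq_0) (auto elim: eventually_mono)
  then show ?thesis using AE_space
  proof eventually_elim
    case (elim \<omega>)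
    then have "P \<omega> \<inter> ?A = {}" using finite_P by (simp add: cnt_def)
    then show ?case by auto
  qed
qed

definition lab :: "nat set \<Rightarrow> nat \<Rightarrow> nat" where "lab I i = (if i \<in> I then 1 else 2)"
definition lab_event :: "nat \<Rightarrow> nat set \<Rightarrow> 'w set" where
  "lab_event n I = {\<omega> \<in> space M. L \<omega> = n \<and> (\<forall>i<n. c \<omega> (Z i \<omega>) = lab I i)}"
definition ones :: "'w \<Rightarrow> nat set" where "ones \<omega> = {i. i < L \<omega> \<and> c \<omega> (Z i \<omega>) = 1}"

lemma lab_event_measurable [measurable]: "lab_event n I \<in> sets M"
proof -
  have "lab_event n I = {\<omega> \<in> space M. L \<omega> = n} \<inter> {\<omega> \<in> space M. \<forall>i\<in>{..<n}. i < L \<omega> \<and> c \<omega> (Z i \<omega>) = lab I i}"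
    by (auto simp: lab_event_def)
  also have "\<dots> \<in> sets M"
    using L_measurable by (intro sets.Int sets.sets_Collect_finite_All label_measurable) auto
  finally show ?thesis .
qed

text \<open>For patterns with values 1 and 2 the conditional joint law of the model is exactly the
  weight in \<open>bern_expect\<close>.\<close>

lemma condexp_lab_event:
  "AE \<omega> in M. \<forall>I\<in>Pow {..<n}. real_cond_exp M Fp (indicator (lab_event n I)) \<omega>
     = of_bool (L \<omega> = n) * ((\<Prod>i\<in>I. lp (Z i \<omega>)) * (\<Prod>i\<in>{..<n} - I. 1 - lp (Z i \<omega>)))"
proof -
  have "AE \<omega> in M. \<forall>I\<in>Pow {..<n}. real_cond_exp M Fp (indicator (lab_event n I)) \<omega>
     = (if L \<omega> = n then \<Prod>i<n. label_prob n1 n2 f g (lab I i) (Z i \<omega>) else 0)"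
    unfolding lab_event_def using labels_independent
    by (intro AE_finite_allI) auto
  then show ?thesis using AE_h_pos
  proof eventually_elim
    case (elim \<omega>)
    show ?case
    proof
      fix I assume I: "I \<in> Pow {..<n}"
      show "real_cond_exp M Fp (indicator (lab_event n I)) \<omega>
          = of_bool (L \<omega> = n) * ((\<Prod>i\<in>I. lp (Z i \<omega>)) * (\<Prod>i\<in>{..<n} - I. 1 - lp (Z i \<omega>)))"
      proof (cases "L \<omega> = n")
        case True
        have fin: "finite I" using I finite_subset by auto
        have "(\<Prod>i<n. label_prob n1 n2 f g (lab I i) (Z i \<omega>))
            = (\<Prod>i\<in>I. label_prob n1 n2 f g (lab I i) (Z i \<omega>)) * (\<Prod>i\<in>{..<n} - I. label_prob n1 n2 f g (lab I i) (Z i \<omega>))"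
          using I by (subst prod.subset_diff[of I]) (auto simp: mult.commute)
        also have "\<dots> = (\<Prod>i\<in>I. lp (Z i \<omega>)) * (\<Prod>i\<in>{..<n} - I. 1 - lp (Z i \<omega>))"
          using elim(2) True
          by (intro arg_cong2[where f = "(*)"] prod.cong refl) (auto simp: lab_def label_prob_2 points_def lp_def)
        finally show ?thesis using elim(1) I True by simp
      qed (use elim(1) I in simp)
    qed
  qed
qed

lemma disjoint_lab_events:
  assumes "I \<subseteq> {..<n}" "I' \<subseteq> {..<n}" "\<omega> \<in> lab_event n I" "\<omega> \<in> lab_event n I'"
  shows "I = I'"
proof -
  have "i \<in> I \<longleftrightarrow> i \<in> I'" if "i < n" for i
    using assms(3,4) that by (auto simp: lab_event_def lab_def split: if_splits)
  with assms(1,2) show ?thesis by blast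
qed

text \<open>The model does not say outright that labels are 1 or 2. But the conditional
  probabilities of such patterns are weights with sum 1 on \<open>L = n\<close>, so nothing is left
  for any other pattern.\<close>

lemma AE_labels: "AE \<omega> in M. \<omega> \<in> lab_event (L \<omega>) (ones \<omega>)"
proof -
  have "AE \<omega> in M. L \<omega> = n \<longrightarrow> \<omega> \<in> lab_event n (ones \<omega>)" for n
  proof -
    let ?U = "\<Union>I\<in>Pow {..<n}. lab_event n I"
    have U: "?U \<in> sets M" by (intro sets.finite_UN) auto
    have Ln: "{\<omega> \<in> space M. L \<omega> = n} \<in> sets M" using L_measurable by simp
    have sub: "?U \<subseteq> {\<omega> \<in> space M. L \<omega> = n}" by (auto simp: lab_event_def)
    have int: "integrable M (indicator (lab_event n I) :: 'w \<Rightarrow> real)" for I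
      by (simp add: emeasure_eq_measure)
    have "prob ?U = (\<Sum>I\<in>Pow {..<n}. prob (lab_event n I))"
    proof (rule finite_measure_finite_Union)
      show "disjoint_family_on (lab_event n) (Pow {..<n})"
        unfolding disjoint_family_on_def using disjoint_lab_events by blast
    qed auto
    also have "\<dots> = (\<Sum>I\<in>Pow {..<n}. \<integral>\<omega>. real_cond_exp M Fp (indicator (lab_event n I)) \<omega> \<partial>M)"
      using Fp.real_cond_exp_int(2)[OF int] by simp
    also have "\<dots> = (\<integral>\<omega>. (\<Sum>I\<in>Pow {..<n}. real_cond_exp M Fp (indicator (lab_event n I)) \<omega>) \<partial>M)"
      by (rule Bochner_Integration.integral_sum[symmetric]) (rule Fp.real_cond_exp_int(1)[OF int])
    also have "\<dots> = (\<integral>\<omega>. indicator {\<omega> \<in> space M. L \<omega> = n} \<omega> \<partial>M)"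
    proof (rule integral_cong_AE)
      show "AE \<omega> in M. (\<Sum>I\<in>Pow {..<n}. real_cond_exp M Fp (indicator (lab_event n I)) \<omega>) = indicator {\<omega> \<in> space M. L \<omega> = n} \<omega>"
        using condexp_lab_event[of n] AE_space
      proof eventually_elim
        case (elim \<omega>)
        have "(\<Sum>I\<in>Pow {..<n}. (\<Prod>i\<in>I. lp (Z i \<omega>)) * (\<Prod>i\<in>{..<n} - I. 1 - lp (Z i \<omega>)))
            = bern_expect {..<n} (\<lambda>i. lp (Z i \<omega>)) (\<lambda>_. 1::real)"
          by (simp add: bern_expect_def)
        then have "(\<Sum>I\<in>Pow {..<n}. (\<Prod>i\<in>I. lp (Z i \<omega>)) * (\<Prod>i\<in>{..<n} - I. 1 - lp (Z i \<omega>))) = 1"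
          by (simp add: bern_expect_const)
        then show ?case using elim by (simp add: indicator_def flip: sum_distrib_left)
      qed
      show "(\<lambda>\<omega>. \<Sum>I\<in>Pow {..<n}. real_cond_exp M Fp (indicator (lab_event n I)) \<omega>) \<in> borel_measurable M"
        by (intro borel_measurable_sum borel_measurable_cond_exp2)
      show "(\<lambda>\<omega>. indicator {\<omega> \<in> space M. L \<omega> = n} \<omega> :: real) \<in> borel_measurable M" using Ln by simp
    qed
    also have "\<dots> = prob {\<omega> \<in> space M. L \<omega> = n}" using Ln by simp
    finally have "prob ({\<omega> \<in> space M. L \<omega> = n} - ?U) = 0"
      using finite_measure_Diff[OF Ln U sub] by simp
    then have "AE \<omega> in M. \<omega> \<notin> {\<omega> \<in> space M. L \<omega> = n} - ?U"
      using Ln U by (subst (asm) prob_eq_0) auto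
    then show ?thesis using AE_space
    proof eventually_elim
      case (elim \<omega>)
      show ?case
      proof
        assume "L \<omega> = n"
        with elim obtain I where I: "I \<subseteq> {..<n}" "\<omega> \<in> lab_event n I" by auto
        then have "ones \<omega> = I" by (auto simp: ones_def lab_event_def lab_def split: if_splits)
        with I show "\<omega> \<in> lab_event n (ones \<omega>)" by simp
      qed
    qed
  qed
  then have "AE \<omega> in M. \<forall>n. L \<omega> = n \<longrightarrow> \<omega> \<in> lab_event n (ones \<omega>)"
    unfolding AE_all_countable by blast
  then show ?thesis by eventually_elim simp
qed

text \<open>On \<open>L = n\<close> the statistic is a finite sum of coefficients depending on the
  points times indicators of label patterns; the coefficients leave the conditional expectation and
  the indicators become weights.\<close>

lemma condexp_labels:
  assumes \<Psi>: "\<Psi> \<in> borel_measurable M" and G: "\<And>n I. G n I \<in> borel_measurable Fp"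
    and bound: "\<And>n. \<exists>b. \<forall>I. \<forall>\<omega>\<in>space M. L \<omega> = n \<longrightarrow> \<bar>G n I \<omega>\<bar> \<le> b"
    and eq: "AE \<omega> in M. \<Psi> \<omega> = G (L \<omega>) (ones \<omega>) \<omega>"
  shows "AE \<omega> in M. real_cond_exp M Fp \<Psi> \<omega> = bern_expect {..<L \<omega>} (\<lambda>i. lp (Z i \<omega>)) (\<lambda>I. G (L \<omega>) I \<omega>)"
proof -
  have "AE \<omega> in M. L \<omega> = n \<longrightarrow> real_cond_exp M Fp \<Psi> \<omega> = bern_expect {..<n} (\<lambda>i. lp (Z i \<omega>)) (\<lambda>I. G n I \<omega>)" for n
  proof -
    obtain b where b: "\<And>I \<omega>. \<omega> \<in> space M \<Longrightarrow> L \<omega> = n \<Longrightarrow> \<bar>G n I \<omega>\<bar> \<le> b" using bound[of n] by blast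
    \<comment> \<open>\<open>\<Psi>\<close> is controlled only on each event \<open>L = n\<close>,
      so the indicator of that event is pulled in for integrability and out again
      afterwards.\<close>
    define u0 where "u0 \<omega> = (of_bool (L \<omega> = n) :: real)" for \<omega>
    define G' where "G' I \<omega> = u0 \<omega> * G n I \<omega>" for I \<omega>
    define E where "E I = (indicator (lab_event n I) :: 'w \<Rightarrow> real)" for I
    have u0_meas: "u0 \<in> borel_measurable Fp" unfolding u0_def by measurable
    have G'_meas: "G' I \<in> borel_measurable Fp" for I
      unfolding G'_def by (intro borel_measurable_times u0_meas G)
    have E_meas: "E I \<in> borel_measurable M" for I unfolding E_def by measurable
    have GE_int: "integrable M (\<lambda>\<omega>. G' I \<omega> * E I \<omega>)" for I
    proof (rule integrable_const_bound[where B = "\<bar>b\<bar>"])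
      show "AE \<omega> in M. norm (G' I \<omega> * E I \<omega>) \<le> \<bar>b\<bar>"
      proof (rule AE_I2)
        fix \<omega> assume "\<omega> \<in> space M"
        then have "L \<omega> = n \<longrightarrow> \<bar>G n I \<omega>\<bar> \<le> \<bar>b\<bar>" using b[of \<omega> I] by (auto intro: order_trans)
        then show "norm (G' I \<omega> * E I \<omega>) \<le> \<bar>b\<bar>" by (simp add: G'_def u0_def E_def indicator_def)
      qed
      show "(\<lambda>\<omega>. G' I \<omega> * E I \<omega>) \<in> borel_measurable M"
        by (intro borel_measurable_times E_meas measurable_Fp_M[OF G'_meas])
    qed
    have split: "AE \<omega> in M. u0 \<omega> * \<Psi> \<omega> = (\<Sum>I\<in>Pow {..<n}. G' I \<omega> * E I \<omega>)"
      using eq AE_labels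
    proof eventually_elim
      case (elim \<omega>)
      show ?case
      proof (cases "L \<omega> = n")
        case True
        have on: "ones \<omega> \<in> Pow {..<n}" using True by (auto simp: ones_def)
        have "(\<Sum>I\<in>Pow {..<n}. G' I \<omega> * E I \<omega>) = (\<Sum>I\<in>Pow {..<n}. if I = ones \<omega> then G n (ones \<omega>) \<omega> else 0)"
        proof (rule sum.cong[OF refl])
          fix I assume I: "I \<in> Pow {..<n}"
          have in_ones: "\<omega> \<in> lab_event n (ones \<omega>)" using elim(2) True by simp
          have "\<omega> \<in> lab_event n I \<longleftrightarrow> I = ones \<omega>"
          proof
            assume "\<omega> \<in> lab_event n I"
            from disjoint_lab_events[OF _ _ this in_ones] show "I = ones \<omega>" using I on by simp
          qed (use in_ones in simp)
          then show "G' I \<omega> * E I \<omega> = (if I = ones \<omega> then G n (ones \<omega>) \<omega> else 0)"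
            by (simp add: G'_def u0_def E_def True indicator_def)
        qed
        then show ?thesis using elim(1) on True by (simp add: u0_def)
      qed (simp add: u0_def G'_def)
    qed
    have int: "integrable M (\<lambda>\<omega>. u0 \<omega> * \<Psi> \<omega>)"
    proof -
      have "integrable M (\<lambda>\<omega>. \<Sum>I\<in>Pow {..<n}. G' I \<omega> * E I \<omega>)" by (intro Bochner_Integration.integrable_sum GE_int)
      moreover have "(\<lambda>\<omega>. u0 \<omega> * \<Psi> \<omega>) \<in> borel_measurable M"
        by (intro borel_measurable_times measurable_Fp_M[OF u0_meas] \<Psi>)
      moreover have "AE \<omega> in M. (\<Sum>I\<in>Pow {..<n}. G' I \<omega> * E I \<omega>) = u0 \<omega> * \<Psi> \<omega>"
        using split by eventually_elim simp
      ultimately show ?thesis by (rule integrable_cong_AE_imp)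
    qed
    have c1: "AE \<omega> in M. real_cond_exp M Fp (\<lambda>\<omega>. u0 \<omega> * \<Psi> \<omega>) \<omega> = u0 \<omega> * real_cond_exp M Fp \<Psi> \<omega>"
      by (rule Fp.real_cond_exp_mult[OF u0_meas \<Psi> int])
    have c2: "AE \<omega> in M. real_cond_exp M Fp (\<lambda>\<omega>. u0 \<omega> * \<Psi> \<omega>) \<omega>
        = real_cond_exp M Fp (\<lambda>\<omega>. \<Sum>I\<in>Pow {..<n}. G' I \<omega> * E I \<omega>) \<omega>"
      by (intro Fp.real_cond_exp_cong split borel_measurable_integrable int Bochner_Integration.integrable_sum GE_int)
    have c3: "AE \<omega> in M. real_cond_exp M Fp (\<lambda>\<omega>. \<Sum>I\<in>Pow {..<n}. G' I \<omega> * E I \<omega>) \<omega>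
        = (\<Sum>I\<in>Pow {..<n}. real_cond_exp M Fp (\<lambda>\<omega>. G' I \<omega> * E I \<omega>) \<omega>)"
      by (rule Fp.real_cond_exp_sum) (rule GE_int)
    have c4: "AE \<omega> in M. \<forall>I\<in>Pow {..<n}. real_cond_exp M Fp (\<lambda>\<omega>. G' I \<omega> * E I \<omega>) \<omega> = G' I \<omega> * real_cond_exp M Fp (E I) \<omega>"
      by (rule AE_finite_allI) (simp, rule Fp.real_cond_exp_mult[OF G'_meas E_meas GE_int])
    show ?thesis
      using c1 c2 c3 c4 condexp_lab_event[of n]
    proof eventually_elim
      case (elim \<omega>)
      show ?case
      proof
        assume n: "L \<omega> = n"
        have "real_cond_exp M Fp \<Psi> \<omega> = (\<Sum>I\<in>Pow {..<n}. G' I \<omega> * real_cond_exp M Fp (E I) \<omega>)"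
          using elim n by (simp add: u0_def)
        also have "\<dots> = bern_expect {..<n} (\<lambda>i. lp (Z i \<omega>)) (\<lambda>I. G n I \<omega>)"
          unfolding bern_expect_def using elim(5) n
          by (intro sum.cong refl) (simp add: G'_def u0_def E_def)
        finally show "real_cond_exp M Fp \<Psi> \<omega> = bern_expect {..<n} (\<lambda>i. lp (Z i \<omega>)) (\<lambda>I. G n I \<omega>)" .
      qed
    qed
  qed
  then have "AE \<omega> in M. \<forall>n. L \<omega> = n \<longrightarrow> real_cond_exp M Fp \<Psi> \<omega> = bern_expect {..<n} (\<lambda>i. lp (Z i \<omega>)) (\<lambda>I. G n I \<omega>)"
    unfolding AE_all_countable by blast
  then show ?thesis by eventually_elim simp
qed

end

section \<open>Conditional mean, variance and characteristic function of the statistic\<close>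

lemma bern_expect_prob_cong:
  "(\<And>x. x \<in> V \<Longrightarrow> a x = b x) \<Longrightarrow> bern_expect V a F = bern_expect V b F"
  unfolding bern_expect_def
  by (intro sum.cong refl arg_cong2[where f = scaleR] arg_cong2[where f = "(*)"] prod.cong) auto

lemma real_cond_var_measurable: "real_cond_var M F X \<in> borel_measurable M"
  unfolding real_cond_var_def by (rule borel_measurable_cond_exp2)

text \<open>The statistic when \<open>S\<close> is the set of label-1 points and all other points
  have label 2.\<close>

definition cut_edges :: "nat \<Rightarrow> 'a::euclidean_space set \<Rightarrow> 'a set \<Rightarrow> real" where
  "cut_edges K P S = (\<Sum>x\<in>P. \<Sum>y\<in>P. of_bool (x \<in> S \<and> y \<notin> S) * of_bool ((x, y) \<in> knn_edges K P))"

definition cut_mean :: "('a \<Rightarrow> real) \<Rightarrow> nat \<Rightarrow> 'a::euclidean_space set \<Rightarrow> real" where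
  "cut_mean a K P = bern_expect P a (cut_edges K P)"

definition cut_var :: "('a \<Rightarrow> real) \<Rightarrow> nat \<Rightarrow> 'a::euclidean_space set \<Rightarrow> real" where
  "cut_var a K P = bern_expect P a (\<lambda>S. (cut_edges K P S - cut_mean a K P)\<^sup>2)"

context two_sample_densities
begin

context
  fixes K :: nat
begin

text \<open>The number of points is frozen at \<open>n\<close>, so that everything is measurable for
  fixed \<open>n\<close>; the random \<open>L\<close> is inserted only at the end.\<close>

definition edge :: "nat \<Rightarrow> nat \<Rightarrow> nat \<Rightarrow> 'w \<Rightarrow> bool" where
  "edge n i j \<omega> \<longleftrightarrow> (Zt i \<omega>, Zt j \<omega>) \<in> knn_edges K ((\<lambda>i. Zt i \<omega>) ` {..<n})"

definition index_cut :: "nat \<Rightarrow> nat set \<Rightarrow> 'w \<Rightarrow> real" where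
  "index_cut n I \<omega> = (\<Sum>i<n. \<Sum>j<n. of_bool (i \<in> I \<and> j \<notin> I) * of_bool (edge n i j \<omega>))"

definition index_mean :: "nat \<Rightarrow> 'w \<Rightarrow> real" where
  "index_mean n \<omega> = bern_expect {..<n} (\<lambda>i. lp (Zt i \<omega>)) (\<lambda>I. index_cut n I \<omega>)"

definition index_var :: "nat \<Rightarrow> 'w \<Rightarrow> real" where
  "index_var n \<omega> = bern_expect {..<n} (\<lambda>i. lp (Zt i \<omega>)) (\<lambda>I. (index_cut n I \<omega> - index_mean n \<omega>)\<^sup>2)"

definition T :: "'w \<Rightarrow> real" where "T \<omega> = T_stat K (P \<omega>) (c \<omega>)"

text \<open>Rewrites the neighbour count by distances and a sum over first indices, a form in which
  measurability is automatic.\<close>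

lemma edge_iff:
  assumes "i < n" "j < n"
  shows "edge n i j \<omega> \<longleftrightarrow> dist (Zt i \<omega>) (Zt j \<omega>) \<noteq> 0 \<and>
    (\<Sum>l<n. if \<exists>l'<l. dist (Zt l' \<omega>) (Zt l \<omega>) = 0 then 0 else
      (if dist (Zt l \<omega>) (Zt i \<omega>) \<noteq> 0 \<and> dist (Zt i \<omega>) (Zt l \<omega>) < dist (Zt i \<omega>) (Zt j \<omega>) then 1 else 0 :: real)) < real K"
proof -
  let ?S = "(\<lambda>i. Zt i \<omega>) ` {..<n}" and ?a = "Zt i \<omega>" and ?b = "Zt j \<omega>"
  have "real (card {x \<in> ?S - {?a}. dist ?a x < dist ?a ?b}) = real (card {x \<in> ?S. x \<noteq> ?a \<and> dist ?a x < dist ?a ?b})"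
    by (intro arg_cong[where f = "\<lambda>A. real (card A)"]) auto
  also have "\<dots> = (\<Sum>x\<in>?S. if x \<noteq> ?a \<and> dist ?a x < dist ?a ?b then 1 else 0)"
    by (simp add: sum.If_cases Int_def)
  also have "\<dots> = (\<Sum>l<n. if \<exists>l'<l. Zt l' \<omega> = Zt l \<omega> then 0 else
      (if Zt l \<omega> \<noteq> ?a \<and> dist ?a (Zt l \<omega>) < dist ?a ?b then 1 else 0))"
    by (rule sum_image_first_index)
  finally have card: "real (card {x \<in> ?S - {?a}. dist ?a x < dist ?a ?b}) = (\<Sum>l<n. if \<exists>l'<l. dist (Zt l' \<omega>) (Zt l \<omega>) = 0 then 0 else
      (if dist (Zt l \<omega>) ?a \<noteq> 0 \<and> dist ?a (Zt l \<omega>) < dist ?a ?b then 1 else 0))"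
    by (simp only: dist_eq_0_iff)
  have "edge n i j \<omega> \<longleftrightarrow> dist ?a ?b \<noteq> 0 \<and> real (card {x \<in> ?S - {?a}. dist ?a x < dist ?a ?b}) < real K"
    using assms by (auto simp: edge_def knn_edges_def)
  then show ?thesis unfolding card .
qed

lemma edge_measurable: "i < n \<Longrightarrow> j < n \<Longrightarrow> (\<lambda>\<omega>. of_bool (edge n i j \<omega>) :: real) \<in> borel_measurable Fp"
  unfolding edge_iff of_bool_def by measurable

lemma index_cut_measurable: "index_cut n I \<in> borel_measurable Fp"
  unfolding index_cut_def by (intro borel_measurable_sum borel_measurable_times edge_measurable) auto

lemma bern_expect_measurable:
  assumes "\<And>I. H I \<in> borel_measurable Fp"
  shows "(\<lambda>\<omega>. bern_expect {..<n} (\<lambda>i. lp (Zt i \<omega>)) (\<lambda>I. H I \<omega>) :: real) \<in> borel_measurable Fp"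
proof -
  have "(\<lambda>\<omega>. lp (Zt i \<omega>)) \<in> borel_measurable Fp" for i by measurable
  then show ?thesis
    unfolding bern_expect_def real_scaleR_def using assms
    by (intro borel_measurable_sum borel_measurable_times borel_measurable_prod borel_measurable_diff) auto
qed

lemma index_mean_measurable: "index_mean n \<in> borel_measurable Fp"
  unfolding index_mean_def by (rule bern_expect_measurable[OF index_cut_measurable])

lemma index_var_measurable: "index_var n \<in> borel_measurable Fp"
  unfolding index_var_def
  by (rule bern_expect_measurable) (intro borel_measurable_power borel_measurable_diff index_cut_measurable index_mean_measurable)

lemma index_cut_bounds: "0 \<le> index_cut n I \<omega>" "index_cut n I \<omega> \<le> (real n)\<^sup>2"
proof -
  show "0 \<le> index_cut n I \<omega>" unfolding index_cut_def by (intro sum_nonneg) auto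
  have "index_cut n I \<omega> \<le> (\<Sum>i<n. \<Sum>j<n. 1)" unfolding index_cut_def by (intro sum_mono) auto
  then show "index_cut n I \<omega> \<le> (real n)\<^sup>2" by (simp add: power2_eq_square)
qed

lemma index_mean_bounds: "0 \<le> index_mean n \<omega>" "index_mean n \<omega> \<le> (real n)\<^sup>2"
proof -
  interpret B: bernoulli_labels "{..<n}" "\<lambda>i. lp (Zt i \<omega>)" by unfold_locales (auto simp: lp_bounds)
  show "0 \<le> index_mean n \<omega>" unfolding index_mean_def by (intro B.E_nonneg index_cut_bounds)
  have "index_mean n \<omega> \<le> bern_expect {..<n} (\<lambda>i. lp (Zt i \<omega>)) (\<lambda>I. (real n)\<^sup>2)"
    unfolding index_mean_def by (intro B.E_mono index_cut_bounds)
  then show "index_mean n \<omega> \<le> (real n)\<^sup>2" by simp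
qed

lemma cut_edges_image:
  assumes "inj_on (\<lambda>i. Z i \<omega>) {..<L \<omega>}" "I \<subseteq> {..<L \<omega>}"
  shows "cut_edges K (P \<omega>) ((\<lambda>i. Z i \<omega>) ` I) = index_cut (L \<omega>) I \<omega>"
proof -
  let ?n = "L \<omega>"
  have mem: "Z i \<omega> \<in> (\<lambda>i. Z i \<omega>) ` I \<longleftrightarrow> i \<in> I" if "i < ?n" for i
    using assms that by (auto dest: inj_onD)
  have ed: "edge ?n i j \<omega> \<longleftrightarrow> (Z i \<omega>, Z j \<omega>) \<in> knn_edges K (P \<omega>)" if "i < ?n" "j < ?n" for i j
    using that by (simp add: edge_def points_Zt Zt_def)
  define S where "S = P \<omega>"
  have "cut_edges K (P \<omega>) ((\<lambda>i. Z i \<omega>) ` I) = (\<Sum>x\<in>(\<lambda>i. Z i \<omega>) ` {..<?n}. \<Sum>y\<in>(\<lambda>i. Z i \<omega>) ` {..<?n}.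
      of_bool (x \<in> (\<lambda>i. Z i \<omega>) ` I \<and> y \<notin> (\<lambda>i. Z i \<omega>) ` I) * of_bool ((x, y) \<in> knn_edges K S))"
    unfolding cut_edges_def S_def points_def ..
  also have "\<dots> = index_cut ?n I \<omega>"
    unfolding index_cut_def sum.reindex[OF assms(1)] o_def
    by (intro sum.cong refl) (simp add: mem ed S_def)
  finally show ?thesis .
qed

lemma bern_expect_points:
  assumes "inj_on (\<lambda>i. Z i \<omega>) {..<L \<omega>}"
  shows "bern_expect (P \<omega>) lp (\<lambda>S. H (cut_edges K (P \<omega>) S))
    = bern_expect {..<L \<omega>} (\<lambda>i. lp (Z i \<omega>)) (\<lambda>I. H (index_cut (L \<omega>) I \<omega>))"
proof -
  have "bern_expect (P \<omega>) lp (\<lambda>S. H (cut_edges K (P \<omega>) S))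
    = bern_expect {..<L \<omega>} (\<lambda>i. lp (Z i \<omega>)) (\<lambda>I. H (cut_edges K (P \<omega>) ((\<lambda>i. Z i \<omega>) ` I)))"
    unfolding points_def by (rule bern_expect_image[OF _ assms]) simp
  also have "\<dots> = bern_expect {..<L \<omega>} (\<lambda>i. lp (Z i \<omega>)) (\<lambda>I. H (index_cut (L \<omega>) I \<omega>))"
    by (rule bern_expect_cong) (simp add: cut_edges_image[OF assms])
  finally show ?thesis .
qed

lemma index_mean_vi_points:
  assumes "inj_on (\<lambda>i. Z i \<omega>) {..<L \<omega>}"
  shows "cut_mean lp K (P \<omega>) = index_mean (L \<omega>) \<omega>" "cut_var lp K (P \<omega>) = index_var (L \<omega>) \<omega>"
proof -
  have a: "bern_expect {..<L \<omega>} (\<lambda>i. lp (Z i \<omega>)) F = bern_expect {..<L \<omega>} (\<lambda>i. lp (Zt i \<omega>)) F" for F :: "nat set \<Rightarrow> real"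
    by (rule bern_expect_prob_cong) (simp add: Zt_def)
  show 1: "cut_mean lp K (P \<omega>) = index_mean (L \<omega>) \<omega>"
    unfolding cut_mean_def index_mean_def using bern_expect_points[OF assms, of "\<lambda>x. x"] by (simp add: a)
  show "cut_var lp K (P \<omega>) = index_var (L \<omega>) \<omega>"
    unfolding cut_var_def index_var_def 1 bern_expect_points[OF assms, of "\<lambda>x. (x - index_mean (L \<omega>) \<omega>)\<^sup>2"] by (simp add: a)
qed

lemma T_measurable: "T \<in> borel_measurable M"
proof -
  \<comment> \<open>Agreement with \<open>T\<close> is needed at every outcome, hence the first
    indices; labels are consulted only under \<open>i < L\<close>, where the model makes them
    measurable.\<close>
  define Tn where "Tn n \<omega> = (\<Sum>i<n. if \<exists>i'<i. dist (Z i' \<omega>) (Z i \<omega>) = 0 then 0 else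
      (\<Sum>j<n. if \<exists>j'<j. dist (Z j' \<omega>) (Z j \<omega>) = 0 then 0 else
        of_bool (i < L \<omega> \<and> c \<omega> (Z i \<omega>) = 1) * of_bool (j < L \<omega> \<and> c \<omega> (Z j \<omega>) = 2) * of_bool (edge n i j \<omega>) :: real))" for n \<omega>
  note [measurable] = L_measurable Z_measurable
  have lm: "(\<lambda>\<omega>. of_bool (i < L \<omega> \<and> c \<omega> (Z i \<omega>) = e) :: real) \<in> borel_measurable M" for i e
  proof -
    have "Measurable.pred M (\<lambda>\<omega>. i < L \<omega> \<and> c \<omega> (Z i \<omega>) = e)"
      unfolding pred_def using label_measurable by simp
    then show ?thesis unfolding of_bool_def by measurable
  qed
  have fm: "Measurable.pred M (\<lambda>\<omega>. \<exists>i'<i. dist (Z i' \<omega>) (Z i \<omega>) = 0)" for i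
    by measurable
  have "Tn n \<in> borel_measurable M" for n
    unfolding Tn_def
    by (intro borel_measurable_sum measurable_If borel_measurable_times lm
        measurable_Fp_M[OF edge_measurable] fm[unfolded pred_def] borel_measurable_const) auto
  then have "(\<lambda>\<omega>. Tn (L \<omega>) \<omega>) \<in> borel_measurable M"
    by (rule measurable_compose_countable[OF _ L_measurable])
  also have "(\<lambda>\<omega>. Tn (L \<omega>) \<omega>) = T"
  proof
    fix \<omega>
    have ed: "edge (L \<omega>) i j \<omega> \<longleftrightarrow> (Z i \<omega>, Z j \<omega>) \<in> knn_edges K (P \<omega>)" if "i < L \<omega>" "j < L \<omega>" for i j
      using that by (simp add: edge_def points_Zt Zt_def)
    show "Tn (L \<omega>) \<omega> = T \<omega>"
    proof -
      define S where "S = P \<omega>"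
      have "T \<omega> = (\<Sum>x\<in>(\<lambda>i. Z i \<omega>) ` {..<L \<omega>}. \<Sum>y\<in>(\<lambda>i. Z i \<omega>) ` {..<L \<omega>}.
          of_bool (c \<omega> x = 1 \<and> c \<omega> y = 2) * of_bool ((x, y) \<in> knn_edges K S))"
        unfolding T_def T_stat_def S_def points_def ..
      also have "\<dots> = Tn (L \<omega>) \<omega>"
        unfolding Tn_def sum_image_first_index dist_eq_0_iff
        by (intro sum.cong refl if_cong) (auto simp: ed S_def)
      finally show ?thesis by simp
    qed
  qed
  finally show ?thesis .
qed

lemma AE_T: "AE \<omega> in M. inj_on (\<lambda>i. Z i \<omega>) {..<L \<omega>} \<and> T \<omega> = index_cut (L \<omega>) (ones \<omega>) \<omega>"
  using Z_distinct AE_labels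
proof eventually_elim
  case (elim \<omega>)
  let ?n = "L \<omega>"
  have ed: "edge ?n i j \<omega> \<longleftrightarrow> (Z i \<omega>, Z j \<omega>) \<in> knn_edges K (P \<omega>)" if "i < ?n" "j < ?n" for i j
    using that by (simp add: edge_def points_Zt Zt_def)
  have l: "c \<omega> (Z i \<omega>) = 1 \<longleftrightarrow> i \<in> ones \<omega>" "c \<omega> (Z i \<omega>) = 2 \<longleftrightarrow> i \<notin> ones \<omega>" if "i < ?n" for i
    using elim(2) that by (auto simp: lab_event_def lab_def split: if_splits)
  have "T \<omega> = (\<Sum>i<?n. \<Sum>j<?n. of_bool (c \<omega> (Z i \<omega>) = 1 \<and> c \<omega> (Z j \<omega>) = 2) * of_bool ((Z i \<omega>, Z j \<omega>) \<in> knn_edges K (P \<omega>)))"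
  proof -
    define S where "S = P \<omega>"
    have "T \<omega> = (\<Sum>x\<in>(\<lambda>i. Z i \<omega>) ` {..<?n}. \<Sum>y\<in>(\<lambda>i. Z i \<omega>) ` {..<?n}.
        of_bool (c \<omega> x = 1 \<and> c \<omega> y = 2) * of_bool ((x, y) \<in> knn_edges K S))"
      unfolding T_def T_stat_def S_def points_def ..
    then show ?thesis unfolding sum.reindex[OF elim(1)] o_def S_def .
  qed
  also have "\<dots> = index_cut ?n (ones \<omega>) \<omega>"
    unfolding index_cut_def by (intro sum.cong refl) (simp add: ed l del: One_nat_def)
  finally show ?case using elim(1) by simp
qed

text \<open>One statement for the conditional mean, the conditional variance, and the cosine and
  sine of the normalised ratio. A bound in terms of the first two arguments suffices, because both
  are at most the square of \<open>n\<close> on \<open>L = n\<close>.\<close>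

lemma condexp_T_function:
  fixes u :: "real \<Rightarrow> real \<Rightarrow> real \<Rightarrow> real"
  assumes \<Psi>: "\<Psi> \<in> borel_measurable M"
    and u: "\<And>A B C. A \<in> borel_measurable Fp \<Longrightarrow> B \<in> borel_measurable Fp \<Longrightarrow> C \<in> borel_measurable Fp \<Longrightarrow>
      (\<lambda>\<omega>. u (A \<omega>) (B \<omega>) (C \<omega>)) \<in> borel_measurable Fp"
    and bound: "\<And>r. \<exists>b. \<forall>x y z. \<bar>x\<bar> \<le> r \<and> \<bar>y\<bar> \<le> r \<longrightarrow> \<bar>u x y z\<bar> \<le> b"
    and eq: "AE \<omega> in M. \<Psi> \<omega> = u (T \<omega>) (cut_mean lp K (P \<omega>)) (cut_var lp K (P \<omega>))"
  shows "AE \<omega> in M. real_cond_exp M Fp \<Psi> \<omega>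
    = bern_expect (P \<omega>) lp (\<lambda>S. u (cut_edges K (P \<omega>) S) (cut_mean lp K (P \<omega>)) (cut_var lp K (P \<omega>)))"
proof -
  have "AE \<omega> in M. real_cond_exp M Fp \<Psi> \<omega>
    = bern_expect {..<L \<omega>} (\<lambda>i. lp (Z i \<omega>)) (\<lambda>I. u (index_cut (L \<omega>) I \<omega>) (index_mean (L \<omega>) \<omega>) (index_var (L \<omega>) \<omega>))"
  proof (rule condexp_labels[where G = "\<lambda>n I \<omega>. u (index_cut n I \<omega>) (index_mean n \<omega>) (index_var n \<omega>)", OF \<Psi>])
    show "(\<lambda>\<omega>. u (index_cut n I \<omega>) (index_mean n \<omega>) (index_var n \<omega>)) \<in> borel_measurable Fp" for n I
      by (intro u index_cut_measurable index_mean_measurable index_var_measurable)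
    show "\<exists>b. \<forall>I. \<forall>\<omega>\<in>space M. L \<omega> = n \<longrightarrow> \<bar>u (index_cut n I \<omega>) (index_mean n \<omega>) (index_var n \<omega>)\<bar> \<le> b" for n
    proof -
      obtain b where b: "\<forall>x y z. \<bar>x\<bar> \<le> (real n)\<^sup>2 \<and> \<bar>y\<bar> \<le> (real n)\<^sup>2 \<longrightarrow> \<bar>u x y z\<bar> \<le> b"
        using bound[of "(real n)\<^sup>2"] by blast
      have "\<bar>index_cut n I \<omega>\<bar> \<le> (real n)\<^sup>2 \<and> \<bar>index_mean n \<omega>\<bar> \<le> (real n)\<^sup>2" for I \<omega>
        using index_cut_bounds[of n I \<omega>] index_mean_bounds[of n \<omega>] by simp
      with b show ?thesis by blast
    qed
    show "AE \<omega> in M. \<Psi> \<omega> = u (index_cut (L \<omega>) (ones \<omega>) \<omega>) (index_mean (L \<omega>) \<omega>) (index_var (L \<omega>) \<omega>)"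
      using eq AE_T by eventually_elim (simp add: index_mean_vi_points)
  qed
  then show ?thesis using AE_T
  proof eventually_elim
    case (elim \<omega>)
    then have inj: "inj_on (\<lambda>i. Z i \<omega>) {..<L \<omega>}" by simp
    show ?case
      unfolding index_mean_vi_points[OF inj] elim(1)
      by (rule bern_expect_points[OF inj, of "\<lambda>x. u x (index_mean (L \<omega>) \<omega>) (index_var (L \<omega>) \<omega>)", symmetric])
  qed
qed

lemma condexp_T: "AE \<omega> in M. real_cond_exp M Fp T \<omega> = cut_mean lp K (P \<omega>)"
  unfolding cut_mean_def
  by (rule condexp_T_function[where u = "\<lambda>x y z. x", OF T_measurable]) auto

lemma bern_expect_const_points: "bern_expect (P \<omega>) a (\<lambda>S. r) = r"
  by (rule bern_expect_const) (simp add: points_def)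

text \<open>Subtracting a function of the points leaves the conditional variance unchanged.
  \<open>r = 0\<close> gives \<open>T\<close>, \<open>r = 1\<close> the centred and scaled
  statistic.\<close>

lemma condvar_affine:
  fixes b :: real
  assumes X: "X = (\<lambda>\<omega>. b * (T \<omega> - r * real_cond_exp M Fp T \<omega>))"
  shows "AE \<omega> in M. real_cond_var M Fp X \<omega> = b\<^sup>2 * cut_var lp K (P \<omega>)"
proof -
  have Xm: "X \<in> borel_measurable M"
    unfolding X using T_measurable borel_measurable_cond_exp2 by measurable
  have bd: "\<exists>B. \<forall>x y z::real. \<bar>x\<bar> \<le> s \<and> \<bar>y\<bar> \<le> s \<longrightarrow> \<bar>b * (x - r * y)\<bar> \<le> B" for s
  proof (intro exI allI impI)
    fix x y z :: real assume xy: "\<bar>x\<bar> \<le> s \<and> \<bar>y\<bar> \<le> s"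
    have "\<bar>x - r * y\<bar> \<le> \<bar>x\<bar> + \<bar>r\<bar> * \<bar>y\<bar>" by (metis abs_mult abs_triangle_ineq4)
    also have "\<dots> \<le> s + \<bar>r\<bar> * s" using xy by (intro add_mono mult_left_mono) auto
    finally show "\<bar>b * (x - r * y)\<bar> \<le> \<bar>b\<bar> * (s + \<bar>r\<bar> * s)" unfolding abs_mult by (rule mult_left_mono) simp
  qed
  have m: "AE \<omega> in M. real_cond_exp M Fp X \<omega> = bern_expect (P \<omega>) lp (\<lambda>S. b * (cut_edges K (P \<omega>) S - r * cut_mean lp K (P \<omega>)))"
  proof (rule condexp_T_function[where u = "\<lambda>x y z. b * (x - r * y)", OF Xm _ bd])
    show "AE \<omega> in M. X \<omega> = b * (T \<omega> - r * cut_mean lp K (P \<omega>))"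
      using condexp_T by eventually_elim (simp add: X)
    fix A B C :: "'w \<Rightarrow> real" assume [measurable]: "A \<in> borel_measurable Fp" "B \<in> borel_measurable Fp"
    show "(\<lambda>\<omega>. b * (A \<omega> - r * B \<omega>)) \<in> borel_measurable Fp" by measurable
  qed
  have m': "AE \<omega> in M. real_cond_exp M Fp X \<omega> = b * ((1 - r) * cut_mean lp K (P \<omega>))"
    using m
  proof eventually_elim
    case (elim \<omega>)
    show ?case unfolding elim
      by (simp add: bern_expect_mult_left bern_expect_diff bern_expect_const_points algebra_simps flip: cut_mean_def)
  qed
  have "AE \<omega> in M. real_cond_exp M Fp (\<lambda>\<omega>. (X \<omega> - real_cond_exp M Fp X \<omega>)\<^sup>2) \<omega>
     = bern_expect (P \<omega>) lp (\<lambda>S. b\<^sup>2 * (cut_edges K (P \<omega>) S - cut_mean lp K (P \<omega>))\<^sup>2)"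
  proof (rule condexp_T_function[where u = "\<lambda>x y z. b\<^sup>2 * (x - y)\<^sup>2"])
    show "(\<lambda>\<omega>. (X \<omega> - real_cond_exp M Fp X \<omega>)\<^sup>2) \<in> borel_measurable M"
      using Xm borel_measurable_cond_exp2 by measurable
    show "\<exists>B. \<forall>x y z::real. \<bar>x\<bar> \<le> s \<and> \<bar>y\<bar> \<le> s \<longrightarrow> \<bar>b\<^sup>2 * (x - y)\<^sup>2\<bar> \<le> B" for s
    proof (intro exI allI impI)
      fix x y z :: real assume xy: "\<bar>x\<bar> \<le> s \<and> \<bar>y\<bar> \<le> s"
      then have "\<bar>x - y\<bar> \<le> 2 * s" by linarith
      then have "(x - y)\<^sup>2 \<le> (2 * s)\<^sup>2" by (metis abs_ge_zero power2_abs power_mono)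
      then show "\<bar>b\<^sup>2 * (x - y)\<^sup>2\<bar> \<le> b\<^sup>2 * (2 * s)\<^sup>2" by (simp add: mult_left_mono)
    qed
    show "AE \<omega> in M. (X \<omega> - real_cond_exp M Fp X \<omega>)\<^sup>2 = b\<^sup>2 * (T \<omega> - cut_mean lp K (P \<omega>))\<^sup>2"
      using m' condexp_T
    proof eventually_elim
      case (elim \<omega>)
      then have "X \<omega> - real_cond_exp M Fp X \<omega> = b * (T \<omega> - cut_mean lp K (P \<omega>))"
        by (simp add: X algebra_simps)
      then show ?case by (simp add: power_mult_distrib)
    qed
  qed measurable
  then show ?thesis
    unfolding real_cond_var_def cut_var_def by (simp add: bern_expect_mult_left)
qed

lemma condvar_T: "AE \<omega> in M. real_cond_var M Fp T \<omega> = cut_var lp K (P \<omega>)"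
  using condvar_affine[of T 1 0] by simp

lemma condvar_R: "AE \<omega> in M. real_cond_var M Fp (R_cond M Fp N K T) \<omega> = 1 / (real N * (real K)\<^sup>2) * cut_var lp K (P \<omega>)"
proof -
  have "(1 / (sqrt (real N) * real K))\<^sup>2 = 1 / (real N * (real K)\<^sup>2)"
    by (simp add: power_divide power_mult_distrib)
  then show ?thesis
    using condvar_affine[of "R_cond M Fp N K T" "1 / (sqrt (real N) * real K)" 1]
    by (simp add: R_cond_def[abs_def])
qed

text \<open>\<open>real_cond_exp\<close> is real valued, so cosine and sine are conditioned
  separately; \<open>\<gamma>\<close> is the resulting conditional characteristic function.\<close>

lemma char_ratio:
  fixes t :: real
  assumes N: "0 < N" and K: "0 < K"
  defines "R \<equiv> R_cond M Fp N K T"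
  defines "ratio \<equiv> \<lambda>\<omega>. R \<omega> / sqrt (real_cond_var M Fp R \<omega>)"
  shows "ratio \<in> borel_measurable M"
    and "\<exists>\<gamma>. \<gamma> \<in> borel_measurable M \<and> integrable M \<gamma> \<and> char (distr M borel ratio) t = (\<integral>\<omega>. \<gamma> \<omega> \<partial>M) \<and>
      (AE \<omega> in M. \<gamma> \<omega> = bern_expect (P \<omega>) lp
         (\<lambda>S. iexp (t * ((cut_edges K (P \<omega>) S - cut_mean lp K (P \<omega>)) / sqrt (cut_var lp K (P \<omega>))))))"
proof -
  have Rm: "R \<in> borel_measurable M"
    unfolding R_def R_cond_def[abs_def] using T_measurable borel_measurable_cond_exp2 by measurable
  show rm: "ratio \<in> borel_measurable M"
    unfolding ratio_def using Rm real_cond_var_measurable by measurable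
  have ratio_eq: "AE \<omega> in M. ratio \<omega> = (T \<omega> - cut_mean lp K (P \<omega>)) / sqrt (cut_var lp K (P \<omega>))"
    using condvar_R[of N] condexp_T
  proof eventually_elim
    case (elim \<omega>)
    have "sqrt (1 / (real N * (real K)\<^sup>2) * cut_var lp K (P \<omega>)) = 1 / (sqrt (real N) * real K) * sqrt (cut_var lp K (P \<omega>))"
      by (simp add: real_sqrt_mult real_sqrt_divide)
    then show ?case using elim N K by (simp add: ratio_def R_def R_cond_def)
  qed
  let ?x = "\<lambda>x y z. t * ((x - y) / sqrt z)"
  let ?c = "\<lambda>\<omega>. cos (t * ratio \<omega>)" and ?s = "\<lambda>\<omega>. sin (t * ratio \<omega>)"
  have cm: "?c \<in> borel_measurable M" "?s \<in> borel_measurable M" using rm by measurable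
  have ci: "integrable M ?c" "integrable M ?s"
    using cm by (auto intro!: integrable_const_bound[where B = 1])
  have c: "AE \<omega> in M. real_cond_exp M Fp ?c \<omega> = bern_expect (P \<omega>) lp (\<lambda>S. cos (?x (cut_edges K (P \<omega>) S) (cut_mean lp K (P \<omega>)) (cut_var lp K (P \<omega>))))"
  proof (rule condexp_T_function[where u = "\<lambda>x y z. cos (?x x y z)", OF cm(1)])
    show "\<exists>b. \<forall>x y z. \<bar>x\<bar> \<le> r \<and> \<bar>y\<bar> \<le> r \<longrightarrow> \<bar>cos (?x x y z)\<bar> \<le> b" for r
      by (intro exI[of _ 1]) simp
    show "AE \<omega> in M. ?c \<omega> = cos (?x (T \<omega>) (cut_mean lp K (P \<omega>)) (cut_var lp K (P \<omega>)))"
      using ratio_eq by eventually_elim simp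
    fix A B C :: "'w \<Rightarrow> real"
    assume [measurable]: "A \<in> borel_measurable Fp" "B \<in> borel_measurable Fp" "C \<in> borel_measurable Fp"
    show "(\<lambda>\<omega>. cos (?x (A \<omega>) (B \<omega>) (C \<omega>))) \<in> borel_measurable Fp" by measurable
  qed
  have s: "AE \<omega> in M. real_cond_exp M Fp ?s \<omega> = bern_expect (P \<omega>) lp (\<lambda>S. sin (?x (cut_edges K (P \<omega>) S) (cut_mean lp K (P \<omega>)) (cut_var lp K (P \<omega>))))"
  proof (rule condexp_T_function[where u = "\<lambda>x y z. sin (?x x y z)", OF cm(2)])
    show "\<exists>b. \<forall>x y z. \<bar>x\<bar> \<le> r \<and> \<bar>y\<bar> \<le> r \<longrightarrow> \<bar>sin (?x x y z)\<bar> \<le> b" for r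
      by (intro exI[of _ 1]) simp
    show "AE \<omega> in M. ?s \<omega> = sin (?x (T \<omega>) (cut_mean lp K (P \<omega>)) (cut_var lp K (P \<omega>)))"
      using ratio_eq by eventually_elim simp
    fix A B C :: "'w \<Rightarrow> real"
    assume [measurable]: "A \<in> borel_measurable Fp" "B \<in> borel_measurable Fp" "C \<in> borel_measurable Fp"
    show "(\<lambda>\<omega>. sin (?x (A \<omega>) (B \<omega>) (C \<omega>))) \<in> borel_measurable Fp" by measurable
  qed
  define \<gamma> where "\<gamma> \<omega> = complex_of_real (real_cond_exp M Fp ?c \<omega>) + \<i> * complex_of_real (real_cond_exp M Fp ?s \<omega>)" for \<omega>
  have iexp_eq: "iexp y = complex_of_real (cos y) + \<i> * complex_of_real (sin y)" for y
    by (simp add: exp_Euler cos_of_real sin_of_real)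
  note ri = Fp.real_cond_exp_int[OF ci(1)] Fp.real_cond_exp_int[OF ci(2)]
  have "char (distr M borel ratio) t = (\<integral>\<omega>. iexp (t * ratio \<omega>) \<partial>M)"
    unfolding char_def using rm by (subst integral_distr) auto
  also have "\<dots> = complex_of_real (\<integral>\<omega>. ?c \<omega> \<partial>M) + \<i> * complex_of_real (\<integral>\<omega>. ?s \<omega> \<partial>M)"
    unfolding iexp_eq using ci by simp
  also have "\<dots> = (\<integral>\<omega>. \<gamma> \<omega> \<partial>M)"
    unfolding \<gamma>_def using ri by simp
  finally have ch: "char (distr M borel ratio) t = (\<integral>\<omega>. \<gamma> \<omega> \<partial>M)" .
  have gi: "integrable M \<gamma>" unfolding \<gamma>_def using ri by simp
  have "AE \<omega> in M. \<gamma> \<omega> = bern_expect (P \<omega>) lp (\<lambda>S. iexp (?x (cut_edges K (P \<omega>) S) (cut_mean lp K (P \<omega>)) (cut_var lp K (P \<omega>))))"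
    using c s
  proof eventually_elim
    case (elim \<omega>)
    show ?case unfolding \<gamma>_def elim iexp_eq
      by (simp add: bern_expect_def scaleR_conv_of_real sum_distrib_left algebra_simps sum.distrib)
  qed
  with ch gi show "\<exists>\<gamma>. \<gamma> \<in> borel_measurable M \<and> integrable M \<gamma> \<and> char (distr M borel ratio) t = (\<integral>\<omega>. \<gamma> \<omega> \<partial>M) \<and>
      (AE \<omega> in M. \<gamma> \<omega> = bern_expect (P \<omega>) lp (\<lambda>S. iexp (?x (cut_edges K (P \<omega>) S) (cut_mean lp K (P \<omega>)) (cut_var lp K (P \<omega>)))))"
    by (intro exI[of _ \<gamma>]) auto
qed

end

end

section \<open>The centred statistic as a quadratic form\<close>

lemma abs_sum_mult_le:
  fixes a b c d :: real
  assumes "0 \<le> b" "0 \<le> c"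
  shows "\<bar>a * b + c * d\<bar> \<le> \<bar>a\<bar> * b + c * \<bar>d\<bar>"
  using abs_triangle_ineq[of "a * b" "c * d"] assms by (simp add: abs_mult)

locale knn_cut = bernoulli_labels P a
  for P :: "'a::euclidean_space set" and a :: "'a \<Rightarrow> real" +
  fixes K :: nat
begin

definition ed :: "'a \<Rightarrow> 'a \<Rightarrow> real" where "ed x y = of_bool ((x, y) \<in> knn_edges K P)"
definition hh :: "'a \<Rightarrow> real" where
  "hh x = (\<Sum>y\<in>out_nbrs K P x. 1 - a y) - (\<Sum>y\<in>in_nbrs K P x. a y)"
definition ww :: "'a \<Rightarrow> 'a \<Rightarrow> real" where "ww x y = - (ed x y + ed y x)"

lemma ed_bounds: "0 \<le> ed x y" "ed x y \<le> 1" "ed x y * ed x y = ed x y" "ed x x = 0"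
  by (auto simp: ed_def knn_edges_def)

lemma ww_sym: "ww x y = ww y x" and ww_diag: "ww x x = 0"
  by (auto simp: ww_def ed_bounds)

lemma sum_out: "(\<Sum>y\<in>P. ed x y * F y) = (\<Sum>y\<in>out_nbrs K P x. F y)"
  and sum_in: "(\<Sum>y\<in>P. ed y x * F y) = (\<Sum>y\<in>in_nbrs K P x. F y)"
proof -
  have "(\<Sum>y\<in>P. ed x y * F y) = (\<Sum>y\<in>P. if y \<in> out_nbrs K P x then F y else 0)"
    by (intro sum.cong refl) (simp add: ed_def out_nbrs_def)
  also have "\<dots> = (\<Sum>y\<in>P \<inter> out_nbrs K P x. F y)" by (rule sum.inter_restrict[OF finite_V, symmetric])
  also have "P \<inter> out_nbrs K P x = out_nbrs K P x" using out_nbrs_subset by blast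
  finally show "(\<Sum>y\<in>P. ed x y * F y) = (\<Sum>y\<in>out_nbrs K P x. F y)" .
  have "(\<Sum>y\<in>P. ed y x * F y) = (\<Sum>y\<in>P. if y \<in> in_nbrs K P x then F y else 0)"
    by (intro sum.cong refl) (simp add: ed_def in_nbrs_def)
  also have "\<dots> = (\<Sum>y\<in>P \<inter> in_nbrs K P x. F y)" by (rule sum.inter_restrict[OF finite_V, symmetric])
  also have "P \<inter> in_nbrs K P x = in_nbrs K P x" using in_nbrs_subset by blast
  finally show "(\<Sum>y\<in>P. ed y x * F y) = (\<Sum>y\<in>in_nbrs K P x. F y)" .
qed

lemma sum_edges: "(\<Sum>x\<in>P. \<Sum>y\<in>P. ed x y * F x y) = (\<Sum>(x,y)\<in>knn_edges K P. F x y)"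
  unfolding sum_out by (rule sum_over_edges(1)[OF finite_V])

text \<open>Insert \<open>a x + \<xi> x\<close> for label 1 at the start and
  \<open>1 - a y - \<xi> y\<close> for label 2 at the end of an edge and multiply out. Linear terms
  are collected at the point of the centred label, over its outgoing and its incoming edges.\<close>

lemma cut_edges_expansion:
  "cut_edges K P S = (\<Sum>x\<in>P. \<Sum>y\<in>P. ed x y * (a x * (1 - a y))) + qform hh ww S"
proof -
  have e: "of_bool (x \<in> S \<and> y \<notin> S) * of_bool ((x, y) \<in> knn_edges K P)
      = ed x y * (a x * (1 - a y)) + ed x y * ((1 - a y) * \<xi> x S) - ed x y * (a x * \<xi> y S) - ed x y * (\<xi> x S * \<xi> y S)" for x y
    by (simp add: ed_def \<xi>_def algebra_simps)
  have l1: "(\<Sum>x\<in>P. \<Sum>y\<in>P. ed x y * ((1 - a y) * \<xi> x S)) = (\<Sum>x\<in>P. (\<Sum>y\<in>out_nbrs K P x. 1 - a y) * \<xi> x S)"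
    unfolding sum_out sum_distrib_right ..
  have l2: "(\<Sum>x\<in>P. \<Sum>y\<in>P. ed x y * (a x * \<xi> y S)) = (\<Sum>x\<in>P. (\<Sum>y\<in>in_nbrs K P x. a y) * \<xi> x S)"
    by (subst sum.swap) (simp only: sum_in sum_distrib_right)
  have q: "(\<Sum>x\<in>P. \<Sum>y\<in>P. ww x y * \<xi> x S * \<xi> y S) = - 2 * (\<Sum>x\<in>P. \<Sum>y\<in>P. ed x y * (\<xi> x S * \<xi> y S))"
  proof -
    have "(\<Sum>x\<in>P. \<Sum>y\<in>P. ed y x * (\<xi> x S * \<xi> y S)) = (\<Sum>x\<in>P. \<Sum>y\<in>P. ed x y * (\<xi> x S * \<xi> y S))"
      by (subst sum.swap) (simp add: mult_ac)
    then show ?thesis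
      by (simp add: ww_def algebra_simps sum.distrib sum_subtractf sum_negf)
  qed
  have "qform hh ww S = (\<Sum>x\<in>P. (\<Sum>y\<in>out_nbrs K P x. 1 - a y) * \<xi> x S) - (\<Sum>x\<in>P. (\<Sum>y\<in>in_nbrs K P x. a y) * \<xi> x S)
      - (\<Sum>x\<in>P. \<Sum>y\<in>P. ed x y * (\<xi> x S * \<xi> y S))"
    unfolding qform_def q by (simp add: hh_def left_diff_distrib sum_subtractf)
  then show ?thesis
    unfolding cut_edges_def e l1[symmetric] l2[symmetric] by (simp add: sum.distrib sum_subtractf)
qed

lemma cut_centred: "cut_edges K P S - cut_mean a K P = qform hh ww S"
proof -
  have "cut_mean a K P = (\<Sum>x\<in>P. \<Sum>y\<in>P. ed x y * (a x * (1 - a y)))"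
    unfolding cut_mean_def cut_edges_expansion[abs_def] bern_expect_add
    using E_qform[where h = hh and w = ww, OF ww_sym ww_diag] by simp
  then show ?thesis by (simp add: cut_edges_expansion)
qed

lemma cut_var_eq: "cut_var a K P = (\<Sum>x\<in>P. v x * (hh x)\<^sup>2) + 1/2 * (\<Sum>x\<in>P. \<Sum>y\<in>P. v x * v y * (ww x y)\<^sup>2)"
  unfolding cut_var_def cut_centred by (rule E_qform_sq[where h = hh and w = ww, OF ww_sym ww_diag])

lemma abs_hh_le: "\<bar>hh x\<bar> \<le> real (card (out_nbrs K P x)) + real (card (in_nbrs K P x))"
proof -
  have "0 \<le> (\<Sum>y\<in>out_nbrs K P x. 1 - a y)" "0 \<le> (\<Sum>y\<in>in_nbrs K P x. a y)"
    using a_bounds out_nbrs_subset[of K P x] in_nbrs_subset[of K P x] by (auto intro!: sum_nonneg)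
  moreover have "(\<Sum>y\<in>out_nbrs K P x. 1 - a y) \<le> (\<Sum>y\<in>out_nbrs K P x. 1)"
    by (rule sum_mono) (use a_bounds out_nbrs_subset[of K P x] in force)
  moreover have "(\<Sum>y\<in>in_nbrs K P x. a y) \<le> (\<Sum>y\<in>in_nbrs K P x. 1)"
    by (rule sum_mono) (use a_bounds in_nbrs_subset[of K P x] in force)
  ultimately show ?thesis unfolding hh_def by simp
qed

lemma sum_abs_ww: "(\<Sum>y\<in>P. \<bar>ww x y\<bar>) = real (card (out_nbrs K P x)) + real (card (in_nbrs K P x))"
proof -
  have "\<bar>ww x y\<bar> = ed x y * 1 + ed y x * 1" for y using ed_bounds(1)[of x y] ed_bounds(1)[of y x] by (simp add: ww_def)
  then show ?thesis by (simp only: sum.distrib sum_out sum_in) simp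
qed

text \<open>The total degree bounds both the linear coefficient and the absolute row sum, so after
  division by the standard deviation a single bound \<open>D\<close> provides
  \<open>\<eta>\<close>.\<close>

lemma cut_cf_normal_approx:
  assumes D: "\<And>x. x \<in> P \<Longrightarrow> real (card (out_nbrs K P x)) + real (card (in_nbrs K P x)) \<le> D"
    and pos: "0 < cut_var a K P"
  shows "cmod (E (\<lambda>S. iexp (t * ((cut_edges K P S - cut_mean a K P) / sqrt (cut_var a K P)))) - of_real (exp (- (t\<^sup>2 / 2))))
    \<le> \<bar>t\<bar> * ((3 * \<bar>t\<bar> + 9/2 * t\<^sup>2) * (D / sqrt (cut_var a K P)))"
proof -
  let ?s = "sqrt (cut_var a K P)"
  have s: "0 < ?s" "?s\<^sup>2 = cut_var a K P" using pos by auto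
  interpret Q: small_quadratic_form P a "\<lambda>x. hh x / ?s" "\<lambda>x y. ww x y / ?s" "D / ?s"
  proof
    show "ww x y / ?s = ww y x / ?s" "ww x x / ?s = 0" for x y using ww_sym ww_diag by auto
    show "\<bar>hh x / ?s\<bar> \<le> D / ?s" if "x \<in> P" for x
      using abs_hh_le[of x] D[OF that] s by (simp add: abs_divide divide_right_mono)
    show "(\<Sum>y\<in>P. \<bar>ww x y / ?s\<bar>) \<le> D / ?s" if "x \<in> P" for x
      using sum_abs_ww[of x] D[OF that] s by (simp add: abs_divide divide_right_mono flip: sum_divide_distrib)
    have "(\<Sum>x\<in>P. v x * (hh x / ?s)\<^sup>2) + 1/2 * (\<Sum>x\<in>P. \<Sum>y\<in>P. v x * v y * (ww x y / ?s)\<^sup>2) = cut_var a K P / ?s\<^sup>2"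
      unfolding cut_var_eq by (simp only: power_divide times_divide_eq_right sum_divide_distrib[symmetric] add_divide_distrib)
    then show "(\<Sum>x\<in>P. v x * (hh x / ?s)\<^sup>2) + 1/2 * (\<Sum>x\<in>P. \<Sum>y\<in>P. v x * v y * (ww x y / ?s)\<^sup>2) = 1"
      using s pos by simp
  qed
  have "qform (\<lambda>x. hh x / ?s) (\<lambda>x y. ww x y / ?s) S = (cut_edges K P S - cut_mean a K P) / ?s" for S
    unfolding cut_centred qform_def
    by (simp only: times_divide_eq_left times_divide_eq_right sum_divide_distrib[symmetric] add_divide_distrib)
  then have "Q.cf t = E (\<lambda>S. iexp (t * ((cut_edges K P S - cut_mean a K P) / ?s)))"
    unfolding Q.cf_def by simp
  with Q.cf_normal_approx[of t] show ?thesis by simp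
qed

lemma ww_sq_bounds: "ed x y + ed y x \<le> (ww x y)\<^sup>2" "(ww x y)\<^sup>2 \<le> 2 * (ed x y + ed y x)"
  by (auto simp: ww_def ed_def power2_eq_square)

text \<open>The number of edges is of order \<open>K * N\<close>, so this part disappears from the
  limit of the variance at scale \<open>N * K * K\<close>.\<close>

lemma quadratic_part_le: "1/2 * (\<Sum>x\<in>P. \<Sum>y\<in>P. v x * v y * (ww x y)\<^sup>2) \<le> 2 * real (card (knn_edges K P))"
proof -
  have "v x * v y * (ww x y)\<^sup>2 \<le> 2 * (ed x y + ed y x)" if "x \<in> P" "y \<in> P" for x y
  proof -
    have "v x * v y \<le> 1" using v_bounds[OF that(1)] v_bounds[OF that(2)] by (simp add: mult_le_one)
    then have "v x * v y * (ww x y)\<^sup>2 \<le> 1 * (ww x y)\<^sup>2" by (intro mult_right_mono) auto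
    also have "\<dots> \<le> 2 * (ed x y + ed y x)" using ww_sq_bounds(2) by simp
    finally show ?thesis .
  qed
  then have "1/2 * (\<Sum>x\<in>P. \<Sum>y\<in>P. v x * v y * (ww x y)\<^sup>2) \<le> 1/2 * (\<Sum>x\<in>P. \<Sum>y\<in>P. 2 * (ed x y + ed y x))"
    by (intro mult_left_mono sum_mono) auto
  also have "\<dots> = (\<Sum>x\<in>P. \<Sum>y\<in>P. ed x y * 1) + (\<Sum>x\<in>P. \<Sum>y\<in>P. ed y x * 1)"
    by (simp add: sum.distrib flip: sum_distrib_left)
  also have "(\<Sum>x\<in>P. \<Sum>y\<in>P. ed y x * 1) = (\<Sum>x\<in>P. \<Sum>y\<in>P. ed x y * 1)" by (rule sum.swap)
  also have "(\<Sum>x\<in>P. \<Sum>y\<in>P. ed x y * 1) = real (card (knn_edges K P))" unfolding sum_edges by simp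
  finally show ?thesis by simp
qed

text \<open>The linear part is dropped, since it may be of smaller order than usual, for instance
  when \<open>p * f = q * g\<close>.\<close>

lemma cut_var_ge: "(\<Sum>(x,y)\<in>knn_edges K P. v x * v y) \<le> cut_var a K P"
proof -
  have "(\<Sum>x\<in>P. \<Sum>y\<in>P. ed x y * (v x * v y)) + (\<Sum>x\<in>P. \<Sum>y\<in>P. ed y x * (v x * v y))
      \<le> (\<Sum>x\<in>P. \<Sum>y\<in>P. v x * v y * (ww x y)\<^sup>2)"
    unfolding sum.distrib[symmetric]
  proof (intro sum_mono)
    fix x y assume "x \<in> P" "y \<in> P"
    then have "0 \<le> v x * v y" using v_bounds by simp
    from mult_left_mono[OF ww_sq_bounds(1) this, of x y]
    show "ed x y * (v x * v y) + ed y x * (v x * v y) \<le> v x * v y * (ww x y)\<^sup>2" by (simp add: algebra_simps)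
  qed
  moreover have "(\<Sum>x\<in>P. \<Sum>y\<in>P. ed y x * (v x * v y)) = (\<Sum>x\<in>P. \<Sum>y\<in>P. ed x y * (v x * v y))"
    by (subst sum.swap) (simp add: mult_ac)
  moreover have "0 \<le> (\<Sum>x\<in>P. v x * (hh x)\<^sup>2)" using v_bounds by (intro sum_nonneg) auto
  ultimately show ?thesis unfolding cut_var_eq sum_edges[symmetric] by linarith
qed

text \<open>The coefficient is about \<open>K * (1 - \<alpha> y) - K * \<alpha> y\<close>. The three
  errors come from \<open>a\<close> against \<open>\<alpha>\<close>, from \<open>\<alpha>\<close>
  varying along edges, and from in-degrees differing from \<open>K\<close>.\<close>

lemma sum_hh_deviation:
  assumes out: "\<And>y. y \<in> P \<Longrightarrow> card (out_nbrs K P y) = K"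
    and \<alpha>: "\<And>y. \<bar>a y - \<alpha> y\<bar> \<le> \<delta>" "\<And>y. 0 \<le> \<alpha> y \<and> \<alpha> y \<le> 1"
  shows "(\<Sum>y\<in>P. \<bar>hh y - real K * (1 - 2 * \<alpha> y)\<bar>)
    \<le> 2 * \<delta> * (real K * real (card P)) + 2 * (\<Sum>(y,z)\<in>knn_edges K P. \<bar>\<alpha> y - \<alpha> z\<bar>)
      + (\<Sum>y\<in>P. \<bar>real (card (in_nbrs K P y)) - real K\<bar>)"
proof -
  have near: "\<bar>a z - \<alpha> y\<bar> \<le> \<delta> + \<bar>\<alpha> y - \<alpha> z\<bar>" for y z using \<alpha>(1)[of z] by linarith
  have pt: "\<bar>hh y - real K * (1 - 2 * \<alpha> y)\<bar> \<le> (\<Sum>z\<in>out_nbrs K P y. \<delta> + \<bar>\<alpha> y - \<alpha> z\<bar>)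
      + (\<Sum>z\<in>in_nbrs K P y. \<delta> + \<bar>\<alpha> y - \<alpha> z\<bar>) + \<bar>real (card (in_nbrs K P y)) - real K\<bar>" if y: "y \<in> P" for y
  proof -
    have o1: "(\<Sum>z\<in>out_nbrs K P y. 1 - a z) - real K * (1 - \<alpha> y) = (\<Sum>z\<in>out_nbrs K P y. \<alpha> y - a z)"
      using out[OF y] by (simp add: sum_subtractf algebra_simps)
    have "\<bar>\<Sum>z\<in>out_nbrs K P y. \<alpha> y - a z\<bar> \<le> (\<Sum>z\<in>out_nbrs K P y. \<delta> + \<bar>\<alpha> y - \<alpha> z\<bar>)"
      by (rule order_trans[OF sum_abs]) (intro sum_mono, use near in \<open>simp add: abs_minus_commute\<close>)
    moreover have o2: "(\<Sum>z\<in>in_nbrs K P y. a z) - real K * \<alpha> y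
        = (\<Sum>z\<in>in_nbrs K P y. a z - \<alpha> y) + (real (card (in_nbrs K P y)) - real K) * \<alpha> y"
      by (simp add: sum_subtractf algebra_simps)
    moreover have "\<bar>\<Sum>z\<in>in_nbrs K P y. a z - \<alpha> y\<bar> \<le> (\<Sum>z\<in>in_nbrs K P y. \<delta> + \<bar>\<alpha> y - \<alpha> z\<bar>)"
      by (rule order_trans[OF sum_abs]) (intro sum_mono near)
    moreover have "\<bar>(real (card (in_nbrs K P y)) - real K) * \<alpha> y\<bar> \<le> \<bar>real (card (in_nbrs K P y)) - real K\<bar>"
      using \<alpha>(2)[of y] by (simp add: abs_mult mult_left_le)
    moreover have "hh y - real K * (1 - 2 * \<alpha> y) = ((\<Sum>z\<in>out_nbrs K P y. 1 - a z) - real K * (1 - \<alpha> y))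
        - ((\<Sum>z\<in>in_nbrs K P y. a z) - real K * \<alpha> y)"
      by (simp add: hh_def algebra_simps)
    ultimately show ?thesis using o1 by linarith
  qed
  have edges: "(\<Sum>(y,z)\<in>knn_edges K P. \<delta> + \<bar>\<alpha> y - \<alpha> z\<bar>) = \<delta> * (real K * real (card P)) + (\<Sum>(y,z)\<in>knn_edges K P. \<bar>\<alpha> y - \<alpha> z\<bar>)"
  proof -
    have "(\<Sum>(y,z)\<in>knn_edges K P. \<delta>) = (\<Sum>y\<in>P. \<Sum>z\<in>out_nbrs K P y. \<delta>)"
      by (rule sum_over_edges(1)[OF finite_V, symmetric])
    also have "\<dots> = \<delta> * (real K * real (card P))" using out by simp
    finally show ?thesis by (simp add: case_prod_unfold sum.distrib)
  qed
  have "(\<Sum>y\<in>P. \<Sum>z\<in>in_nbrs K P y. \<delta> + \<bar>\<alpha> y - \<alpha> z\<bar>) = (\<Sum>(y,z)\<in>knn_edges K P. \<delta> + \<bar>\<alpha> y - \<alpha> z\<bar>)"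
    using sum_over_edges(2)[OF finite_V, of "\<lambda>y z. \<delta> + \<bar>\<alpha> y - \<alpha> z\<bar>" K] by (simp add: abs_minus_commute)
  moreover have "(\<Sum>y\<in>P. \<Sum>z\<in>out_nbrs K P y. \<delta> + \<bar>\<alpha> y - \<alpha> z\<bar>) = (\<Sum>(y,z)\<in>knn_edges K P. \<delta> + \<bar>\<alpha> y - \<alpha> z\<bar>)"
    by (rule sum_over_edges(1)[OF finite_V])
  moreover have "(\<Sum>y\<in>P. \<bar>hh y - real K * (1 - 2 * \<alpha> y)\<bar>) \<le> (\<Sum>y\<in>P. (\<Sum>z\<in>out_nbrs K P y. \<delta> + \<bar>\<alpha> y - \<alpha> z\<bar>)
      + (\<Sum>z\<in>in_nbrs K P y. \<delta> + \<bar>\<alpha> y - \<alpha> z\<bar>) + \<bar>real (card (in_nbrs K P y)) - real K\<bar>)"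
    by (rule sum_mono) (rule pt)
  moreover have "\<dots> = (\<Sum>y\<in>P. \<Sum>z\<in>out_nbrs K P y. \<delta> + \<bar>\<alpha> y - \<alpha> z\<bar>)
      + (\<Sum>y\<in>P. \<Sum>z\<in>in_nbrs K P y. \<delta> + \<bar>\<alpha> y - \<alpha> z\<bar>) + (\<Sum>y\<in>P. \<bar>real (card (in_nbrs K P y)) - real K\<bar>)"
    by (simp only: sum.distrib)
  ultimately show ?thesis using edges by linarith
qed

text \<open>A difference of squares is factorised, so the deviation of \<open>hh\<close> enters to
  the first power while the degree bound controls the other factor. The last error is the quadratic
  part.\<close>

lemma cut_var_deviation:
  assumes out: "\<And>y. y \<in> P \<Longrightarrow> card (out_nbrs K P y) = K" and K: "0 < K"
    and inn: "\<And>y. card (in_nbrs K P y) \<le> C * K"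
    and \<alpha>: "\<And>y. \<bar>a y - \<alpha> y\<bar> \<le> \<delta>" "\<And>y. 0 \<le> \<alpha> y \<and> \<alpha> y \<le> 1"
  shows "\<bar>cut_var a K P / (real K)\<^sup>2 - (\<Sum>y\<in>P. \<alpha> y * (1 - \<alpha> y) * (1 - 2 * \<alpha> y)\<^sup>2)\<bar>
    \<le> \<delta> * (1 + real C)\<^sup>2 * real (card P) + (2 + real C) * ((\<Sum>y\<in>P. \<bar>hh y - real K * (1 - 2 * \<alpha> y)\<bar>) / real K)
      + 2 * real (card P) / real K"
proof -
  have d0: "0 \<le> \<delta>" using \<alpha>(1)[of undefined] by linarith
  have vv: "\<bar>v y - \<alpha> y * (1 - \<alpha> y)\<bar> \<le> \<delta>" if y: "y \<in> P" for y
  proof -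
    have "v y - \<alpha> y * (1 - \<alpha> y) = (a y - \<alpha> y) * (1 - a y - \<alpha> y)" by (simp add: v_def algebra_simps)
    moreover have "\<bar>1 - a y - \<alpha> y\<bar> \<le> 1" using a_bounds[OF y] \<alpha>(2)[of y] by (simp add: abs_le_iff)
    ultimately have "\<bar>v y - \<alpha> y * (1 - \<alpha> y)\<bar> \<le> \<bar>a y - \<alpha> y\<bar> * 1"
      by (simp add: abs_mult mult_left_le)
    with \<alpha>(1)[of y] show ?thesis by simp
  qed
  have hK: "\<bar>hh y / real K\<bar> \<le> 1 + real C" if "y \<in> P" for y
  proof -
    have "\<bar>hh y\<bar> \<le> real K + real (C * K)"
      using abs_hh_le[of y] out[OF that] inn[of y] by (simp only: of_nat_le_iff[symmetric, where 'a = real])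
    also have "\<dots> = (1 + real C) * real K" by (simp add: algebra_simps)
    finally show ?thesis using K by (simp add: abs_divide divide_le_eq)
  qed
  have pt: "\<bar>v y * (hh y / real K)\<^sup>2 - \<alpha> y * (1 - \<alpha> y) * (1 - 2 * \<alpha> y)\<^sup>2\<bar>
     \<le> \<delta> * (1 + real C)\<^sup>2 + (2 + real C) * (\<bar>hh y - real K * (1 - 2 * \<alpha> y)\<bar> / real K)" if y: "y \<in> P" for y
  proof -
    let ?H = "hh y / real K" and ?r = "1 - 2 * \<alpha> y" and ?w = "\<alpha> y * (1 - \<alpha> y)"
    have r: "\<bar>?r\<bar> \<le> 1" using \<alpha>(2)[of y] by (simp add: abs_le_iff)
    have w: "0 \<le> ?w" "?w \<le> 1" using \<alpha>(2)[of y] by (auto intro: mult_le_one)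
    have alg: "v0 * H\<^sup>2 - w0 * r0\<^sup>2 = (v0 - w0) * H\<^sup>2 + w0 * ((H - r0) * (H + r0))" for v0 w0 H r0 :: real
      by (simp add: algebra_simps power2_eq_square)
    have "\<bar>v y * ?H\<^sup>2 - ?w * ?r\<^sup>2\<bar> \<le> \<bar>v y - ?w\<bar> * ?H\<^sup>2 + ?w * (\<bar>?H - ?r\<bar> * \<bar>?H + ?r\<bar>)"
      unfolding alg abs_mult[of "?H - ?r", symmetric] by (rule abs_sum_mult_le) (use w in auto)
    also have "\<dots> \<le> \<delta> * (1 + real C)\<^sup>2 + 1 * (\<bar>?H - ?r\<bar> * (2 + real C))"
    proof (intro add_mono mult_mono)
      show "?H\<^sup>2 \<le> (1 + real C)\<^sup>2" using hK[OF y] by (metis abs_ge_zero power2_abs power_mono)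
      show "\<bar>?H + ?r\<bar> \<le> 2 + real C" using hK[OF y] r by linarith
    qed (use vv[OF y] w d0 in auto)
    also have "\<bar>?H - ?r\<bar> = \<bar>hh y - real K * ?r\<bar> / real K"
    proof -
      have "?H - ?r = (hh y - real K * ?r) / real K" using K by (simp add: field_simps)
      then show ?thesis by (simp add: abs_divide)
    qed
    finally show ?thesis by (simp add: mult.commute)
  qed
  have ke: "real (card (knn_edges K P)) = real K * real (card P)"
  proof -
    have "real (card (knn_edges K P)) = (\<Sum>(y,z)\<in>knn_edges K P. 1)" by simp
    also have "\<dots> = (\<Sum>y\<in>P. \<Sum>z\<in>out_nbrs K P y. 1)" by (rule sum_over_edges(1)[OF finite_V, symmetric])
    finally show ?thesis using out by simp
  qed
  let ?Q = "1/2 * (\<Sum>x\<in>P. \<Sum>y\<in>P. v x * v y * (ww x y)\<^sup>2)"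
  have Q: "0 \<le> ?Q" "?Q \<le> 2 * (real K * real (card P))"
    using quadratic_part_le ke v_bounds by (auto intro!: sum_nonneg mult_nonneg_nonneg)
  then have Q': "\<bar>?Q / (real K)\<^sup>2\<bar> \<le> 2 * real (card P) / real K"
    using K divide_right_mono[OF Q(2), of "(real K)\<^sup>2"] by (simp add: power2_eq_square)
  have split: "cut_var a K P / (real K)\<^sup>2 - (\<Sum>y\<in>P. \<alpha> y * (1 - \<alpha> y) * (1 - 2 * \<alpha> y)\<^sup>2)
    = (\<Sum>y\<in>P. v y * (hh y / real K)\<^sup>2 - \<alpha> y * (1 - \<alpha> y) * (1 - 2 * \<alpha> y)\<^sup>2) + ?Q / (real K)\<^sup>2"
    unfolding cut_var_eq by (simp add: sum_subtractf add_divide_distrib sum_divide_distrib power_divide)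
  have "\<bar>\<Sum>y\<in>P. v y * (hh y / real K)\<^sup>2 - \<alpha> y * (1 - \<alpha> y) * (1 - 2 * \<alpha> y)\<^sup>2\<bar>
     \<le> (\<Sum>y\<in>P. \<delta> * (1 + real C)\<^sup>2 + (2 + real C) * (\<bar>hh y - real K * (1 - 2 * \<alpha> y)\<bar> / real K))"
    by (rule order_trans[OF sum_abs]) (intro sum_mono pt)
  also have "\<dots> = \<delta> * (1 + real C)\<^sup>2 * real (card P) + (2 + real C) * ((\<Sum>y\<in>P. \<bar>hh y - real K * (1 - 2 * \<alpha> y)\<bar>) / real K)"
    by (simp only: sum.distrib sum_distrib_left[symmetric] sum_divide_distrib[symmetric]) simp
  finally show ?thesis unfolding split using Q' by linarith
qed

text \<open>Since \<open>x * (1 - x)\<close> is 1-Lipschitz on [0, 1], the end of an edge may be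
  replaced by its start at the cost of the oscillation of \<open>\<alpha>\<close>; each point then
  starts exactly \<open>K\<close> edges.\<close>

lemma cut_var_lower:
  assumes out: "\<And>y. y \<in> P \<Longrightarrow> card (out_nbrs K P y) = K"
    and \<alpha>: "\<And>y. \<bar>a y - \<alpha> y\<bar> \<le> \<delta>" "\<And>y. 0 \<le> \<alpha> y \<and> \<alpha> y \<le> 1"
  shows "real K * (\<Sum>y\<in>P. (\<alpha> y * (1 - \<alpha> y))\<^sup>2) - 2 * \<delta> * (real K * real (card P))
      - (\<Sum>(y,z)\<in>knn_edges K P. \<bar>\<alpha> y - \<alpha> z\<bar>) \<le> cut_var a K P"
proof -
  let ?w = "\<lambda>y. \<alpha> y * (1 - \<alpha> y)"
  have w: "0 \<le> ?w y" "?w y \<le> 1" for y using \<alpha>(2)[of y] by (auto intro: mult_le_one)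
  have lip: "\<bar>x * (1 - x) - y * (1 - y)\<bar> \<le> \<bar>x - y\<bar>" if "0 \<le> x" "x \<le> 1" "0 \<le> y" "y \<le> 1" for x y :: real
  proof -
    have "x * (1 - x) - y * (1 - y) = (x - y) * (1 - x - y)" by (simp add: algebra_simps)
    moreover have "\<bar>1 - x - y\<bar> \<le> 1" using that by (simp add: abs_le_iff)
    ultimately show ?thesis by (simp add: abs_mult mult_left_le)
  qed
  have vw: "\<bar>v y - ?w y\<bar> \<le> \<delta>" if "y \<in> P" for y
    using lip[of "a y" "\<alpha> y"] a_bounds[OF that] \<alpha>(2)[of y] \<alpha>(1)[of y] by (simp add: v_def)
  have pt: "(?w y)\<^sup>2 - 2 * \<delta> - \<bar>\<alpha> y - \<alpha> z\<bar> \<le> v y * v z" if yz: "(y, z) \<in> knn_edges K P" for y z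
  proof -
    have P: "y \<in> P" "z \<in> P" using yz knn_edges_subset by blast+
    have "\<bar>?w y - ?w z\<bar> \<le> \<bar>\<alpha> y - \<alpha> z\<bar>" using \<alpha>(2) by (intro lip) auto
    then have "?w y - \<bar>\<alpha> y - \<alpha> z\<bar> \<le> ?w z" by linarith
    then have "?w y * (?w y - \<bar>\<alpha> y - \<alpha> z\<bar>) \<le> ?w y * ?w z" using w by (intro mult_left_mono) auto
    moreover have "?w y * \<bar>\<alpha> y - \<alpha> z\<bar> \<le> \<bar>\<alpha> y - \<alpha> z\<bar>" using w[of y] by (simp add: mult_left_le_one_le)
    ultimately have 1: "(?w y)\<^sup>2 - \<bar>\<alpha> y - \<alpha> z\<bar> \<le> ?w y * ?w z" by (simp add: power2_eq_square right_diff_distrib)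
    have "\<bar>?w y * ?w z - v y * v z\<bar> = \<bar>(?w y - v y) * ?w z + v y * (?w z - v z)\<bar>" by (simp add: algebra_simps)
    also have "\<dots> \<le> \<bar>?w y - v y\<bar> * ?w z + v y * \<bar>?w z - v z\<bar>"
      by (rule abs_sum_mult_le) (use w v_bounds[OF P(1)] in auto)
    also have "\<dots> \<le> \<delta> * 1 + 1 * \<delta>"
      using vw[OF P(1)] vw[OF P(2)] w v_bounds[OF P(1)] by (intro add_mono mult_mono) (auto simp: abs_minus_commute)
    finally show ?thesis using 1 by linarith
  qed
  have "(\<Sum>(y,z)\<in>knn_edges K P. (?w y)\<^sup>2 - 2 * \<delta> - \<bar>\<alpha> y - \<alpha> z\<bar>) \<le> (\<Sum>(y,z)\<in>knn_edges K P. v y * v z)"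
    by (rule sum_mono) (use pt in auto)
  also have "\<dots> \<le> cut_var a K P" by (rule cut_var_ge)
  finally have "(\<Sum>(y,z)\<in>knn_edges K P. (?w y)\<^sup>2 - 2 * \<delta>) - (\<Sum>(y,z)\<in>knn_edges K P. \<bar>\<alpha> y - \<alpha> z\<bar>) \<le> cut_var a K P"
    by (simp add: case_prod_unfold sum_subtractf)
  moreover have "(\<Sum>(y,z)\<in>knn_edges K P. (?w y)\<^sup>2 - 2 * \<delta>) = (\<Sum>y\<in>P. \<Sum>z\<in>out_nbrs K P y. (?w y)\<^sup>2 - 2 * \<delta>)"
    by (rule sum_over_edges(1)[OF finite_V, symmetric])
  moreover have "\<dots> = real K * (\<Sum>y\<in>P. (?w y)\<^sup>2) - 2 * \<delta> * (real K * real (card P))"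
    using out by (simp add: right_diff_distrib sum_subtractf sum_distrib_left)
  ultimately show ?thesis by linarith
qed

end

section \<open>Limits of the conditional variance and characteristic function\<close>

context two_sample_sequence
begin

definition lpN :: "nat \<Rightarrow> 'a \<Rightarrow> real" where "lpN N y = label_prob (N1 N) (N2 N) f g 1 y"
text \<open>The limiting probability of label 1 at \<open>y\<close>, which is 0 by division by zero
  where \<open>\<phi>\<close> vanishes.\<close>

definition \<alpha> :: "'a \<Rightarrow> real" where "\<alpha> y = p * f y / \<phi> y"
definition \<delta>N :: "nat \<Rightarrow> real" where "\<delta>N N = \<bar>real (N1 N) / real N - p\<bar> / min p q"

lemma alpha_measurable [measurable]: "\<alpha> \<in> borel_measurable borel"
  unfolding \<alpha>_def[abs_def] by measurable

lemma alpha_bounds: "0 \<le> \<alpha> y \<and> \<alpha> y \<le> 1"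
proof -
  have "0 \<le> p * f y" "0 \<le> q * g y" using p q_pos f_nonneg g_nonneg by simp_all
  then show ?thesis by (auto simp: \<alpha>_def \<phi>_def divide_le_eq_1)
qed

lemma lpN_bounds: "0 \<le> lpN N y \<and> lpN N y \<le> 1"
proof -
  have "0 \<le> real (N1 N) * f y" "0 \<le> real (N2 N) * g y" using f_nonneg g_nonneg by simp_all
  then show ?thesis by (auto simp: lpN_def label_prob_def divide_le_eq_1)
qed

lemma deltaN_lim: "\<delta>N \<longlonglongrightarrow> 0"
proof -
  have "(\<lambda>N. \<bar>real (N1 N) / real N - p\<bar> / min p q) \<longlonglongrightarrow> \<bar>p - p\<bar> / min p q"
    using p q_pos by (intro tendsto_intros N1_lim) auto
  then show ?thesis by (simp add: \<delta>N_def[abs_def])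
qed

text \<open>The difference of the two fractions has numerator \<open>(a - p) * (f y * g y)\<close>,
  while the product of the denominators is at least \<open>min p q * (f y * g y)\<close>. Hence the
  bound is uniform in \<open>y\<close> without any lower bound on the densities.\<close>

lemma lpN_near_alpha:
  assumes "0 < N1 N" "0 < N2 N"
  shows "\<bar>lpN N y - \<alpha> y\<bar> \<le> \<delta>N N"
proof -
  define a b where "a = real (N1 N) / real N" and "b = real (N2 N) / real N"
  have N: "0 < real N" using assms sizes[of N] by linarith
  have "real (N1 N) + real (N2 N) = real N" using sizes[of N] by linarith
  then have ab: "0 < a" "0 < b" "a + b = 1" using assms N by (simp_all add: a_def b_def flip: add_divide_distrib)
  have lp: "lpN N y = a * f y / (a * f y + b * g y)"
  proof -
    have "real (N1 N) * f y = real N * (a * f y)" "real (N2 N) * g y = real N * (b * g y)"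
      using N by (simp_all add: a_def b_def)
    then have "lpN N y = real N * (a * f y) / (real N * (a * f y + b * g y))"
      by (simp only: lpN_def label_prob_def distrib_left simp_thms if_True)
    then show ?thesis using N by simp
  qed
  have mn: "0 < min p q" using p q_pos by simp
  show ?thesis
  proof (cases "f y = 0 \<and> g y = 0")
    case True
    then show ?thesis using mn by (simp add: lp \<alpha>_def \<delta>N_def)
  next
    case False
    then have fg: "0 \<le> f y" "0 \<le> g y" "0 < f y \<or> 0 < g y" using f_nonneg[of y] g_nonneg[of y] by auto
    let ?D' = "a * f y + b * g y" and ?D = "p * f y + q * g y"
    have D: "0 < ?D'" "0 < ?D"
      using fg ab p q_pos by (auto intro: add_pos_nonneg add_nonneg_pos)
    have "lpN N y - \<alpha> y = (a * f y * ?D - p * f y * ?D') / (?D' * ?D)"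
      unfolding lp \<alpha>_def \<phi>_def using D by (simp add: diff_frac_eq)
    also have "a * f y * ?D - p * f y * ?D' = (a * q - p * b) * (f y * g y)" by (simp add: algebra_simps)
    also have "a * q - p * b = a - p" 
    proof -
      have b: "b = 1 - a" using ab(3) by simp
      show ?thesis unfolding b q by (simp add: algebra_simps)
    qed
    finally have eq: "\<bar>lpN N y - \<alpha> y\<bar> = \<bar>a - p\<bar> * (f y * g y) / (?D' * ?D)"
      using D fg by (simp add: abs_mult)
    have "min p q * (f y * g y) = (a * min p q + b * min p q) * (f y * g y)"
      using ab(3) by (simp flip: distrib_right)
    also have "\<dots> \<le> (a * q + b * p) * (f y * g y)"
      using ab fg by (intro mult_right_mono add_mono mult_left_mono) auto
    also have "\<dots> \<le> ?D' * ?D"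
    proof -
      have "?D' * ?D = a * p * (f y * f y) + b * q * (g y * g y) + (a * q + b * p) * (f y * g y)"
        by (simp add: algebra_simps)
      moreover have "0 \<le> a * p * (f y * f y)" "0 \<le> b * q * (g y * g y)" using ab p q_pos fg by simp_all
      ultimately show ?thesis by linarith
    qed
    finally have mD: "min p q * (f y * g y) \<le> ?D' * ?D" .
    have frac: "x / d \<le> 1 / m" if "m * x \<le> d" "0 < d" "0 < m" for x d m :: real
      using that by (simp add: field_simps)
    have "(f y * g y) / (?D' * ?D) \<le> 1 / min p q"
      by (rule frac[OF mD]) (use D mn in auto)
    then have "\<bar>a - p\<bar> * ((f y * g y) / (?D' * ?D)) \<le> \<bar>a - p\<bar> * (1 / min p q)" by (rule mult_left_mono) simp
    then show ?thesis by (simp add: eq \<delta>N_def a_def)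
  qed
qed

lemma eventually_sizes_pos: "eventually (\<lambda>x. 0 < N1 (fst x) \<and> 0 < N2 (fst x)) hp"
proof (rule eventually_hp_fst, rule eventually_conj)
  have "eventually (\<lambda>N. 0 < real (N1 N) / real N) sequentially"
    using p by (intro order_tendstoD(1)[OF N1_lim]) simp
  then show "eventually (\<lambda>N. 0 < N1 N) sequentially" by eventually_elim (auto intro!: Nat.gr0I)
  have "eventually (\<lambda>N. 0 < real (N2 N) / real N) sequentially"
    using q_pos by (intro order_tendstoD(1)[OF N2_lim]) simp
  then show "eventually (\<lambda>N. 0 < N2 N) sequentially" by eventually_elim (auto intro!: Nat.gr0I)
qed

abbreviation cvar :: "nat \<times> 'w \<Rightarrow> real" where "cvar x \<equiv> cut_var (lpN (fst x)) (kk x) (pts x)"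

definition edge_osc :: "nat \<times> 'w \<Rightarrow> real" where
  "edge_osc x = (\<Sum>(y,z)\<in>knn_edges (kk x) (pts x). \<bar>\<alpha> y - \<alpha> z\<bar>) / (NN x * real (kk x))"

lemma edge_osc_lim: "(edge_osc \<longlongrightarrow> 0) hp"
  unfolding edge_osc_def[abs_def] by (rule edge_smoothing[OF alpha_measurable alpha_bounds])

lemma knn_cut_pts: "knn_cut (pts x) (lpN N)"
  by (intro knn_cut.intro bernoulli_labels.intro) (use lpN_bounds in auto)

text \<open>Limiting variance of a label times the square of its limiting linear coefficient per
  \<open>K\<close>, averaged over the points.\<close>

lemma sigma2_eq: "sigma2_cond p f g = (\<integral>y. \<alpha> y * (1 - \<alpha> y) * (1 - 2 * \<alpha> y)\<^sup>2 * \<phi> y \<partial>lborel)"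
proof -
  have pt: "\<alpha> y * (1 - \<alpha> y) * (1 - 2 * \<alpha> y)\<^sup>2 * \<phi> y = p * q * (f y * g y * (p * f y - q * g y)\<^sup>2 / (\<phi> y) ^ 3)" for y
  proof (cases "\<phi> y = 0")
    case False
    then have "1 - \<alpha> y = q * g y / \<phi> y" "1 - 2 * \<alpha> y = (q * g y - p * f y) / \<phi> y"
      by (simp_all add: \<alpha>_def \<phi>_def field_simps)
    then have "\<alpha> y * (1 - \<alpha> y) * (1 - 2 * \<alpha> y)\<^sup>2 * \<phi> y
        = (p * f y / \<phi> y) * (q * g y / \<phi> y) * ((q * g y - p * f y) / \<phi> y)\<^sup>2 * \<phi> y"
      by (simp only: \<alpha>_def)
    also have "\<dots> = p * q * (f y * g y * (p * f y - q * g y)\<^sup>2 / (\<phi> y) ^ 3)"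
      using False by (simp add: power2_eq_square power3_eq_cube field_simps)
    finally show ?thesis .
  qed (simp add: \<alpha>_def)
  show ?thesis
    unfolding sigma2_cond_def Let_def q[symmetric] pt \<phi>_def[symmetric]
    by (rule integral_mult_right_zero[symmetric])
qed

lemma variance_limit: "((\<lambda>x. cvar x / (NN x * (real (kk x))\<^sup>2)) \<longlongrightarrow> sigma2_cond p f g) hp"
proof -
  obtain C :: nat where C: "\<And>S K (x::'a). finite S \<Longrightarrow> card (in_nbrs K S x) \<le> C * K"
    using in_degree_bounded by blast
  let ?w = "\<lambda>y. \<alpha> y * (1 - \<alpha> y) * (1 - 2 * \<alpha> y)\<^sup>2"
  let ?Y = "\<lambda>x. (\<Sum>y\<in>pts x. ?w y) / NN x"
  let ?cd = "\<lambda>x. real (card (pts x)) / NN x"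
  let ?in = "\<lambda>x. (\<Sum>y\<in>pts x. \<bar>real (card (in_nbrs (kk x) (pts x) y)) - real (kk x)\<bar>) / (NN x * real (kk x))"
  let ?B = "\<lambda>x. \<delta>N (fst x) * (1 + real C)\<^sup>2 * ?cd x + (2 + real C) * (2 * \<delta>N (fst x) * ?cd x + 2 * edge_osc x + ?in x)
    + 2 * ?cd x * inverse (real (kk x))"
  have "(?Y \<longlongrightarrow> (\<integral>y. ?w y * \<phi> y \<partial>lborel)) hp"
  proof (rule LLN_fun)
    show "?w \<in> borel_measurable borel" by measurable
    fix y
    have "\<bar>\<alpha> y\<bar> \<le> 1" "\<bar>1 - \<alpha> y\<bar> \<le> 1" "\<bar>1 - 2 * \<alpha> y\<bar> \<le> 1" using alpha_bounds[of y] by auto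
    then show "\<bar>?w y\<bar> \<le> 1"
      unfolding abs_mult power_abs by (intro mult_le_one power_le_one) auto
  qed
  then have Y: "(?Y \<longlongrightarrow> sigma2_cond p f g) hp" by (simp add: sigma2_eq)
  have kinv: "((\<lambda>x. inverse (real (kk x))) \<longlongrightarrow> 0) hp"
    by (intro hp_const tendsto_inverse_0_at_top filterlim_compose[OF filterlim_real_sequentially k_infinity])
  have "(?B \<longlongrightarrow> 0 * (1 + real C)\<^sup>2 * 1 + (2 + real C) * (2 * 0 * 1 + 2 * 0 + 0) + 2 * 1 * 0) hp"
    by (intro tendsto_intros hp_const deltaN_lim LLN_card edge_osc_lim in_degree_regular kinv)
  then have B: "(?B \<longlongrightarrow> 0) hp" by simp
  have "eventually (\<lambda>x. \<bar>cvar x / (NN x * (real (kk x))\<^sup>2) - ?Y x\<bar> \<le> ?B x) hp"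
    using eventually_regular eventually_sizes_pos
  proof eventually_elim
    case (elim x)
    let ?S = "pts x" and ?K = "kk x" and ?N = "NN x" and ?\<delta> = "\<delta>N (fst x)"
    have N: "0 < ?N" and K: "0 < real ?K" using elim by auto
    interpret kc: knn_cut ?S "lpN (fst x)" ?K by (rule knn_cut_pts)
    have out: "card (out_nbrs ?K ?S y) = ?K" if "y \<in> ?S" for y using elim that by (simp add: card_out_nbrs)
    have near: "\<bar>lpN (fst x) y - \<alpha> y\<bar> \<le> ?\<delta>" for y using elim by (intro lpN_near_alpha) auto
    let ?H = "\<Sum>y\<in>?S. \<bar>kc.hh y - real ?K * (1 - 2 * \<alpha> y)\<bar>"
    have 1: "?H / ?N / real ?K \<le> 2 * ?\<delta> * ?cd x + 2 * edge_osc x + ?in x"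
    proof -
      have "?H / (?N * real ?K) \<le> (2 * ?\<delta> * (real ?K * real (card ?S)) + 2 * (\<Sum>(y,z)\<in>knn_edges ?K ?S. \<bar>\<alpha> y - \<alpha> z\<bar>)
         + (\<Sum>y\<in>?S. \<bar>real (card (in_nbrs ?K ?S y)) - real ?K\<bar>)) / (?N * real ?K)"
        by (rule divide_right_mono[OF kc.sum_hh_deviation[OF out near alpha_bounds]]) auto
      also have "\<dots> = 2 * ?\<delta> * ?cd x + 2 * edge_osc x + ?in x"
        using N K by (simp add: edge_osc_def add_divide_distrib)
      finally show ?thesis by (simp add: mult.commute)
    qed
    have "\<bar>cvar x / (real ?K)\<^sup>2 - (\<Sum>y\<in>?S. ?w y)\<bar> / ?N
      \<le> (?\<delta> * (1 + real C)\<^sup>2 * real (card ?S) + (2 + real C) * (?H / real ?K) + 2 * real (card ?S) / real ?K) / ?N"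
      by (rule divide_right_mono[OF kc.cut_var_deviation[OF out _ C near alpha_bounds]]) (use K in auto)
    also have "\<dots> = ?\<delta> * (1 + real C)\<^sup>2 * ?cd x + (2 + real C) * (?H / ?N / real ?K) + 2 * ?cd x * inverse (real ?K)"
      by (simp add: divide_inverse distrib_left distrib_right mult_ac)
    also have "\<dots> \<le> ?B x" by (intro add_mono order_refl mult_left_mono 1) auto
    finally have "\<bar>cvar x / (real ?K)\<^sup>2 - (\<Sum>y\<in>?S. ?w y)\<bar> / ?N \<le> ?B x" .
    moreover have "\<bar>cvar x / (?N * (real ?K)\<^sup>2) - ?Y x\<bar> = \<bar>cvar x / (real ?K)\<^sup>2 - (\<Sum>y\<in>?S. ?w y)\<bar> / ?N"
    proof -
      have "cvar x / (?N * (real ?K)\<^sup>2) - ?Y x = (cvar x / (real ?K)\<^sup>2 - (\<Sum>y\<in>?S. ?w y)) / ?N"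
        by (simp add: diff_divide_distrib mult.commute)
      then show ?thesis by (simp add: abs_divide)
    qed
    ultimately show ?case by simp
  qed
  then have "((\<lambda>x. cvar x / (NN x * (real (kk x))\<^sup>2) - ?Y x) \<longlongrightarrow> 0) hp"
    by (intro Lim_null_comparison[OF _ B]) simp
  from tendsto_add[OF this Y] show ?thesis by simp
qed

text \<open>The limit of the lower bound for the variance divided by \<open>N * K\<close>, coming
  from the quadratic part alone.\<close>

definition m0 :: real where "m0 = (\<integral>y. (\<alpha> y * (1 - \<alpha> y))\<^sup>2 * \<phi> y \<partial>lborel)"

lemma alpha_var_bound: "\<bar>(\<alpha> y * (1 - \<alpha> y))\<^sup>2\<bar> \<le> 1"
proof -
  have "\<bar>\<alpha> y\<bar> \<le> 1" "\<bar>1 - \<alpha> y\<bar> \<le> 1" using alpha_bounds[of y] by auto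
  then show ?thesis unfolding abs_mult power_abs by (intro mult_le_one power_le_one) auto
qed

lemma m0_pos:
  assumes "\<not> (AE x in lborel. f x * g x = 0)"
  shows "0 < m0"
proof -
  have int: "integrable lborel (\<lambda>y. (\<alpha> y * (1 - \<alpha> y))\<^sup>2 * \<phi> y)"
    by (rule integrable_bounded_phi[OF _ alpha_var_bound]) measurable
  have "0 \<le> m0" unfolding m0_def by (intro Bochner_Integration.integral_nonneg) (simp add: phi_nonneg)
  moreover have "m0 \<noteq> 0"
  proof
    assume "m0 = 0"
    then have "AE y in lborel. (\<alpha> y * (1 - \<alpha> y))\<^sup>2 * \<phi> y = 0"
      unfolding m0_def using int by (subst (asm) integral_nonneg_eq_0_iff_AE) (auto simp: phi_nonneg)
    then have "AE y in lborel. f y * g y = 0"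
    proof eventually_elim
      case (elim y)
      show ?case
      proof (rule ccontr)
        assume "f y * g y \<noteq> 0"
        then have fg: "0 < f y" "0 < g y" using f_nonneg[of y] g_nonneg[of y] by (auto simp: less_le)
        then have "0 < p * f y" "0 < q * g y" using p q_pos by simp_all
        then have "0 < \<phi> y" "0 < \<alpha> y" "\<alpha> y < 1" by (simp_all add: \<phi>_def \<alpha>_def)
        then show False using elim by simp
      qed
    qed
    with assms show False by simp
  qed
  ultimately show ?thesis by simp
qed

lemma variance_lower_bound:
  assumes "0 < m0"
  shows "eventually (\<lambda>x. m0 / 2 * (NN x * real (kk x)) \<le> cvar x) hp"
proof -
  let ?Y = "\<lambda>x. (\<Sum>y\<in>pts x. (\<alpha> y * (1 - \<alpha> y))\<^sup>2) / NN x"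
  let ?X = "\<lambda>x. ?Y x - 2 * \<delta>N (fst x) * (real (card (pts x)) / NN x) - edge_osc x"
  have Y: "(?Y \<longlongrightarrow> m0) hp" unfolding m0_def
    by (rule LLN_fun[OF _ alpha_var_bound]) measurable
  have "(?X \<longlongrightarrow> m0 - 2 * 0 * 1 - 0) hp"
    by (intro tendsto_intros Y hp_const deltaN_lim LLN_card edge_osc_lim)
  then have "eventually (\<lambda>x. m0 / 2 < ?X x) hp"
    by (rule order_tendstoD(1)) (use assms in simp)
  then show ?thesis using eventually_regular eventually_sizes_pos
  proof eventually_elim
    case (elim x)
    let ?S = "pts x" and ?K = "kk x" and ?N = "NN x" and ?\<delta> = "\<delta>N (fst x)"
    have N: "0 < ?N" and K: "0 < real ?K" using elim by auto
    interpret kc: knn_cut ?S "lpN (fst x)" ?K by (rule knn_cut_pts)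
    have out: "card (out_nbrs ?K ?S y) = ?K" if "y \<in> ?S" for y using elim that by (simp add: card_out_nbrs)
    have near: "\<bar>lpN (fst x) y - \<alpha> y\<bar> \<le> ?\<delta>" for y using elim by (intro lpN_near_alpha) auto
    have "m0 / 2 * (?N * real ?K) \<le> ?X x * (?N * real ?K)"
      using elim N K by (intro mult_right_mono) auto
    also have "\<dots> = real ?K * (\<Sum>y\<in>?S. (\<alpha> y * (1 - \<alpha> y))\<^sup>2) - 2 * ?\<delta> * (real ?K * real (card ?S))
        - (\<Sum>(y,z)\<in>knn_edges ?K ?S. \<bar>\<alpha> y - \<alpha> z\<bar>)"
      using N K by (simp add: edge_osc_def left_diff_distrib)
    also have "\<dots> \<le> cvar x" by (rule kc.cut_var_lower[OF out near alpha_bounds])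
    finally show ?case .
  qed
qed

definition cfx :: "real \<Rightarrow> nat \<times> 'w \<Rightarrow> complex" where
  "cfx t x = bern_expect (pts x) (lpN (fst x)) (\<lambda>S. iexp (t * ((cut_edges (kk x) (pts x) S - cut_mean (lpN (fst x)) (kk x) (pts x)) / sqrt (cvar x))))"

lemma cfx_norm_le: "cmod (cfx t x) \<le> 1"
proof -
  interpret kc: knn_cut "pts x" "lpN (fst x)" "kk x" by (rule knn_cut_pts)
  show ?thesis unfolding cfx_def by (rule order_trans[OF kc.E_norm_le]) simp
qed

lemma cfx_limit:
  assumes "0 < m0"
  shows "(cfx t \<longlongrightarrow> of_real (exp (- (t\<^sup>2 / 2)))) hp"
proof -
  obtain C :: nat where C: "\<And>S K (x::'a). finite S \<Longrightarrow> card (in_nbrs K S x) \<le> C * K"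
    using in_degree_bounded by blast
  let ?B = "\<lambda>x. \<bar>t\<bar> * ((3 * \<bar>t\<bar> + 9/2 * t\<^sup>2) * ((1 + real C) * sqrt (2 / m0) * sqrt (real (kk x) / NN x)))"
  have "(?B \<longlongrightarrow> \<bar>t\<bar> * ((3 * \<bar>t\<bar> + 9/2 * t\<^sup>2) * ((1 + real C) * sqrt (2 / m0) * sqrt 0))) hp"
    by (intro tendsto_intros hp_const[OF k_small])
  then have B: "(?B \<longlongrightarrow> 0) hp" by simp
  have "eventually (\<lambda>x. cmod (cfx t x - of_real (exp (- (t\<^sup>2 / 2)))) \<le> ?B x) hp"
    using eventually_regular variance_lower_bound[OF assms]
  proof eventually_elim
    case (elim x)
    let ?S = "pts x" and ?K = "kk x" and ?N = "NN x"
    have N: "0 < ?N" and K: "0 < real ?K" using elim by auto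
    interpret kc: knn_cut ?S "lpN (fst x)" ?K by (rule knn_cut_pts)
    have lowpos: "0 < m0 / 2 * (?N * real ?K)" using assms N K by simp
    then have pos: "0 < cvar x" using elim by linarith
    have D: "real (card (out_nbrs ?K ?S y)) + real (card (in_nbrs ?K ?S y)) \<le> (1 + real C) * real ?K" if "y \<in> ?S" for y
    proof -
      have "card (out_nbrs ?K ?S y) = ?K" using elim that by (simp add: card_out_nbrs)
      moreover have "real (card (in_nbrs ?K ?S y)) \<le> real (C * ?K)" using C[of ?S ?K y] by (simp only: of_nat_le_iff finite_pts)
      ultimately show ?thesis by (simp add: algebra_simps)
    qed
    have "(1 + real C) * real ?K / sqrt (cvar x) \<le> (1 + real C) * real ?K / sqrt (m0 / 2 * (?N * real ?K))"
      using elim lowpos K pos by (intro divide_left_mono mult_pos_pos) auto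
    also have "\<dots> = (1 + real C) * sqrt (2 / m0) * sqrt (real ?K / ?N)"
    proof -
      have "real ?K / sqrt (m0 / 2 * (?N * real ?K)) = sqrt (real ?K * real ?K) / sqrt (m0 / 2 * (?N * real ?K))" by simp
      also have "\<dots> = sqrt ((real ?K * real ?K) / (m0 / 2 * (?N * real ?K)))" by (rule real_sqrt_divide[symmetric])
      also have "(real ?K * real ?K) / (m0 / 2 * (?N * real ?K)) = 2 / m0 * (real ?K / ?N)" using K by simp
      finally have r: "real ?K / sqrt (m0 / 2 * (?N * real ?K)) = sqrt (2 / m0) * sqrt (real ?K / ?N)"
        by (simp only: real_sqrt_mult)
      show ?thesis unfolding times_divide_eq_right[symmetric] r by (simp only: mult.assoc)
    qed
    finally have "\<bar>t\<bar> * ((3 * \<bar>t\<bar> + 9/2 * t\<^sup>2) * ((1 + real C) * real ?K / sqrt (cvar x))) \<le> ?B x"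
      by (intro mult_left_mono) auto
    with kc.cut_cf_normal_approx[OF D pos, of t] show ?case unfolding cfx_def by linarith
  qed
  then have "((\<lambda>x. cfx t x - of_real (exp (- (t\<^sup>2 / 2)))) \<longlongrightarrow> 0) hp"
    by (rule Lim_null_comparison[OF _ B])
  then show ?thesis by (rule LIM_zero_cancel)
qed

text \<open>Bounded convergence in probability: off an event of probability near 1 the integrand is
  within 2 of \<open>e\<close>. What is integrated is \<open>\<gamma>\<close>, an almost everywhere
  version of \<open>Y\<close>, whose own measurability is not known.\<close>

lemma hp_integral_limit:
  fixes Y :: "nat \<times> 'w \<Rightarrow> complex"
  assumes int: "eventually (\<lambda>N. integrable (M N) (\<gamma> N)) sequentially"
    and ae: "eventually (\<lambda>N. AE \<omega> in M N. \<gamma> N \<omega> = Y (N, \<omega>)) sequentially"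
    and bound: "\<And>x. cmod (Y x) \<le> 1" and lim: "(Y \<longlongrightarrow> e) hp" and e: "cmod e \<le> 1"
  shows "(\<lambda>N. \<integral>\<omega>. \<gamma> N \<omega> \<partial>M N) \<longlonglongrightarrow> e"
proof (rule tendstoI)
  fix r :: real assume r: "0 < r"
  have "eventually (\<lambda>x. dist (Y x) e < r / 2) hp" using r by (intro tendstoD[OF lim]) simp
  then obtain A where A: "\<And>N. N \<ge> 1 \<Longrightarrow> A N \<in> sets (M N) \<and> (\<forall>\<omega>\<in>A N. dist (Y (N, \<omega>)) e < r / 2)"
    and PA: "(\<lambda>N. measure (M N) (A N)) \<longlonglongrightarrow> 1" unfolding eventually_hp by auto
  have "eventually (\<lambda>N. 1 - r / 4 < measure (M N) (A N)) sequentially"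
    by (rule order_tendstoD(1)[OF PA]) (use r in simp)
  then show "eventually (\<lambda>N. dist (\<integral>\<omega>. \<gamma> N \<omega> \<partial>M N) e < r) sequentially"
    using int ae eventually_ge_at_top[of 1]
  proof eventually_elim
    case (elim N)
    interpret two_sample_densities "M N" "N1 N" "N2 N" f g "L N" "Z N" "c N" by (rule model'[OF elim(4)])
    note A' = A[OF elim(4)]
    have ib: "integrable (M N) (\<lambda>\<omega>. r / 2 + 2 * indicator (space (M N) - A N) \<omega> :: real)"
      using A' by (intro Bochner_Integration.integrable_add integrable_mult_right integrable_real_indicator)
        (auto simp: emeasure_eq_measure)
    have "dist (\<integral>\<omega>. \<gamma> N \<omega> \<partial>M N) e = cmod (\<integral>\<omega>. \<gamma> N \<omega> - e \<partial>M N)"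
      using elim(2) by (simp add: dist_norm prob_space)
    also have "\<dots> \<le> (\<integral>\<omega>. cmod (\<gamma> N \<omega> - e) \<partial>M N)" by (rule integral_norm_bound)
    also have "\<dots> \<le> (\<integral>\<omega>. r / 2 + 2 * indicator (space (M N) - A N) \<omega> \<partial>M N)"
    proof (rule integral_mono_AE)
      show "integrable (M N) (\<lambda>\<omega>. cmod (\<gamma> N \<omega> - e))" using elim(2) by auto
      show "AE \<omega> in M N. cmod (\<gamma> N \<omega> - e) \<le> r / 2 + 2 * indicator (space (M N) - A N) \<omega>"
        using elim(3) AE_space
      proof eventually_elim
        case (elim \<omega>)
        show ?case
        proof (cases "\<omega> \<in> A N")
          case True
          then show ?thesis using A' elim by (auto simp: dist_norm intro: less_imp_le)
        next
          case False
          have "cmod (\<gamma> N \<omega> - e) \<le> cmod (Y (N, \<omega>)) + cmod e" using elim by (simp add: norm_triangle_ineq4)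
          then have "cmod (\<gamma> N \<omega> - e) \<le> 2" using bound[of "(N, \<omega>)"] e by linarith
          then show ?thesis using False elim r by simp
        qed
      qed
    qed (rule ib)
    also have "\<dots> = r / 2 + 2 * prob (space (M N) - A N)"
      using A' by (subst Bochner_Integration.integral_add) (auto simp: prob_space emeasure_eq_measure)
    also have "\<dots> < r" using prob_compl[of "A N"] A' elim(1) by simp
    finally show ?case .
  qed
qed

end

theorem theorem3p1:
  fixes p q :: real
    and N1 N2 k :: "nat \<Rightarrow> nat"
    and f g :: "'a::euclidean_space \<Rightarrow> real"
    and M :: "nat \<Rightarrow> 'w measure"
    and L :: "nat \<Rightarrow> 'w \<Rightarrow> nat"
    and Z :: "nat \<Rightarrow> nat \<Rightarrow> 'w \<Rightarrow> 'a"
    and c :: "nat \<Rightarrow> 'w \<Rightarrow> 'a \<Rightarrow> nat"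
  defines "F \<equiv> \<lambda>N. points_algebra (M N) (L N) (Z N)"
    and "T \<equiv> \<lambda>N \<omega>. T_stat (k N) (points (L N) (Z N) \<omega>) (c N \<omega>)"
  defines "R \<equiv> \<lambda>N. R_cond (M N) (F N) N (k N) (T N)"
  assumes p: "0 < p" "p < 1" and q: "q = 1 - p"
    and sizes: "\<And>N. N1 N + N2 N = N"
    and N1_rate: "(\<lambda>N. real (N1 N) / real N - p) \<in> o(\<lambda>N. real N powr (-1/2))"
    and N2_rate: "(\<lambda>N. real (N2 N) / real N - q) \<in> o(\<lambda>N. real N powr (-1/2))"
    and densities: "prob_density f" "prob_density g"
    and model: "\<And>N. N \<ge> 1 \<Longrightarrow>
          poissonized_two_sample (M N) (N1 N) (N2 N) f g (L N) (Z N) (c N)"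
    and k_infinity: "filterlim k at_top sequentially"
    and k_small: "(\<lambda>N. real (k N)) \<in> o(\<lambda>N. real N)"
  shows
    (* if f g = 0 a.e., the labels are a.s. determined by the points and the ratio is 0/0 *)
    "(\<not> (AE x in lborel. f x * g x = 0) \<longrightarrow>
       weak_conv_m
         (\<lambda>N. distr (M N) borel (\<lambda>\<omega>. R N \<omega> / sqrt (real_cond_var (M N) (F N) (R N) \<omega>)))
         std_normal_distribution) \<and>
     (\<forall>N\<ge>1. AE \<omega> in M N. real_cond_var (M N) (F N) (R N) \<omega> =
        1 / (real N * (real (k N))\<^sup>2) * real_cond_var (M N) (F N) (T N) \<omega>) \<and>
     tendsto_in_prob M (\<lambda>N. real_cond_var (M N) (F N) (R N)) (sigma2_cond p f g)"
proof -
  have k0: "(\<lambda>N. real (k N) / real N) \<longlonglongrightarrow> 0" by (rule smalloD_tendsto[OF k_small])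
  \<comment> \<open>The deviation is written as its ratio to the rate times the rate, two null
    sequences.\<close>
  have "(\<lambda>N. (real (N1 N) / real N - p) / real N powr (-1/2) * real N powr (-1/2)) \<longlonglongrightarrow> 0 * 0"
    by (intro tendsto_mult smalloD_tendsto[OF N1_rate] tendsto_neg_powr filterlim_real_sequentially) simp
  moreover have "eventually (\<lambda>N. (real (N1 N) / real N - p) / real N powr (-1/2) * real N powr (-1/2) = real (N1 N) / real N - p) sequentially"
    using eventually_gt_at_top[of 0] by eventually_elim simp
  ultimately have "(\<lambda>N. real (N1 N) / real N - p) \<longlonglongrightarrow> 0"
    using Lim_transform_eventually by fastforce
  then have N1_lim: "(\<lambda>N. real (N1 N) / real N) \<longlonglongrightarrow> p" by (rule LIM_zero_cancel)
  interpret tss: two_sample_sequence p q N1 N2 k f g M L Z c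
    by (rule two_sample_sequence.intro[OF p q sizes N1_lim densities model k_infinity k0])
  have T_eq: "T N = two_sample_densities.T (L N) (Z N) (c N) (k N)" if "N \<ge> 1" for N
  proof -
    interpret S: two_sample_densities "M N" "N1 N" "N2 N" f g "L N" "Z N" "c N" by (rule tss.model'[OF that])
    show ?thesis by (simp add: T_def S.T_def fun_eq_iff)
  qed
  have lp_eq: "two_sample_densities.lp (N1 N) (N2 N) f g = tss.lpN N" if "N \<ge> 1" for N
  proof -
    interpret S: two_sample_densities "M N" "N1 N" "N2 N" f g "L N" "Z N" "c N" by (rule tss.model'[OF that])
    show ?thesis by (simp only: fun_eq_iff S.lp_def tss.lpN_def) simp
  qed
  have var_T: "AE \<omega> in M N. real_cond_var (M N) (F N) (T N) \<omega> = tss.cvar (N, \<omega>)"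
    and var_R: "AE \<omega> in M N. real_cond_var (M N) (F N) (R N) \<omega> = 1 / (real N * (real (k N))\<^sup>2) * tss.cvar (N, \<omega>)"
    if N: "N \<ge> 1" for N
  proof -
    interpret S: two_sample_densities "M N" "N1 N" "N2 N" f g "L N" "Z N" "c N" by (rule tss.model'[OF N])
    show "AE \<omega> in M N. real_cond_var (M N) (F N) (T N) \<omega> = tss.cvar (N, \<omega>)"
      using S.condvar_T[of "k N"] unfolding T_eq[OF N] F_def lp_eq[OF N] fst_conv snd_conv .
    show "AE \<omega> in M N. real_cond_var (M N) (F N) (R N) \<omega> = 1 / (real N * (real (k N))\<^sup>2) * tss.cvar (N, \<omega>)"
      using S.condvar_R[where N = N and K = "k N"] unfolding R_def T_eq[OF N] F_def lp_eq[OF N] fst_conv snd_conv .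
  qed
  have second: "\<forall>N\<ge>1. AE \<omega> in M N. real_cond_var (M N) (F N) (R N) \<omega> =
        1 / (real N * (real (k N))\<^sup>2) * real_cond_var (M N) (F N) (T N) \<omega>"
  proof (intro allI impI)
    fix N :: nat assume N: "N \<ge> 1"
    show "AE \<omega> in M N. real_cond_var (M N) (F N) (R N) \<omega> = 1 / (real N * (real (k N))\<^sup>2) * real_cond_var (M N) (F N) (T N) \<omega>"
      using var_T[OF N] var_R[OF N] by eventually_elim simp
  qed
  have third: "tendsto_in_prob M (\<lambda>N. real_cond_var (M N) (F N) (R N)) (sigma2_cond p f g)"
    unfolding tendsto_in_prob_def
  proof (intro allI impI)
    fix \<epsilon> :: real assume \<epsilon>: "0 < \<epsilon>"
    have "eventually (\<lambda>x. dist (tss.cvar x / (tss.NN x * (real (tss.kk x))\<^sup>2)) (sigma2_cond p f g) < \<epsilon>) tss.hp"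
      by (rule tendstoD[OF tss.variance_limit \<epsilon>])
    moreover have "eventually (\<lambda>x. real_cond_var (M (fst x)) (F (fst x)) (R (fst x)) (snd x) = 1 / (real (fst x) * (real (k (fst x)))\<^sup>2) * tss.cvar x) tss.hp"
      by (rule tss.eventually_hp_AE) (use var_R in simp)
    ultimately have "eventually (\<lambda>x. \<bar>real_cond_var (M (fst x)) (F (fst x)) (R (fst x)) (snd x) - sigma2_cond p f g\<bar> < \<epsilon>) tss.hp"
      by eventually_elim (simp add: dist_real_def)
    then obtain A where A: "\<And>N. N \<ge> 1 \<Longrightarrow> A N \<in> sets (M N) \<and> (\<forall>\<omega>\<in>A N. \<bar>real_cond_var (M N) (F N) (R N) \<omega> - sigma2_cond p f g\<bar> < \<epsilon>)"
      and PA: "(\<lambda>N. measure (M N) (A N)) \<longlonglongrightarrow> 1" unfolding tss.eventually_hp by auto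
    have PA0: "(\<lambda>N. 1 - measure (M N) (A N)) \<longlonglongrightarrow> 0" using tendsto_diff[OF tendsto_const PA, of 1] by simp
    show "(\<lambda>N. measure (M N) {\<omega> \<in> space (M N). \<bar>real_cond_var (M N) (F N) (R N) \<omega> - sigma2_cond p f g\<bar> > \<epsilon>}) \<longlonglongrightarrow> 0"
    proof (rule tendsto_sandwich[OF _ _ tendsto_const PA0])
      show "eventually (\<lambda>N. 0 \<le> measure (M N) {\<omega> \<in> space (M N). \<bar>real_cond_var (M N) (F N) (R N) \<omega> - sigma2_cond p f g\<bar> > \<epsilon>}) sequentially"
        by simp
      show "eventually (\<lambda>N. measure (M N) {\<omega> \<in> space (M N). \<bar>real_cond_var (M N) (F N) (R N) \<omega> - sigma2_cond p f g\<bar> > \<epsilon>} \<le> 1 - measure (M N) (A N)) sequentially"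
        using eventually_ge_at_top[of 1]
      proof eventually_elim
        case (elim N)
        interpret S: two_sample_densities "M N" "N1 N" "N2 N" f g "L N" "Z N" "c N" by (rule tss.model'[OF elim])
        have "S.prob {\<omega> \<in> space (M N). \<bar>real_cond_var (M N) (F N) (R N) \<omega> - sigma2_cond p f g\<bar> > \<epsilon>} \<le> S.prob (space (M N) - A N)"
          using A[OF elim] by (intro S.finite_measure_mono) force+
        also have "\<dots> = 1 - S.prob (A N)" using A[OF elim] by (intro S.prob_compl) simp
        finally show ?case .
      qed
    qed
  qed
  have first: "weak_conv_m (\<lambda>N. distr (M N) borel (\<lambda>\<omega>. R N \<omega> / sqrt (real_cond_var (M N) (F N) (R N) \<omega>))) std_normal_distribution"
    if fg: "\<not> (AE x in lborel. f x * g x = 0)"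
  proof -
    let ?r = "\<lambda>N \<omega>. R N \<omega> / sqrt (real_cond_var (M N) (F N) (R N) \<omega>)"
    \<comment> \<open>Levy's theorem asks for a real distribution at every index, but
      \<open>M 0\<close> is arbitrary and \<open>char_ratio\<close> supposes \<open>0 < k N\<close>.
      The finitely many exceptions are replaced by the limit law.\<close>
    define D where "D N = (if 1 \<le> N \<and> 0 < k N then distr (M N) borel (?r N) else std_normal_distribution)" for N
    have big: "eventually (\<lambda>N. 1 \<le> N \<and> 0 < k N) sequentially"
      using filterlim_at_top[THEN iffD1, OF k_infinity, rule_format, of 1] eventually_ge_at_top[of 1]
      by eventually_elim simp
    have ratio: "?r N \<in> borel_measurable (M N)"
      "\<exists>\<gamma>. integrable (M N) \<gamma> \<and> char (distr (M N) borel (?r N)) t = (\<integral>\<omega>. \<gamma> \<omega> \<partial>M N) \<and> (AE \<omega> in M N. \<gamma> \<omega> = tss.cfx t (N, \<omega>))"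
      if N: "1 \<le> N" "0 < k N" for N t
    proof -
      interpret S: two_sample_densities "M N" "N1 N" "N2 N" f g "L N" "Z N" "c N" by (rule tss.model'[OF N(1)])
      have N0: "0 < N" using N by simp
      show "?r N \<in> borel_measurable (M N)"
        using S.char_ratio(1)[OF N0 N(2)] unfolding R_def T_eq[OF N(1)] F_def .
      show "\<exists>\<gamma>. integrable (M N) \<gamma> \<and> char (distr (M N) borel (?r N)) t = (\<integral>\<omega>. \<gamma> \<omega> \<partial>M N) \<and> (AE \<omega> in M N. \<gamma> \<omega> = tss.cfx t (N, \<omega>))"
        using S.char_ratio(2)[OF N0 N(2), of t]
        unfolding R_def T_eq[OF N(1)] F_def lp_eq[OF N(1)] tss.cfx_def fst_conv snd_conv by blast
    qed
    have "weak_conv_m D std_normal_distribution"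
    proof (rule levy_continuity)
      show "real_distribution (D N)" for N
      proof (cases "1 \<le> N \<and> 0 < k N")
        case True
        then interpret S: two_sample_densities "M N" "N1 N" "N2 N" f g "L N" "Z N" "c N" by (intro tss.model') simp
        show ?thesis using True ratio(1)[of N] by (simp add: D_def S.real_distribution_distr)
      qed (auto simp: D_def intro: real_dist_normal_dist)
      show "real_distribution std_normal_distribution" by (rule real_dist_normal_dist)
      fix t :: real
      have "\<forall>N. \<exists>\<gamma>. 1 \<le> N \<and> 0 < k N \<longrightarrow> integrable (M N) \<gamma> \<and>
          char (distr (M N) borel (?r N)) t = (\<integral>\<omega>. \<gamma> \<omega> \<partial>M N) \<and> (AE \<omega> in M N. \<gamma> \<omega> = tss.cfx t (N, \<omega>))"
        using ratio(2)[where t = t] by blast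
      from choice[OF this] obtain \<gamma> where \<gamma>: "\<forall>N. 1 \<le> N \<and> 0 < k N \<longrightarrow> integrable (M N) (\<gamma> N) \<and>
          char (distr (M N) borel (?r N)) t = (\<integral>\<omega>. \<gamma> N \<omega> \<partial>M N) \<and> (AE \<omega> in M N. \<gamma> N \<omega> = tss.cfx t (N, \<omega>))"
        by blast
      have "(\<lambda>N. \<integral>\<omega>. \<gamma> N \<omega> \<partial>M N) \<longlonglongrightarrow> of_real (exp (- (t\<^sup>2 / 2)))"
      proof (rule tss.hp_integral_limit[OF _ _ tss.cfx_norm_le tss.cfx_limit[OF tss.m0_pos[OF fg]]])
        show "eventually (\<lambda>N. integrable (M N) (\<gamma> N)) sequentially"
          by (rule eventually_mono[OF big]) (use \<gamma> in blast)
        show "eventually (\<lambda>N. AE \<omega> in M N. \<gamma> N \<omega> = tss.cfx t (N, \<omega>)) sequentially"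
          by (rule eventually_mono[OF big]) (use \<gamma> in blast)
      qed simp
      moreover have "eventually (\<lambda>N. (\<integral>\<omega>. \<gamma> N \<omega> \<partial>M N) = char (D N) t) sequentially"
        using big by eventually_elim (use \<gamma> in \<open>simp add: D_def\<close>)
      ultimately have "(\<lambda>N. char (D N) t) \<longlonglongrightarrow> of_real (exp (- (t\<^sup>2 / 2)))"
        by (rule Lim_transform_eventually)
      then show "(\<lambda>N. char (D N) t) \<longlonglongrightarrow> char std_normal_distribution t"
        by (simp add: char_std_normal_distribution)
    qed
    then have lim: "(\<lambda>N. cdf (D N) x) \<longlonglongrightarrow> cdf std_normal_distribution x" if "isCont (cdf std_normal_distribution) x" for x
      using that by (auto simp: weak_conv_m_def weak_conv_def)
    have eqD: "eventually (\<lambda>N. cdf (D N) x = cdf (distr (M N) borel (?r N)) x) sequentially" for x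
      using big by eventually_elim (simp add: D_def)
    show ?thesis
      unfolding weak_conv_m_def weak_conv_def
    proof (intro allI impI)
      fix x assume "isCont (cdf std_normal_distribution) x"
      from Lim_transform_eventually[OF lim[OF this] eqD]
      show "(\<lambda>N. cdf (distr (M N) borel (?r N)) x) \<longlonglongrightarrow> cdf std_normal_distribution x" .
    qed
  qed
  show ?thesis using first second third by blast
qed

end
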